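(* Let $k$ be an arbitrary number field, and let $G_1\subset S_n$ and $G_2\subset S_m$ be two transitive permutation groups (Galois groups) with no nontrivial isomorphic quotient. Suppose Malle's conjecture holds over $k$ for both $G_1\subset S_n$ and $G_2\subset S_m$. Then there is a constant $C>0$ such that $$N_k(G_1\times G_2\subset S_{mn},X) \ge CX^{\alpha}\ln^{r} X + o(X^{\alpha}\ln^r X),$$ where $$\alpha = \max\left\{ \frac{1}{m\,a(G_1)},\ \frac{1}{n\,a(G_2)}\right\},$$ and: if $\frac{1}{m\,a(G_1)}=\frac{1}{n\,a(G_2)}$, then $r = b(k,G_1)+ b(k,G_2)-1$; if $\frac{1}{m\,a(G_1)}>\frac{1}{n\,a(G_2)}$, then $r = b(k,G_1) -1$.
   Context: For a degree $d$ extension $K/k$ of number fields with Galois closure $\tilde K/k$, $\mathrm{Gal}(K/k)$ denotes $\mathrm{Gal}(\tilde K/k)$ regarded as a transitive permutation subgroup of $S_d$ via its action on the $d$ embeddings of $K$ into $\bar k$. $\mathrm{Disc}(K)$ denotes the absolute norm of the relative discriminant ideal $\mathrm{disc}(K/k)$. For a transitive permutation group $G\subset S_d$, $N_k(G,X)=N_k(G\subset S_d,X)$ is the number of isomorphism classes of degree $d$ extensions $K/k$ with $\mathrm{Gal}(K/k)$ isomorphic to $G$ as a permutation subgroup of $S_d$ and $\mathrm{Disc}(K)$ bounded by $X$. $G_1\times G_2$ is viewed in $S_{mn}$ via its componentwise action on $\{1,\dots,n\}\times\{1,\dots,m\}$. For $g\in S_d$, $\mathrm{ind}(g)=d-\#\{\text{orbits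 of } g\}$. $a(G)$ is the minimum of $\mathrm{ind}(g)$ over $g\in G$, $g\ne e$. The absolute Galois group $G_k$ acts on the conjugacy classes of $G$ via its action on the character table of $G$ (equivalently, $\sigma$ sends the class of $g$ to the class of $g^{\chi(\sigma)}$, with $\chi$ the cyclotomic character); $b(k,G)$ is the number of $G_k$-orbits on the set of conjugacy classes of $G$ of index $a(G)$. Malle's conjecture for $G$ over $k$ is the statement that $N_k(G,X)\sim C_G X^{1/a(G)}(\ln X)^{b(k,G)-1}$ for some constant $C_G>0$, where $f\sim g$ means $f(X)/g(X)\to 1$ as $X\to\infty$. *)

theory Defs
  imports
    Complex_Main
    "HOL-Library.Landau_Symbols"
    "HOL-Combinatorics.Orbits"
    "HOL-Algebra.Algebra"
    "HOL-Algebra.Algebraic_Closure_Type"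
    "Jordan_Normal_Form.Determinant"
begin

section \<open>Number fields and their extensions\<close>

text \<open>
  All fields live inside the complex numbers. Every number field embeds into them, and for
  \<open>k\<close> a subfield every algebraic extension of \<open>k\<close> is \<open>k\<close>-isomorphic to one inside \<open>kbar k\<close>;
  since only \<open>k\<close>-isomorphism classes of extensions are counted, nothing is lost.
\<close>

abbreviation CC :: "complex ring" where
  "CC \<equiv> ring_of_type_algebra"

abbreviation subring_of_CC :: "complex set \<Rightarrow> complex ring" where
  "subring_of_CC A \<equiv> CC\<lparr>carrier := A\<rparr>"

definition number_field :: "complex set \<Rightarrow> bool" where
  "number_field k \<longleftrightarrow> subfield k CC \<and> ring.finite_dimension CC \<rat> k"

definition extension_of_degree :: "complex set \<Rightarrow> nat \<Rightarrow> complex set \<Rightarrow> bool" where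
  "extension_of_degree k d K \<longleftrightarrow> subfield K CC \<and> k \<subseteq> K \<and> ring.dimension CC d k K"

definition kbar :: "complex set \<Rightarrow> complex set" where
  "kbar k = {x. ring.algebraic CC k x}"

text \<open>Homomorphisms are taken to be extensional (\<open>undefined\<close> off their domain) so that distinct
  homomorphisms are distinct functions and can be counted.\<close>

definition embeddings :: "complex set \<Rightarrow> complex set \<Rightarrow> (complex \<Rightarrow> complex) set" where
  "embeddings k K = {\<sigma> \<in> extensional K.
     \<sigma> \<in> Ring.ring_hom (subring_of_CC K) (subring_of_CC (kbar k)) \<and> (\<forall>x\<in>k. \<sigma> x = x)}"

definition aut_group :: "complex set \<Rightarrow> complex set \<Rightarrow> (complex \<Rightarrow> complex) monoid" where
  "aut_group k L = (BijGroup L)\<lparr>carrier := {\<tau> \<in> Bij L.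
     \<tau> \<in> Ring.ring_hom (subring_of_CC L) (subring_of_CC L) \<and> (\<forall>x\<in>k. \<tau> x = x)}\<rparr>"

text \<open>The Galois closure, as the compositum of all conjugates of \<open>K\<close> over \<open>k\<close>.\<close>

definition galois_closure :: "complex set \<Rightarrow> complex set \<Rightarrow> complex set" where
  "galois_closure k K = generate_field CC (\<Union>\<sigma>\<in>embeddings k K. \<sigma> ` K)"

definition field_iso_over :: "complex set \<Rightarrow> (complex set \<times> complex set) set" where
  "field_iso_over k = {(K, K'). \<exists>h \<in> ring_iso (subring_of_CC K) (subring_of_CC K'). \<forall>x\<in>k. h x = x}"


section \<open>The relative discriminant\<close>

definition integers_of :: "complex set \<Rightarrow> complex set" where
  "integers_of K = {x \<in> K. algebraic_int x}"

text \<open>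
  The discriminants \<open>det (\<sigma>\<^sub>i \<omega>\<^sub>j)\<^sup>2\<close> of all \<open>k\<close>-bases \<open>\<omega>\<close> of \<open>K\<close> that consist of integral elements;
  they do not depend on the enumeration \<open>\<sigma>\<close> of the embeddings.
\<close>

definition basis_discriminants :: "complex set \<Rightarrow> complex set \<Rightarrow> complex set" where
  "basis_discriminants k K =
     {(det (mat (length \<omega>) (length \<omega>) (\<lambda>(i, j). (\<sigma> ! i) (\<omega> ! j))))\<^sup>2 | \<sigma> \<omega>.
        distinct \<sigma> \<and> set \<sigma> = embeddings k K \<and>
        set \<omega> \<subseteq> integers_of K \<and> ring.independent CC k \<omega> \<and> ring.Span CC k \<omega> = K}"

definition discriminant_ideal :: "complex set \<Rightarrow> complex set \<Rightarrow> complex set" where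
  "discriminant_ideal k K =
     genideal (subring_of_CC (integers_of k)) (basis_discriminants k K)"

text \<open>The absolute norm of an ideal is its index in the ring of integers.\<close>

definition Disc :: "complex set \<Rightarrow> complex set \<Rightarrow> nat" where
  "Disc k K = card (carrier (subring_of_CC (integers_of k) Quot discriminant_ideal k K))"


section \<open>Permutation groups\<close>

text \<open>
  A permutation group of degree \<open>card \<Omega>\<close> is a set \<open>G\<close> of permutations of a finite set \<open>\<Omega>\<close> (fixing
  everything outside \<open>\<Omega>\<close>), which allows \<open>\<Omega> = {1..n} \<times> {1..m}\<close> without renumbering.
\<close>

definition perm_grp :: "('a \<Rightarrow> 'a) set \<Rightarrow> ('a \<Rightarrow> 'a) monoid" where
  "perm_grp G = \<lparr>carrier = G, mult = (\<circ>), one = id\<rparr>"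

definition transitive_on :: "'a set \<Rightarrow> ('a \<Rightarrow> 'a) set \<Rightarrow> bool" where
  "transitive_on \<Omega> G \<longleftrightarrow> (\<forall>x\<in>\<Omega>. \<forall>y\<in>\<Omega>. \<exists>g\<in>G. g x = y)"

definition perm_prod ::
  "'a set \<Rightarrow> 'b set \<Rightarrow> ('a \<Rightarrow> 'a) set \<Rightarrow> ('b \<Rightarrow> 'b) set \<Rightarrow> ('a \<times> 'b \<Rightarrow> 'a \<times> 'b) set" where
  "perm_prod \<Omega>\<^sub>1 \<Omega>\<^sub>2 G\<^sub>1 G\<^sub>2 =
     {(\<lambda>p. if p \<in> \<Omega>\<^sub>1 \<times> \<Omega>\<^sub>2 then map_prod g\<^sub>1 g\<^sub>2 p else p) | g\<^sub>1 g\<^sub>2. g\<^sub>1 \<in> G\<^sub>1 \<and> g\<^sub>2 \<in> G\<^sub>2}"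

definition no_common_quotient :: "('a, 'c) monoid_scheme \<Rightarrow> ('b, 'd) monoid_scheme \<Rightarrow> bool" where
  "no_common_quotient G H \<longleftrightarrow>
     (\<forall>M N. M \<lhd> G \<longrightarrow> N \<lhd> H \<longrightarrow> G Mod M \<cong> H Mod N \<longrightarrow> trivial_group (G Mod M))"

definition ind :: "'a set \<Rightarrow> ('a \<Rightarrow> 'a) \<Rightarrow> nat" where
  "ind \<Omega> g = card \<Omega> - card (Orbits.orbit g ` \<Omega>)"

text \<open>Only meaningful for nontrivial \<open>G\<close>.\<close>

definition malle_a :: "'a set \<Rightarrow> ('a \<Rightarrow> 'a) set \<Rightarrow> nat" where
  "malle_a \<Omega> G = Min (ind \<Omega> ` (G - {id}))"

definition conj_classes :: "('a, 'b) monoid_scheme \<Rightarrow> 'a set set" where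
  "conj_classes G = orbits G (carrier G) (\<lambda>h g. h \<otimes>\<^bsub>G\<^esub> g \<otimes>\<^bsub>G\<^esub> inv\<^bsub>G\<^esub> h)"

text \<open>
  The cyclotomic character modulo \<open>N\<close>, as some natural representative; applied to elements of a
  group of order \<open>N\<close>, the power \<open>g\<close> to the \<open>cyclotomic_char N \<sigma>\<close> is independent of the choice.
\<close>

definition cyclotomic_char :: "nat \<Rightarrow> (complex \<Rightarrow> complex) \<Rightarrow> nat" where
  "cyclotomic_char N \<sigma> = (SOME t. \<forall>\<zeta>. \<zeta> ^ N = 1 \<longrightarrow> \<sigma> \<zeta> = \<zeta> ^ t)"

definition class_action ::
  "('a, 'b) monoid_scheme \<Rightarrow> (complex \<Rightarrow> complex) \<Rightarrow> 'a set \<Rightarrow> 'a set" where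
  "class_action G \<sigma> c = (\<lambda>g. g [^]\<^bsub>G\<^esub> cyclotomic_char (Coset.order G) \<sigma>) ` c"

definition malle_b :: "complex set \<Rightarrow> 'a set \<Rightarrow> ('a \<Rightarrow> 'a) set \<Rightarrow> nat" where
  "malle_b k \<Omega> G = card (orbits (aut_group k (kbar k))
     {c \<in> conj_classes (perm_grp G). \<forall>g\<in>c. ind \<Omega> g = malle_a \<Omega> G}
     (class_action (perm_grp G)))"


section \<open>Counting extensions\<close>

text \<open>
  \<open>Gal(K/k)\<close>, acting on the embeddings by composition, is isomorphic to \<open>G\<close> as a permutation group:
  a group isomorphism together with a compatible bijection of the sets acted upon.
\<close>

definition has_galois_perm_group ::
  "complex set \<Rightarrow> complex set \<Rightarrow> 'a set \<Rightarrow> ('a \<Rightarrow> 'a) set \<Rightarrow> bool" where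
  "has_galois_perm_group k K \<Omega> G \<longleftrightarrow>
     (\<exists>b f. bij_betw b (embeddings k K) \<Omega> \<and>
       f \<in> iso (aut_group k (galois_closure k K)) (perm_grp G) \<and>
       (\<forall>\<tau> \<in> carrier (aut_group k (galois_closure k K)). \<forall>\<sigma> \<in> embeddings k K.
          b (compose K \<tau> \<sigma>) = f \<tau> (b \<sigma>)))"

text \<open>The set counted is finite by Hermite's theorem, so \<open>card\<close> is the true number of classes.\<close>

definition N_ext :: "complex set \<Rightarrow> 'a set \<Rightarrow> ('a \<Rightarrow> 'a) set \<Rightarrow> real \<Rightarrow> nat" where
  "N_ext k \<Omega> G x =
     (let S = {K. extension_of_degree k (card \<Omega>) K \<and> has_galois_perm_group k K \<Omega> G \<and>
                  real (Disc k K) \<le> x}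
      in card (S // (field_iso_over k \<inter> S \<times> S)))"

definition malle_conjecture :: "complex set \<Rightarrow> 'a set \<Rightarrow> ('a \<Rightarrow> 'a) set \<Rightarrow> bool" where
  "malle_conjecture k \<Omega> G \<longleftrightarrow>
     (\<exists>C>0. (\<lambda>x. real (N_ext k \<Omega> G x)) \<sim>[at_top]
        (\<lambda>x. C * x powr (1 / real (malle_a \<Omega> G)) * ln x powr (real (malle_b k \<Omega> G) - 1)))"

end

theory Submission
  imports Defs "Jordan_Normal_Form.Char_Poly"
begin

text \<open>
  Let \<open>K\<^sub>1\<close> and \<open>K\<^sub>2\<close> be extensions of \<open>k\<close> with groups \<open>G\<^sub>1\<close> and \<open>G\<^sub>2\<close>. Every automorphism over \<open>k\<close> acts on
  the embeddings of both fields, and the pairs of permutations that arise in this way form a subgroup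
  of \<open>G\<^sub>1 \<times> G\<^sub>2\<close> that surjects onto both factors. By Goursat's lemma such a subgroup is everything if the
  groups have no common nontrivial quotient (\<open>Goursat_no_common_quotient\<close>). Hence the compositum
  \<open>K\<^sub>1 K\<^sub>2\<close> has degree \<open>n m\<close> and group \<open>G\<^sub>1 \<times> G\<^sub>2\<close>, and counting such composita bounds the number of
  product extensions from below. Four ingredients are needed.

  Discriminants. Call a basis over \<open>k\<close> integral if it consists of algebraic integers. If \<open>\<omega>\<close> and \<open>\<eta>\<close>
  are integral bases of \<open>K\<^sub>1\<close> and \<open>K\<^sub>2\<close>, the products \<open>\<omega>\<^sub>i \<eta>\<^sub>j\<close> form an integral basis of the compositum, whose matrix of conjugates is a Kronecker product; its
  discriminant is therefore \<open>d(\<omega>)\<^sup>m d(\<eta>)\<^sup>n\<close>. The discriminant ideal need not be principal, and no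
  basis need generate it, but up to a factor depending only on \<open>k\<close> and the degree some basis does:
  by a lemma of Hurwitz there is an integer \<open>T > 0\<close> depending only on \<open>k\<close> such that every extension
  has an integral basis whose \<open>\<O>\<^sub>k\<close>-span contains \<open>T\<close> times all integers (\<open>near_minimal_basis\<close>).
  This gives \<open>Disc (K\<^sub>1 K\<^sub>2) \<le> C Disc(K\<^sub>1)\<^sup>m Disc(K\<^sub>2)\<^sup>n\<close> with \<open>C\<close> depending only on \<open>k\<close>, \<open>n\<close> and \<open>m\<close>
  (\<open>compositum_Disc_bound\<close>). Norms of ideals are handled throughout as numbers of residue classes,
  bounded by exhibiting sets that meet every class.

  Multiplicity. A field with \<open>N\<close> embeddings has at most \<open>2\<^sup>N\<^sup>*\<^sup>N\<close> intermediate fields over \<open>k\<close>, so the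
  map taking a pair of isomorphism classes to the class of the compositum has bounded fibres
  (\<open>intermediate_fields_bound\<close>, \<open>product_count\<close>).

  Finiteness. The counting function is a cardinality, which would be zero if infinitely many product
  extensions had bounded discriminant. Each of them is the compositum of the two subfields that
  belong to the coordinate projections, and the discriminants of these are bounded in terms of that
  of the whole field (\<open>sub_Disc_le\<close>). As Malle's conjecture makes the counts for \<open>G\<^sub>1\<close> and \<open>G\<^sub>2\<close>
  positive eventually, these count finite sets, and finiteness passes to the product.

  Analysis. It remains to count pairs with \<open>Disc(K\<^sub>1)\<^sup>m Disc(K\<^sub>2)\<^sup>n \<le> X\<close>. If the
  exponent belonging to \<open>K\<^sub>1\<close> is the larger one, a fixed \<open>K\<^sub>2\<close> already gives the right order of magnitude (\<open>pairs_unbalanced\<close>). If both agree, the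
  range of \<open>Disc(K\<^sub>1)\<close> is cut into geometric shells. About \<open>ln X\<close> of them contribute \<open>X\<^sup>\<alpha>\<close> times
  the power \<open>b\<^sub>1 + b\<^sub>2 - 2\<close> of \<open>ln X\<close> each, up to constants, and their number is the additional
  logarithm (\<open>pairs_balanced\<close>).
\<close>

section \<open>Subfields of the complex numbers\<close>

lemma CC_simps [simp]:
  "carrier CC = UNIV" "mult CC = (*)" "add CC = (+)" "\<one>\<^bsub>CC\<^esub> = 1" "\<zero>\<^bsub>CC\<^esub> = 0"
  by (auto simp: ring_of_type_algebra_def)

lemma CC_field: "field CC" by (rule field_from_type_algebra)
lemma CC_domain: "domain CC" using CC_field by (simp add: field_def)
lemma CC_ring: "ring CC" by (rule ring_from_type_algebra)

lemma CC_uminus [simp]: "\<ominus>\<^bsub>CC\<^esub> x = - x"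
proof -
  interpret ring CC by (rule CC_ring)
  show ?thesis using minus_equality[of "-x" x] by simp
qed

lemma CC_inv [simp]: "x \<noteq> 0 \<Longrightarrow> inv\<^bsub>CC\<^esub> x = inverse x"
proof -
  interpret field CC by (rule CC_field)
  show "x \<noteq> 0 \<Longrightarrow> inv\<^bsub>CC\<^esub> x = inverse x" using comm_inv_char[of x "inverse x"] by simp
qed

lemma CC_pow [simp]: "x [^]\<^bsub>CC\<^esub> (n::nat) = x ^ n"
proof -
  interpret ring CC by (rule CC_ring)
  show ?thesis by (induction n) (auto simp: mult.commute)
qed

lemma subfieldD:
  assumes "subfield F CC"
  shows "0 \<in> F" "1 \<in> F" "x \<in> F \<Longrightarrow> y \<in> F \<Longrightarrow> x + y \<in> F" "x \<in> F \<Longrightarrow> y \<in> F \<Longrightarrow> x * y \<in> F"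
    "x \<in> F \<Longrightarrow> - x \<in> F" "x \<in> F \<Longrightarrow> inverse x \<in> F" "x \<in> F \<Longrightarrow> y \<in> F \<Longrightarrow> x - y \<in> F"
    "x \<in> F \<Longrightarrow> y \<in> F \<Longrightarrow> x / y \<in> F"
proof -
  interpret field CC by (rule CC_field)
  have r: "subring F CC" using subfieldE(1)[OF assms] .
  show 0: "0 \<in> F" "1 \<in> F" using subringE(2,3)[OF r] by auto
  show m: "x \<in> F \<Longrightarrow> y \<in> F \<Longrightarrow> x * y \<in> F" for x y using subringE(6)[OF r] by auto
  show a: "x \<in> F \<Longrightarrow> y \<in> F \<Longrightarrow> x + y \<in> F" for x y using subringE(7)[OF r] by auto
  show n: "x \<in> F \<Longrightarrow> - x \<in> F" for x using subringE(5)[OF r] by auto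
  show i: "x \<in> F \<Longrightarrow> inverse x \<in> F" for x
  proof (cases "x = 0")
    case False
    assume "x \<in> F"
    then have "inv\<^bsub>CC\<^esub> x \<in> F - {0}" using subfield_m_inv(1)[OF assms, of x] False by simp
    then show ?thesis using False by simp
  qed (use 0 in auto)
  show "x \<in> F \<Longrightarrow> y \<in> F \<Longrightarrow> x - y \<in> F" using a[of x "-y"] n by simp
  show "x \<in> F \<Longrightarrow> y \<in> F \<Longrightarrow> x / y \<in> F" using m[of x "inverse y"] i by (simp add: divide_inverse)
qed

lemma subfieldI_CC:
  assumes "1 \<in> F" "\<And>x y. x \<in> F \<Longrightarrow> y \<in> F \<Longrightarrow> x + y \<in> F" "\<And>x y. x \<in> F \<Longrightarrow> y \<in> F \<Longrightarrow> x * y \<in> F"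
    "\<And>x. x \<in> F \<Longrightarrow> - x \<in> F" "\<And>x. x \<in> F \<Longrightarrow> x \<noteq> 0 \<Longrightarrow> inverse x \<in> F"
  shows "subfield F CC"
proof -
  interpret field CC by (rule CC_field)
  show ?thesis by (rule subfieldI'[OF subringI]) (use assms in auto)
qed

lemma subfield_sum: "subfield F CC \<Longrightarrow> (\<And>i. i \<in> A \<Longrightarrow> f i \<in> F) \<Longrightarrow> sum f A \<in> F"
  by (induction A rule: infinite_finite_induct) (auto simp: subfieldD)

lemma subfield_prod: "subfield F CC \<Longrightarrow> (\<And>i. i \<in> A \<Longrightarrow> f i \<in> F) \<Longrightarrow> prod f A \<in> F"
  by (induction A rule: infinite_finite_induct) (auto simp: subfieldD)

lemma subfield_power: "subfield F CC \<Longrightarrow> x \<in> F \<Longrightarrow> x ^ n \<in> F"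
  by (induction n) (auto simp: subfieldD)

lemma subfield_of_nat: "subfield F CC \<Longrightarrow> of_nat n \<in> F"
  by (induction n) (auto simp: subfieldD)

lemma subfield_of_int: "subfield F CC \<Longrightarrow> of_int n \<in> F"
  by (cases n rule: int_cases2) (auto simp: subfieldD subfield_of_nat)

lemma subfield_Rats: "subfield F CC \<Longrightarrow> \<rat> \<subseteq> F"
  by (auto elim!: Rats_cases' simp: subfieldD subfield_of_int)

lemma Rats_subfield: "subfield \<rat> CC"
  by (rule subfieldI_CC) auto

definition poly_over :: "complex set \<Rightarrow> complex poly \<Rightarrow> bool" where
  "poly_over F p \<longleftrightarrow> (\<forall>i. Polynomial.coeff p i \<in> F)"

lemma eval_eq_poly: "ring.eval CC p x = poly (Poly (rev p)) x"
proof -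
  interpret ring CC by (rule CC_ring)
  show ?thesis
  proof (induction p)
    case (Cons a p)
    have "poly (Poly (rev p @ [a])) x = poly (Poly (rev p)) x + a * x ^ length p"
      by (simp add: Poly_append poly_monom)
    then show ?case using Cons by simp
  qed simp
qed

text \<open>
  Translates the list polynomials of the ring locale into univariate polynomials with a predicate
  on the coefficients, so that degree arguments can use the type of polynomials.
\<close>

lemma kbar_iff:
  assumes "subfield k CC"
  shows "x \<in> kbar k \<longleftrightarrow> (\<exists>p. poly_over k p \<and> p \<noteq> 0 \<and> poly p x = 0)"
proof -
  interpret field CC by (rule CC_field)
  interpret domain CC by (rule CC_domain)
  have r: "subring k CC" using subfieldE(1)[OF assms] .
  have z: "0 \<in> k" using assms by (rule subfieldD)
  show ?thesis
  proof
    assume "x \<in> kbar k"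
    then have "(algebraic over k) x" by (simp add: kbar_def over_def)
    then obtain p where p: "p \<in> carrier (k[X]\<^bsub>CC\<^esub>)" "p \<noteq> []" "eval p x = 0"
      using algebraicE[OF r, of x] by auto
    have s: "set p \<subseteq> k" "hd p \<noteq> 0" using p(1,2) univ_poly_carrier[of CC k p] by (auto simp: polynomial_def)
    have "poly_over k (Poly (rev p))" unfolding poly_over_def
      using s(1) z by (auto simp: nth_default_def)
        (metis length_rev nth_mem set_rev subsetD)
    moreover have "Polynomial.coeff (Poly (rev p)) (length p - 1) \<noteq> 0"
      using p(2) s(2) by (simp add: nth_default_def rev_nth hd_conv_nth)
    ultimately show "\<exists>p. poly_over k p \<and> p \<noteq> 0 \<and> poly p x = 0"
      using p(3) eval_eq_poly by (metis coeff_0)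
  next
    assume "\<exists>p. poly_over k p \<and> p \<noteq> 0 \<and> poly p x = 0"
    then obtain p where p: "poly_over k p" "p \<noteq> 0" "poly p x = 0" by auto
    let ?q = "rev (coeffs p)"
    have ne: "?q \<noteq> []" using p(2) by simp
    have "set ?q \<subseteq> k" using p(1) by (auto simp: coeffs_def poly_over_def)
    moreover have "hd ?q \<noteq> 0" using p(2) by (simp add: hd_rev last_coeffs_eq_coeff_degree)
    ultimately have "?q \<in> carrier (k[X]\<^bsub>CC\<^esub>)" using univ_poly_carrier[of CC k ?q]
      by (auto simp: polynomial_def)
    then have "(algebraic over k) x"
      by (rule algebraicI) (use ne p(3) eval_eq_poly[of ?q x] in auto)
    then show "x \<in> kbar k" by (simp add: kbar_def over_def)
  qed
qed

lemma kbar_subfield: assumes "subfield k CC" shows "subfield (kbar k) CC"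
proof -
  interpret field CC by (rule CC_field)
  show ?thesis using subfield_of_algebraics[OF assms] by (simp add: kbar_def over_def)
qed

lemma subset_kbar: assumes "subfield k CC" shows "k \<subseteq> kbar k"
proof
  fix c assume c: "c \<in> k"
  have "poly_over k [:-c, 1:]" using assms c
    by (auto simp: poly_over_def subfieldD coeff_pCons split: nat.splits)
  then show "c \<in> kbar k" using kbar_iff[OF assms] by force
qed

lemma finite_dimension_subset_kbar:
  assumes "subfield k CC" "subfield F CC" "ring.finite_dimension CC k F"
  shows "F \<subseteq> kbar k"
proof -
  interpret field CC by (rule CC_field)
  show ?thesis using finite_dimension_imp_algebraic[OF assms(1) subfieldE(1)[OF assms(2)] assms(3)]
    by (auto simp: kbar_def over_def)
qed

text \<open>
  Cancelling powers of the variable makes the constant term of an annihilating polynomial nonzero;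
  the equation can then be solved for the inverse.
\<close>

lemma inverse_as_poly:
  assumes k: "subfield k CC" and x: "x \<in> kbar k" "x \<noteq> 0"
  obtains q where "poly_over k q" "inverse x = poly q x"
proof -
  obtain p where p: "poly_over k p" "p \<noteq> 0" "poly p x = 0"
    using x(1) kbar_iff[OF k] by auto
  have "\<exists>p. poly_over k p \<and> Polynomial.coeff p 0 \<noteq> 0 \<and> poly p x = 0"
    using p
  proof (induction p)
    case (pCons c p)
    show ?case
    proof (cases "c = 0")
      case False
      then show ?thesis using pCons(3-5) by (intro exI[of _ "pCons c p"]) auto
    next
      case True
      then have "poly_over k p" "p \<noteq> 0" "poly p x = 0" using pCons(3-5) x(2)
        by (auto simp: poly_over_def coeff_pCons split: nat.splits)
      then show ?thesis using pCons(2) by auto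
    qed
  qed simp
  then obtain p where p: "poly_over k p" "Polynomial.coeff p 0 \<noteq> 0" "poly p x = 0" by auto
  obtain c q where cq: "p = pCons c q" by (cases p)
  have c: "c \<in> k" "c \<noteq> 0" and q: "poly_over k q" using p cq
    by (auto simp: poly_over_def coeff_pCons split: nat.splits)
  have "c + x * poly q x = 0" using p(3) cq by simp
  then have "x * (- inverse c * poly q x) = 1" using c(2)
    by (metis (no_types, lifting) add_eq_0_iff mult.left_commute mult_minus_left mult_minus_right left_inverse minus_mult_minus minus_equation_iff)
  then have "inverse x = - inverse c * poly q x" by (rule inverse_unique)
  then have "inverse x = poly (Polynomial.smult (- inverse c) q) x" by simp
  moreover have "poly_over k (Polynomial.smult (- inverse c) q)"
    using q c k by (auto simp: poly_over_def subfieldD)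
  ultimately show ?thesis using that by blast
qed

section \<open>Automorphisms of the algebraic closure\<close>

text \<open>
  Automorphisms of the algebraic closure of \<open>k\<close> over \<open>k\<close>, extended by the identity to all complex
  numbers. Being total bijections, they can be composed, inverted and applied to subsets without
  restricting domains, and every embedding of every extension is the restriction of one of them.
\<close>

definition Gal :: "complex set \<Rightarrow> (complex \<Rightarrow> complex) set" where
  "Gal k = {\<gamma>. (\<forall>x\<in>kbar k. \<forall>y\<in>kbar k. \<gamma> (x + y) = \<gamma> x + \<gamma> y \<and> \<gamma> (x * y) = \<gamma> x * \<gamma> y) \<and>
     (\<forall>c\<in>k. \<gamma> c = c) \<and> \<gamma> ` kbar k = kbar k \<and> (\<forall>x. x \<notin> kbar k \<longrightarrow> \<gamma> x = x)}"

text \<open>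
  Graphs of partial \<open>k\<close>-homomorphisms from subrings of the algebraic closure into the complex
  numbers; the third condition says that \<open>0\<close> is the only value at \<open>0\<close>, which makes the relation
  single-valued. As graphs, partial homomorphisms are ordered by inclusion and unions of chains are
  again of this kind, as Zorn's lemma requires.
\<close>

definition hom_graph :: "complex set \<Rightarrow> (complex \<times> complex) set \<Rightarrow> bool" where
  "hom_graph k R \<longleftrightarrow> (\<forall>c\<in>k. (c, c) \<in> R) \<and>
     (\<forall>a b a' b'. (a, b) \<in> R \<longrightarrow> (a', b') \<in> R \<longrightarrow> (a + a', b + b') \<in> R \<and> (a * a', b * b') \<in> R) \<and>
     (\<forall>b. (0, b) \<in> R \<longrightarrow> b = 0) \<and> Domain R \<subseteq> kbar k"

lemma hom_graphD:
  assumes "hom_graph k R"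
  shows "c \<in> k \<Longrightarrow> (c, c) \<in> R" "(a, b) \<in> R \<Longrightarrow> (a', b') \<in> R \<Longrightarrow> (a + a', b + b') \<in> R"
    "(a, b) \<in> R \<Longrightarrow> (a', b') \<in> R \<Longrightarrow> (a * a', b * b') \<in> R" "(0, b) \<in> R \<Longrightarrow> b = 0"
    "(a, b) \<in> R \<Longrightarrow> a \<in> kbar k"
  using assms unfolding hom_graph_def by (auto simp: Domain_iff subset_iff)

lemma hom_graph_sum:
  assumes "hom_graph k R" "subfield k CC" "\<And>i. i \<in> A \<Longrightarrow> (f i, g i) \<in> R"
  shows "(sum f A, sum g A) \<in> R"
  using assms(3)
  by (induction A rule: infinite_finite_induct)
    (use hom_graphD(1)[OF assms(1), of 0] assms(2) in \<open>auto simp: subfieldD hom_graphD(2)[OF assms(1)]\<close>)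

lemma hom_graph_power:
  assumes "hom_graph k R" "subfield k CC" "(a, b) \<in> R"
  shows "(a ^ n, b ^ n) \<in> R"
  by (induction n)
    (use hom_graphD(1)[OF assms(1), of 1] assms(2,3) in \<open>auto simp: subfieldD hom_graphD(3)[OF assms(1)]\<close>)

lemma hom_graph_minus:
  assumes "hom_graph k R" "subfield k CC" "(a, b) \<in> R" "(a', b') \<in> R"
  shows "(a - a', b - b') \<in> R"
proof -
  have "(-1, -1) \<in> R" using hom_graphD(1)[OF assms(1), of "-1"] assms(2) by (simp add: subfieldD)
  from hom_graphD(2)[OF assms(1,3) hom_graphD(3)[OF assms(1) this assms(4)]] show ?thesis by simp
qed

lemma hom_graph_unique:
  assumes "hom_graph k R" "subfield k CC" "(a, b) \<in> R" "(a, b') \<in> R"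
  shows "b = b'"
  using hom_graph_minus[OF assms] hom_graphD(4)[OF assms(1), of "b - b'"] by simp

lemma hom_graph_poly:
  assumes R: "hom_graph k R" and k: "subfield k CC" and ab: "(a, b) \<in> R"
    and pq: "\<And>i. (Polynomial.coeff p i, Polynomial.coeff q i) \<in> R"
  shows "(poly p a, poly q b) \<in> R"
proof -
  let ?n = "max (Polynomial.degree p) (Polynomial.degree q)"
  have e: "poly r x = (\<Sum>i\<le>?n. Polynomial.coeff r i * x ^ i)" if "Polynomial.degree r \<le> ?n" for r and x :: complex
  proof -
    have "poly r x = (\<Sum>i\<le>Polynomial.degree r. Polynomial.coeff r i * x ^ i)" by (rule poly_altdef)
    also have "\<dots> = (\<Sum>i\<le>?n. Polynomial.coeff r i * x ^ i)"
      by (rule sum.mono_neutral_left) (use that in \<open>auto simp: coeff_eq_0\<close>)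
    finally show ?thesis .
  qed
  show ?thesis unfolding e[OF max.cobounded1] e[OF max.cobounded2]
    by (rule hom_graph_sum[OF R k]) (intro hom_graphD(3)[OF R] pq hom_graph_power[OF R k ab])
qed

lemma hom_graph_inverse:
  assumes R: "hom_graph k R" and k: "subfield k CC" and ab: "(a, b) \<in> R" "a \<noteq> 0"
  shows "(inverse a, inverse b) \<in> R"
proof -
  obtain q where q: "poly_over k q" "inverse a = poly q a"
    using inverse_as_poly[OF k hom_graphD(5)[OF R ab(1)] ab(2)] by metis
  have pq: "(poly q a, poly q b) \<in> R"
    by (rule hom_graph_poly[OF R k ab(1)]) (use q(1) hom_graphD(1)[OF R] in \<open>auto simp: poly_over_def\<close>)
  have "(1, b * poly q b) \<in> R" using hom_graphD(3)[OF R ab(1) pq] ab(2) by (simp flip: q(2))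
  moreover have "(1, 1) \<in> R" using hom_graphD(1)[OF R] k by (simp add: subfieldD)
  ultimately have "b * poly q b = 1" by (rule hom_graph_unique[OF R k])
  then have "inverse b = poly q b" by (rule inverse_unique)
  then show ?thesis using pq by (simp add: q(2))
qed

text \<open>
  The extension of a partial homomorphism to the ring generated by its domain and \<open>x\<close> that sends
  \<open>x\<close> to \<open>y\<close>. Pairs of polynomials with related coefficients play the role of a polynomial and its
  image under the homomorphism.
\<close>

definition adjoin_graph where
  "adjoin_graph R x y = {(poly q x, poly q' y) | q q'. \<forall>i. (Polynomial.coeff q i, Polynomial.coeff q' i) \<in> R}"

text \<open>
  Division by the minimal polynomial \<open>p\<close> of \<open>x\<close> shows that a polynomial vanishing at \<open>x\<close> is a multiple
  of \<open>p\<close>, so its image vanishes at the root \<open>y\<close> of the image of \<open>p\<close>. This makes the extension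
  well defined.
\<close>

lemma hom_graph_adjoin:
  assumes R: "hom_graph k R" and k: "subfield k CC" and x: "x \<in> kbar k"
    and pp: "\<And>i. (Polynomial.coeff p i, Polynomial.coeff p' i) \<in> R"
    and lead: "Polynomial.lead_coeff p = 1"
    and min: "\<forall>q q'. (\<forall>i. (Polynomial.coeff q i, Polynomial.coeff q' i) \<in> R) \<longrightarrow> poly q x = 0 \<longrightarrow> q \<noteq> 0 \<longrightarrow>
         Polynomial.degree p \<le> Polynomial.degree q"
    and px: "poly p x = 0" and py: "poly p' y = 0"
  shows "hom_graph k (adjoin_graph R x y)" "R \<subseteq> adjoin_graph R x y" "(x, y) \<in> adjoin_graph R x y"
proof -
  let ?P = "\<lambda>q q'. \<forall>i. (Polynomial.coeff q i, Polynomial.coeff q' i) \<in> R"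
  have z: "(0, 0) \<in> R" "(1, 1) \<in> R" using hom_graphD(1)[OF R] k by (auto simp: subfieldD)
  have Padd: "?P (q + r) (q' + r')" if "?P q q'" "?P r r'" for q r q' r'
    using that hom_graphD(2)[OF R] by auto
  have Psub: "?P (q - r) (q' - r')" if "?P q q'" "?P r r'" for q r q' r'
    using that hom_graph_minus[OF R k] by auto
  have Pmul: "?P (q * r) (q' * r')" if "?P q q'" "?P r r'" for q r q' r'
    unfolding coeff_mult using that
    by (intro allI hom_graph_sum[OF R k] hom_graphD(3)[OF R]) auto
  have Pmon: "?P (Polynomial.monom a n) (Polynomial.monom a' n)" if "(a, a') \<in> R" for a a' n
    using that z by auto
  have zero: "q' = 0" if "?P 0 q'" for q'
    using that hom_graphD(4)[OF R] by (intro poly_eqI) auto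
  have kills: "poly q' y = 0" if "?P q q'" "poly q x = 0" for q q'
    using that
  proof (induction "Polynomial.degree q" arbitrary: q q' rule: less_induct)
    case less
    show ?case
    proof (cases "q = 0")
      case True
      then show ?thesis using zero[of q'] less.prems by (metis poly_0)
    next
      case False
      have d: "Polynomial.degree p \<le> Polynomial.degree q" using min less.prems False by blast
      define n where "n = Polynomial.degree q - Polynomial.degree p"
      define a a' where "a = Polynomial.lead_coeff q" and "a' = Polynomial.coeff q' (Polynomial.degree q)"
      have aa: "(a, a') \<in> R" using less.prems unfolding a_def a'_def by auto
      define r r' where "r = q - Polynomial.monom a n * p" and "r' = q' - Polynomial.monom a' n * p'"
      have P: "?P r r'" unfolding r_def r'_def by (intro Psub Pmul Pmon aa) (use less.prems pp in auto)
      have rx: "poly r x = 0" using less.prems px by (simp add: r_def)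
      have a0: "a \<noteq> 0" using False by (simp add: a_def)
      have p0: "p \<noteq> 0" using lead by auto
      have dm: "Polynomial.degree (Polynomial.monom a n * p) = Polynomial.degree q"
        using a0 p0 d by (simp add: degree_mult_eq degree_monom_eq n_def)
      have lm: "Polynomial.coeff (Polynomial.monom a n * p) (Polynomial.degree q) = a"
        using dm lead by (metis lead_coeff_mult lead_coeff_monom mult.right_neutral)
      have le: "Polynomial.degree r \<le> Polynomial.degree q" unfolding r_def by (rule degree_diff_le) (use dm in auto)
      have c0: "Polynomial.coeff r (Polynomial.degree q) = 0" using lm by (simp add: r_def a_def)
      have "poly r' y = 0"
      proof (cases "r = 0")
        case True
        with P have "\<forall>i. (Polynomial.coeff 0 i, Polynomial.coeff r' i) \<in> R" by simp
        from zero[OF this] show ?thesis by simp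
      next
        case False
        then have "Polynomial.degree r < Polynomial.degree q" using le c0
          by (metis leading_coeff_0_iff le_neq_implies_less)
        then show ?thesis using less.hyps P rx by blast
      qed
      then show ?thesis using py by (simp add: r'_def)
    qed
  qed
  show "R \<subseteq> adjoin_graph R x y"
  proof
    fix ab assume ab: "ab \<in> R"
    obtain a b where [simp]: "ab = (a, b)" by (cases ab)
    show "ab \<in> adjoin_graph R x y" unfolding adjoin_graph_def mem_Collect_eq
      by (rule exI[of _ "[:a:]"], rule exI[of _ "[:b:]"])
        (use ab z in \<open>auto simp: coeff_pCons split: nat.splits\<close>)
  qed
  then have 1: "(c, c) \<in> adjoin_graph R x y" if "c \<in> k" for c using that hom_graphD(1)[OF R] by auto
  show "(x, y) \<in> adjoin_graph R x y" unfolding adjoin_graph_def mem_Collect_eq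
    by (rule exI[of _ "[:0, 1:]"], rule exI[of _ "[:0, 1:]"])
      (use z in \<open>auto simp: coeff_pCons split: nat.splits\<close>)
  have Rk: "a \<in> kbar k" if "(a, b) \<in> R" for a b using hom_graphD(5)[OF R that] .
  have dom: "Domain (adjoin_graph R x y) \<subseteq> kbar k"
  proof
    fix a assume "a \<in> Domain (adjoin_graph R x y)"
    then obtain q q' where q: "a = poly q x" "?P q q'" unfolding adjoin_graph_def by auto
    have kb: "subfield (kbar k) CC" by (rule kbar_subfield[OF k])
    show "a \<in> kbar k" unfolding q(1) poly_altdef
      by (intro subfield_sum[OF kb] subfieldD(4)[OF kb] subfield_power[OF kb] x) (use q(2) Rk in blast)
  qed
  show "hom_graph k (adjoin_graph R x y)"
    unfolding hom_graph_def
  proof (intro conjI ballI allI impI)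
    fix a b a' b' assume "(a, b) \<in> adjoin_graph R x y" "(a', b') \<in> adjoin_graph R x y"
    then obtain q q' r r' where q: "a = poly q x" "b = poly q' y" "?P q q'" "a' = poly r x" "b' = poly r' y" "?P r r'"
      unfolding adjoin_graph_def by blast
    show "(a + a', b + b') \<in> adjoin_graph R x y" unfolding adjoin_graph_def mem_Collect_eq
      by (rule exI[of _ "q + r"], rule exI[of _ "q' + r'"]) (simp only: q(1,2,4,5) poly_add Padd[OF q(3,6)] simp_thms)
    show "(a * a', b * b') \<in> adjoin_graph R x y" unfolding adjoin_graph_def mem_Collect_eq
      by (rule exI[of _ "q * r"], rule exI[of _ "q' * r'"]) (simp only: q(1,2,4,5) poly_mult Pmul[OF q(3,6)] simp_thms)
  next
    fix b assume "(0, b) \<in> adjoin_graph R x y"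
    then obtain q q' where "0 = poly q x" "b = poly q' y" "?P q q'" unfolding adjoin_graph_def by blast
    then show "b = 0" using kills[of q q'] by metis
  qed (use 1 dom in auto)
qed

lemma min_graph_poly:
  assumes R: "hom_graph k R" and k: "subfield k CC" and x: "x \<in> kbar k"
  obtains p p' where "\<And>i. (Polynomial.coeff p i, Polynomial.coeff p' i) \<in> R" "Polynomial.lead_coeff p = 1"
    "\<forall>q q'. (\<forall>i. (Polynomial.coeff q i, Polynomial.coeff q' i) \<in> R) \<longrightarrow> poly q x = 0 \<longrightarrow> q \<noteq> 0 \<longrightarrow>
         Polynomial.degree p \<le> Polynomial.degree q"
    "poly p x = 0" "Polynomial.degree p' = Polynomial.degree p" "Polynomial.degree p > 0"
proof -
  let ?P = "\<lambda>q q'. \<forall>i. (Polynomial.coeff q i, Polynomial.coeff q' i) \<in> R"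
  obtain p0 where p0: "poly_over k p0" "p0 \<noteq> 0" "poly p0 x = 0"
    using x kbar_iff[OF k] by auto
  have P0: "?P p0 p0" using p0(1) hom_graphD(1)[OF R] by (auto simp: poly_over_def)
  define Q where "Q = (\<lambda>n. \<exists>q q'. ?P q q' \<and> poly q x = 0 \<and> q \<noteq> 0 \<and> Polynomial.degree q = n)"
  have "Q (Polynomial.degree p0)" using P0 p0 unfolding Q_def by auto
  define n where "n = (LEAST n. Q n)"
  have "Q n" unfolding n_def by (rule LeastI) fact
  then obtain q q' where q: "?P q q'" "poly q x = 0" "q \<noteq> 0" "Polynomial.degree q = n" unfolding Q_def by auto
  have minq: "n \<le> Polynomial.degree r" if "?P r r'" "poly r x = 0" "r \<noteq> 0" for r r'
    unfolding n_def by (rule Least_le) (use that in \<open>auto simp: Q_def\<close>)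
  define a a' where "a = inverse (Polynomial.lead_coeff q)" and "a' = inverse (Polynomial.coeff q' n)"
  have lq: "Polynomial.lead_coeff q \<noteq> 0" using q(3) by simp
  have aa: "(a, a') \<in> R" unfolding a_def a'_def
    by (rule hom_graph_inverse[OF R k]) (use q lq in auto)
  define p p' where "p = Polynomial.smult a q" and "p' = Polynomial.smult a' q'"
  have a0: "a \<noteq> 0" using lq by (simp add: a_def)
  have P: "?P p p'" unfolding p_def p'_def using q(1) aa hom_graphD(3)[OF R] by auto
  have l: "Polynomial.lead_coeff p = 1" using a0 lq by (simp add: p_def a_def)
  have dp: "Polynomial.degree p = n" using a0 q(4) by (simp add: p_def)
  have "Polynomial.coeff p' n = 1"
  proof -
    have "(1, Polynomial.coeff p' n) \<in> R" using P l dp by metis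
    moreover have "(1, 1) \<in> R" using hom_graphD(1)[OF R] k by (simp add: subfieldD)
    ultimately show ?thesis using hom_graph_unique[OF R k] by blast
  qed
  moreover have "Polynomial.coeff p' i = 0" if "i > n" for i
  proof -
    have "Polynomial.coeff p i = 0" using that dp by (simp add: coeff_eq_0)
    then show ?thesis using P hom_graphD(4)[OF R] by metis
  qed
  ultimately have dp': "Polynomial.degree p' = n"
    by (metis degree_le le_antisym le_degree zero_neq_one)
  have px: "poly p x = 0" using q by (simp add: p_def)
  have "n > 0"
  proof (rule ccontr)
    assume "\<not> n > 0"
    then have "p = [:1:]" using dp l by (metis degree_0_id neq0_conv coeff_pCons_0 degree_eq_zeroE)
    then show False using px by simp
  qed
  show ?thesis
  proof (rule that[of p p'])
    show "(Polynomial.coeff p i, Polynomial.coeff p' i) \<in> R" for i using P by simp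
    show "\<forall>q q'. (\<forall>i. (Polynomial.coeff q i, Polynomial.coeff q' i) \<in> R) \<longrightarrow> poly q x = 0 \<longrightarrow> q \<noteq> 0 \<longrightarrow>
         Polynomial.degree p \<le> Polynomial.degree q"
      using minq dp by blast
  qed (use l px dp dp' \<open>n > 0\<close> in simp_all)
qed

text \<open>
  A maximal extension, which exists by Zorn's lemma, is defined on the whole closure, since otherwise
  a further element could be adjoined. It is surjective because a polynomial over \<open>k\<close> has finitely
  many roots and an injective map permutes them.
\<close>

lemma hom_graph_extends:
  assumes R: "hom_graph k R" and k: "subfield k CC"
  obtains \<gamma> where "\<gamma> \<in> Gal k" "\<And>a b. (a, b) \<in> R \<Longrightarrow> \<gamma> a = b"
proof -
  define A where "A = {S. hom_graph k S \<and> R \<subseteq> S}"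
  have "\<exists>M\<in>A. \<forall>Y\<in>A. M \<subseteq> Y \<longrightarrow> Y = M"
  proof (rule subset_Zorn)
    fix C assume C: "subset.chain A C"
    show "\<exists>U\<in>A. \<forall>Y\<in>C. Y \<subseteq> U"
    proof (cases "C = {}")
      case True
      then show ?thesis using R by (auto simp: A_def)
    next
      case False
      have CA: "\<And>S. S \<in> C \<Longrightarrow> hom_graph k S \<and> R \<subseteq> S"
        using C by (auto simp: subset.chain_def A_def)
      have ch: "\<And>S T. S \<in> C \<Longrightarrow> T \<in> C \<Longrightarrow> S \<subseteq> T \<or> T \<subseteq> S"
        using C unfolding subset_chain_def by blast
      have two: "\<exists>S\<in>C. u \<in> S \<and> v \<in> S" if uv: "u \<in> \<Union>C" "v \<in> \<Union>C" for u v
      proof -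
        obtain S T where S: "S \<in> C" "u \<in> S" "T \<in> C" "v \<in> T" using uv by auto
        then show ?thesis using ch[OF S(1,3)] by auto
      qed
      have "hom_graph k (\<Union>C)" unfolding hom_graph_def
      proof (intro conjI ballI allI impI)
        fix c assume "c \<in> k"
        moreover obtain S where "S \<in> C" using False by auto
        ultimately show "(c, c) \<in> \<Union>C" using CA hom_graphD(1) by (metis UnionI)
      next
        fix a b a' b' assume "(a, b) \<in> \<Union>C" "(a', b') \<in> \<Union>C"
        then obtain S where S: "S \<in> C" "(a, b) \<in> S" "(a', b') \<in> S" using two by metis
        have h: "hom_graph k S" using CA[OF S(1)] by simp
        show "(a + a', b + b') \<in> \<Union>C" "(a * a', b * b') \<in> \<Union>C"
          using S(1) hom_graphD(2,3)[OF h S(2,3)] by auto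
      next
        fix b assume "(0, b) \<in> \<Union>C"
        then obtain S where S: "S \<in> C" "(0, b) \<in> S" by auto
        then show "b = 0" using CA[OF S(1)] hom_graphD(4) by metis
      next
        show "Domain (\<Union>C) \<subseteq> kbar k"
        proof
          fix a assume "a \<in> Domain (\<Union>C)"
          then obtain S b where S: "S \<in> C" "(a, b) \<in> S" by auto
          then show "a \<in> kbar k" using CA[OF S(1)] hom_graphD(5) by metis
        qed
      qed
      then have "\<Union>C \<in> A" using False CA by (auto simp: A_def)
      then show ?thesis by blast
    qed
  qed
  then obtain M where M: "hom_graph k M" "R \<subseteq> M" and max: "\<And>Y. hom_graph k Y \<Longrightarrow> M \<subseteq> Y \<Longrightarrow> Y = M"
    unfolding A_def by auto
  have all: "x \<in> Domain M" if x: "x \<in> kbar k" for x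
  proof -
    obtain p p' where p: "\<And>i. (Polynomial.coeff p i, Polynomial.coeff p' i) \<in> M" "Polynomial.lead_coeff p = 1"
      "\<forall>q q'. (\<forall>i. (Polynomial.coeff q i, Polynomial.coeff q' i) \<in> M) \<longrightarrow> poly q x = 0 \<longrightarrow> q \<noteq> 0 \<longrightarrow>
         Polynomial.degree p \<le> Polynomial.degree q"
      "poly p x = 0" "Polynomial.degree p' = Polynomial.degree p" "Polynomial.degree p > 0"
      using min_graph_poly[OF M(1) k x] by metis
    obtain y where y: "poly p' y = 0" using p(5,6) fundamental_theorem_of_algebra[of p']
      by (metis constant_degree neq0_conv)
    note h = hom_graph_adjoin[OF M(1) k x p(1,2,3,4) y]
    have "adjoin_graph M x y = M" using max h(1,2) by blast
    then show ?thesis using h(3) by auto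
  qed
  define \<gamma> where "\<gamma> = (\<lambda>x. if x \<in> kbar k then (THE y. (x, y) \<in> M) else x)"
  have g: "\<gamma> a = b" if "(a, b) \<in> M" for a b
    using that hom_graph_unique[OF M(1) k] hom_graphD(5)[OF M(1)] unfolding \<gamma>_def by auto
  have gM: "(x, \<gamma> x) \<in> M" if "x \<in> kbar k" for x using all[OF that] g by auto
  have hom: "\<gamma> (x + y) = \<gamma> x + \<gamma> y" "\<gamma> (x * y) = \<gamma> x * \<gamma> y" if "x \<in> kbar k" "y \<in> kbar k" for x y
    using g gM[OF that(1)] gM[OF that(2)] hom_graphD(2,3)[OF M(1)] by blast+
  have fixes_k: "\<gamma> c = c" if "c \<in> k" for c using g hom_graphD(1)[OF M(1) that] .
  have inj: "inj_on \<gamma> (kbar k)"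
  proof (rule inj_onI)
    fix x y assume xy: "x \<in> kbar k" "y \<in> kbar k" "\<gamma> x = \<gamma> y"
    show "x = y"
    proof (rule ccontr)
      assume "x \<noteq> y"
      have d: "(x - y, 0) \<in> M" using hom_graph_minus[OF M(1) k gM[OF xy(1)] gM[OF xy(2)]] xy(3) by simp
      have "(inverse (x - y), inverse 0) \<in> M"
        by (rule hom_graph_inverse[OF M(1) k d]) (use \<open>x \<noteq> y\<close> in simp)
      from hom_graphD(3)[OF M(1) d this] have "(1, 0) \<in> M" using \<open>x \<noteq> y\<close> by simp
      moreover have "(1, 1) \<in> M" using hom_graphD(1)[OF M(1)] k by (simp add: subfieldD)
      ultimately show False using hom_graph_unique[OF M(1) k] by fastforce
    qed
  qed
  have kk: "(Polynomial.coeff r i, Polynomial.coeff r i) \<in> M" if "poly_over k r" for r i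
    using that hom_graphD(1)[OF M(1)] by (auto simp: poly_over_def)
  have roots: "poly p (\<gamma> x) = 0" "\<gamma> x \<in> kbar k" if "poly_over k p" "poly p x = 0" "p \<noteq> 0" for p x
  proof -
    have x: "x \<in> kbar k" using that kbar_iff[OF k] by auto
    have "(poly p x, poly p (\<gamma> x)) \<in> M" by (rule hom_graph_poly[OF M(1) k gM[OF x]]) (use kk that in auto)
    then show "poly p (\<gamma> x) = 0" using that hom_graphD(4)[OF M(1)] by auto
    then show "\<gamma> x \<in> kbar k" using kbar_iff[OF k] that by auto
  qed
  have "\<gamma> ` kbar k = kbar k"
  proof
    show "\<gamma> ` kbar k \<subseteq> kbar k" using roots kbar_iff[OF k] by blast
    show "kbar k \<subseteq> \<gamma> ` kbar k"
    proof
      fix y assume "y \<in> kbar k"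
      then obtain p where p: "poly_over k p" "p \<noteq> 0" "poly p y = 0" using kbar_iff[OF k] by auto
      let ?Z = "{z. poly p z = 0}"
      have fin: "finite ?Z" using p(2) by (rule poly_roots_finite)
      have sub: "?Z \<subseteq> kbar k" using p kbar_iff[OF k] by auto
      have "\<gamma> ` ?Z = ?Z"
        by (rule endo_inj_surj[OF fin]) (use roots(1)[OF p(1) _ p(2)] inj_on_subset[OF inj sub] in auto)
      then show "y \<in> \<gamma> ` kbar k" using p(3) sub by blast
    qed
  qed
  then have "\<gamma> \<in> Gal k" unfolding Gal_def using hom fixes_k by (auto simp: \<gamma>_def)
  then show ?thesis using that g M(2) by blast
qed

text \<open>
  The algebraic closure is Galois over \<open>F\<close>: if the minimal polynomial of \<open>x\<close> had no other root, it
  would be a power of a linear polynomial, and its second coefficient would put \<open>x\<close> into \<open>F\<close>.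
\<close>

lemma Gal_moves:
  assumes k: "subfield k CC" and F: "subfield F CC" "k \<subseteq> F" "F \<subseteq> kbar k" and x: "x \<in> kbar k" "x \<notin> F"
  obtains \<gamma> where "\<gamma> \<in> Gal k" "\<And>y. y \<in> F \<Longrightarrow> \<gamma> y = y" "\<gamma> x \<noteq> x"
proof -
  define R where "R = Id_on F"
  have R: "hom_graph k R" using F by (auto simp: hom_graph_def R_def subfieldD)
  obtain p p' where p: "\<And>i. (Polynomial.coeff p i, Polynomial.coeff p' i) \<in> R" "Polynomial.lead_coeff p = 1"
    "\<forall>q q'. (\<forall>i. (Polynomial.coeff q i, Polynomial.coeff q' i) \<in> R) \<longrightarrow> poly q x = 0 \<longrightarrow> q \<noteq> 0 \<longrightarrow>
         Polynomial.degree p \<le> Polynomial.degree q"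
    "poly p x = 0" "Polynomial.degree p' = Polynomial.degree p" "Polynomial.degree p > 0"
    using min_graph_poly[OF R k x(1)] by metis
  have [simp]: "p' = p" using p(1) by (intro poly_eqI) (auto simp: R_def)
  have co: "Polynomial.coeff p i \<in> F" for i using p(1)[of i] by (auto simp: R_def)
  have "\<exists>y. y \<noteq> x \<and> poly p y = 0"
  proof (rule ccontr)
    assume none: "\<not> ?thesis"
    have p0: "p \<noteq> 0" using p(2) by auto
    obtain A where A: "size A = Polynomial.degree p" "p = smult (Polynomial.lead_coeff p) (\<Prod>a\<in>#A. [:- a, 1:])"
      using alg_closed_imp_factorization[OF p0] by metis
    have A': "p = (\<Prod>a\<in>#A. [:- a, 1:])" using A(2) p(2) by simp
    have "a = x" if "a \<in># A" for a
    proof -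
      have "poly p a = 0" using that by (subst A') (auto simp: poly_prod_mset)
      then show ?thesis using none by blast
    qed
    define d where "d = Polynomial.degree p"
    have sz: "size A = d" using A(1) by (simp add: d_def)
    have sub: "set_mset A \<subseteq> {x}" using \<open>\<And>a. a \<in># A \<Longrightarrow> a = x\<close> by auto
    have "A = replicate_mset d x" using set_mset_subset_singletonD[OF sub] unfolding sz .
    from A'[unfolded this] have "p = [:-x, 1:] ^ d" by simp
    then have pe: "p = [:-x, 1:] ^ Polynomial.degree p" unfolding d_def .
    obtain m where m: "Polynomial.degree p = Suc m" using p(6) by (cases "Polynomial.degree p") auto
    have "Polynomial.coeff ([:a, 1:] ^ Suc n) n = of_nat (Suc n) * a" for a :: complex and n
    proof (induction n)
      case (Suc n)
      have "Polynomial.coeff ([:a, 1:] ^ Suc n) (Suc n) = 1"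
        by (rule coeff_linear_power)
      then show ?case using Suc by (simp add: power_Suc[of _ "Suc n"] algebra_simps del: power_Suc)
    qed simp
    then have "Polynomial.coeff p m = of_nat (Suc m) * (- x)" using pe m by metis
    then have "x = - (Polynomial.coeff p m / of_nat (Suc m))" by (simp add: field_simps del: of_nat_Suc)
    moreover have "- (Polynomial.coeff p m / of_nat (Suc m)) \<in> F"
      by (intro subfieldD(5)[OF F(1)] subfieldD(8)[OF F(1)] co subfield_of_nat[OF F(1)])
    ultimately show False using x(2) by simp
  qed
  then obtain y where y: "y \<noteq> x" "poly p' y = 0" by auto
  note h = hom_graph_adjoin[OF R k x(1) p(1,2,3,4) y(2)]
  obtain \<gamma> where g: "\<gamma> \<in> Gal k" "\<And>a b. (a, b) \<in> adjoin_graph R x y \<Longrightarrow> \<gamma> a = b"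
    using hom_graph_extends[OF h(1) k] by metis
  show ?thesis
  proof (rule that[OF g(1)])
    show "\<gamma> y = y" if "y \<in> F" for y using g(2) h(2) that by (auto simp: R_def)
    show "\<gamma> x \<noteq> x" using g(2)[OF h(3)] y(1) by simp
  qed
qed

lemma GalD:
  assumes "\<gamma> \<in> Gal k"
  shows "x \<in> kbar k \<Longrightarrow> y \<in> kbar k \<Longrightarrow> \<gamma> (x + y) = \<gamma> x + \<gamma> y"
    "x \<in> kbar k \<Longrightarrow> y \<in> kbar k \<Longrightarrow> \<gamma> (x * y) = \<gamma> x * \<gamma> y"
    "c \<in> k \<Longrightarrow> \<gamma> c = c" "x \<in> kbar k \<Longrightarrow> \<gamma> x \<in> kbar k" "\<gamma> ` kbar k = kbar k"
    "x \<notin> kbar k \<Longrightarrow> \<gamma> x = x"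
  using assms unfolding Gal_def by auto

context
  fixes k :: "complex set"
  assumes k: "subfield k CC"
begin

lemma kbar_closed:
  "0 \<in> kbar k" "1 \<in> kbar k" "x \<in> kbar k \<Longrightarrow> y \<in> kbar k \<Longrightarrow> x + y \<in> kbar k"
  "x \<in> kbar k \<Longrightarrow> y \<in> kbar k \<Longrightarrow> x * y \<in> kbar k" "x \<in> kbar k \<Longrightarrow> - x \<in> kbar k"
  "x \<in> kbar k \<Longrightarrow> inverse x \<in> kbar k" "x \<in> kbar k \<Longrightarrow> y \<in> kbar k \<Longrightarrow> x - y \<in> kbar k"
  by (simp_all add: subfieldD[OF kbar_subfield[OF k]])

lemma Gal_01: "\<gamma> \<in> Gal k \<Longrightarrow> \<gamma> 0 = 0" "\<gamma> \<in> Gal k \<Longrightarrow> \<gamma> 1 = 1"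
  using GalD(3) k by (simp_all add: subfieldD)

lemma Gal_uminus: "\<gamma> \<in> Gal k \<Longrightarrow> x \<in> kbar k \<Longrightarrow> \<gamma> (- x) = - \<gamma> x"
  using GalD(1)[of \<gamma> k x "-x"] Gal_01(1)[of \<gamma>] kbar_closed(5)[of x] by (simp add: eq_neg_iff_add_eq_0 add.commute)

lemma Gal_diff: "\<gamma> \<in> Gal k \<Longrightarrow> x \<in> kbar k \<Longrightarrow> y \<in> kbar k \<Longrightarrow> \<gamma> (x - y) = \<gamma> x - \<gamma> y"
  using GalD(1)[of \<gamma> k x "-y"] Gal_uminus[of \<gamma> y] kbar_closed(5)[of y] by simp

lemma Gal_nonzero: "\<gamma> \<in> Gal k \<Longrightarrow> x \<in> kbar k \<Longrightarrow> x \<noteq> 0 \<Longrightarrow> \<gamma> x \<noteq> 0"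
  using GalD(2)[of \<gamma> k x "inverse x"] Gal_01(2)[of \<gamma>] kbar_closed(6)[of x] by auto

lemma Gal_inj: "\<gamma> \<in> Gal k \<Longrightarrow> x \<in> kbar k \<Longrightarrow> y \<in> kbar k \<Longrightarrow> \<gamma> x = \<gamma> y \<Longrightarrow> x = y"
  using Gal_nonzero[of \<gamma> "x - y"] Gal_diff[of \<gamma> x y] kbar_closed(7)[of x y] by auto

lemma Gal_inverse: "\<gamma> \<in> Gal k \<Longrightarrow> x \<in> kbar k \<Longrightarrow> \<gamma> (inverse x) = inverse (\<gamma> x)"
proof (cases "x = 0")
  case False
  assume a: "\<gamma> \<in> Gal k" "x \<in> kbar k"
  then have "\<gamma> x * \<gamma> (inverse x) = 1"
    using GalD(2)[OF a(1) a(2) kbar_closed(6)[OF a(2)]] Gal_01(2)[OF a(1)] False by simp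
  then show ?thesis by (metis inverse_unique)
qed (simp add: Gal_01)

lemma Gal_sum: "\<gamma> \<in> Gal k \<Longrightarrow> (\<And>i. i \<in> A \<Longrightarrow> f i \<in> kbar k) \<Longrightarrow> \<gamma> (sum f A) = (\<Sum>i\<in>A. \<gamma> (f i))"
  by (induction A rule: infinite_finite_induct)
    (auto simp: Gal_01 GalD(1) subfield_sum[OF kbar_subfield[OF k]])

lemma Gal_prod: "\<gamma> \<in> Gal k \<Longrightarrow> (\<And>i. i \<in> A \<Longrightarrow> f i \<in> kbar k) \<Longrightarrow> \<gamma> (prod f A) = (\<Prod>i\<in>A. \<gamma> (f i))"
  by (induction A rule: infinite_finite_induct)
    (auto simp: Gal_01 GalD(2) subfield_prod[OF kbar_subfield[OF k]])

lemma Gal_id: "id \<in> Gal k" by (auto simp: Gal_def)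

lemma Gal_comp: "\<gamma> \<in> Gal k \<Longrightarrow> \<delta> \<in> Gal k \<Longrightarrow> \<gamma> \<circ> \<delta> \<in> Gal k"
proof -
  assume g: "\<gamma> \<in> Gal k" and d: "\<delta> \<in> Gal k"
  have "(\<gamma> \<circ> \<delta>) ` kbar k = kbar k" using GalD(5)[OF g] GalD(5)[OF d] by (metis image_comp)
  then show ?thesis using GalD[OF g] GalD[OF d] unfolding Gal_def by simp
qed

lemma Gal_bij: assumes "\<gamma> \<in> Gal k" shows "bij \<gamma>"
proof (rule bijI)
  show "inj \<gamma>"
  proof (rule injI)
    fix x y assume e: "\<gamma> x = \<gamma> y"
    show "x = y"
    proof (cases "x \<in> kbar k \<longleftrightarrow> y \<in> kbar k")
      case True
      then show ?thesis using e Gal_inj[OF assms] GalD(6)[OF assms] by metis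
    next
      case False
      then show ?thesis using e GalD(4,6)[OF assms] by metis
    qed
  qed
  show "surj \<gamma>"
  proof (rule surjI)
    show "\<gamma> (if y \<in> kbar k then inv_into (kbar k) \<gamma> y else y) = y" for y
      using GalD(5,6)[OF assms] by (auto simp: f_inv_into_f)
  qed
qed

lemma Gal_inv: assumes "\<gamma> \<in> Gal k" shows "inv' \<gamma> \<in> Gal k"
proof -
  note b = Gal_bij[OF assms]
  have s: "\<gamma> (inv' \<gamma> x) = x" "inv' \<gamma> (\<gamma> x) = x" for x
    using b by (auto simp: bij_def surj_f_inv_f)
  have kb: "inv' \<gamma> x \<in> kbar k" if "x \<in> kbar k" for x
    using that GalD(6)[OF assms, of "inv' \<gamma> x"] s by metis
  have "inv' \<gamma> (x + y) = inv' \<gamma> x + inv' \<gamma> y" "inv' \<gamma> (x * y) = inv' \<gamma> x * inv' \<gamma> y"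
    if "x \<in> kbar k" "y \<in> kbar k" for x y
    using that s kb GalD(1,2)[OF assms, of "inv' \<gamma> x" "inv' \<gamma> y"] by metis+
  moreover have "inv' \<gamma> c = c" if "c \<in> k" for c using that s GalD(3)[OF assms] by metis
  moreover have "inv' \<gamma> ` kbar k = kbar k"
  proof
    show "inv' \<gamma> ` kbar k \<subseteq> kbar k" using kb by auto
    show "kbar k \<subseteq> inv' \<gamma> ` kbar k"
    proof
      fix x assume "x \<in> kbar k"
      then have "inv' \<gamma> (\<gamma> x) \<in> inv' \<gamma> ` kbar k" using GalD(4)[OF assms] by blast
      then show "x \<in> inv' \<gamma> ` kbar k" by (simp only: s(2))
    qed
  qed
  moreover have "inv' \<gamma> x = x" if "x \<notin> kbar k" for x using that s GalD(6)[OF assms] by metis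
  ultimately show ?thesis unfolding Gal_def by blast
qed

lemma Gal_eq_subfield:
  assumes "\<gamma> \<in> Gal k" "\<delta> \<in> Gal k"
  shows "subfield {x \<in> kbar k. \<gamma> x = \<delta> x} CC"
  by (rule subfieldI_CC) (use assms in \<open>auto simp: kbar_closed Gal_01 GalD(1,2) Gal_uminus Gal_inverse\<close>)

lemma Gal_vimage_subfield:
  assumes "\<gamma> \<in> Gal k" "subfield F CC"
  shows "subfield {x \<in> kbar k. \<gamma> x \<in> F} CC"
  by (rule subfieldI_CC) (use assms in \<open>auto simp: kbar_closed Gal_01 GalD(1,2) Gal_uminus Gal_inverse subfieldD\<close>)

lemma Gal_image_subfield:
  assumes "\<gamma> \<in> Gal k" "subfield F CC" "F \<subseteq> kbar k"
  shows "subfield (\<gamma> ` F) CC"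
proof (rule subfieldI_CC)
  show "1 \<in> \<gamma> ` F" using Gal_01(2)[OF assms(1)] subfieldD(2)[OF assms(2)] by (metis imageI)
  fix x assume "x \<in> \<gamma> ` F"
  then obtain a where a: "a \<in> F" "x = \<gamma> a" by auto
  show "- x \<in> \<gamma> ` F" using a assms(3) Gal_uminus[OF assms(1)] subfieldD(5)[OF assms(2)] by (metis imageI subsetD)
  show "inverse x \<in> \<gamma> ` F" using a assms(3) Gal_inverse[OF assms(1)] subfieldD(6)[OF assms(2)] by (metis imageI subsetD)
  fix y assume "y \<in> \<gamma> ` F"
  then obtain b where b: "b \<in> F" "y = \<gamma> b" by auto
  have ab: "a \<in> kbar k" "b \<in> kbar k" using a b assms(3) by auto
  show "x + y \<in> \<gamma> ` F" using a b GalD(1)[OF assms(1) ab] subfieldD(3)[OF assms(2)] by (metis imageI)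
  show "x * y \<in> \<gamma> ` F" using a b GalD(2)[OF assms(1) ab] subfieldD(4)[OF assms(2)] by (metis imageI)
qed

lemma hom_extends:
  assumes F: "subfield F CC" "k \<subseteq> F" "F \<subseteq> kbar k"
    and add: "\<And>x y. x \<in> F \<Longrightarrow> y \<in> F \<Longrightarrow> \<phi> (x + y) = \<phi> x + \<phi> y"
    and mult: "\<And>x y. x \<in> F \<Longrightarrow> y \<in> F \<Longrightarrow> \<phi> (x * y) = \<phi> x * \<phi> y"
    and fix_k: "\<And>c. c \<in> k \<Longrightarrow> \<phi> c = c"
  obtains \<gamma> where "\<gamma> \<in> Gal k" "\<And>x. x \<in> F \<Longrightarrow> \<gamma> x = \<phi> x"
proof -
  have "hom_graph k ((\<lambda>x. (x, \<phi> x)) ` F)"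
    unfolding hom_graph_def
  proof (intro conjI ballI allI impI)
    fix c assume "c \<in> k"
    then show "(c, c) \<in> (\<lambda>x. (x, \<phi> x)) ` F" using fix_k F(2) by force
  next
    fix a b a' b' assume "(a, b) \<in> (\<lambda>x. (x, \<phi> x)) ` F" "(a', b') \<in> (\<lambda>x. (x, \<phi> x)) ` F"
    then have ab: "a \<in> F" "b = \<phi> a" "a' \<in> F" "b' = \<phi> a'" by auto
    show "(a + a', b + b') \<in> (\<lambda>x. (x, \<phi> x)) ` F" using ab F(1) add by (auto simp: subfieldD)
    show "(a * a', b * b') \<in> (\<lambda>x. (x, \<phi> x)) ` F" using ab F(1) mult by (auto simp: subfieldD)
  next
    fix b assume "(0, b) \<in> (\<lambda>x. (x, \<phi> x)) ` F"
    then show "b = 0" using fix_k[of 0] k by (auto simp: subfieldD)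
  qed (use F(3) in auto)
  then obtain \<gamma> where "\<gamma> \<in> Gal k" "\<And>a b. (a, b) \<in> (\<lambda>x. (x, \<phi> x)) ` F \<Longrightarrow> \<gamma> a = b"
    using hom_graph_extends[OF _ k] by metis
  then show ?thesis using that by auto
qed

lemma embeddings_eq:
  assumes K: "subfield K CC" "k \<subseteq> K" "K \<subseteq> kbar k"
  shows "embeddings k K = (\<lambda>\<gamma>. restrict \<gamma> K) ` Gal k"
proof
  show "embeddings k K \<subseteq> (\<lambda>\<gamma>. restrict \<gamma> K) ` Gal k"
  proof
    fix \<sigma> assume s: "\<sigma> \<in> embeddings k K"
    obtain \<gamma> where g: "\<gamma> \<in> Gal k" "\<And>x. x \<in> K \<Longrightarrow> \<gamma> x = \<sigma> x"
      by (rule hom_extends[OF K, of \<sigma>]) (use s in \<open>auto simp: embeddings_def Ring.ring_hom_def\<close>)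
    have "\<sigma> = restrict \<gamma> K" using s g(2) by (auto simp: embeddings_def extensional_def fun_eq_iff)
    then show "\<sigma> \<in> (\<lambda>\<gamma>. restrict \<gamma> K) ` Gal k" using g(1) by auto
  qed
  show "(\<lambda>\<gamma>. restrict \<gamma> K) ` Gal k \<subseteq> embeddings k K"
  proof safe
    fix \<gamma> assume g: "\<gamma> \<in> Gal k"
    show "restrict \<gamma> K \<in> embeddings k K"
      using K g by (auto simp: embeddings_def Ring.ring_hom_def subfieldD GalD subset_iff Gal_01)
  qed
qed

lemma galois_closure_props:
  assumes K: "subfield K CC" "k \<subseteq> K" "K \<subseteq> kbar k"
  shows "subfield (galois_closure k K) CC" "galois_closure k K \<subseteq> kbar k" "k \<subseteq> galois_closure k K"
    "\<gamma> \<in> Gal k \<Longrightarrow> x \<in> K \<Longrightarrow> \<gamma> x \<in> galois_closure k K"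
    "\<And>F. subfield F CC \<Longrightarrow> (\<And>\<gamma> x. \<gamma> \<in> Gal k \<Longrightarrow> x \<in> K \<Longrightarrow> \<gamma> x \<in> F) \<Longrightarrow> galois_closure k K \<subseteq> F"
proof -
  interpret field CC by (rule CC_field)
  let ?H = "\<Union>\<sigma>\<in>embeddings k K. \<sigma> ` K"
  have H: "?H = {\<gamma> x | \<gamma> x. \<gamma> \<in> Gal k \<and> x \<in> K}"
    unfolding embeddings_eq[OF K] by auto
  show "subfield (galois_closure k K) CC" unfolding galois_closure_def
    by (rule generate_field_is_subfield) simp
  show *: "galois_closure k K \<subseteq> F" if "subfield F CC" "\<And>\<gamma> x. \<gamma> \<in> Gal k \<Longrightarrow> x \<in> K \<Longrightarrow> \<gamma> x \<in> F" for F
    unfolding galois_closure_def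
    by (rule generate_field_min_subfield1) (use that H in auto)
  show "galois_closure k K \<subseteq> kbar k"
    by (rule *[OF kbar_subfield[OF k]]) (use K GalD(4) in blast)
  have incl: "?H \<subseteq> galois_closure k K" unfolding galois_closure_def by (blast intro: generate_field.incl)
  then show conj: "\<gamma> \<in> Gal k \<Longrightarrow> x \<in> K \<Longrightarrow> \<gamma> x \<in> galois_closure k K" for \<gamma> x using H by auto
  show "k \<subseteq> galois_closure k K" using conj[OF Gal_id] K(2) by auto
qed

lemma Gal_galois_closure:
  assumes K: "subfield K CC" "k \<subseteq> K" "K \<subseteq> kbar k" and g: "\<gamma> \<in> Gal k"
  shows "\<gamma> ` galois_closure k K = galois_closure k K"
proof -
  note L = galois_closure_props[OF K]
  have *: "\<delta> ` galois_closure k K \<subseteq> galois_closure k K" if d: "\<delta> \<in> Gal k" for \<delta>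
  proof -
    have "galois_closure k K \<subseteq> {x \<in> kbar k. \<delta> x \<in> galois_closure k K}"
    proof (rule L(5)[OF Gal_vimage_subfield[OF d L(1)]])
      fix \<gamma> x assume gx: "\<gamma> \<in> Gal k" "x \<in> K"
      then show "\<gamma> x \<in> {x \<in> kbar k. \<delta> x \<in> galois_closure k K}"
        using L(4)[OF Gal_comp[OF d gx(1)] gx(2)] L(2) L(4)[OF gx] by auto
    qed
    then show ?thesis by auto
  qed
  have "x \<in> \<gamma> ` galois_closure k K" if "x \<in> galois_closure k K" for x
  proof -
    have "inv' \<gamma> x \<in> galois_closure k K" using *[OF Gal_inv[OF g]] that by auto
    moreover have "\<gamma> (inv' \<gamma> x) = x" using Gal_bij[OF g] by (simp add: bij_def surj_f_inv_f)
    ultimately show ?thesis by (metis imageI)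
  qed
  then show ?thesis using *[OF g] by blast
qed

lemma aut_group_carrier:
  assumes K: "subfield K CC" "k \<subseteq> K" "K \<subseteq> kbar k"
  shows "carrier (aut_group k (galois_closure k K)) = (\<lambda>\<gamma>. restrict \<gamma> (galois_closure k K)) ` Gal k"
proof -
  define L where "L = galois_closure k K"
  note L = galois_closure_props[OF K, folded L_def]
  show ?thesis unfolding L_def[symmetric]
  proof
    show "carrier (aut_group k L) \<subseteq> (\<lambda>\<gamma>. restrict \<gamma> L) ` Gal k"
    proof
      fix \<tau> assume t: "\<tau> \<in> carrier (aut_group k L)"
      obtain \<gamma> where g: "\<gamma> \<in> Gal k" "\<And>x. x \<in> L \<Longrightarrow> \<gamma> x = \<tau> x"
        by (rule hom_extends[OF L(1,3,2), of \<tau>]) (use t in \<open>auto simp: aut_group_def Ring.ring_hom_def\<close>)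
      have "\<tau> = restrict \<gamma> L" using t g(2) by (auto simp: aut_group_def Bij_def extensional_def fun_eq_iff)
      then show "\<tau> \<in> (\<lambda>\<gamma>. restrict \<gamma> L) ` Gal k" using g(1) by auto
    qed
    show "(\<lambda>\<gamma>. restrict \<gamma> L) ` Gal k \<subseteq> carrier (aut_group k L)"
    proof safe
      fix \<gamma> assume g: "\<gamma> \<in> Gal k"
      have im: "\<gamma> ` L = L" using Gal_galois_closure[OF K g] by (simp add: L_def)
      have "bij_betw \<gamma> L L" unfolding bij_betw_def using im Gal_bij[OF g] by (meson bij_is_inj inj_on_subset subset_UNIV)
      then have "restrict \<gamma> L \<in> Bij L" by (auto simp: Bij_def bij_betw_def inj_on_def)
      moreover have "restrict \<gamma> L \<in> Ring.ring_hom (subring_of_CC L) (subring_of_CC L)"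
      proof -
        have kb: "x \<in> kbar k" if "x \<in> L" for x using that L(2) by auto
        have gL: "\<gamma> x \<in> L" if "x \<in> L" for x using that im by auto
        show ?thesis unfolding Ring.ring_hom_def
          by (simp add: gL subfieldD[OF L(1)] GalD(1,2)[OF g] kb Gal_01[OF g])
      qed
      moreover have "restrict \<gamma> L c = c" if "c \<in> k" for c
        using that L(3) GalD(3)[OF g] by auto
      ultimately show "restrict \<gamma> L \<in> carrier (aut_group k L)"
        unfolding aut_group_def by simp
    qed
  qed
qed

end

text \<open>
  \<open>e\<close> labels the embeddings of \<open>K\<close> bijectively by \<open>\<Omega>\<close>. Only the values on \<open>K\<close> matter, so that
  automorphisms of the closure may serve as labels without being restricted.
\<close>

definition emb_index :: "complex set \<Rightarrow> complex set \<Rightarrow> 'i set \<Rightarrow> ('i \<Rightarrow> complex \<Rightarrow> complex) \<Rightarrow> bool" where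
  "emb_index k K \<Omega> e \<longleftrightarrow> (\<forall>i\<in>\<Omega>. \<exists>\<gamma>\<in>Gal k. \<forall>x\<in>K. e i x = \<gamma> x) \<and>
     (\<forall>\<gamma>\<in>Gal k. \<exists>i\<in>\<Omega>. \<forall>x\<in>K. e i x = \<gamma> x) \<and>
     (\<forall>i\<in>\<Omega>. \<forall>j\<in>\<Omega>. (\<forall>x\<in>K. e i x = e j x) \<longrightarrow> i = j)"

definition gal_index ::
  "complex set \<Rightarrow> complex set \<Rightarrow> 'i set \<Rightarrow> ('i \<Rightarrow> 'i) set \<Rightarrow> ('i \<Rightarrow> complex \<Rightarrow> complex) \<Rightarrow> bool" where
  "gal_index k K \<Omega> G e \<longleftrightarrow> emb_index k K \<Omega> e \<and>
     (\<forall>\<gamma>\<in>Gal k. \<exists>g\<in>G. \<forall>i\<in>\<Omega>. \<forall>x\<in>K. \<gamma> (e i x) = e (g i) x) \<and>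
     (\<forall>g\<in>G. \<exists>\<gamma>\<in>Gal k. \<forall>i\<in>\<Omega>. \<forall>x\<in>K. \<gamma> (e i x) = e (g i) x)"

lemma emb_index_iff_bij:
  assumes k: "subfield k CC" and K: "subfield K CC" "k \<subseteq> K" "K \<subseteq> kbar k"
  shows "emb_index k K \<Omega> e \<longleftrightarrow> bij_betw (\<lambda>i. restrict (e i) K) \<Omega> (embeddings k K)"
proof -
  have r: "restrict f K = restrict g K \<longleftrightarrow> (\<forall>x\<in>K. f x = g x)" for f g :: "complex \<Rightarrow> complex"
    by (metis restrict_apply restrict_ext)
  have 1: "inj_on (\<lambda>i. restrict (e i) K) \<Omega> \<longleftrightarrow> (\<forall>i\<in>\<Omega>. \<forall>j\<in>\<Omega>. (\<forall>x\<in>K. e i x = e j x) \<longrightarrow> i = j)"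
    unfolding inj_on_def r ..
  have 2: "(\<lambda>i. restrict (e i) K) ` \<Omega> \<subseteq> (\<lambda>\<gamma>. restrict \<gamma> K) ` Gal k \<longleftrightarrow> (\<forall>i\<in>\<Omega>. \<exists>\<gamma>\<in>Gal k. \<forall>x\<in>K. e i x = \<gamma> x)"
    unfolding image_subset_iff image_iff r ..
  have 3: "(\<lambda>\<gamma>. restrict \<gamma> K) ` Gal k \<subseteq> (\<lambda>i. restrict (e i) K) ` \<Omega> \<longleftrightarrow> (\<forall>\<gamma>\<in>Gal k. \<exists>i\<in>\<Omega>. \<forall>x\<in>K. \<gamma> x = e i x)"
    unfolding image_subset_iff image_iff r ..
  show ?thesis unfolding embeddings_eq[OF k K] bij_betw_def emb_index_def 1 set_eq_subset 2 3
    by (simp add: eq_commute conj_ac)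
qed

text \<open>
  Replaces the Galois closure and its automorphism group by the automorphisms of the algebraic
  closure. An automorphism of the Galois closure is determined by the permutation that it induces on
  the embeddings of \<open>K\<close>, because the conjugates of \<open>K\<close> generate the Galois closure.
\<close>

lemma has_galois_perm_group_iff:
  assumes k: "subfield k CC" and K: "subfield K CC" "k \<subseteq> K" "K \<subseteq> kbar k"
    and G: "\<And>g i. g \<in> G \<Longrightarrow> i \<in> \<Omega> \<Longrightarrow> g i \<in> \<Omega>" "\<And>g i. g \<in> G \<Longrightarrow> i \<notin> \<Omega> \<Longrightarrow> g i = i"
      "\<And>g h. g \<in> G \<Longrightarrow> h \<in> G \<Longrightarrow> g \<circ> h \<in> G"
  shows "has_galois_perm_group k K \<Omega> G \<longleftrightarrow> (\<exists>e. gal_index k K \<Omega> G e)"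
proof
  define L where "L = galois_closure k K"
  note L = galois_closure_props[OF k K, folded L_def]
  note ac = aut_group_carrier[OF k K, folded L_def]
  note E = embeddings_eq[OF k K]
  {
    assume "has_galois_perm_group k K \<Omega> G"
    then obtain b f where b: "bij_betw b (embeddings k K) \<Omega>"
      and f: "f \<in> iso (aut_group k L) (perm_grp G)"
      and comp: "\<And>\<tau> \<sigma>. \<tau> \<in> carrier (aut_group k L) \<Longrightarrow> \<sigma> \<in> embeddings k K \<Longrightarrow> b (compose K \<tau> \<sigma>) = f \<tau> (b \<sigma>)"
      unfolding has_galois_perm_group_def L_def by blast
    define e where "e = inv_into (embeddings k K) b"
    have eE: "e i \<in> embeddings k K" "b (e i) = i" if "i \<in> \<Omega>" for i
      unfolding e_def using b that by (auto simp: bij_betw_def inv_into_into f_inv_into_f)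
    have be: "e (b \<sigma>) = \<sigma>" if "\<sigma> \<in> embeddings k K" for \<sigma>
      unfolding e_def using b that by (simp add: bij_betw_def)
    have bij: "bij_betw e \<Omega> (embeddings k K)" unfolding e_def by (rule bij_betw_inv_into[OF b])
    have re: "restrict (e i) K = e i" if "i \<in> \<Omega>" for i
      using eE(1)[OF that] by (simp add: embeddings_def extensional_restrict)
    have ei: "emb_index k K \<Omega> e" unfolding emb_index_iff_bij[OF k K]
      using bij by (subst bij_betw_cong[of _ _ e]) (auto simp: re)
    have key: "\<gamma> (e i x) = e (f (restrict \<gamma> L) i) x" if g: "\<gamma> \<in> Gal k" and i: "i \<in> \<Omega>" and x: "x \<in> K" for \<gamma> i x
    proof -
      have t: "restrict \<gamma> L \<in> carrier (aut_group k L)" using ac g by auto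
      obtain \<delta> where d: "\<delta> \<in> Gal k" "e i = restrict \<delta> K" using eE(1)[OF i] E by auto
      have c: "compose K (restrict \<gamma> L) (e i) = restrict (\<gamma> \<circ> \<delta>) K"
        using d L(4) by (auto simp: compose_def fun_eq_iff)
      have "compose K (restrict \<gamma> L) (e i) \<in> embeddings k K"
        unfolding c E using Gal_comp[OF k g d(1)] by auto
      then have "compose K (restrict \<gamma> L) (e i) = e (f (restrict \<gamma> L) i)"
        using be comp[OF t eE(1)[OF i]] eE(2)[OF i] by metis
      then show ?thesis using x d L(4) by (metis compose_eq restrict_apply')
    qed
    have fG: "f ` carrier (aut_group k L) = G" using f by (auto simp: iso_def bij_betw_def perm_grp_def)
    have "gal_index k K \<Omega> G e" unfolding gal_index_def
    proof (intro conjI ei ballI)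
      fix \<gamma> assume g: "\<gamma> \<in> Gal k"
      then have "f (restrict \<gamma> L) \<in> G" using fG ac by auto
      then show "\<exists>g\<in>G. \<forall>i\<in>\<Omega>. \<forall>x\<in>K. \<gamma> (e i x) = e (g i) x" using key[OF g] by blast
    next
      fix g assume "g \<in> G"
      then obtain \<gamma> where "\<gamma> \<in> Gal k" "f (restrict \<gamma> L) = g" using fG ac by (metis (no_types, lifting) image_iff)
      then show "\<exists>\<gamma>\<in>Gal k. \<forall>i\<in>\<Omega>. \<forall>x\<in>K. \<gamma> (e i x) = e (g i) x" using key by blast
    qed
    then show "\<exists>e. gal_index k K \<Omega> G e" by blast
  next
    assume "\<exists>e. gal_index k K \<Omega> G e"
    then obtain e where e: "gal_index k K \<Omega> G e" by blast
    then have e1: "\<forall>i\<in>\<Omega>. \<exists>\<gamma>\<in>Gal k. \<forall>x\<in>K. e i x = \<gamma> x"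
      and e2: "\<And>\<gamma>. \<gamma> \<in> Gal k \<Longrightarrow> \<exists>i\<in>\<Omega>. \<forall>x\<in>K. e i x = \<gamma> x"
      and e3: "\<And>g. g \<in> G \<Longrightarrow> \<exists>\<gamma>\<in>Gal k. \<forall>i\<in>\<Omega>. \<forall>x\<in>K. \<gamma> (e i x) = e (g i) x"
      unfolding gal_index_def emb_index_def by simp_all
    define r where "r = (\<lambda>i. restrict (e i) K)"
    have r: "bij_betw r \<Omega> (embeddings k K)" using e emb_index_iff_bij[OF k K] by (auto simp: gal_index_def r_def)
    define b where "b = inv_into \<Omega> r"
    have b: "bij_betw b (embeddings k K) \<Omega>" unfolding b_def by (rule bij_betw_inv_into[OF r])
    have br: "b (r i) = i" if "i \<in> \<Omega>" for i using r that by (simp add: b_def bij_betw_def)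
    define acts where "acts \<gamma> g \<longleftrightarrow> g \<in> G \<and> (\<forall>i\<in>\<Omega>. \<forall>x\<in>K. \<gamma> (e i x) = e (g i) x)" for \<gamma> g
    have dist: "i = j" if "i \<in> \<Omega>" "j \<in> \<Omega>" "\<And>x. x \<in> K \<Longrightarrow> e i x = e j x" for i j
      using e that by (auto simp: gal_index_def emb_index_def)
    have uniq: "g = g'" if acts1: "acts \<gamma> g" and acts2: "acts \<gamma> g'" for \<gamma> g g'
    proof
      fix i
      show "g i = g' i"
      proof (cases "i \<in> \<Omega>")
        case True
        have eq: "e (g i) x = e (g' i) x" if "x \<in> K" for x
          using acts1 acts2 True that unfolding acts_def by (metis (no_types))
        have "g i \<in> \<Omega>" using G(1)[OF _ True] acts1 unfolding acts_def by simp
        moreover have "g' i \<in> \<Omega>" using G(1)[OF _ True] acts2 unfolding acts_def by simp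
        ultimately show ?thesis using dist[OF _ _ eq] by blast
      next
        case False
        then show ?thesis using that G(2)[OF _ False] unfolding acts_def by metis
      qed
    qed
    have eL: "e i x \<in> L" if iO: "i \<in> \<Omega>" and xK: "x \<in> K" for i x
    proof -
      obtain \<gamma> where "\<gamma> \<in> Gal k" "\<forall>x\<in>K. e i x = \<gamma> x"
        using bspec[OF e1 iO] by auto
      then show ?thesis using L(4) xK by simp
    qed
    have ex: "\<exists>g. acts \<gamma> g" if "\<gamma> \<in> Gal k" for \<gamma> using e that by (auto simp: gal_index_def acts_def)
    have acts_restrict: "acts (restrict \<gamma> L) = acts \<gamma>" for \<gamma> unfolding acts_def fun_eq_iff using eL by auto
    define f where "f = (\<lambda>\<tau>. THE g. acts \<tau> g)"
    have f: "acts \<gamma> (f (restrict \<gamma> L))" if "\<gamma> \<in> Gal k" for \<gamma>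
      unfolding f_def acts_restrict using ex[OF that] uniq by (metis theI)
    have feq: "f (restrict \<gamma> L) = g" if "\<gamma> \<in> Gal k" "acts \<gamma> g" for \<gamma> g
      using f[OF that(1)] that(2) uniq by blast
    have inj: "restrict \<gamma> L = restrict \<delta> L" if g: "\<gamma> \<in> Gal k" "\<delta> \<in> Gal k" "acts \<gamma> g" "acts \<delta> g" for \<gamma> \<delta> g
    proof -
      have "L \<subseteq> {x \<in> kbar k. \<gamma> x = \<delta> x}"
      proof (rule L(5)[OF Gal_eq_subfield[OF k g(1,2)]])
        fix \<epsilon> x assume ex: "\<epsilon> \<in> Gal k" "x \<in> K"
        then obtain i where i: "i \<in> \<Omega>" "e i x = \<epsilon> x" using e2[OF ex(1)] by auto
        have "\<gamma> (e i x) = e (g i) x" "\<delta> (e i x) = e (g i) x"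
          using g(3,4) i(1) ex(2) unfolding acts_def by blast+
        then show "\<epsilon> x \<in> {x \<in> kbar k. \<gamma> x = \<delta> x}" using i(2) GalD(4)[OF ex(1)] K(3) ex(2) by auto
      qed
      then show ?thesis by (auto simp: fun_eq_iff)
    qed
    have "f \<in> iso (aut_group k L) (perm_grp G)"
    proof (rule isoI)
      show "f \<in> Group.hom (aut_group k L) (perm_grp G)"
      proof (rule homI)
        fix \<tau> assume "\<tau> \<in> carrier (aut_group k L)"
        then show "f \<tau> \<in> carrier (perm_grp G)" using f ac by (auto simp: perm_grp_def acts_def)
        fix \<tau>' assume "\<tau>' \<in> carrier (aut_group k L)"
        with \<open>\<tau> \<in> _\<close> obtain \<gamma> \<delta> where g: "\<gamma> \<in> Gal k" "\<delta> \<in> Gal k" "\<tau> = restrict \<gamma> L" "\<tau>' = restrict \<delta> L"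
          using ac by auto
        have dL: "\<delta> x \<in> L" if "x \<in> L" for x using Gal_galois_closure[OF k K g(2)] that by (auto simp: L_def)
        have B: "\<tau> \<in> Bij L" "\<tau>' \<in> Bij L" using \<open>\<tau> \<in> _\<close> \<open>\<tau>' \<in> _\<close> by (auto simp: aut_group_def)
        have "\<tau> \<otimes>\<^bsub>aut_group k L\<^esub> \<tau>' = restrict (\<gamma> \<circ> \<delta>) L"
          using B by (simp add: aut_group_def BijGroup_def) (use g dL in \<open>auto simp: compose_def fun_eq_iff\<close>)
        moreover have "acts (\<gamma> \<circ> \<delta>) (f \<tau> \<circ> f \<tau>')"
          using f[OF g(1)] f[OF g(2)] G unfolding acts_def g(3,4) by auto
        ultimately show "f (\<tau> \<otimes>\<^bsub>aut_group k L\<^esub> \<tau>') = f \<tau> \<otimes>\<^bsub>perm_grp G\<^esub> f \<tau>'"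
          using feq[OF Gal_comp[OF k g(1,2)]] by (simp add: perm_grp_def)
      qed
      show "bij_betw f (carrier (aut_group k L)) (carrier (perm_grp G))"
        unfolding bij_betw_def
      proof
        show "inj_on f (carrier (aut_group k L))"
          unfolding ac inj_on_def using f inj by (smt (verit, best) imageE)
        have "g \<in> f ` carrier (aut_group k L)" if "g \<in> G" for g
        proof -
          obtain \<gamma> where g: "\<gamma> \<in> Gal k" "\<forall>i\<in>\<Omega>. \<forall>x\<in>K. \<gamma> (e i x) = e (g i) x"
            using e3[OF \<open>g \<in> G\<close>] by auto
          then have "acts \<gamma> g" using \<open>g \<in> G\<close> by (simp add: acts_def)
          then show ?thesis unfolding ac using feq[OF g(1)] g(1) by (metis image_eqI)
        qed
        moreover have "f ` carrier (aut_group k L) \<subseteq> G" using f unfolding ac by (auto simp: acts_def)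
        ultimately show "f ` carrier (aut_group k L) = carrier (perm_grp G)" by (auto simp: perm_grp_def)
      qed
    qed
    moreover have "b (compose K \<tau> \<sigma>) = f \<tau> (b \<sigma>)" if ts: "\<tau> \<in> carrier (aut_group k L)" "\<sigma> \<in> embeddings k K" for \<tau> \<sigma>
    proof -
      obtain \<gamma> where g: "\<gamma> \<in> Gal k" "\<tau> = restrict \<gamma> L" using ts ac by auto
      obtain i where i: "i \<in> \<Omega>" "\<sigma> = r i" using ts(2) r by (auto simp: bij_betw_def)
      have a: "acts \<gamma> (f \<tau>)" using f[OF g(1)] g(2) by simp
      have "compose K \<tau> \<sigma> = r (f \<tau> i)"
        using a i eL by (auto simp: compose_def fun_eq_iff r_def g(2) acts_def)
      then show ?thesis using br i G(1) a by (simp add: acts_def)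
    qed
    ultimately show "has_galois_perm_group k K \<Omega> G"
      unfolding has_galois_perm_group_def L_def[symmetric] using b by blast
  }
qed

section \<open>Bases\<close>

lemma combine_eq_sum:
  "length Ks = length Us \<Longrightarrow> ring.combine CC Ks Us = (\<Sum>i<length Us. Ks ! i * Us ! i)"
proof (induction Ks Us rule: list_induct2)
  case Nil
  interpret ring CC by (rule CC_ring)
  show ?case by simp
next
  case (Cons x xs y ys)
  interpret ring CC by (rule CC_ring)
  show ?case using Cons by (simp add: sum.lessThan_Suc_shift del: sum.lessThan_Suc)
qed

lemma Span_iff:
  assumes k: "subfield k CC"
  shows "x \<in> ring.Span CC k \<omega> \<longleftrightarrow> (\<exists>c. (\<forall>i<length \<omega>. c i \<in> k) \<and> x = (\<Sum>i<length \<omega>. c i * \<omega> ! i))"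
proof -
  interpret field CC by (rule CC_field)
  have "x \<in> Span k \<omega> \<longleftrightarrow> (\<exists>Ks. set Ks \<subseteq> k \<and> length Ks = length \<omega> \<and> x = combine Ks \<omega>)"
    by (rule Span_mem_iff_length_version[OF k]) simp
  also have "\<dots> \<longleftrightarrow> (\<exists>c. (\<forall>i<length \<omega>. c i \<in> k) \<and> x = (\<Sum>i<length \<omega>. c i * \<omega> ! i))"
  proof
    assume "\<exists>Ks. set Ks \<subseteq> k \<and> length Ks = length \<omega> \<and> x = combine Ks \<omega>"
    then obtain Ks where K: "set Ks \<subseteq> k" "length Ks = length \<omega>" "x = combine Ks \<omega>" by auto
    show "\<exists>c. (\<forall>i<length \<omega>. c i \<in> k) \<and> x = (\<Sum>i<length \<omega>. c i * \<omega> ! i)"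
      by (rule exI[of _ "\<lambda>i. Ks ! i"]) (use K combine_eq_sum[OF K(2)] in \<open>auto simp: subset_iff\<close>)
  next
    assume "\<exists>c. (\<forall>i<length \<omega>. c i \<in> k) \<and> x = (\<Sum>i<length \<omega>. c i * \<omega> ! i)"
    then obtain c where c: "\<forall>i<length \<omega>. c i \<in> k" "x = (\<Sum>i<length \<omega>. c i * \<omega> ! i)" by auto
    show "\<exists>Ks. set Ks \<subseteq> k \<and> length Ks = length \<omega> \<and> x = combine Ks \<omega>"
      by (rule exI[of _ "map c [0..<length \<omega>]"]) (use c in \<open>auto simp: combine_eq_sum\<close>)
  qed
  finally show ?thesis .
qed

lemma independent_iff:
  assumes k: "subfield k CC"
  shows "ring.independent CC k \<omega> \<longleftrightarrow>
    (\<forall>c. (\<forall>i<length \<omega>. c i \<in> k) \<longrightarrow> (\<Sum>i<length \<omega>. c i * \<omega> ! i) = 0 \<longrightarrow> (\<forall>i<length \<omega>. c i = 0))"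
proof -
  interpret field CC by (rule CC_field)
  show ?thesis
  proof (intro iffI allI impI)
    fix c i
    assume ind: "independent k \<omega>" and c: "\<forall>i<length \<omega>. c i \<in> k" "(\<Sum>i<length \<omega>. c i * \<omega> ! i) = 0"
      and i: "i < length \<omega>"
    let ?Ks = "map c [0..<length \<omega>]"
    have "set ?Ks \<subseteq> k" using c(1) by auto
    moreover have "combine ?Ks \<omega> = \<zero>\<^bsub>CC\<^esub>" using c(2) by (simp add: combine_eq_sum)
    ultimately have "set (take (length \<omega>) ?Ks) \<subseteq> {0}"
      using independent_imp_trivial_combine[OF k ind, of ?Ks] by simp
    then show "c i = 0" using i by (auto simp: image_subset_iff)
  next
    assume *: "\<forall>c. (\<forall>i<length \<omega>. c i \<in> k) \<longrightarrow> (\<Sum>i<length \<omega>. c i * \<omega> ! i) = 0 \<longrightarrow> (\<forall>i<length \<omega>. c i = 0)"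
    show "independent k \<omega>"
    proof (rule trivial_combine_imp_independent[OF k])
      fix Ks assume Ks: "set Ks \<subseteq> k" "combine Ks \<omega> = \<zero>\<^bsub>CC\<^esub>"
      define c where "c = (\<lambda>i. if i < length Ks then Ks ! i else 0)"
      let ?L = "map c [0..<length \<omega>]"
      let ?L' = "take (length \<omega>) (Ks @ replicate (length \<omega>) 0)"
      have L: "?L = ?L'" by (rule nth_equalityI) (auto simp: c_def nth_append)
      have "combine ?L \<omega> = combine Ks \<omega>" unfolding L combine_take
        using combine_append_replicate[of \<omega> Ks "length \<omega>"] by simp
      then have "(\<Sum>i<length \<omega>. c i * \<omega> ! i) = 0" using Ks(2) by (simp add: combine_eq_sum)
      moreover have "\<forall>i<length \<omega>. c i \<in> k" using Ks(1) subfieldD(1)[OF k] by (auto simp: c_def)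
      ultimately have "\<forall>i<length \<omega>. c i = 0" using * by blast
      then show "set (take (length \<omega>) Ks) \<subseteq> {\<zero>\<^bsub>CC\<^esub>}"
      proof (intro subsetI)
        fix x assume "x \<in> set (take (length \<omega>) Ks)"
        then obtain i where i: "i < length Ks" "i < length \<omega>" "x = Ks ! i" by (auto simp: in_set_conv_nth)
        then have "x = c i" by (simp add: c_def)
        then show "x \<in> {\<zero>\<^bsub>CC\<^esub>}" using \<open>\<forall>i<length \<omega>. c i = 0\<close> i(2) by simp
      qed
    qed simp
  qed
qed

definition is_basis :: "complex set \<Rightarrow> complex set \<Rightarrow> complex list \<Rightarrow> bool" where
  "is_basis k K \<omega> \<longleftrightarrow> ring.independent CC k \<omega> \<and> ring.Span CC k \<omega> = K"

lemma is_basisD: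
  assumes "subfield k CC" "is_basis k K \<omega>"
  shows "i < length \<omega> \<Longrightarrow> \<omega> ! i \<in> K"
    "x \<in> K \<Longrightarrow> \<exists>c. (\<forall>i<length \<omega>. c i \<in> k) \<and> x = (\<Sum>i<length \<omega>. c i * \<omega> ! i)"
    "(\<And>i. i < length \<omega> \<Longrightarrow> c i \<in> k) \<Longrightarrow> (\<Sum>i<length \<omega>. c i * \<omega> ! i) \<in> K"
    "(\<And>i. i < length \<omega> \<Longrightarrow> c i \<in> k) \<Longrightarrow> (\<Sum>i<length \<omega>. c i * \<omega> ! i) = 0 \<Longrightarrow> i < length \<omega> \<Longrightarrow> c i = 0"
proof -
  interpret field CC by (rule CC_field)
  have ind: "independent k \<omega>" and sp: "Span k \<omega> = K" using assms(2) by (auto simp: is_basis_def)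
  show "i < length \<omega> \<Longrightarrow> \<omega> ! i \<in> K" using Span_base_incl[OF assms(1), of \<omega>] sp by (auto simp: subset_iff)
  show "x \<in> K \<Longrightarrow> \<exists>c. (\<forall>i<length \<omega>. c i \<in> k) \<and> x = (\<Sum>i<length \<omega>. c i * \<omega> ! i)"
    using Span_iff[OF assms(1)] sp by blast
  show "(\<Sum>i<length \<omega>. c i * \<omega> ! i) \<in> K" if "\<And>i. i < length \<omega> \<Longrightarrow> c i \<in> k"
    using Span_iff[OF assms(1), of _ \<omega>] sp that by blast
  show "(\<And>i. i < length \<omega> \<Longrightarrow> c i \<in> k) \<Longrightarrow> (\<Sum>i<length \<omega>. c i * \<omega> ! i) = 0 \<Longrightarrow> i < length \<omega> \<Longrightarrow> c i = 0"
    using ind independent_iff[OF assms(1), of \<omega>] by blast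
qed

lemma is_basisI:
  assumes k: "subfield k CC"
    and ind: "\<And>c. (\<And>i. i < length \<omega> \<Longrightarrow> c i \<in> k) \<Longrightarrow> (\<Sum>i<length \<omega>. c i * \<omega> ! i) = 0 \<Longrightarrow> \<forall>i<length \<omega>. c i = 0"
    and sp: "\<And>x. x \<in> K \<longleftrightarrow> (\<exists>c. (\<forall>i<length \<omega>. c i \<in> k) \<and> x = (\<Sum>i<length \<omega>. c i * \<omega> ! i))"
  shows "is_basis k K \<omega>"
  unfolding is_basis_def independent_iff[OF k] set_eq_iff Span_iff[OF k] using ind sp by auto

lemma extension_of_degree_iff:
  assumes "subfield k CC"
  shows "extension_of_degree k d K \<longleftrightarrow>
    subfield K CC \<and> k \<subseteq> K \<and> (\<exists>\<omega>. is_basis k K \<omega> \<and> length \<omega> = d)"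
proof -
  interpret field CC by (rule CC_field)
  show ?thesis unfolding extension_of_degree_def is_basis_def
    using exists_base[OF assms] dimensionI[OF assms] by metis
qed

lemma basis_length:
  assumes k: "subfield k CC" and K: "extension_of_degree k d K"
  shows "is_basis k K \<omega> \<Longrightarrow> length \<omega> = d"
    "ring.independent CC k \<omega> \<Longrightarrow> set \<omega> \<subseteq> K \<Longrightarrow> length \<omega> \<le> d"
    "ring.independent CC k \<omega> \<Longrightarrow> set \<omega> \<subseteq> K \<Longrightarrow> length \<omega> = d \<Longrightarrow> is_basis k K \<omega>"
proof -
  interpret field CC by (rule CC_field)
  have d: "dimension d k K" using K by (simp add: extension_of_degree_def)
  show "is_basis k K \<omega> \<Longrightarrow> length \<omega> = d" unfolding is_basis_def
    using dimensionI[OF k] dimension_is_inj[OF k d] by blast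
  show "independent k \<omega> \<Longrightarrow> set \<omega> \<subseteq> K \<Longrightarrow> length \<omega> \<le> d"
    by (rule independent_length_le_dimension[OF k d])
  show "independent k \<omega> \<Longrightarrow> set \<omega> \<subseteq> K \<Longrightarrow> length \<omega> = d \<Longrightarrow> is_basis k K \<omega>"
    unfolding is_basis_def using independent_length_eq_dimension[OF k d] by blast
qed

lemma extensionD:
  assumes "subfield k CC" "extension_of_degree k d K"
  shows "subfield K CC" "k \<subseteq> K" "K \<subseteq> kbar k" "\<exists>\<omega>. is_basis k K \<omega> \<and> length \<omega> = d" "d > 0"
proof -
  interpret field CC by (rule CC_field)
  show K: "subfield K CC" "k \<subseteq> K" using assms(2) by (auto simp: extension_of_degree_def)
  have "finite_dimension k K" using assms(2) finite_dimensionI[of d k K] by (simp add: extension_of_degree_def)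
  then show "K \<subseteq> kbar k" using finite_dimension_subset_kbar[OF assms(1) K(1)] by simp
  show b: "\<exists>\<omega>. is_basis k K \<omega> \<and> length \<omega> = d" using assms extension_of_degree_iff by blast
  show "d > 0"
  proof (rule ccontr)
    assume "\<not> d > 0"
    then obtain \<omega> where "is_basis k K \<omega>" "length \<omega> = 0" using b by auto
    then have "K = {0}" using is_basisD(2)[OF assms(1), of K \<omega>] subfieldD(1)[OF K(1)] by auto
    then show False using subfieldD(2)[OF K(1)] by auto
  qed
qed

section \<open>Independence of characters and determinants\<close>

text \<open>
  Artin's argument: multiplying the variable by an element that separates two characters and
  subtracting yields a shorter relation.
\<close>

lemma Dedekind_independence:
  assumes "finite I" "1 \<in> K" "\<And>x y. x \<in> K \<Longrightarrow> y \<in> K \<Longrightarrow> x * y \<in> K"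
    and "\<And>i x y. i \<in> I \<Longrightarrow> x \<in> K \<Longrightarrow> y \<in> K \<Longrightarrow> f i (x * y) = f i x * f i y"
    and "\<And>i. i \<in> I \<Longrightarrow> f i 1 = (1 :: complex)"
    and "\<And>i j. i \<in> I \<Longrightarrow> j \<in> I \<Longrightarrow> (\<And>x. x \<in> K \<Longrightarrow> f i x = f j x) \<Longrightarrow> i = j"
    and "\<And>x. x \<in> K \<Longrightarrow> (\<Sum>i\<in>I. c i * f i x) = 0"
  shows "\<forall>i\<in>I. c i = (0 :: complex)"
  using assms(1,4-7)
proof (induction I arbitrary: c rule: finite_induct)
  case (insert a I)
  have I0: "c b = 0" if b: "b \<in> I" for b
  proof -
    have "a \<noteq> b" using insert.hyps b by auto
    then obtain y where y: "y \<in> K" "f a y \<noteq> f b y" using insert.prems(3)[of a b] b by auto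
    have "\<forall>i\<in>I. c i * (f i y - f a y) = 0"
    proof (rule insert.IH)
      show "(\<Sum>i\<in>I. c i * (f i y - f a y) * f i x) = 0" if x: "x \<in> K" for x
      proof -
        have "(\<Sum>i\<in>insert a I. c i * f i (y * x)) - f a y * (\<Sum>i\<in>insert a I. c i * f i x) = 0"
          using insert.prems(4) assms(3) x y(1) by simp
        also have "(\<Sum>i\<in>insert a I. c i * f i (y * x)) - f a y * (\<Sum>i\<in>insert a I. c i * f i x)
           = (\<Sum>i\<in>insert a I. c i * (f i y - f a y) * f i x)"
          unfolding sum_distrib_left sum_subtractf[symmetric]
          by (rule sum.cong) (use insert.prems(1) x y(1) in \<open>auto simp: algebra_simps\<close>)
        also have "\<dots> = (\<Sum>i\<in>I. c i * (f i y - f a y) * f i x)"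
          using insert.hyps by simp
        finally show ?thesis .
      qed
    qed (use insert.prems(1,2,3) in blast)+
    then show ?thesis using b y(2) by auto
  qed
  have "(\<Sum>i\<in>insert a I. c i * f i 1) = 0" using insert.prems(4) assms(2) by blast
  then have "c a = 0" using insert.hyps insert.prems(2) I0 by simp
  then show ?case using I0 by auto
qed simp

lemma det_zero_right_kernel:
  fixes a :: "nat \<Rightarrow> nat \<Rightarrow> complex"
  assumes "det (mat n n (\<lambda>(i, j). a i j)) = 0"
  obtains c where "\<exists>j<n. c j \<noteq> 0" "\<And>i. i < n \<Longrightarrow> (\<Sum>j<n. a i j * c j) = 0"
proof -
  let ?A = "mat n n (\<lambda>(i, j). a i j)"
  obtain v where v: "v \<in> carrier_vec n" "v \<noteq> 0\<^sub>v n" "?A *\<^sub>v v = 0\<^sub>v n"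
    using det_0_iff_vec_prod_zero[of ?A n] assms by auto
  have "\<exists>j<n. v $ j \<noteq> 0" using v(1,2) by (metis carrier_vecD eq_vecI index_zero_vec)
  moreover have "(\<Sum>j<n. a i j * v $ j) = 0" if "i < n" for i
  proof -
    have "(?A *\<^sub>v v) $ i = 0" using v(3) that by simp
    then show ?thesis using that v(1) by (simp add: scalar_prod_def atLeast0LessThan)
  qed
  ultimately show ?thesis using that by blast
qed

lemma det_transpose_fun:
  "det (mat n n (\<lambda>(i, j). a j i)) = det (mat n n (\<lambda>(i, j). a i j :: complex))"
proof -
  have "mat n n (\<lambda>(i, j). a j i) = transpose_mat (mat n n (\<lambda>(i, j). a i j))"
    by (rule eq_matI) auto
  then show ?thesis using det_transpose[of "mat n n (\<lambda>(i, j). a i j)" n] by simp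
qed

lemma det_zero_left_kernel:
  fixes a :: "nat \<Rightarrow> nat \<Rightarrow> complex"
  assumes "det (mat n n (\<lambda>(i, j). a i j)) = 0"
  obtains c where "\<exists>i<n. c i \<noteq> 0" "\<And>j. j < n \<Longrightarrow> (\<Sum>i<n. c i * a i j) = 0"
proof -
  have "det (mat n n (\<lambda>(i, j). a j i)) = 0" using assms det_transpose_fun[of n a] by simp
  from det_zero_right_kernel[OF this] obtain c where "\<exists>j<n. c j \<noteq> 0" "\<And>i. i < n \<Longrightarrow> (\<Sum>j<n. a j i * c j) = 0"
    by metis
  then show ?thesis using that[of c] by (simp add: mult.commute)
qed

lemma underdetermined_system:
  fixes a :: "nat \<Rightarrow> nat \<Rightarrow> complex"
  assumes "d < n"
  obtains c where "\<exists>i<n. c i \<noteq> 0" "\<And>j. j < d \<Longrightarrow> (\<Sum>i<n. c i * a i j) = 0"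
proof -
  define b where "b = (\<lambda>i j. if j < d then a i j else 0)"
  have "det (mat n n (\<lambda>(i, j). b i j)) = 0"
  proof -
    let ?v = "unit_vec n d :: complex vec"
    have "mat n n (\<lambda>(i, j). b i j) *\<^sub>v ?v = 0\<^sub>v n"
      using assms by (intro eq_vecI) (auto simp: b_def)
    moreover have "?v \<noteq> 0\<^sub>v n" using assms by (metis index_unit_vec(1) index_zero_vec(1) zero_neq_one)
    ultimately have "\<exists>v. v \<in> carrier_vec n \<and> v \<noteq> 0\<^sub>v n \<and> mat n n (\<lambda>(i, j). b i j) *\<^sub>v v = 0\<^sub>v n"
      using unit_vec_carrier[of n d] by blast
    then show ?thesis using det_0_iff_vec_prod_zero[of "mat n n (\<lambda>(i, j). b i j)" n] by simp
  qed
  from det_zero_left_kernel[OF this] obtain c where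
    c: "\<exists>i<n. c i \<noteq> 0" "\<And>j. j < n \<Longrightarrow> (\<Sum>i<n. c i * b i j) = 0" by metis
  have "(\<Sum>i<n. c i * a i j) = 0" if "j < d" for j
    using c(2)[of j] that assms by (simp add: b_def)
  then show ?thesis using that c(1) by blast
qed

lemma det_mult_fun:
  "det (mat n n (\<lambda>(i, j). \<Sum>l<n. a i l * b l j)) = det (mat n n (\<lambda>(i, j). a i j)) * det (mat n n (\<lambda>(i, j). b i j :: complex))"
proof -
  have "mat n n (\<lambda>(i, j). \<Sum>l<n. a i l * b l j) = mat n n (\<lambda>(i, j). a i j) * mat n n (\<lambda>(i, j). b i j)"
    by (rule eq_matI) (auto simp: scalar_prod_def atLeast0LessThan)
  then show ?thesis using det_mult[of "mat n n (\<lambda>(i, j). a i j)" n "mat n n (\<lambda>(i, j). b i j)"] by simp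
qed

lemma det_in_subring:
  assumes "\<And>x y. x \<in> S \<Longrightarrow> y \<in> S \<Longrightarrow> x + y \<in> S" "\<And>x y. x \<in> S \<Longrightarrow> y \<in> S \<Longrightarrow> x * y \<in> S" "1 \<in> S" "0 \<in> S"
    "\<And>x. x \<in> S \<Longrightarrow> - x \<in> S" "\<And>i j. i < n \<Longrightarrow> j < n \<Longrightarrow> a i j \<in> S"
  shows "det (mat n n (\<lambda>(i, j). a i j :: complex)) \<in> S"
proof -
  have s: "sum f A \<in> S" if "\<And>i. i \<in> A \<Longrightarrow> f i \<in> S" for f and A :: "(nat \<Rightarrow> nat) set"
    using that by (induction A rule: infinite_finite_induct) (auto simp: assms)
  have p: "prod f A \<in> S" if "\<And>i. i \<in> A \<Longrightarrow> f i \<in> S" for f and A :: "nat set"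
    using that by (induction A rule: infinite_finite_induct) (auto simp: assms)
  have "(\<Sum>p\<in>{p. p permutes {0..<n}}. signof p * (\<Prod>i = 0..<n. a i (p i))) \<in> S"
  proof (rule s)
    fix p assume pp: "p \<in> {p. p permutes {0..<n}}"
    have "(\<Prod>i = 0..<n. a i (p i)) \<in> S"
    proof (rule p)
      fix i assume i: "i \<in> {0..<n}"
      then have "p i < n" using pp permutes_in_image[of p "{0..<n}" i] by auto
      then show "a i (p i) \<in> S" using assms(6) i by auto
    qed
    then show "signof p * (\<Prod>i = 0..<n. a i (p i)) \<in> S"
      using assms(3,5) by (auto simp: sign_def)
  qed
  moreover have "det (mat n n (\<lambda>(i, j). a i j)) = (\<Sum>p\<in>{p. p permutes {0..<n}}. signof p * (\<Prod>i = 0..<n. a i (p i)))"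
    unfolding det_def
    by (auto intro!: sum.cong prod.cong simp: permutes_in_image)
  ultimately show ?thesis by simp
qed

lemma Gal_det:
  assumes k: "subfield k CC" and g: "\<gamma> \<in> Gal k" and a: "\<And>i j. i < n \<Longrightarrow> j < n \<Longrightarrow> a i j \<in> kbar k"
  shows "\<gamma> (det (mat n n (\<lambda>(i, j). a i j))) = det (mat n n (\<lambda>(i, j). \<gamma> (a i j)))"
proof -
  note kb = kbar_subfield[OF k]
  have D: "det (mat n n (\<lambda>(i, j). b i j)) = (\<Sum>p\<in>{p. p permutes {0..<n}}. signof p * (\<Prod>i = 0..<n. b i (p i)))"
    for b :: "nat \<Rightarrow> nat \<Rightarrow> complex"
    unfolding det_def by (auto intro!: sum.cong prod.cong simp: permutes_in_image)
  have sg: "\<gamma> (signof p) = signof p" "(signof p :: complex) \<in> kbar k" for p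
    using Gal_01[OF k g] Gal_uminus[OF k g, of 1] kbar_closed[OF k] by (auto simp: sign_def)
  have ap: "a i (p i) \<in> kbar k" if "p permutes {0..<n}" "i \<in> {0..<n}" for p i
    using a that permutes_in_image[of p "{0..<n}" i] by auto
  have pr: "(\<Prod>i = 0..<n. a i (p i)) \<in> kbar k" if "p permutes {0..<n}" for p
    by (rule subfield_prod[OF kb]) (use ap that in auto)
  have gp: "\<gamma> (signof p * (\<Prod>i = 0..<n. a i (p i))) = signof p * (\<Prod>i = 0..<n. \<gamma> (a i (p i)))"
    if p: "p permutes {0..<n}" for p
  proof -
    have "\<gamma> (\<Prod>i = 0..<n. a i (p i)) = (\<Prod>i = 0..<n. \<gamma> (a i (p i)))"
      by (rule Gal_prod[OF k g]) (rule ap[OF p])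
    then show ?thesis by (simp add: GalD(2)[OF g sg(2) pr[OF p]] sg(1))
  qed
  show ?thesis unfolding D
    by (subst Gal_sum[OF k g]) (simp_all add: subfieldD(4)[OF kb] sg(2) pr gp)
qed

lemma emb_indexD:
  assumes k: "subfield k CC" and K: "subfield K CC" "k \<subseteq> K" "K \<subseteq> kbar k"
    and e: "emb_index k K \<Omega> e" and i: "i \<in> \<Omega>"
  shows "x \<in> K \<Longrightarrow> y \<in> K \<Longrightarrow> e i (x + y) = e i x + e i y"
    "x \<in> K \<Longrightarrow> y \<in> K \<Longrightarrow> e i (x * y) = e i x * e i y"
    "c \<in> k \<Longrightarrow> e i c = c" "x \<in> K \<Longrightarrow> e i x \<in> kbar k" "e i 1 = 1" "e i 0 = 0"
    "(\<And>l. l \<in> A \<Longrightarrow> f l \<in> K) \<Longrightarrow> e i (sum f A) = (\<Sum>l\<in>A. e i (f l))"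
    "x \<in> K \<Longrightarrow> x \<noteq> 0 \<Longrightarrow> e i x \<noteq> 0"
    "x \<in> K \<Longrightarrow> y \<in> K \<Longrightarrow> e i (x - y) = e i x - e i y"
proof -
  obtain \<gamma> where g: "\<gamma> \<in> Gal k" "\<And>x. x \<in> K \<Longrightarrow> e i x = \<gamma> x"
    using e i unfolding emb_index_def by blast
  have kb: "x \<in> kbar k" if "x \<in> K" for x using that K(3) by auto
  show "x \<in> K \<Longrightarrow> y \<in> K \<Longrightarrow> e i (x + y) = e i x + e i y"
    using g kb GalD(1)[OF g(1)] subfieldD(3)[OF K(1)] by simp
  show "x \<in> K \<Longrightarrow> y \<in> K \<Longrightarrow> e i (x * y) = e i x * e i y"
    using g kb GalD(2)[OF g(1)] subfieldD(4)[OF K(1)] by simp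
  show fixk: "c \<in> k \<Longrightarrow> e i c = c" for c using g(2)[of c] K(2) GalD(3)[OF g(1)] by auto
  show "x \<in> K \<Longrightarrow> e i x \<in> kbar k" using g kb GalD(4)[OF g(1)] by simp
  show "e i 1 = 1" "e i 0 = 0" using fixk k by (simp_all add: subfieldD)
  show "(\<And>l. l \<in> A \<Longrightarrow> f l \<in> K) \<Longrightarrow> e i (sum f A) = (\<Sum>l\<in>A. e i (f l))"
    using g(2) Gal_sum[OF k g(1), of A f] subfield_sum[OF K(1), of A f] kb by simp
  show "x \<in> K \<Longrightarrow> x \<noteq> 0 \<Longrightarrow> e i x \<noteq> 0" using g(2) Gal_nonzero[OF k g(1)] kb by simp
  show "x \<in> K \<Longrightarrow> y \<in> K \<Longrightarrow> e i (x - y) = e i x - e i y"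
    using g(2) Gal_diff[OF k g(1)] kb subfieldD(7)[OF K(1)] by simp
qed

lemma emb_index_distinct:
  "emb_index k K \<Omega> e \<Longrightarrow> i \<in> \<Omega> \<Longrightarrow> j \<in> \<Omega> \<Longrightarrow> (\<And>x. x \<in> K \<Longrightarrow> e i x = e j x) \<Longrightarrow> i = j"
  unfolding emb_index_def by blast

lemma emb_index_Gal: "emb_index k K \<Omega> e \<Longrightarrow> i \<in> \<Omega> \<Longrightarrow> \<exists>\<gamma>\<in>Gal k. \<forall>x\<in>K. e i x = \<gamma> x"
  and Gal_emb_index: "emb_index k K \<Omega> e \<Longrightarrow> \<gamma> \<in> Gal k \<Longrightarrow> \<exists>i\<in>\<Omega>. \<forall>x\<in>K. e i x = \<gamma> x"
  unfolding emb_index_def by blast+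

lemma emb_index_id:
  assumes "emb_index k K \<Omega> e" "subfield k CC"
  obtains i where "i \<in> \<Omega>" "\<And>x. x \<in> K \<Longrightarrow> e i x = x"
  using Gal_emb_index[OF assms(1) Gal_id[OF assms(2)]] by auto

lemma emb_index_permute:
  assumes k: "subfield k CC" and K: "subfield K CC" "k \<subseteq> K" "K \<subseteq> kbar k"
    and e: "emb_index k K \<Omega> e" and fin: "finite \<Omega>" and g: "\<gamma> \<in> Gal k"
  obtains \<pi> where "bij_betw \<pi> \<Omega> \<Omega>" "\<And>i x. i \<in> \<Omega> \<Longrightarrow> x \<in> K \<Longrightarrow> \<gamma> (e i x) = e (\<pi> i) x"
proof -
  have "\<exists>j. j \<in> \<Omega> \<and> (\<forall>x\<in>K. \<gamma> (e i x) = e j x)" if i: "i \<in> \<Omega>" for i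
  proof -
    obtain \<delta> where d: "\<delta> \<in> Gal k" "\<forall>x\<in>K. e i x = \<delta> x" using emb_index_Gal[OF e i] by auto
    then obtain j where "j \<in> \<Omega>" "\<forall>x\<in>K. e j x = (\<gamma> \<circ> \<delta>) x"
      using Gal_emb_index[OF e Gal_comp[OF k g d(1)]] by auto
    then show ?thesis using d(2) by auto
  qed
  then obtain \<pi> where p: "\<And>i. i \<in> \<Omega> \<Longrightarrow> \<pi> i \<in> \<Omega>" "\<And>i x. i \<in> \<Omega> \<Longrightarrow> x \<in> K \<Longrightarrow> \<gamma> (e i x) = e (\<pi> i) x"
    by metis
  have "inj_on \<pi> \<Omega>"
  proof (rule inj_onI)
    fix i j assume ij: "i \<in> \<Omega>" "j \<in> \<Omega>" "\<pi> i = \<pi> j"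
    show "i = j"
    proof (rule emb_index_distinct[OF e ij(1,2)])
      fix x assume x: "x \<in> K"
      have "\<gamma> (e i x) = \<gamma> (e j x)" using p(2) ij x by simp
      then show "e i x = e j x"
        using Gal_inj[OF k g] emb_indexD(4)[OF k K e ij(1) x] emb_indexD(4)[OF k K e ij(2) x] by blast
    qed
  qed
  then have "bij_betw \<pi> \<Omega> \<Omega>" unfolding bij_betw_def
    using endo_inj_surj[OF fin, of \<pi>] p(1) by auto
  then show ?thesis using that p(2) by blast
qed

lemma emb_index_reindex:
  assumes u: "bij_betw u I \<Omega>" and e: "emb_index k K \<Omega> e"
  shows "emb_index k K I (\<lambda>i. e (u i))"
  unfolding emb_index_def
proof (intro conjI ballI impI)
  have uI: "u i \<in> \<Omega>" if "i \<in> I" for i using u that by (auto simp: bij_betw_def)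
  show "\<exists>\<gamma>\<in>Gal k. \<forall>x\<in>K. e (u i) x = \<gamma> x" if "i \<in> I" for i using emb_index_Gal[OF e uI[OF that]] .
  show "\<exists>i\<in>I. \<forall>x\<in>K. e (u i) x = \<gamma> x" if g: "\<gamma> \<in> Gal k" for \<gamma>
  proof -
    obtain j where "j \<in> \<Omega>" "\<forall>x\<in>K. e j x = \<gamma> x" using Gal_emb_index[OF e g] by auto
    moreover have "\<Omega> = u ` I" using u by (simp add: bij_betw_def)
    ultimately show ?thesis by auto
  qed
  show "i = j" if "i \<in> I" "j \<in> I" "\<forall>x\<in>K. e (u i) x = e (u j) x" for i j
    using emb_index_distinct[OF e uI[OF that(1)] uI[OF that(2)]] that u by (auto simp: bij_betw_def inj_on_def)
qed

lemma emb_index_Dedekind: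
  assumes k: "subfield k CC" and K: "subfield K CC" "k \<subseteq> K" "K \<subseteq> kbar k"
    and e: "emb_index k K \<Omega> e" and fin: "finite \<Omega>"
    and "\<And>x. x \<in> K \<Longrightarrow> (\<Sum>i\<in>\<Omega>. c i * e i x) = 0" and i: "i \<in> \<Omega>"
  shows "c i = 0"
proof -
  have "\<forall>i\<in>\<Omega>. c i = 0"
  proof (rule Dedekind_independence[OF fin, of K e])
    show "i = j" if "i \<in> \<Omega>" "j \<in> \<Omega>" "\<And>x. x \<in> K \<Longrightarrow> e i x = e j x" for i j
      by (rule emb_index_distinct[OF e that])
  qed (use K(1) emb_indexD(2,5)[OF k K e] assms(7) in \<open>auto simp: subfieldD\<close>)
  then show ?thesis using i by auto
qed

text \<open>
  With more embeddings than basis elements there would be a nontrivial relation among the rows of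
  their values on a basis, contradicting independence of characters.
\<close>

lemma card_embeddings_le_degree:
  assumes k: "subfield k CC" and K: "extension_of_degree k d K"
  shows "finite (embeddings k K)" "card (embeddings k K) \<le> d"
proof -
  note KD = extensionD[OF k K]
  have "card S \<le> d" if S: "finite S" "S \<subseteq> embeddings k K" for S
  proof (rule ccontr)
    assume "\<not> card S \<le> d"
    then have less: "d < card S" by simp
    obtain f where f: "bij_betw f {0..<card S} S" using ex_bij_betw_nat_finite[OF S(1)] by auto
    obtain \<omega> where w: "is_basis k K \<omega>" "length \<omega> = d" using KD(4) by auto
    have fE: "f i \<in> embeddings k K" if "i < card S" for i
      using bij_betwE[OF f] that S(2) by auto
    have hom: "f i (x + y) = f i x + f i y" "f i (x * y) = f i x * f i y" "f i 1 = 1" "c \<in> k \<Longrightarrow> f i c = c"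
      if i: "i < card S" and xy: "x \<in> K" "y \<in> K" for i x y c
      using fE[OF i] xy by (auto simp: embeddings_def Ring.ring_hom_def)
    have hsum: "f i (\<Sum>j<m. a j * \<omega> ! j) = (\<Sum>j<m. a j * f i (\<omega> ! j))"
      if i: "i < card S" and a: "\<And>j. j < d \<Longrightarrow> a j \<in> k" and m: "m \<le> d" for i a m
      using m
    proof (induction m)
      case 0
      then show ?case using hom(4)[OF i, of 0 0 0] subfieldD(1)[OF k] KD(2) by auto
    next
      case (Suc m)
      have aK: "a j \<in> K" if "j < d" for j using a[OF that] KD(2) by auto
      have wK: "\<omega> ! j \<in> K" if "j < d" for j using is_basisD(1)[OF k w(1)] w(2) that by auto
      have 1: "(\<Sum>j<m. a j * \<omega> ! j) \<in> K"
        by (intro subfield_sum[OF KD(1)] subfieldD(4)[OF KD(1)] aK wK) (use Suc.prems in auto)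
      have 2: "a m * \<omega> ! m \<in> K"
        by (intro subfieldD(4)[OF KD(1)] aK wK) (use Suc.prems in auto)
      have m: "m < d" using Suc.prems by simp
      show ?case using Suc hom(1)[OF i 1 2] hom(2)[OF i aK[OF m] wK[OF m]] hom(4)[OF i 1 1 a[OF m]] by simp
    qed
    obtain c where c: "\<exists>i<card S. c i \<noteq> 0" "\<And>j. j < d \<Longrightarrow> (\<Sum>i<card S. c i * f i (\<omega> ! j)) = 0"
      using underdetermined_system[OF less, of "\<lambda>i j. f i (\<omega> ! j)"] by metis
    have "\<forall>i\<in>{..<card S}. c i = 0"
    proof (rule Dedekind_independence[where K = K and f = f])
      show "i = j" if ij: "i \<in> {..<card S}" "j \<in> {..<card S}" "\<And>x. x \<in> K \<Longrightarrow> f i x = f j x" for i j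
      proof -
        have "f i x = f j x" for x
          using fE[of i] fE[of j] ij by (cases "x \<in> K") (auto simp: embeddings_def extensional_def)
        then have "f i = f j" by blast
        then show ?thesis using f ij(1,2) by (auto simp: bij_betw_def inj_on_def)
      qed
      show "(\<Sum>i<card S. c i * f i x) = 0" if x: "x \<in> K" for x
      proof -
        obtain a where a: "\<forall>j<d. a j \<in> k" "x = (\<Sum>j<d. a j * \<omega> ! j)"
          using is_basisD(2)[OF k w(1) x] w(2) by auto
        have "(\<Sum>i<card S. c i * f i x) = (\<Sum>i<card S. \<Sum>j<d. a j * (c i * f i (\<omega> ! j)))"
          unfolding a(2)
          by (rule sum.cong[OF refl]) (use hsum[where a = a and m = d] a(1) in \<open>simp add: sum_distrib_left mult_ac\<close>)
        also have "\<dots> = (\<Sum>j<d. a j * (\<Sum>i<card S. c i * f i (\<omega> ! j)))"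
          by (subst sum.swap) (simp add: sum_distrib_left)
        finally show ?thesis using c(2) by simp
      qed
    qed (use hom subfieldD[OF KD(1)] in auto)
    then show False using c(1) by auto
  qed
  then show "finite (embeddings k K)" "card (embeddings k K) \<le> d"
    using finite_if_finite_subsets_card_bdd[of "embeddings k K" d] by auto
qed

lemma exists_emb_index:
  assumes k: "subfield k CC" and K: "extension_of_degree k d K"
  obtains N e where "emb_index k K {..<N} e" "0 < N" "N \<le> d"
proof -
  note KD = extensionD[OF k K]
  let ?N = "card (embeddings k K)"
  obtain f where f: "bij_betw f {0..<?N} (embeddings k K)"
    using ex_bij_betw_nat_finite[OF card_embeddings_le_degree(1)[OF k K]] by auto
  have re: "restrict (f i) K = f i" if "i \<in> {..<?N}" for i
  proof -
    have "f i \<in> embeddings k K" using bij_betwE[OF f] that by auto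
    then show ?thesis by (simp add: embeddings_def extensional_restrict)
  qed
  have "bij_betw (\<lambda>i. restrict (f i) K) {..<?N} (embeddings k K)"
    using f bij_betw_cong[of "{..<?N}" "\<lambda>i. restrict (f i) K" f] re by (simp add: atLeast0LessThan)
  then have ei: "emb_index k K {..<?N} f" unfolding emb_index_iff_bij[OF k KD(1-3)] .
  moreover have "0 < ?N"
  proof -
    obtain i where "i \<in> {..<?N}" by (rule emb_index_id[OF ei k])
    then show ?thesis by (cases ?N) auto
  qed
  ultimately show ?thesis using that card_embeddings_le_degree(2)[OF k K] by blast
qed

lemma emb_index_card:
  assumes k: "subfield k CC" and K: "extension_of_degree k d K" and e: "emb_index k K \<Omega> e"
  shows "finite \<Omega>" "card \<Omega> = card (embeddings k K)" "card \<Omega> \<le> d"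
proof -
  note KD = extensionD[OF k K]
  have b: "bij_betw (\<lambda>i. restrict (e i) K) \<Omega> (embeddings k K)"
    using emb_index_iff_bij[OF k KD(1-3)] e by blast
  show "finite \<Omega>" using bij_betw_finite[OF b] card_embeddings_le_degree(1)[OF k K] by simp
  show "card \<Omega> = card (embeddings k K)" by (rule bij_betw_same_card[OF b])
  then show "card \<Omega> \<le> d" using card_embeddings_le_degree(2)[OF k K] by simp
qed

section \<open>Discriminants of bases\<close>

text \<open>
  Its square is the discriminant of the family \<open>\<omega>\<close>.
\<close>

definition emb_det :: "(nat \<Rightarrow> complex \<Rightarrow> complex) \<Rightarrow> nat \<Rightarrow> complex list \<Rightarrow> complex" where
  "emb_det e n \<omega> = det (mat n n (\<lambda>(i, j). e i (\<omega> ! j)))"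

lemma right_kernel_det_zero:
  fixes a :: "nat \<Rightarrow> nat \<Rightarrow> complex"
  assumes "\<And>i. i < n \<Longrightarrow> (\<Sum>j<n. a i j * c j) = 0" "j < n" "c j \<noteq> 0"
  shows "det (mat n n (\<lambda>(i, j). a i j)) = 0"
proof -
  let ?v = "vec n c"
  have "mat n n (\<lambda>(i, j). a i j) *\<^sub>v ?v = 0\<^sub>v n"
    using assms(1) by (intro eq_vecI) (auto simp: scalar_prod_def atLeast0LessThan)
  moreover have "?v \<noteq> 0\<^sub>v n" using assms(2,3) by (metis index_vec index_zero_vec(1))
  ultimately have "\<exists>v. v \<in> carrier_vec n \<and> v \<noteq> 0\<^sub>v n \<and> mat n n (\<lambda>(i, j). a i j) *\<^sub>v v = 0\<^sub>v n"
    using vec_carrier[of n c] by blast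
  then show ?thesis using det_0_iff_vec_prod_zero[of "mat n n (\<lambda>(i, j). a i j)" n] by simp
qed

context
  fixes k K :: "complex set" and n :: nat and e :: "nat \<Rightarrow> complex \<Rightarrow> complex"
  assumes k: "subfield k CC" and K: "subfield K CC" "k \<subseteq> K" "K \<subseteq> kbar k"
    and e: "emb_index k K {..<n} e"
begin

lemma emb_lincomb:
  assumes "i < n" "\<And>l. l < m \<Longrightarrow> c l \<in> k" "\<And>l. l < m \<Longrightarrow> w l \<in> K"
  shows "e i (\<Sum>l<m. c l * w l) = (\<Sum>l<m. c l * e i (w l))"
proof -
  have i: "i \<in> {..<n}" using assms(1) by simp
  have cw: "c l \<in> K" "w l \<in> K" "c l \<in> k" if "l \<in> {..<m}" for l using that assms(2,3) K(2) by auto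
  have "e i (\<Sum>l<m. c l * w l) = (\<Sum>l<m. e i (c l * w l))"
    by (rule emb_indexD(7)[OF k K e i]) (use cw subfieldD(4)[OF K(1)] in blast)
  also have "\<dots> = (\<Sum>l<m. c l * e i (w l))"
    by (rule sum.cong[OF refl]) (use cw emb_indexD(2,3)[OF k K e i] in simp)
  finally show ?thesis .
qed

lemma emb_det_basis_nonzero:
  assumes w: "is_basis k K \<omega>" "length \<omega> = n"
  shows "emb_det e n \<omega> \<noteq> 0"
proof
  assume "emb_det e n \<omega> = 0"
  then obtain c where c: "\<exists>i<n. c i \<noteq> 0" "\<And>j. j < n \<Longrightarrow> (\<Sum>i<n. c i * e i (\<omega> ! j)) = 0"
    unfolding emb_det_def using det_zero_left_kernel[of n "\<lambda>i j. e i (\<omega> ! j)"] by metis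
  have "(\<Sum>i<n. c i * e i x) = 0" if x: "x \<in> K" for x
  proof -
    obtain a where a: "\<forall>j<n. a j \<in> k" "x = (\<Sum>j<n. a j * \<omega> ! j)"
      using is_basisD(2)[OF k w(1) x] w(2) by auto
    have "(\<Sum>i<n. c i * e i x) = (\<Sum>i<n. \<Sum>j<n. a j * (c i * e i (\<omega> ! j)))"
      unfolding a(2)
      by (rule sum.cong[OF refl])
        (use emb_lincomb[where c = a and m = n and w = "(!) \<omega>"] a(1) is_basisD(1)[OF k w(1)] w(2)
          in \<open>simp add: sum_distrib_left mult_ac\<close>)
    also have "\<dots> = (\<Sum>j<n. a j * (\<Sum>i<n. c i * e i (\<omega> ! j)))"
      by (subst sum.swap) (simp add: sum_distrib_left)
    finally show ?thesis using c(2) by simp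
  qed
  then have "c i = 0" if "i < n" for i
    using emb_index_Dedekind[OF k K e, of c i] that by simp
  then show False using c(1) by auto
qed

lemma emb_det_nonzero_independent:
  assumes w: "set \<omega> \<subseteq> K" "length \<omega> = n" and d: "emb_det e n \<omega> \<noteq> 0"
  shows "ring.independent CC k \<omega>"
  unfolding independent_iff[OF k]
proof (intro allI impI, rule ccontr)
  fix c j
  assume c: "\<forall>i<length \<omega>. c i \<in> k" "(\<Sum>i<length \<omega>. c i * \<omega> ! i) = 0" and j: "j < length \<omega>" "c j \<noteq> 0"
  have "(\<Sum>l<n. e i (\<omega> ! l) * c l) = 0" if i: "i < n" for i
  proof -
    have "(\<Sum>l<n. c l * e i (\<omega> ! l)) = e i (\<Sum>l<n. c l * \<omega> ! l)"
      by (rule emb_lincomb[OF i, symmetric]) (use c w in auto)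
    also have "\<dots> = 0" using c(2) w(2) emb_indexD(6)[OF k K e] i by simp
    finally show ?thesis by (simp add: mult.commute)
  qed
  then have "emb_det e n \<omega> = 0" unfolding emb_det_def
    by (rule right_kernel_det_zero) (use j w(2) in auto)
  then show False using d by simp
qed

lemma emb_det_change_basis:
  assumes "\<And>l. l < n \<Longrightarrow> \<omega> ! l \<in> K" "\<And>l j. l < n \<Longrightarrow> j < n \<Longrightarrow> p l j \<in> k"
    and "\<And>j. j < n \<Longrightarrow> \<omega>' ! j = (\<Sum>l<n. p l j * \<omega> ! l)"
  shows "emb_det e n \<omega>' = emb_det e n \<omega> * det (mat n n (\<lambda>(i, j). p i j))"
proof -
  have "emb_det e n \<omega>' = det (mat n n (\<lambda>(i, j). \<Sum>l<n. e i (\<omega> ! l) * p l j))"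
    unfolding emb_det_def
    by (rule arg_cong[where f = det], rule eq_matI)
      (use assms emb_lincomb[where c = "\<lambda>l. p l _" and m = n and w = "(!) \<omega>"] in \<open>auto simp: mult.commute\<close>)
  then show ?thesis unfolding emb_det_def det_mult_fun .
qed

text \<open>
  An automorphism permutes the rows, which changes the determinant by a sign at most.
\<close>

lemma emb_det_square_in_base:
  assumes w: "\<And>l. l < n \<Longrightarrow> \<omega> ! l \<in> K"
  shows "(emb_det e n \<omega>)\<^sup>2 \<in> k"
proof (rule ccontr)
  have ek: "e i (\<omega> ! j) \<in> kbar k" if "i < n" "j < n" for i j
    using emb_indexD(4)[OF k K e] that w by simp
  have dk: "emb_det e n \<omega> \<in> kbar k" unfolding emb_det_def
    by (rule det_in_subring) (use kbar_closed[OF k] ek in auto)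
  assume "(emb_det e n \<omega>)\<^sup>2 \<notin> k"
  moreover have "(emb_det e n \<omega>)\<^sup>2 \<in> kbar k" using dk kbar_closed(4)[OF k] by (simp add: power2_eq_square)
  ultimately obtain \<gamma> where g: "\<gamma> \<in> Gal k" "\<gamma> ((emb_det e n \<omega>)\<^sup>2) \<noteq> (emb_det e n \<omega>)\<^sup>2"
    using Gal_moves[OF k k order_refl subset_kbar[OF k]] by metis
  obtain \<pi> where p: "bij_betw \<pi> {..<n} {..<n}" "\<And>i x. i \<in> {..<n} \<Longrightarrow> x \<in> K \<Longrightarrow> \<gamma> (e i x) = e (\<pi> i) x"
    using emb_index_permute[OF k K e _ g(1)] by blast
  define q where "q = (\<lambda>i. if i < n then \<pi> i else i)"
  have q: "q permutes {0..<n}"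
  proof (rule bij_imp_permutes)
    show "bij_betw q {0..<n} {0..<n}" using p(1) bij_betw_cong[of "{0..<n}" q \<pi>]
      by (simp add: q_def atLeast0LessThan)
  qed (simp add: q_def)
  have qn: "q i < n" if "i < n" for i using permutes_in_image[OF q, of i] that by simp
  have "\<gamma> (emb_det e n \<omega>) = det (mat n n (\<lambda>(i, j). \<gamma> (e i (\<omega> ! j))))"
    unfolding emb_det_def by (rule Gal_det[OF k g(1)]) (rule ek)
  also have "\<dots> = det (mat n n (\<lambda>(i, j). mat n n (\<lambda>(i, j). e i (\<omega> ! j)) $$ (q i, j)))"
    by (rule arg_cong[where f = det], rule eq_matI) (use p(2) w qn in \<open>auto simp: q_def\<close>)
  also have "\<dots> = signof q * emb_det e n \<omega>"
    unfolding emb_det_def by (rule det_permute_rows[OF _ q]) simp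
  finally have "\<gamma> (emb_det e n \<omega>) = signof q * emb_det e n \<omega>" .
  then have "\<gamma> ((emb_det e n \<omega>)\<^sup>2) = (emb_det e n \<omega>)\<^sup>2"
    using GalD(2)[OF g(1) dk dk] by (auto simp: power2_eq_square sign_def)
  then show False using g(2) by simp
qed

text \<open>
  Another enumeration of the embeddings permutes the rows and leaves the square unchanged, so one
  labelling suffices to describe all discriminants of bases.
\<close>

lemma basis_discriminants_eq:
  assumes deg: "extension_of_degree k n K"
  shows "basis_discriminants k K = {(emb_det e n \<omega>)\<^sup>2 | \<omega>. set \<omega> \<subseteq> integers_of K \<and> is_basis k K \<omega>}"
proof
  have re: "bij_betw (\<lambda>i. restrict (e i) K) {..<n} (embeddings k K)"
    using e emb_index_iff_bij[OF k K] by blast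
  have card: "card (embeddings k K) = n" using bij_betw_same_card[OF re] by simp
  show "basis_discriminants k K \<subseteq> {(emb_det e n \<omega>)\<^sup>2 | \<omega>. set \<omega> \<subseteq> integers_of K \<and> is_basis k K \<omega>}"
  proof
    fix d assume "d \<in> basis_discriminants k K"
    then obtain \<sigma> \<omega> where d: "d = (det (mat (length \<omega>) (length \<omega>) (\<lambda>(i, j). (\<sigma> ! i) (\<omega> ! j))))\<^sup>2"
      and s: "distinct \<sigma>" "set \<sigma> = embeddings k K" and w: "set \<omega> \<subseteq> integers_of K" "is_basis k K \<omega>"
      unfolding basis_discriminants_def is_basis_def by blast
    have lw: "length \<omega> = n" by (rule basis_length(1)[OF k deg w(2)])
    have ls: "length \<sigma> = n" using distinct_card[OF s(1)] s(2) card by simp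
    have "\<exists>j. j < n \<and> \<sigma> ! i = restrict (e j) K" if i: "i < n" for i
    proof -
      have "\<sigma> ! i \<in> embeddings k K" using s(2) ls i nth_mem by metis
      then show ?thesis using re by (auto simp: bij_betw_def)
    qed
    then obtain \<pi> where p: "\<And>i. i < n \<Longrightarrow> \<pi> i < n" "\<And>i. i < n \<Longrightarrow> \<sigma> ! i = restrict (e (\<pi> i)) K"
      by metis
    define q where "q = (\<lambda>i. if i < n then \<pi> i else i)"
    have inj: "inj_on q {0..<n}"
    proof (rule inj_onI)
      fix i j assume ij: "i \<in> {0..<n}" "j \<in> {0..<n}" "q i = q j"
      then have "\<sigma> ! i = \<sigma> ! j" using p(2) by (simp add: q_def)
      then show "i = j" using s(1) ls ij nth_eq_iff_index_eq[of \<sigma> i j] by simp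
    qed
    have q: "q permutes {0..<n}"
    proof (rule bij_imp_permutes)
      have "q ` {0..<n} \<subseteq> {0..<n}" using p(1) by (auto simp: q_def)
      then show "bij_betw q {0..<n} {0..<n}" unfolding bij_betw_def
        using endo_inj_surj[of "{0..<n}" q] inj by simp
    qed (simp add: q_def)
    have qn: "q i < n" if "i < n" for i using permutes_in_image[OF q, of i] that by simp
    have wK: "\<omega> ! j \<in> K" if "j < n" for j using subsetD[OF w(1) nth_mem[of j \<omega>]] lw that by (simp add: integers_of_def)
    have "det (mat (length \<omega>) (length \<omega>) (\<lambda>(i, j). (\<sigma> ! i) (\<omega> ! j)))
        = det (mat n n (\<lambda>(i, j). mat n n (\<lambda>(i, j). e i (\<omega> ! j)) $$ (q i, j)))"
      by (rule arg_cong[where f = det], rule eq_matI) (use p(2) wK qn lw in \<open>auto simp: q_def\<close>)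
    also have "\<dots> = signof q * emb_det e n \<omega>"
      unfolding emb_det_def by (rule det_permute_rows[OF _ q]) simp
    finally have "d = (emb_det e n \<omega>)\<^sup>2" unfolding d by (auto simp: power2_eq_square sign_def)
    then show "d \<in> {(emb_det e n \<omega>)\<^sup>2 | \<omega>. set \<omega> \<subseteq> integers_of K \<and> is_basis k K \<omega>}"
      using w by blast
  qed
  show "{(emb_det e n \<omega>)\<^sup>2 | \<omega>. set \<omega> \<subseteq> integers_of K \<and> is_basis k K \<omega>} \<subseteq> basis_discriminants k K"
  proof
    fix d assume "d \<in> {(emb_det e n \<omega>)\<^sup>2 | \<omega>. set \<omega> \<subseteq> integers_of K \<and> is_basis k K \<omega>}"
    then obtain \<omega> where d: "d = (emb_det e n \<omega>)\<^sup>2" and w: "set \<omega> \<subseteq> integers_of K" "is_basis k K \<omega>" by blast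
    have lw: "length \<omega> = n" by (rule basis_length(1)[OF k deg w(2)])
    define \<sigma> where "\<sigma> = map (\<lambda>i. restrict (e i) K) [0..<n]"
    have wK: "\<omega> ! j \<in> K" if "j < n" for j using subsetD[OF w(1) nth_mem[of j \<omega>]] lw that by (simp add: integers_of_def)
    have "distinct \<sigma>" using re by (simp add: \<sigma>_def distinct_map bij_betw_def atLeast0LessThan)
    moreover have "set \<sigma> = embeddings k K" using re by (simp add: \<sigma>_def bij_betw_def atLeast0LessThan)
    moreover have "d = (det (mat (length \<omega>) (length \<omega>) (\<lambda>(i, j). (\<sigma> ! i) (\<omega> ! j))))\<^sup>2"
      unfolding d emb_det_def lw
      by (rule arg_cong[where f = "\<lambda>A. (det A)\<^sup>2"], rule eq_matI) (use wK in \<open>auto simp: \<sigma>_def\<close>)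
    ultimately show "d \<in> basis_discriminants k K"
      unfolding basis_discriminants_def using w unfolding is_basis_def by blast
  qed
qed

end

section \<open>Algebraic integers\<close>

text \<open>
  \<open>x\<close> is an eigenvalue of an integer matrix and hence a root of its characteristic polynomial.
\<close>

lemma algebraic_int_eigenvalue:
  fixes v :: "'i \<Rightarrow> complex" and a :: "'i \<Rightarrow> 'i \<Rightarrow> int"
  assumes "finite I" "i0 \<in> I" "v i0 \<noteq> 0" "\<And>i. i \<in> I \<Longrightarrow> x * v i = (\<Sum>j\<in>I. of_int (a i j) * v j)"
  shows "algebraic_int x"
proof -
  define n where "n = card I"
  obtain f where f: "bij_betw f {0..<n} I" using ex_bij_betw_nat_finite[OF assms(1)] n_def by auto
  have fI: "f i \<in> I" if "i < n" for i using bij_betwE[OF f] that by auto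
  define A where "A = mat n n (\<lambda>(i, j). a (f i) (f j))"
  have A: "A \<in> carrier_mat n n" by (simp add: A_def)
  define B :: "complex mat" where "B = map_mat of_int A"
  have B: "B \<in> carrier_mat n n" using A by (simp add: B_def)
  define w where "w = vec n (\<lambda>i. v (f i))"
  have w0: "w \<noteq> 0\<^sub>v n"
  proof -
    obtain i where "i < n" "f i = i0" using f assms(2) by (force simp: bij_betw_def)
    then have "w $ i \<noteq> 0\<^sub>v n $ i" using assms(3) by (simp add: w_def)
    then show ?thesis by metis
  qed
  have "B *\<^sub>v w = x \<cdot>\<^sub>v w"
  proof (rule eq_vecI)
    fix i assume "i < dim_vec (x \<cdot>\<^sub>v w)"
    then have i: "i < n" by (simp add: w_def)
    have "(B *\<^sub>v w) $ i = (\<Sum>j = 0..<n. of_int (a (f i) (f j)) * v (f j))"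
      using i by (simp add: B_def A_def w_def scalar_prod_def)
    also have "\<dots> = (\<Sum>j\<in>I. of_int (a (f i) j) * v j)"
      by (rule sum.reindex_bij_betw[OF f])
    also have "\<dots> = x * v (f i)" using assms(4)[OF fI[OF i]] by simp
    finally show "(B *\<^sub>v w) $ i = (x \<cdot>\<^sub>v w) $ i" using i by (simp add: w_def)
  qed (use B in \<open>simp add: w_def\<close>)
  then have "eigenvector B w x" using B w0 by (simp add: eigenvector_def w_def)
  then have "poly (char_poly B) x = 0"
    using eigenvalue_root_char_poly[OF B] unfolding eigenvalue_def by blast
  moreover have "char_poly B = map_poly of_int (char_poly A)"
    unfolding B_def by (rule of_int_hom.char_poly_hom[OF A])
  moreover have "Polynomial.lead_coeff (char_poly A) = 1"
    using degree_monic_char_poly[OF A] by simp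
  ultimately show ?thesis unfolding algebraic_int_altdef_ipoly by metis
qed

text \<open>
  The additive group generated by the family \<open>v\<close> is stable under multiplication by \<open>z\<close>. If \<open>v\<close> is
  not identically zero this makes \<open>z\<close> integral; unlike integrality it is plainly preserved by sums
  and products.
\<close>

definition int_stable :: "'i set \<Rightarrow> ('i \<Rightarrow> complex) \<Rightarrow> complex \<Rightarrow> bool" where
  "int_stable I v z \<longleftrightarrow> (\<exists>a. \<forall>i\<in>I. z * v i = (\<Sum>j\<in>I. of_int (a i j) * v j))"

lemma int_stable_add: "int_stable I v y \<Longrightarrow> int_stable I v z \<Longrightarrow> int_stable I v (y + z)"
proof -
  assume "int_stable I v y" "int_stable I v z"
  then obtain a b where ab: "\<And>i. i \<in> I \<Longrightarrow> y * v i = (\<Sum>j\<in>I. of_int (a i j) * v j)"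
    "\<And>i. i \<in> I \<Longrightarrow> z * v i = (\<Sum>j\<in>I. of_int (b i j) * v j)" unfolding int_stable_def by metis
  show ?thesis unfolding int_stable_def
    by (rule exI[of _ "\<lambda>i j. a i j + b i j"]) (simp add: ab distrib_right sum.distrib)
qed

lemma int_stable_mult: "int_stable I v y \<Longrightarrow> int_stable I v z \<Longrightarrow> int_stable I v (y * z)"
proof -
  assume "int_stable I v y" "int_stable I v z"
  then obtain a b where ab: "\<And>i. i \<in> I \<Longrightarrow> y * v i = (\<Sum>j\<in>I. of_int (a i j) * v j)"
    "\<And>i. i \<in> I \<Longrightarrow> z * v i = (\<Sum>j\<in>I. of_int (b i j) * v j)" unfolding int_stable_def by metis
  have "y * z * v i = (\<Sum>l\<in>I. of_int (\<Sum>j\<in>I. b i j * a j l) * v l)" if i: "i \<in> I" for i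
  proof -
    have "y * z * v i = (\<Sum>j\<in>I. of_int (b i j) * (y * v j))"
      using ab(2)[OF i] by (simp add: sum_distrib_left mult_ac)
    also have "\<dots> = (\<Sum>j\<in>I. \<Sum>l\<in>I. of_int (b i j * a j l) * v l)"
      by (rule sum.cong[OF refl]) (simp add: ab(1) sum_distrib_left mult_ac)
    also have "\<dots> = (\<Sum>l\<in>I. of_int (\<Sum>j\<in>I. b i j * a j l) * v l)"
      by (subst sum.swap) (simp add: sum_distrib_right)
    finally show ?thesis .
  qed
  then show ?thesis unfolding int_stable_def by (intro exI[of _ "\<lambda>i l. \<Sum>j\<in>I. b i j * a j l"]) blast
qed

lemma int_stable_times_left:
  assumes "finite I" "finite J" "int_stable I v z"
  shows "int_stable (I \<times> J) (\<lambda>(i, j). v i * w j) z"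
proof -
  obtain a where a: "\<And>i. i \<in> I \<Longrightarrow> z * v i = (\<Sum>j\<in>I. of_int (a i j) * v j)"
    using assms(3) unfolding int_stable_def by metis
  have "z * (v i * w j) = (\<Sum>(i', j')\<in>I \<times> J. of_int (if j' = j then a i i' else 0) * (v i' * w j'))"
    if ij: "i \<in> I" "j \<in> J" for i j
  proof -
    have "(\<Sum>(i', j')\<in>I \<times> J. of_int (if j' = j then a i i' else 0) * (v i' * w j'))
      = (\<Sum>i'\<in>I. \<Sum>j'\<in>J. if j' = j then of_int (a i i') * (v i' * w j') else 0)"
      unfolding sum.cartesian_product[symmetric] by (intro sum.cong refl) auto
    also have "\<dots> = (\<Sum>i'\<in>I. of_int (a i i') * (v i' * w j))"
      using ij(2) assms(2) by (simp add: sum.delta)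
    also have "\<dots> = (z * v i) * w j" unfolding a[OF ij(1)] sum_distrib_right by (simp add: mult.assoc)
    finally show ?thesis by (simp add: mult_ac)
  qed
  note * = this
  show ?thesis unfolding int_stable_def
  proof (intro exI[of _ "\<lambda>p q. if snd q = snd p then a (fst p) (fst q) else 0"] ballI)
    fix p assume "p \<in> I \<times> J"
    then obtain i j where p: "p = (i, j)" "i \<in> I" "j \<in> J" by auto
    show "z * (case p of (i, j) \<Rightarrow> v i * w j) =
        (\<Sum>q\<in>I \<times> J. of_int (if snd q = snd p then a (fst p) (fst q) else 0) * (case q of (i, j) \<Rightarrow> v i * w j))"
      unfolding p(1) fst_conv snd_conv prod.case using *[OF p(2,3)] by (simp add: case_prod_unfold)
  qed
qed

lemma int_stable_bij:
  assumes "bij_betw f J I" "int_stable I v z"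
  shows "int_stable J (\<lambda>j. v (f j)) z"
proof -
  obtain a where a: "\<And>i. i \<in> I \<Longrightarrow> z * v i = (\<Sum>j\<in>I. of_int (a i j) * v j)"
    using assms(2) unfolding int_stable_def by metis
  show ?thesis unfolding int_stable_def
  proof (intro exI[of _ "\<lambda>i j. a (f i) (f j)"] ballI)
    fix i assume "i \<in> J"
    then have "f i \<in> I" using assms(1) by (auto simp: bij_betw_def)
    from a[OF this] show "z * v (f i) = (\<Sum>j\<in>J. of_int (a (f i) (f j)) * v (f j))"
      by (simp add: sum.reindex_bij_betw[OF assms(1), of "\<lambda>j. of_int (a (f i) j) * v j", symmetric])
  qed
qed

lemma int_stable_times_right:
  assumes "finite I" "finite J" "int_stable J w z"
  shows "int_stable (I \<times> J) (\<lambda>(i, j). v i * w j) z"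
proof -
  have "int_stable (J \<times> I) (\<lambda>(i, j). w i * v j) z" by (rule int_stable_times_left[OF assms(2,1,3)])
  moreover have "bij_betw prod.swap (I \<times> J) (J \<times> I)" by (auto simp: bij_betw_def inj_on_def)
  ultimately have "int_stable (I \<times> J) (\<lambda>p. case prod.swap p of (i, j) \<Rightarrow> w i * v j) z"
    using int_stable_bij by blast
  moreover have "(\<lambda>p. case prod.swap p of (i, j) \<Rightarrow> w i * v j) = (\<lambda>(i, j). v i * w j)"
    by (auto simp: fun_eq_iff)
  ultimately show ?thesis by simp
qed

lemma algebraic_int_powers_stable:
  fixes x :: complex
  assumes "algebraic_int x"
  obtains d where "d > 0" "int_stable {..<d} (\<lambda>i. x ^ i) x"
proof -
  obtain p :: "int poly" where p: "poly (map_poly of_int p) x = 0" "Polynomial.lead_coeff p = 1"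
    using assms unfolding algebraic_int_altdef_ipoly by auto
  define d where "d = Polynomial.degree p"
  have eq: "(\<Sum>i\<le>d. of_int (Polynomial.coeff p i) * x ^ i) = 0"
    using p(1) by (simp add: poly_altdef d_def degree_map_poly coeff_map_poly)
  then have xd: "x ^ d = (\<Sum>i<d. of_int (- Polynomial.coeff p i) * x ^ i)"
    using p(2) by (simp add: lessThan_Suc_atMost[symmetric] d_def sum_negf eq_neg_iff_add_eq_0 add.commute)
  have "d > 0"
  proof (rule ccontr)
    assume "\<not> d > 0"
    then show False using eq p(2) by (simp add: d_def)
  qed
  moreover have "int_stable {..<d} (\<lambda>i. x ^ i) x" unfolding int_stable_def
  proof (intro exI[of _ "\<lambda>i j. if Suc i < d then (if j = Suc i then 1 else 0) else - Polynomial.coeff p j"] ballI)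
    fix i assume i: "i \<in> {..<d}"
    show "x * x ^ i = (\<Sum>j<d. of_int (if Suc i < d then (if j = Suc i then 1 else 0) else - Polynomial.coeff p j) * x ^ j)"
    proof (cases "Suc i < d")
      case True
      have "(\<Sum>j<d. of_int (if j = Suc i then 1 else 0) * x ^ j) = (\<Sum>j<d. if j = Suc i then x ^ j else 0)"
        by (rule sum.cong) auto
      then show ?thesis using True by (simp add: sum.delta)
    next
      case False
      then have "Suc i = d" using i by auto
      then have "x * x ^ i = x ^ d" by auto
      then show ?thesis using False xd by simp
    qed
  qed
  ultimately show ?thesis using that by blast
qed

text \<open>
  The products of powers of \<open>x\<close> with powers of \<open>y\<close> generate a group that is stable under both \<open>x\<close>
  and \<open>y\<close>.
\<close>

lemma algebraic_int_add_mult: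
  fixes x y :: complex
  assumes "algebraic_int x" "algebraic_int y"
  shows "algebraic_int (x + y)" "algebraic_int (x * y)"
proof -
  obtain a where a: "a > 0" "int_stable {..<a} (\<lambda>i. x ^ i) x"
    using algebraic_int_powers_stable[OF assms(1)] by blast
  obtain b where b: "b > 0" "int_stable {..<b} (\<lambda>i. y ^ i) y"
    using algebraic_int_powers_stable[OF assms(2)] by blast
  let ?I = "{..<a} \<times> {..<b}" and ?v = "\<lambda>(i, j). x ^ i * y ^ j"
  have x: "int_stable ?I ?v x" by (rule int_stable_times_left) (use a in auto)
  have y: "int_stable ?I ?v y" by (rule int_stable_times_right) (use b in auto)
  have *: "algebraic_int z" if st: "int_stable ?I ?v z" for z
  proof -
    obtain c where "\<And>i. i \<in> ?I \<Longrightarrow> z * ?v i = (\<Sum>j\<in>?I. of_int (c i j) * ?v j)"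
      using st unfolding int_stable_def by blast
    then show ?thesis by (intro algebraic_int_eigenvalue[of ?I "(0, 0)" ?v z c]) (use a b in auto)
  qed
  show "algebraic_int (x + y)" "algebraic_int (x * y)"
    using * int_stable_add[OF x y] int_stable_mult[OF x y] by auto
qed

lemma algebraic_int_of_int: "algebraic_int (of_int n :: complex)"
  by (rule int_imp_algebraic_int) simp

lemma algebraic_int_one: "algebraic_int (1 :: complex)"
  using algebraic_int_of_int[of 1] by simp

lemma algebraic_int_sum: "(\<And>i. i \<in> A \<Longrightarrow> algebraic_int (f i :: complex)) \<Longrightarrow> algebraic_int (sum f A)"
  by (induction A rule: infinite_finite_induct) (auto simp: algebraic_int_add_mult)

lemma algebraic_int_prod: "(\<And>i. i \<in> A \<Longrightarrow> algebraic_int (f i :: complex)) \<Longrightarrow> algebraic_int (prod f A)"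
  by (induction A rule: infinite_finite_induct) (auto simp: algebraic_int_add_mult algebraic_int_one)

lemma algebraic_int_det:
  "(\<And>i j. i < n \<Longrightarrow> j < n \<Longrightarrow> algebraic_int (a i j :: complex)) \<Longrightarrow> algebraic_int (det (mat n n (\<lambda>(i, j). a i j)))"
  using det_in_subring[of "{x. algebraic_int x}" n a]
  by (simp add: algebraic_int_add_mult algebraic_int_one)

lemma Gal_algebraic_int:
  assumes k: "subfield k CC" and g: "\<gamma> \<in> Gal k" and x: "x \<in> kbar k" "algebraic_int x"
  shows "algebraic_int (\<gamma> x)"
proof -
  have *: "poly (map_poly of_int p) x \<in> kbar k \<and> \<gamma> (poly (map_poly of_int p) x) = poly (map_poly of_int p) (\<gamma> x)"
    for p :: "int poly"
  proof (induction p)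
    case 0
    then show ?case using kbar_closed[OF k] Gal_01[OF k g] by simp
  next
    case (pCons a p)
    have a: "of_int a \<in> k" "of_int a \<in> kbar k" using subfield_of_int[OF k] subset_kbar[OF k] by auto
    have e: "poly (map_poly of_int (pCons a p)) z = of_int a + z * poly (map_poly of_int p) z" for z :: complex
      using pCons(1) by (simp add: map_poly_pCons)
    show ?case unfolding e
      using pCons(2) a x(1) by (simp add: kbar_closed[OF k] GalD(1,2,3)[OF g])
  qed
  obtain p :: "int poly" where p: "poly (map_poly of_int p) x = 0" "Polynomial.lead_coeff p = 1"
    using x(2) unfolding algebraic_int_altdef_ipoly by auto
  then have "poly (map_poly of_int p) (\<gamma> x) = 0" using *[of p] Gal_01(1)[OF k g] by simp
  then show ?thesis unfolding algebraic_int_altdef_ipoly using p(2) by blast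
qed

lemma emb_algebraic_int:
  assumes k: "subfield k CC" and K: "K \<subseteq> kbar k" and e: "emb_index k K \<Omega> e" and "i \<in> \<Omega>"
    and x: "x \<in> K" "algebraic_int x"
  shows "algebraic_int (e i x)"
  using emb_index_Gal[OF e assms(4)] Gal_algebraic_int[OF k] x K by auto

lemma integers_of_closed:
  assumes "subfield K CC"
  shows "0 \<in> integers_of K" "1 \<in> integers_of K" "of_int n \<in> integers_of K"
    "x \<in> integers_of K \<Longrightarrow> y \<in> integers_of K \<Longrightarrow> x + y \<in> integers_of K"
    "x \<in> integers_of K \<Longrightarrow> y \<in> integers_of K \<Longrightarrow> x * y \<in> integers_of K"
    "x \<in> integers_of K \<Longrightarrow> - x \<in> integers_of K"
    "x \<in> integers_of K \<Longrightarrow> y \<in> integers_of K \<Longrightarrow> x - y \<in> integers_of K"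
    "x \<in> integers_of K \<Longrightarrow> x ^ m \<in> integers_of K"
    "of_nat m \<in> integers_of K"
    "(\<And>i. i \<in> A \<Longrightarrow> f i \<in> integers_of K) \<Longrightarrow> sum f A \<in> integers_of K"
    "(\<And>i j. i < m \<Longrightarrow> j < m \<Longrightarrow> a i j \<in> integers_of K) \<Longrightarrow> det (mat m m (\<lambda>(i, j). a i j)) \<in> integers_of K"
proof -
  note F = subfieldD[OF assms]
  show 0: "0 \<in> integers_of K" "1 \<in> integers_of K" using F by (simp_all add: integers_of_def algebraic_int_one)
  show i: "of_int n \<in> integers_of K" for n
    using subfield_of_int[OF assms] by (simp add: integers_of_def algebraic_int_of_int)
  show a: "x \<in> integers_of K \<Longrightarrow> y \<in> integers_of K \<Longrightarrow> x + y \<in> integers_of K" for x y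
    using F(3) by (simp add: integers_of_def algebraic_int_add_mult)
  show m: "x \<in> integers_of K \<Longrightarrow> y \<in> integers_of K \<Longrightarrow> x * y \<in> integers_of K" for x y
    using F(4) by (simp add: integers_of_def algebraic_int_add_mult)
  show n: "x \<in> integers_of K \<Longrightarrow> - x \<in> integers_of K" for x
    using F(5) by (simp add: integers_of_def)
  show "x \<in> integers_of K \<Longrightarrow> y \<in> integers_of K \<Longrightarrow> x - y \<in> integers_of K"
    using a[of x "-y"] n by simp
  show "x \<in> integers_of K \<Longrightarrow> x ^ m \<in> integers_of K" for m
    by (induction m) (auto simp: 0 m)
  show "of_nat m \<in> integers_of K" using i[of "int m"] by simp
  show "(\<And>i. i \<in> A \<Longrightarrow> f i \<in> integers_of K) \<Longrightarrow> sum f A \<in> integers_of K"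
    by (induction A rule: infinite_finite_induct) (auto simp: 0 a)
  show "(\<And>i j. i < m \<Longrightarrow> j < m \<Longrightarrow> a i j \<in> integers_of K) \<Longrightarrow> det (mat m m (\<lambda>(i, j). a i j)) \<in> integers_of K" for a
    by (rule det_in_subring) (use 0 \<open>\<And>x y. _ \<Longrightarrow> _ \<Longrightarrow> x + y \<in> integers_of K\<close> m n in auto)
qed

text \<open>
  The leading coefficient of an integer polynomial that vanishes at \<open>x\<close> is a suitable multiplier.
\<close>

lemma scale_to_algebraic_int:
  fixes x :: complex
  assumes "x \<in> kbar \<rat>"
  obtains m :: int where "m > 0" "algebraic_int (of_int m * x)"
proof -
  have "algebraic x" using assms kbar_iff[OF Rats_subfield] unfolding algebraic_altdef poly_over_def by blast
  then obtain p' where p': "\<forall>i. Polynomial.coeff p' i \<in> \<int>" "p' \<noteq> 0" "poly p' x = 0"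
    unfolding algebraic_def by blast
  define d where "d = Polynomial.degree p'"
  have "\<forall>i. \<exists>z. Polynomial.coeff p' i = of_int z" using p'(1) by (auto elim!: Ints_cases)
  then obtain c where c: "\<And>i. Polynomial.coeff p' i = of_int (c i)" by metis
  have cd: "c d \<noteq> 0" using p'(2) c[of d] by (auto simp: d_def)
  have eq: "(\<Sum>i\<le>d. of_int (c i) * x ^ i) = 0"
    using p'(3) by (simp add: poly_altdef d_def c)
  then have xd: "of_int (c d) * x ^ d = - (\<Sum>i<d. of_int (c i) * x ^ i)"
    by (simp add: lessThan_Suc_atMost[symmetric] eq_neg_iff_add_eq_0 add.commute)
  have d0: "d > 0"
  proof (rule ccontr)
    assume "\<not> d > 0"
    then show False using eq cd by simp
  qed
  let ?a = "of_int (c d) :: complex"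
  have "algebraic_int (?a * x)"
  proof (rule algebraic_int_eigenvalue[of "{..<d}" 0 "\<lambda>i. (?a * x) ^ i" _
        "\<lambda>i j. if Suc i < d then (if j = Suc i then 1 else 0) else - (c j * c d ^ (d - 1 - j))"])
    fix i assume i: "i \<in> {..<d}"
    show "?a * x * (?a * x) ^ i = (\<Sum>j<d. of_int (if Suc i < d then (if j = Suc i then 1 else 0)
        else - (c j * c d ^ (d - 1 - j))) * (?a * x) ^ j)"
    proof (cases "Suc i < d")
      case True
      have "(\<Sum>j<d. of_int (if j = Suc i then 1 else 0) * (?a * x) ^ j) = (\<Sum>j<d. if j = Suc i then (?a * x) ^ j else 0)"
        by (rule sum.cong) auto
      then show ?thesis using True by (simp add: sum.delta)
    next
      case False
      then have si: "Suc i = d" using i by auto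
      have "?a * x * (?a * x) ^ i = (?a * x) ^ d" unfolding si[symmetric] by simp
      also have "\<dots> = ?a ^ (d - 1) * (?a * x ^ d)"
        using d0 by (cases d) (simp_all add: power_mult_distrib)
      also have "\<dots> = (\<Sum>j<d. - (of_int (c j) * ?a ^ (d - 1) * x ^ j))"
        unfolding xd by (simp add: sum_distrib_left sum_negf mult_ac)
      also have "\<dots> = (\<Sum>j<d. of_int (- (c j * c d ^ (d - 1 - j))) * (?a * x) ^ j)"
      proof (rule sum.cong[OF refl])
        fix j assume "j \<in> {..<d}"
        then have "?a ^ (d - 1) = ?a ^ (d - 1 - j) * ?a ^ j" by (simp flip: power_add)
        then show "- (of_int (c j) * ?a ^ (d - 1) * x ^ j) = of_int (- (c j * c d ^ (d - 1 - j))) * (?a * x) ^ j"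
          by (simp add: power_mult_distrib)
      qed
      finally show ?thesis using False by simp
    qed
  qed (use d0 in auto)
  then have "algebraic_int (of_int \<bar>c d\<bar> * x)"
    by (cases "c d > 0") (auto simp: abs_if)
  then show ?thesis using that[of "\<bar>c d\<bar>"] cd by simp
qed

section \<open>Covering numbers and the absolute norm\<close>

text \<open>
  For a subgroup \<open>H\<close> this says that its index in \<open>A\<close> is at most \<open>n\<close>. The form with representatives
  makes monotonicity and multiplicativity immediate, without passing through quotient structures.
\<close>

definition covers :: "complex set \<Rightarrow> complex set \<Rightarrow> nat \<Rightarrow> bool" where
  "covers A H n \<longleftrightarrow> (\<exists>S. finite S \<and> card S \<le> n \<and> S \<subseteq> A \<and> (\<forall>x\<in>A. \<exists>s\<in>S. x - s \<in> H))"

lemma covers_mono: "covers A H n \<Longrightarrow> H \<subseteq> H' \<Longrightarrow> n \<le> n' \<Longrightarrow> covers A H' n'"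
  unfolding covers_def by (meson order_trans subsetD)

text \<open>
  If \<open>s\<close> represents \<open>x\<close> modulo \<open>a A\<close>, say \<open>x = s + a y\<close>, and \<open>s'\<close> represents \<open>y\<close> modulo \<open>H\<close>, then
  \<open>s + a s'\<close> represents \<open>x\<close> modulo \<open>a H\<close>.
\<close>

lemma covers_mult:
  assumes add: "\<And>x y. x \<in> A \<Longrightarrow> y \<in> A \<Longrightarrow> x + y \<in> A" and mult: "\<And>x y. x \<in> A \<Longrightarrow> y \<in> A \<Longrightarrow> x * y \<in> A"
    and a: "a \<in> A" "covers A ((*) a ` A) p" and H: "covers A H q"
  shows "covers A ((*) a ` H) (p * q)"
proof -
  obtain S where S: "finite S" "card S \<le> p" "S \<subseteq> A" "\<And>x. x \<in> A \<Longrightarrow> \<exists>s\<in>S. x - s \<in> (*) a ` A"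
    using a(2) unfolding covers_def by blast
  obtain S' where S': "finite S'" "card S' \<le> q" "S' \<subseteq> A" "\<And>x. x \<in> A \<Longrightarrow> \<exists>s\<in>S'. x - s \<in> H"
    using H unfolding covers_def by blast
  let ?f = "\<lambda>(s, s'). s + a * s'"
  show ?thesis unfolding covers_def
  proof (intro exI[of _ "?f ` (S \<times> S')"] conjI ballI)
    show "finite (?f ` (S \<times> S'))" using S(1) S'(1) by simp
    have "card (?f ` (S \<times> S')) \<le> card (S \<times> S')" using S(1) S'(1) by (intro card_image_le) simp
    also have "\<dots> \<le> p * q" using S(2) S'(2) by (simp add: card_cartesian_product mult_le_mono)
    finally show "card (?f ` (S \<times> S')) \<le> p * q" .
    show "?f ` (S \<times> S') \<subseteq> A" by (auto intro!: add mult a(1) dest: subsetD[OF S(3)] subsetD[OF S'(3)])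
    fix x assume "x \<in> A"
    then obtain s y where s: "s \<in> S" "y \<in> A" "x - s = a * y" using S(4) by fastforce
    then obtain s' where s': "s' \<in> S'" "y - s' \<in> H" using S'(4) by blast
    have "x - (s + a * s') = a * (y - s')" using s(3) by (simp add: algebra_simps)
    then have "x - (s + a * s') \<in> (*) a ` H" using s'(2) by (metis imageI)
    then show "\<exists>s\<in>?f ` (S \<times> S'). x - s \<in> (*) a ` H"
      using s(1) s'(1) by (intro bexI[of _ "s + a * s'"]) auto
  qed
qed

lemma cosets_eq:
  "carrier (subring_of_CC A Quot I) = (\<lambda>x. (\<lambda>h. h + x) ` I) ` A"
  unfolding FactRing_def A_RCOSETS_defs r_coset_def by auto

lemma card_quotient_le:
  assumes cov: "covers A I n" and IA: "\<And>x y. x \<in> I \<Longrightarrow> y \<in> I \<Longrightarrow> x + y \<in> I" "\<And>x. x \<in> I \<Longrightarrow> - x \<in> I"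
  shows "finite (carrier (subring_of_CC A Quot I))" "card (carrier (subring_of_CC A Quot I)) \<le> n"
proof -
  obtain S where S: "finite S" "card S \<le> n" "S \<subseteq> A" "\<And>x. x \<in> A \<Longrightarrow> \<exists>s\<in>S. x - s \<in> I"
    using cov unfolding covers_def by blast
  have "(\<lambda>x. (\<lambda>h. h + x) ` I) ` A \<subseteq> (\<lambda>x. (\<lambda>h. h + x) ` I) ` S"
  proof (rule image_subsetI)
    fix x assume "x \<in> A"
    then obtain s where s: "s \<in> S" "x - s \<in> I" using S(4) by blast
    have "(\<lambda>h. h + x) ` I = (\<lambda>h. h + s) ` I"
    proof (rule equalityI; rule subsetI)
      fix y assume "y \<in> (\<lambda>h. h + x) ` I"
      then obtain h where "h \<in> I" "y = h + x" by auto
      then have "y = (h + (x - s)) + s" "h + (x - s) \<in> I" using IA(1) s(2) by auto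
      then show "y \<in> (\<lambda>h. h + s) ` I" by blast
    next
      fix y assume "y \<in> (\<lambda>h. h + s) ` I"
      then obtain h where "h \<in> I" "y = h + s" by auto
      moreover have "h + - (x - s) \<in> I" by (rule IA(1)[OF \<open>h \<in> I\<close> IA(2)[OF s(2)]])
      ultimately have "y = (h + - (x - s)) + x" "h + - (x - s) \<in> I" by auto
      then show "y \<in> (\<lambda>h. h + x) ` I" by blast
    qed
    then show "(\<lambda>h. h + x) ` I \<in> (\<lambda>x. (\<lambda>h. h + x) ` I) ` S" using s(1) by blast
  qed
  note sub = this
  have fin: "finite ((\<lambda>x. (\<lambda>h. h + x) ` I) ` S)" using S(1) by simp
  show "finite (carrier (subring_of_CC A Quot I))"
    unfolding cosets_eq by (rule finite_subset[OF sub fin])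
  show "card (carrier (subring_of_CC A Quot I)) \<le> n"
    unfolding cosets_eq using card_mono[OF fin sub] card_image_le[OF S(1), of "\<lambda>x. (\<lambda>h. h + x) ` I"] S(2)
    by linarith
qed

lemma covers_card_quotient:
  assumes fin: "finite (carrier (subring_of_CC A Quot I))" and I: "0 \<in> I"
  shows "covers A I (card (carrier (subring_of_CC A Quot I)))"
proof -
  let ?f = "\<lambda>x. (\<lambda>h. h + x) ` I"
  have fin: "finite (?f ` A)" using fin unfolding cosets_eq .
  define S where "S = inv_into A ?f ` (?f ` A)"
  have "finite S" using fin by (simp add: S_def)
  moreover have "card S \<le> card (?f ` A)" unfolding S_def using fin by (rule card_image_le)
  moreover have "S \<subseteq> A" unfolding S_def by (auto intro: inv_into_into)
  moreover have "\<exists>s\<in>S. x - s \<in> I" if x: "x \<in> A" for x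
  proof -
    define s where "s = inv_into A ?f (?f x)"
    have "?f s = ?f x" unfolding s_def by (rule f_inv_into_f) (use x in blast)
    moreover have "x \<in> ?f x" using I by force
    ultimately have "x \<in> ?f s" by simp
    then have "x - s \<in> I" by auto
    moreover have "s \<in> S" unfolding S_def s_def using x by blast
    ultimately show ?thesis by blast
  qed
  ultimately show ?thesis unfolding covers_def cosets_eq by blast
qed

section \<open>Number fields: finiteness of residue rings and Hurwitz' lemma\<close>

lemma number_fieldD:
  assumes "number_field k"
  obtains D where "subfield k CC" "extension_of_degree \<rat> D k"
proof -
  interpret field CC by (rule CC_field)
  have k: "subfield k CC" "finite_dimension \<rat> k" using assms by (auto simp: number_field_def)
  then obtain D where "dimension D \<rat> k" using finite_dimensionE'[OF k(2)] by metis
  then have "extension_of_degree \<rat> D k"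
    using k(1) subfield_Rats[OF k(1)] by (simp add: extension_of_degree_def)
  then show ?thesis using that k(1) by blast
qed

lemma extension_over_Rats:
  assumes "extension_of_degree \<rat> D k" "extension_of_degree k n K"
  shows "extension_of_degree \<rat> (D * n) K"
proof -
  interpret field CC by (rule CC_field)
  have k: "subfield k CC" using assms(1) by (simp add: extension_of_degree_def)
  have "dimension (D * n) \<rat> K"
    by (rule telescopic_base[OF Rats_subfield k]) (use assms in \<open>simp_all add: extension_of_degree_def\<close>)
  then show ?thesis using assms subfield_Rats by (simp add: extension_of_degree_def)
qed

lemma common_denominator:
  fixes c :: "nat \<Rightarrow> complex"
  assumes "\<And>i. i < n \<Longrightarrow> c i \<in> \<rat>"
  obtains N :: int where "N > 0" "\<And>i. i < n \<Longrightarrow> of_int N * c i \<in> \<int>"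
proof -
  have "\<exists>N::int. N > 0 \<and> (\<forall>i<m. of_int N * c i \<in> \<int>)" if "m \<le> n" for m
    using that
  proof (induction m)
    case (Suc m)
    then obtain N :: int where N: "N > 0" "\<forall>i<m. of_int N * c i \<in> \<int>" by auto
    have "c m \<in> \<rat>" using assms Suc.prems by simp
    then obtain a b :: int where ab: "b > 0" "c m = of_int a / of_int b" by (auto elim!: Rats_cases')
    have "of_int (N * b) * c i \<in> \<int>" if "i < Suc m" for i
    proof (cases "i = m")
      case True
      then have "of_int (N * b) * c i = of_int (N * a)" using ab by simp
      then show ?thesis by (metis Ints_of_int)
    next
      case False
      then have "of_int N * c i \<in> \<int>" using that N(2) by simp
      then have "of_int b * (of_int N * c i) \<in> \<int>" by (rule Ints_mult[OF Ints_of_int])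
      then show ?thesis by (simp add: mult_ac)
    qed
    then show ?case using N(1) ab(1) by (intro exI[of _ "N * b"]) auto
  qed (auto intro: exI[of _ 1])
  then show ?thesis using that by blast
qed

lemma integral_basis:
  assumes k: "subfield k CC" and K: "extension_of_degree k n K" and KQ: "K \<subseteq> kbar \<rat>"
  obtains \<omega> where "is_basis k K \<omega>" "set \<omega> \<subseteq> integers_of K" "length \<omega> = n"
proof -
  note KD = extensionD[OF k K]
  obtain \<omega> where w: "is_basis k K \<omega>" "length \<omega> = n" using KD(4) by auto
  have wK: "\<omega> ! i \<in> K" if "i < n" for i using is_basisD(1)[OF k w(1)] w(2) that by simp
  have "\<exists>m::int. i < n \<longrightarrow> m > 0 \<and> algebraic_int (of_int m * \<omega> ! i)" for i
    using scale_to_algebraic_int[of "\<omega> ! i"] wK[of i] KQ by (metis subsetD)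
  then obtain m :: "nat \<Rightarrow> int" where m: "\<And>i. i < n \<Longrightarrow> m i > 0" "\<And>i. i < n \<Longrightarrow> algebraic_int (of_int (m i) * \<omega> ! i)"
    by metis
  define \<omega>' where "\<omega>' = map (\<lambda>i. of_int (m i) * \<omega> ! i) [0..<n]"
  have len: "length \<omega>' = n" by (simp add: \<omega>'_def)
  have int: "set \<omega>' \<subseteq> integers_of K"
    using m(2) wK subfieldD(4)[OF KD(1) subfield_of_int[OF KD(1)]] by (auto simp: \<omega>'_def integers_of_def)
  have "ring.independent CC k \<omega>'" unfolding independent_iff[OF k]
  proof (intro allI impI)
    fix c i assume c: "\<forall>i<length \<omega>'. c i \<in> k" "(\<Sum>i<length \<omega>'. c i * \<omega>' ! i) = 0" and i: "i < length \<omega>'"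
    have "(\<Sum>i<n. (c i * of_int (m i)) * \<omega> ! i) = 0"
      using c(2) unfolding len by (simp add: \<omega>'_def mult.assoc)
    then have "c i * of_int (m i) = 0"
      using is_basisD(4)[OF k w(1), of "\<lambda>i. c i * of_int (m i)" i] w(2) i len c(1)
        subfieldD(4)[OF k _ subfield_of_int[OF k]] by simp
    then show "c i = 0" using m(1)[of i] i len by simp
  qed
  then have "is_basis k K \<omega>'"
    using basis_length(3)[OF k K] len int by (auto simp: integers_of_def)
  then show ?thesis using that int len by blast
qed

text \<open>
  After clearing denominators, the coefficients of a rational relation are divisible by \<open>p\<close>;
  dividing by \<open>p\<close> gives another relation, so they are divisible by every power of \<open>p\<close>.
\<close>

lemma mod_independent_imp_independent:
  fixes p :: int
  assumes p: "p > 1" and A0: "0 \<in> A"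
    and ind: "\<And>a. (\<exists>y\<in>A. (\<Sum>i<length xs. of_int (a i) * xs ! i) = of_int p * y) \<Longrightarrow> \<forall>i<length xs. p dvd a i"
  shows "ring.independent CC \<rat> xs"
  unfolding independent_iff[OF Rats_subfield]
proof (intro allI impI, rule ccontr)
  fix c j assume c: "\<forall>i<length xs. c i \<in> \<rat>" "(\<Sum>i<length xs. c i * xs ! i) = 0" and j: "j < length xs" "c j \<noteq> 0"
  obtain N :: int where N: "N > 0" "\<And>i. i < length xs \<Longrightarrow> of_int N * c i \<in> \<int>"
    using common_denominator[of "length xs" c] c(1) by auto
  have "\<forall>i. \<exists>z. i < length xs \<longrightarrow> of_int N * c i = of_int z" using N(2) by (auto elim: Ints_cases)
  then obtain a where a: "\<And>i. i < length xs \<Longrightarrow> of_int N * c i = of_int (a i)" by metis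
  have rel: "(\<Sum>i<length xs. of_int (a i) * xs ! i) = 0"
  proof -
    have "(\<Sum>i<length xs. of_int (a i) * xs ! i) = (\<Sum>i<length xs. of_int N * (c i * xs ! i))"
      by (rule sum.cong[OF refl]) (simp add: a[symmetric] mult.assoc)
    also have "\<dots> = of_int N * (\<Sum>i<length xs. c i * xs ! i)" by (simp add: sum_distrib_left)
    finally show ?thesis using c(2) by simp
  qed
  have "\<forall>i<length xs. p ^ m dvd a i" for m
  proof (induction m)
    case (Suc m)
    then have "\<forall>i. \<exists>b. i < length xs \<longrightarrow> a i = p ^ m * b" by (auto simp: dvd_def)
    then obtain b where b: "\<And>i. i < length xs \<Longrightarrow> a i = p ^ m * b i" by metis
    have "of_int (p ^ m) * (\<Sum>i<length xs. of_int (b i) * xs ! i) = 0"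
      using rel b by (simp add: sum_distrib_left mult_ac)
    then have "(\<Sum>i<length xs. of_int (b i) * xs ! i) = of_int p * 0" using p by simp
    then have "\<forall>i<length xs. p dvd b i" using ind[of b] A0 by blast
    then show ?case using b by (auto simp: mult_dvd_mono mult.commute)
  qed simp
  then have div: "p ^ nat \<bar>a j\<bar> dvd a j" using j(1) by blast
  have "a j \<noteq> 0" using a[OF j(1)] j(2) N(1) by auto
  then have "\<bar>p ^ nat \<bar>a j\<bar>\<bar> \<le> \<bar>a j\<bar>" using div by (rule dvd_imp_le_int)
  moreover have "int (nat \<bar>a j\<bar>) < 2 ^ nat \<bar>a j\<bar>" by (rule of_nat_less_two_power)
  moreover have "(2::int) ^ nat \<bar>a j\<bar> \<le> p ^ nat \<bar>a j\<bar>" by (rule power_mono) (use p in auto)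
  ultimately show False by linarith
qed

text \<open>
  The residue ring modulo \<open>p\<close> is a vector space over the field with \<open>p\<close> elements, of dimension at
  most the degree of \<open>k\<close>, since elements independent modulo \<open>p\<close> are linearly independent over the
  rationals. This avoids constructing a basis of the ring of integers.
\<close>

lemma covers_prime:
  assumes D: "extension_of_degree \<rat> D k" and p: "Factorial_Ring.prime (p :: nat)"
  shows "\<exists>n. covers (integers_of k) ((*) (of_nat p) ` integers_of k) n"
proof -
  define A where "A = integers_of k"
  have k: "subfield k CC" using D by (simp add: extension_of_degree_def)
  note A = integers_of_closed[OF k, folded A_def]
  \<comment> \<open>linear independence over the field with \<open>p\<close> elements of the residues modulo \<open>p\<close>\<close>
  define ind where "ind xs \<longleftrightarrow> set xs \<subseteq> A \<and>
    (\<forall>a. (\<exists>y\<in>A. (\<Sum>i<length xs. of_int (a i) * xs ! i) = of_int (int p) * y) \<longrightarrow> (\<forall>i<length xs. int p dvd a i))" for xs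
  have len: "length xs \<le> D" if "ind xs" for xs
  proof -
    have "ring.independent CC \<rat> xs"
      by (rule mod_independent_imp_independent[of "int p" A]) (use that prime_gt_1_nat[OF p] A(1) in \<open>auto simp: ind_def\<close>)
    then show ?thesis using basis_length(2)[OF Rats_subfield D] that by (auto simp: ind_def A_def integers_of_def)
  qed
  have "ind []" by (simp add: ind_def)
  then obtain xs where xs: "ind xs" and max: "\<And>ys. ind ys \<Longrightarrow> length ys \<le> length xs"
    using ex_has_greatest_nat[of ind "[]" length "Suc D"] len by (auto simp: less_Suc_eq_le)
  let ?r = "length xs"
  \<comment> \<open>a maximal independent family generates, so its combinations with coefficients below \<open>p\<close>
    represent all residues\<close>
  define S where "S = (\<lambda>c. \<Sum>i<?r. of_int (c i) * xs ! i) ` PiE {..<?r} (\<lambda>_. {0..<int p})"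
  have finS: "finite S" unfolding S_def by (intro finite_imageI finite_PiE) auto
  have xA: "xs ! i \<in> A" if "i < ?r" for i using xs that nth_mem unfolding ind_def by blast
  have combA: "(\<Sum>i<?r. of_int (c i) * xs ! i) \<in> A" for c
    by (rule A(10)) (use xA A(3,5) in auto)
  have SA: "S \<subseteq> A" unfolding S_def using combA by auto
  have "\<exists>s\<in>S. y - s \<in> (*) (of_nat p) ` A" if y: "y \<in> A" for y
  proof -
    have "\<not> ind (xs @ [y])" using max[of "xs @ [y]"] by auto
    then obtain a z j where a: "z \<in> A" "(\<Sum>i<length (xs @ [y]). of_int (a i) * (xs @ [y]) ! i) = of_int (int p) * z"
      "j < length (xs @ [y])" "\<not> int p dvd a j"
      using xs y unfolding ind_def by auto
    define b where "b = a ?r"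
    have rel: "(\<Sum>i<?r. of_int (a i) * xs ! i) + of_int b * y = of_nat p * z"
      using a(2) by (simp add: b_def nth_append)
    have "\<not> int p dvd b"
    proof
      assume "int p dvd b"
      then obtain b' where b': "b = int p * b'" by auto
      have "(\<Sum>i<?r. of_int (a i) * xs ! i) = of_int (int p) * (z - of_int b' * y)"
        using rel by (simp add: b' algebra_simps)
      moreover have "z - of_int b' * y \<in> A" using a(1) y A(3,5,7) by blast
      ultimately have "\<forall>i<?r. int p dvd a i" using xs unfolding ind_def by blast
      then show False using a(3,4) \<open>int p dvd b\<close> by (auto simp: b_def less_Suc_eq)
    qed
    then have "Rings.coprime (int p) b" using p by (metis prime_imp_coprime prime_nat_int_transfer)
    then obtain u w where uw: "b * u + int p * w = 1"
      by (metis bezout_int coprime_iff_gcd_eq_1 mult.commute add.commute)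
    define c where "c = (\<lambda>i\<in>{..<?r}. (- u * a i) mod int p)"
    have cS: "(\<Sum>i<?r. of_int (c i) * xs ! i) \<in> S" unfolding S_def
      by (rule imageI) (use p in \<open>auto simp: c_def prime_gt_0_nat\<close>)
    define v where "v = (\<Sum>i<?r. of_int ((- u * a i) div int p) * xs ! i)"
    have ci: "of_int (- u * a i) = of_int p * of_int ((- u * a i) div int p) + (of_int (c i) :: complex)" if "i < ?r" for i
    proof -
      have "- u * a i = int p * ((- u * a i) div int p) + c i" using that by (simp add: c_def)
      then show ?thesis by (metis of_int_add of_int_mult)
    qed
    define \<sigma> where "\<sigma> = (\<Sum>i<?r. of_int (a i) * xs ! i)"
    define C where "C = (\<Sum>i<?r. of_int (c i) * xs ! i)"
    have "(\<Sum>i<?r. of_int (- u * a i) * xs ! i) = of_nat p * v + C"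
      unfolding v_def C_def sum_distrib_left sum.distrib[symmetric]
    proof (rule sum.cong[OF refl])
      fix i assume "i \<in> {..<?r}"
      then have "of_int (- u * a i) * xs ! i = (of_int p * of_int ((- u * a i) div int p) + of_int (c i)) * xs ! i"
        using ci by simp
      then show "of_int (- u * a i) * xs ! i = of_nat p * (of_int ((- u * a i) div int p) * xs ! i) + of_int (c i) * xs ! i"
        by (simp add: distrib_right mult.assoc)
    qed
    moreover have "(\<Sum>i<?r. of_int (- u * a i) * xs ! i) = - (of_int u * \<sigma>)"
      by (simp add: \<sigma>_def sum_distrib_left sum_negf mult_ac)
    ultimately have us: "of_int u * \<sigma> = - (of_nat p * v + C)" by (metis minus_minus)
    have X: "of_int b * y = of_nat p * z - \<sigma>" using rel unfolding \<sigma>_def by (simp add: eq_diff_eq add.commute)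
    have "(of_int (b * u + int p * w) :: complex) = 1" using uw by simp
    then have "y = (of_int b * of_int u + of_nat p * of_int w) * y" by simp
    also have "\<dots> = of_int u * (of_int b * y) + of_nat p * (of_int w * y)" by (simp add: algebra_simps)
    also have "\<dots> = of_nat p * (of_int u * z) - of_int u * \<sigma> + of_nat p * (of_int w * y)"
      unfolding X by (simp add: algebra_simps)
    also have "\<dots> = of_nat p * (of_int u * z + of_int w * y + v) + C"
      unfolding us by (simp add: algebra_simps)
    finally have "y - (\<Sum>i<?r. of_int (c i) * xs ! i) = of_nat p * (of_int u * z + of_int w * y + v)"
      unfolding C_def[symmetric] by (metis add_diff_cancel_right')
    moreover have "of_int u * z + of_int w * y + v \<in> A"
      unfolding v_def by (intro A(4,5) A(3) combA a(1) y)
    ultimately show ?thesis using cS by blast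
  qed
  then show ?thesis unfolding covers_def A_def[symmetric] using finS SA by blast
qed

lemma covers_nat:
  assumes D: "extension_of_degree \<rat> D k" and t: "t > (0::nat)"
  shows "\<exists>n. covers (integers_of k) ((*) (of_nat t) ` integers_of k) n"
proof -
  have k: "subfield k CC" using D by (simp add: extension_of_degree_def)
  note A = integers_of_closed[OF k]
  show ?thesis using t
  proof (induction t rule: prime_divisors_induct)
    case (unit t)
    then show ?case by (intro exI[of _ 1]) (auto simp: covers_def intro!: exI[of _ "{0}"] A)
  next
    case (factor p t)
    then obtain m n where "covers (integers_of k) ((*) (of_nat p) ` integers_of k) m"
      "covers (integers_of k) ((*) (of_nat t) ` integers_of k) n"
      using covers_prime[OF D, of p] by auto
    then have "covers (integers_of k) ((*) (of_nat p) ` ((*) (of_nat t) ` integers_of k)) (m * n)"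
      by (intro covers_mult A(4,5,9))
    moreover have "(*) (of_nat p) ` ((*) (of_nat t) ` integers_of k) = (*) (of_nat (p * t)) ` integers_of k"
      by (simp add: image_image mult.assoc)
    ultimately show ?case by metis
  qed simp
qed

text \<open>
  If \<open>e\<close> enumerates the embeddings of a number field, this is its norm over the rationals.
\<close>

definition nrm :: "(nat \<Rightarrow> complex \<Rightarrow> complex) \<Rightarrow> nat \<Rightarrow> complex \<Rightarrow> complex" where
  "nrm e N x = (\<Prod>i<N. e i x)"

context
  fixes k :: "complex set" and D N :: nat and e :: "nat \<Rightarrow> complex \<Rightarrow> complex"
  assumes D: "extension_of_degree \<rat> D k" and e: "emb_index \<rat> k {..<N} e"
begin

lemma kQ: "subfield k CC" "\<rat> \<subseteq> k" "k \<subseteq> kbar \<rat>"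
  using extensionD[OF Rats_subfield D] by auto

lemma N_pos: "N > 0"
proof -
  obtain i where "i \<in> {..<N}" by (rule emb_index_id[OF e Rats_subfield])
  then show ?thesis by (cases N) auto
qed

lemma nrm_mult: "x \<in> k \<Longrightarrow> y \<in> k \<Longrightarrow> nrm e N (x * y) = nrm e N x * nrm e N y"
  unfolding nrm_def prod.distrib[symmetric]
  by (rule prod.cong[OF refl]) (rule emb_indexD(2)[OF Rats_subfield kQ e])

lemma nrm_nonzero: "x \<in> k \<Longrightarrow> x \<noteq> 0 \<Longrightarrow> nrm e N x \<noteq> 0"
  unfolding nrm_def using emb_indexD(8)[OF Rats_subfield kQ e] by auto

lemma nrm_rational: assumes x: "x \<in> k" shows "nrm e N x \<in> \<rat>"
proof (rule ccontr)
  have kb: "e i x \<in> kbar \<rat>" if "i \<in> {..<N}" for i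
    by (rule emb_indexD(4)[OF Rats_subfield kQ e that x])
  have "nrm e N x \<in> kbar \<rat>" unfolding nrm_def
    by (rule subfield_prod[OF kbar_subfield[OF Rats_subfield]]) (rule kb)
  moreover assume "nrm e N x \<notin> \<rat>"
  ultimately obtain \<gamma> where g: "\<gamma> \<in> Gal \<rat>" "\<gamma> (nrm e N x) \<noteq> nrm e N x"
    using Gal_moves[OF Rats_subfield Rats_subfield order_refl subset_kbar[OF Rats_subfield]] by metis
  obtain \<pi> where p: "bij_betw \<pi> {..<N} {..<N}" "\<And>i x. i \<in> {..<N} \<Longrightarrow> x \<in> k \<Longrightarrow> \<gamma> (e i x) = e (\<pi> i) x"
    using emb_index_permute[OF Rats_subfield kQ e _ g(1)] by blast
  have "\<gamma> (nrm e N x) = (\<Prod>i<N. \<gamma> (e i x))" unfolding nrm_def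
    by (rule Gal_prod[OF Rats_subfield g(1)]) (rule kb)
  also have "\<dots> = (\<Prod>i<N. e (\<pi> i) x)" by (rule prod.cong[OF refl]) (rule p(2)[OF _ x])
  also have "\<dots> = nrm e N x" unfolding nrm_def by (rule prod.reindex_bij_betw[OF p(1)])
  finally show False using g(2) by simp
qed

lemma nrm_integer: assumes "x \<in> integers_of k" shows "nrm e N x \<in> \<int>"
proof (rule rational_algebraic_int_is_int)
  show "algebraic_int (nrm e N x)" unfolding nrm_def
    by (rule algebraic_int_prod)
      (rule emb_algebraic_int[OF Rats_subfield kQ(3) e], use assms in \<open>auto simp: integers_of_def\<close>)
  show "nrm e N x \<in> \<rat>" by (rule nrm_rational) (use assms in \<open>simp add: integers_of_def\<close>)
qed

text \<open>
  The cofactor is the product of the remaining conjugates, which is integral; it lies in \<open>k\<close> as the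
  quotient of a rational number by \<open>x\<close>.
\<close>

lemma nrm_multiple:
  assumes x: "x \<in> integers_of k" "x \<noteq> 0"
  shows "\<exists>y\<in>integers_of k. nrm e N x = x * y"
proof -
  obtain i where i: "i \<in> {..<N}" "\<And>x. x \<in> k \<Longrightarrow> e i x = x" using emb_index_id[OF e Rats_subfield] by blast
  define y where "y = (\<Prod>j\<in>{..<N} - {i}. e j x)"
  have xk: "x \<in> k" using x by (simp add: integers_of_def)
  have "nrm e N x = x * y" unfolding nrm_def y_def using prod.remove[of "{..<N}" i "\<lambda>i. e i x"] i xk by simp
  moreover have "algebraic_int y" unfolding y_def
    by (rule algebraic_int_prod)
      (rule emb_algebraic_int[OF Rats_subfield kQ(3) e], use x in \<open>auto simp: integers_of_def\<close>)
  moreover have "y \<in> k"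
  proof -
    have "y = nrm e N x / x" using \<open>nrm e N x = x * y\<close> x(2) by simp
    moreover have "nrm e N x \<in> k" using nrm_rational[OF xk] kQ(2) by auto
    ultimately show ?thesis using subfieldD(8)[OF kQ(1)] xk by simp
  qed
  ultimately show ?thesis by (auto simp: integers_of_def)
qed

text \<open>
  The ideal generated by \<open>x\<close> contains the norm of \<open>x\<close>, a nonzero rational integer.
\<close>

lemma covers_principal:
  assumes x: "x \<in> integers_of k" "x \<noteq> 0"
  shows "\<exists>n. covers (integers_of k) ((*) x ` integers_of k) n"
proof -
  note A = integers_of_closed[OF kQ(1)]
  obtain z where z: "nrm e N x = of_int z" using nrm_integer[OF x(1)] by (auto elim: Ints_cases)
  have xk: "x \<in> k" using x by (simp add: integers_of_def)
  have "z \<noteq> 0" using nrm_nonzero[OF xk x(2)] z by auto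
  obtain y where y: "y \<in> integers_of k" "nrm e N x = x * y" using nrm_multiple[OF x] by auto
  have "\<exists>y\<in>integers_of k. of_nat (nat \<bar>z\<bar>) = x * y"
  proof (cases "z \<ge> 0")
    case True
    then have "of_nat (nat \<bar>z\<bar>) = x * y" using z y(2) by simp
    then show ?thesis using y(1) by blast
  next
    case False
    then have "of_nat (nat \<bar>z\<bar>) = x * (- y)" using z y(2) by simp
    then show ?thesis using A(6)[OF y(1)] by blast
  qed
  then obtain y' where y': "y' \<in> integers_of k" "of_nat (nat \<bar>z\<bar>) = x * y'" by auto
  have "(*) (of_nat (nat \<bar>z\<bar>)) ` integers_of k \<subseteq> (*) x ` integers_of k"
  proof (rule image_subsetI)
    fix a assume "a \<in> integers_of k"
    then have "y' * a \<in> integers_of k" using y'(1) A(5) by blast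
    moreover have "of_nat (nat \<bar>z\<bar>) * a = x * (y' * a)" unfolding y'(2) by simp
    ultimately show "of_nat (nat \<bar>z\<bar>) * a \<in> (*) x ` integers_of k" by (metis imageI)
  qed
  moreover obtain n where "covers (integers_of k) ((*) (of_nat (nat \<bar>z\<bar>)) ` integers_of k) n"
    using covers_nat[OF D, of "nat \<bar>z\<bar>"] \<open>z \<noteq> 0\<close> by auto
  ultimately show ?thesis using covers_mono by blast
qed

lemma integral_basis_over_Rats:
  obtains \<beta> where "is_basis \<rat> k \<beta>" "set \<beta> \<subseteq> integers_of k" "length \<beta> = D"
  using integral_basis[OF Rats_subfield D kQ(3)] by blast

text \<open>
  A substitute for the Euclidean algorithm: every element of \<open>k\<close> has a multiple, by a factor from a
  fixed finite range, that differs from an integer by an element of norm less than one. This follows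
  from the pigeonhole principle for the coordinates modulo one with respect to an integral basis.
\<close>

lemma Hurwitz:
  obtains M :: nat where "M \<ge> 1"
    "\<And>c. c \<in> k \<Longrightarrow> \<exists>t q. 1 \<le> t \<and> t \<le> M \<and> q \<in> integers_of k \<and> norm (nrm e N (of_nat t * c - q)) < 1"
proof -
  obtain \<beta> where b: "is_basis \<rat> k \<beta>" "set \<beta> \<subseteq> integers_of k" "length \<beta> = D"
    using integral_basis_over_Rats by blast
  have bO: "\<beta> ! j \<in> integers_of k" if "j < D" for j using b(2,3) that nth_mem by blast
  have bk: "\<beta> ! j \<in> k" if "j < D" for j using bO[OF that] by (simp add: integers_of_def)
  define B where "B = (\<Sum>i<N. \<Sum>j<D. norm (e i (\<beta> ! j)))"
  have B: "(\<Sum>j<D. norm (e i (\<beta> ! j))) \<le> B" if "i < N" for i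
    unfolding B_def by (rule member_le_sum[of i "{..<N}" "\<lambda>i. \<Sum>j<D. norm (e i (\<beta> ! j))"]) (use that in \<open>auto intro: sum_nonneg\<close>)
  obtain L :: nat where L: "real L > B" "L > 0"
    using reals_Archimedean2[of "max B 0"] by (metis max_less_iff_conj of_nat_0_less_iff)
  show ?thesis
  proof (rule that[of "L ^ D"])
    show "1 \<le> L ^ D" using L(2) by simp
    fix c assume "c \<in> k"
    then obtain c' where c': "\<forall>j<D. c' j \<in> \<rat>" "c = (\<Sum>j<D. c' j * \<beta> ! j)"
      using is_basisD(2)[OF Rats_subfield b(1)] b(3) by blast
    have "\<exists>r. j < D \<longrightarrow> c' j = of_real r" for j
    proof (cases "j < D")
      case True
      then have "c' j \<in> \<rat>" using c'(1) by simp
      then obtain a b :: int where "c' j = of_int a / of_int b" by (auto elim!: Rats_cases')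
      then have "c' j = of_real (of_int a / of_int b)" by simp
      then show ?thesis by blast
    qed simp
    then obtain r where r: "\<And>j. j < D \<Longrightarrow> c' j = of_real (r j)" by metis
    \<comment> \<open>the box, of side \<open>1 / L\<close>, that contains the coordinates of \<open>t * c\<close> modulo one\<close>
    define F where "F t = (\<lambda>j\<in>{..<D}. nat \<lfloor>real L * frac (real t * r j)\<rfloor>)" for t
    have F: "F t \<in> PiE {..<D} (\<lambda>_. {..<L})" for t
    proof (rule PiE_I)
      fix j assume "j \<in> {..<D}"
      have "real L * frac (real t * r j) < real L" using L(2) frac_lt_1[of "real t * r j"] by simp
      then have "\<lfloor>real L * frac (real t * r j)\<rfloor> < int L" by linarith
      then show "F t j \<in> {..<L}" using \<open>j \<in> {..<D}\<close> L(2) by (simp add: F_def nat_less_iff)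
    qed (simp add: F_def)
    have "card (F ` {0..L ^ D}) \<le> card (PiE {..<D} (\<lambda>_. {..<L}))"
      by (rule card_mono) (use F in \<open>auto intro: finite_PiE\<close>)
    also have "\<dots> = L ^ D" by (simp add: card_PiE)
    also have "\<dots> < card {0..L ^ D}" by simp
    finally have "\<not> inj_on F {0..L ^ D}" by (rule pigeonhole)
    then obtain t1 t2 where t: "t1 \<in> {0..L ^ D}" "t2 \<in> {0..L ^ D}" "F t1 = F t2" "t1 < t2"
      unfolding inj_on_def by (metis nat_neq_iff)
    define q where "q = (\<Sum>j<D. of_int (\<lfloor>real t2 * r j\<rfloor> - \<lfloor>real t1 * r j\<rfloor>) * \<beta> ! j)"
    define s where "s j = frac (real t2 * r j) - frac (real t1 * r j)" for j
    have q: "q \<in> integers_of k" unfolding q_def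
      by (rule integers_of_closed(10)[OF kQ(1)], rule integers_of_closed(5)[OF kQ(1) integers_of_closed(3)[OF kQ(1)] bO]) simp
    have diff: "of_nat (t2 - t1) * c - q = (\<Sum>j<D. of_real (s j) * \<beta> ! j)"
    proof -
      have "of_nat (t2 - t1) * c - q = (\<Sum>j<D. (of_nat (t2 - t1) * c' j - of_int (\<lfloor>real t2 * r j\<rfloor> - \<lfloor>real t1 * r j\<rfloor>)) * \<beta> ! j)"
        unfolding c'(2) q_def by (simp add: sum_distrib_left left_diff_distrib sum_subtractf mult.assoc)
      also have "\<dots> = (\<Sum>j<D. of_real (s j) * \<beta> ! j)"
      proof (rule sum.cong[OF refl])
        fix j assume j: "j \<in> {..<D}"
        have "real (t2 - t1) * r j - of_int (\<lfloor>real t2 * r j\<rfloor> - \<lfloor>real t1 * r j\<rfloor>) = s j"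
          using t(4) by (simp add: s_def frac_def of_nat_diff algebra_simps)
        then have "of_nat (t2 - t1) * c' j - of_int (\<lfloor>real t2 * r j\<rfloor> - \<lfloor>real t1 * r j\<rfloor>) = of_real (s j)"
          using r[of j] j by (metis lessThan_iff of_real_diff of_real_mult of_real_of_int_eq of_real_of_nat_eq)
        then show "(of_nat (t2 - t1) * c' j - of_int (\<lfloor>real t2 * r j\<rfloor> - \<lfloor>real t1 * r j\<rfloor>)) * \<beta> ! j = of_real (s j) * \<beta> ! j"
          by simp
      qed
      finally show ?thesis .
    qed
    have small: "\<bar>s j\<bar> < 1 / real L" if j: "j < D" for j
    proof -
      have "\<lfloor>real L * frac (real t1 * r j)\<rfloor> = \<lfloor>real L * frac (real t2 * r j)\<rfloor>"
        using fun_cong[OF t(3), of j] j by (simp add: F_def eq_nat_nat_iff)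
      then have "\<bar>real L * frac (real t2 * r j) - real L * frac (real t1 * r j)\<bar> < 1" by linarith
      then have "real L * \<bar>s j\<bar> < 1" unfolding s_def using L(2)
        by (metis abs_mult abs_of_nat right_diff_distrib)
      then show ?thesis using L(2) by (simp add: field_simps)
    qed
    have sQ: "complex_of_real (s j) \<in> \<rat>" if "j < D" for j
    proof -
      have "of_nat (t2 - t1) * c' j - of_int (\<lfloor>real t2 * r j\<rfloor> - \<lfloor>real t1 * r j\<rfloor>) \<in> \<rat>" using c'(1) that by simp
      moreover have "of_nat (t2 - t1) * c' j - of_int (\<lfloor>real t2 * r j\<rfloor> - \<lfloor>real t1 * r j\<rfloor>) = of_real (s j)"
        using r[OF that] t(4) by (simp add: s_def frac_def of_nat_diff algebra_simps)
      ultimately show ?thesis by simp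
    qed
    have e1: "norm (e i (of_nat (t2 - t1) * c - q)) < 1" if i: "i < N" for i
    proof -
      have "e i (of_nat (t2 - t1) * c - q) = (\<Sum>j<D. of_real (s j) * e i (\<beta> ! j))"
        unfolding diff by (rule emb_lincomb[OF Rats_subfield kQ e i]) (use sQ bk in auto)
      then have "norm (e i (of_nat (t2 - t1) * c - q)) \<le> (\<Sum>j<D. norm (of_real (s j) * e i (\<beta> ! j)))"
        using norm_sum[of "\<lambda>j. of_real (s j) * e i (\<beta> ! j)" "{..<D}"] by simp
      also have "\<dots> = (\<Sum>j<D. \<bar>s j\<bar> * norm (e i (\<beta> ! j)))" by (simp add: norm_mult)
      also have "\<dots> \<le> (\<Sum>j<D. 1 / real L * norm (e i (\<beta> ! j)))"
        by (rule sum_mono, rule mult_right_mono[OF less_imp_le[OF small]]) auto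
      also have "\<dots> = 1 / real L * (\<Sum>j<D. norm (e i (\<beta> ! j)))" by (simp add: sum_distrib_left)
      also have "\<dots> \<le> 1 / real L * B" using B[OF i] by (intro mult_left_mono) auto
      also have "\<dots> < 1" using L by (simp add: field_simps)
      finally show ?thesis .
    qed
    have "norm (nrm e N (of_nat (t2 - t1) * c - q)) < 1"
    proof -
      obtain N' where N': "N = Suc N'" using N_pos by (cases N) auto
      have "norm (nrm e N (of_nat (t2 - t1) * c - q)) = (\<Prod>i<N'. norm (e i (of_nat (t2 - t1) * c - q))) * norm (e N' (of_nat (t2 - t1) * c - q))"
        unfolding nrm_def N' by (simp add: norm_mult prod_norm)
      also have "\<dots> \<le> 1 * norm (e N' (of_nat (t2 - t1) * c - q))"
        by (rule mult_right_mono, rule prod_le_1) (use e1 N' in \<open>auto simp: less_imp_le\<close>)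
      also have "\<dots> < 1" using e1[of N'] N' by simp
      finally show ?thesis .
    qed
    then show "\<exists>t q. 1 \<le> t \<and> t \<le> L ^ D \<and> q \<in> integers_of k \<and> norm (nrm e N (of_nat t * c - q)) < 1"
      using t q by (intro exI[of _ "t2 - t1"] exI[of _ q]) auto
  qed
qed

end

section \<open>The discriminant and discriminants of bases\<close>

lemma ex_emb_index_Rats:
  assumes D: "extension_of_degree \<rat> D k"
  shows "\<exists>(N::nat) e. emb_index \<rat> k {..<N} e"
proof (rule exists_emb_index[OF Rats_subfield D])
  fix N :: nat and e assume "emb_index \<rat> k {..<N} e"
  then show ?thesis by (intro exI)
qed

lemma integers_ring: assumes "subfield k CC" shows "cring (subring_of_CC (integers_of k))"
proof -
  interpret cring CC by (rule cring_from_type_algebra)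
  have "subcring (integers_of k) CC"
    by (rule subcringI'[OF subringI]) (use integers_of_closed[OF assms] in auto)
  then show ?thesis by (simp add: subcring_iff)
qed

context
  fixes k K :: "complex set" and n D :: nat and e :: "nat \<Rightarrow> complex \<Rightarrow> complex"
  assumes k: "subfield k CC" and D: "extension_of_degree \<rat> D k"
    and K: "extension_of_degree k n K" and e: "emb_index k K {..<n} e"
begin

lemma disc_in_integers:
  assumes "\<And>l. l < n \<Longrightarrow> \<omega> ! l \<in> integers_of K"
  shows "(emb_det e n \<omega>)\<^sup>2 \<in> integers_of k"
proof -
  note KD = extensionD[OF k K]
  have "algebraic_int (emb_det e n \<omega>)" unfolding emb_det_def
    by (rule algebraic_int_det, rule emb_algebraic_int[OF k KD(3) e])
      (use assms in \<open>auto simp: integers_of_def\<close>)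
  then have "algebraic_int ((emb_det e n \<omega>)\<^sup>2)" by (simp add: power2_eq_square algebraic_int_add_mult)
  moreover have "(emb_det e n \<omega>)\<^sup>2 \<in> k"
    by (rule emb_det_square_in_base[OF k KD(1-3) e]) (use assms in \<open>auto simp: integers_of_def\<close>)
  ultimately show ?thesis by (simp add: integers_of_def)
qed

lemma nth_integral: "is_basis k K \<omega> \<Longrightarrow> set \<omega> \<subseteq> integers_of K \<Longrightarrow> l < n \<Longrightarrow> \<omega> ! l \<in> integers_of K"
  using subsetD[OF _ nth_mem, of \<omega> "integers_of K" l] basis_length(1)[OF k K] by simp

lemma discriminant_ideal_props:
  shows "ideal (discriminant_ideal k K) (subring_of_CC (integers_of k))"
    "\<And>\<omega>. is_basis k K \<omega> \<Longrightarrow> set \<omega> \<subseteq> integers_of K \<Longrightarrow> (emb_det e n \<omega>)\<^sup>2 \<in> discriminant_ideal k K"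
    "\<And>J. ideal J (subring_of_CC (integers_of k)) \<Longrightarrow>
      (\<And>\<omega>. is_basis k K \<omega> \<Longrightarrow> set \<omega> \<subseteq> integers_of K \<Longrightarrow> (emb_det e n \<omega>)\<^sup>2 \<in> J) \<Longrightarrow> discriminant_ideal k K \<subseteq> J"
proof -
  interpret R: cring "subring_of_CC (integers_of k)" by (rule integers_ring[OF k])
  have bd: "basis_discriminants k K = {(emb_det e n \<omega>)\<^sup>2 | \<omega>. set \<omega> \<subseteq> integers_of K \<and> is_basis k K \<omega>}"
    by (rule basis_discriminants_eq[OF k extensionD(1-3)[OF k K] e K])
  have sub: "basis_discriminants k K \<subseteq> carrier (subring_of_CC (integers_of k))"
    unfolding bd using disc_in_integers nth_integral by auto
  show "ideal (discriminant_ideal k K) (subring_of_CC (integers_of k))"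
    unfolding discriminant_ideal_def by (rule R.genideal_ideal[OF sub])
  show "(emb_det e n \<omega>)\<^sup>2 \<in> discriminant_ideal k K" if "is_basis k K \<omega>" "set \<omega> \<subseteq> integers_of K" for \<omega>
    using R.genideal_self[OF sub] that unfolding discriminant_ideal_def bd by blast
  show "discriminant_ideal k K \<subseteq> J" if "ideal J (subring_of_CC (integers_of k))"
    "\<And>\<omega>. is_basis k K \<omega> \<Longrightarrow> set \<omega> \<subseteq> integers_of K \<Longrightarrow> (emb_det e n \<omega>)\<^sup>2 \<in> J" for J
  proof -
    have "basis_discriminants k K \<subseteq> J" unfolding bd using that(2) by auto
    then show ?thesis unfolding discriminant_ideal_def by (rule R.genideal_minimal[OF that(1)])
  qed
qed

lemma discriminant_ideal_closed:
  "x \<in> discriminant_ideal k K \<Longrightarrow> y \<in> discriminant_ideal k K \<Longrightarrow> x + y \<in> discriminant_ideal k K"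
  "x \<in> discriminant_ideal k K \<Longrightarrow> - x \<in> discriminant_ideal k K"
  "0 \<in> discriminant_ideal k K"
  "x \<in> discriminant_ideal k K \<Longrightarrow> a \<in> integers_of k \<Longrightarrow> x * a \<in> discriminant_ideal k K"
  "discriminant_ideal k K \<subseteq> integers_of k"
proof -
  interpret I: ideal "discriminant_ideal k K" "subring_of_CC (integers_of k)"
    by (rule discriminant_ideal_props(1))
  note Ok = integers_of_closed[OF k]
  show sub: "discriminant_ideal k K \<subseteq> integers_of k" using I.a_subset by simp
  show add: "x \<in> discriminant_ideal k K \<Longrightarrow> y \<in> discriminant_ideal k K \<Longrightarrow> x + y \<in> discriminant_ideal k K" for x y
    using additive_subgroup.a_closed[OF I.is_additive_subgroup, of x y] by simp
  show "0 \<in> discriminant_ideal k K" using additive_subgroup.zero_closed[OF I.is_additive_subgroup] by simp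
  show m: "x \<in> discriminant_ideal k K \<Longrightarrow> a \<in> integers_of k \<Longrightarrow> x * a \<in> discriminant_ideal k K" for x a
    using I.I_r_closed[of x a] by simp
  show "x \<in> discriminant_ideal k K \<Longrightarrow> - x \<in> discriminant_ideal k K"
    using m[of x "-1"] Ok(6)[OF Ok(2)] by simp
qed

text \<open>
  The discriminant of a single integral basis already bounds the norm of the discriminant ideal.
\<close>

lemma Disc_le_covers:
  assumes w: "is_basis k K \<omega>" "set \<omega> \<subseteq> integers_of K"
    and cov: "covers (integers_of k) ((*) ((emb_det e n \<omega>)\<^sup>2) ` integers_of k) m"
  shows "Disc k K \<le> m"
  unfolding Disc_def
proof (rule card_quotient_le(2))
  show "covers (integers_of k) (discriminant_ideal k K) m"
    by (rule covers_mono[OF cov _ order_refl])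
      (use discriminant_ideal_closed(4)[OF discriminant_ideal_props(2)[OF w]] in auto)
qed (simp_all add: discriminant_ideal_closed(1,2))

lemma Disc_pos: "Disc k K > 0" and Disc_covers: "covers (integers_of k) (discriminant_ideal k K) (Disc k K)"
proof -
  note KD = extensionD[OF k K]
  have KQ: "K \<subseteq> kbar \<rat>" using extensionD(3)[OF Rats_subfield extension_over_Rats[OF D K]] .
  obtain \<omega> where w: "is_basis k K \<omega>" "set \<omega> \<subseteq> integers_of K" "length \<omega> = n"
    using integral_basis[OF k K KQ] by blast
  obtain N :: nat and e0 where e0: "emb_index \<rat> k {..<N} e0" using ex_emb_index_Rats[OF D] by (elim exE)
  have d: "(emb_det e n \<omega>)\<^sup>2 \<in> integers_of k" by (rule disc_in_integers) (rule nth_integral[OF w(1,2)])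
  have "(emb_det e n \<omega>)\<^sup>2 \<noteq> 0" using emb_det_basis_nonzero[OF k KD(1-3) e w(1,3)] by simp
  then obtain m where m: "covers (integers_of k) ((*) ((emb_det e n \<omega>)\<^sup>2) ` integers_of k) m"
    using covers_principal[OF D e0 d] by blast
  have cov: "covers (integers_of k) (discriminant_ideal k K) m"
    by (rule covers_mono[OF m _ order_refl])
      (use discriminant_ideal_closed(4)[OF discriminant_ideal_props(2)[OF w(1,2)]] in auto)
  have fin: "finite (carrier (subring_of_CC (integers_of k) Quot discriminant_ideal k K))"
    by (rule card_quotient_le(1)[OF cov]) (simp_all add: discriminant_ideal_closed(1,2))
  show "Disc k K > 0" unfolding Disc_def card_gt_0_iff using fin integers_of_closed(1)[OF k]
    unfolding cosets_eq by auto
  show "covers (integers_of k) (discriminant_ideal k K) (Disc k K)"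
    unfolding Disc_def by (rule covers_card_quotient[OF fin discriminant_ideal_closed(3)])
qed

text \<open>
  A converse to \<open>Disc_le_covers\<close>: expressing \<open>T\<close> times any other integral basis by \<open>\<omega>\<close> shows that
  \<open>T\<^sup>2\<^sup>n\<close> times its discriminant is a multiple of that of \<open>\<omega>\<close>. The same then holds for all elements
  of the discriminant ideal.
\<close>

lemma covers_near_minimal:
  assumes w: "is_basis k K \<omega>" "set \<omega> \<subseteq> integers_of K"
    and T: "\<And>x. x \<in> integers_of K \<Longrightarrow> \<exists>c. (\<forall>i<n. c i \<in> integers_of k) \<and> of_nat T * x = (\<Sum>i<n. c i * \<omega> ! i)"
    and A: "covers (integers_of k) ((*) (of_nat (T ^ (2 * n))) ` integers_of k) A"
  shows "covers (integers_of k) ((*) ((emb_det e n \<omega>)\<^sup>2) ` integers_of k) (A * Disc k K)"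
proof -
  note KD = extensionD[OF k K]
  note Ok = integers_of_closed[OF k]
  define d where "d = (emb_det e n \<omega>)\<^sup>2"
  define t :: complex where "t = of_nat (T ^ (2 * n))"
  have d: "d \<in> integers_of k" unfolding d_def by (rule disc_in_integers) (rule nth_integral[OF w(1,2)])
  have t: "t \<in> integers_of k" unfolding t_def by (rule Ok(9))
  have wK: "\<omega> ! l \<in> K" if "l < n" for l using nth_integral[OF w that] by (simp add: integers_of_def)
  \<comment> \<open>an ideal that contains the discriminants of all integral bases, hence the discriminant ideal\<close>
  define J where "J = {y \<in> integers_of k. t * y \<in> (*) d ` integers_of k}"
  have gen: "(emb_det e n \<omega>')\<^sup>2 \<in> J" if w': "is_basis k K \<omega>'" "set \<omega>' \<subseteq> integers_of K" for \<omega>'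
  proof -
    note w'O = nth_integral[OF w']
    have "\<exists>c. (\<forall>i<n. c i \<in> integers_of k) \<and> of_nat T * \<omega>' ! j = (\<Sum>i<n. c i * \<omega> ! i)" if "j < n" for j
      by (rule T[OF w'O[OF that]])
    then obtain p where p: "\<And>i j. j < n \<Longrightarrow> i < n \<Longrightarrow> p j i \<in> integers_of k"
      "\<And>j. j < n \<Longrightarrow> of_nat T * \<omega>' ! j = (\<Sum>i<n. p j i * \<omega> ! i)" by metis
    define \<omega>'' where "\<omega>'' = map (\<lambda>j. of_nat T * \<omega>' ! j) [0..<n]"
    have 1: "emb_det e n \<omega>'' = emb_det e n \<omega> * det (mat n n (\<lambda>(i, j). p j i))"
      by (rule emb_det_change_basis[OF k KD(1-3) e wK])
        (use p in \<open>auto simp: \<omega>''_def integers_of_def\<close>)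
    have 2: "emb_det e n \<omega>'' = of_nat T ^ n * emb_det e n \<omega>'"
    proof -
      have "mat n n (\<lambda>(i, j). e i (\<omega>'' ! j)) = of_nat T \<cdot>\<^sub>m mat n n (\<lambda>(i, j). e i (\<omega>' ! j))"
      proof (rule eq_matI)
        fix i j assume "i < dim_row (of_nat T \<cdot>\<^sub>m mat n n (\<lambda>(i, j). e i (\<omega>' ! j)))"
          "j < dim_col (of_nat T \<cdot>\<^sub>m mat n n (\<lambda>(i, j). e i (\<omega>' ! j)))"
        then have ij: "i < n" "j < n" by auto
        have "e i (of_nat T * \<omega>' ! j) = of_nat T * e i (\<omega>' ! j)"
          using emb_indexD(2,3)[OF k KD(1-3) e, of i] ij w'O[OF ij(2)] subfield_of_nat[OF k] KD(2)
          by (auto simp: integers_of_def subset_iff)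
        then show "mat n n (\<lambda>(i, j). e i (\<omega>'' ! j)) $$ (i, j) = (of_nat T \<cdot>\<^sub>m mat n n (\<lambda>(i, j). e i (\<omega>' ! j))) $$ (i, j)"
          using ij by (simp add: \<omega>''_def)
      qed auto
      then show ?thesis unfolding emb_det_def by simp
    qed
    have "t * (emb_det e n \<omega>')\<^sup>2 = (of_nat T ^ n * emb_det e n \<omega>')\<^sup>2"
      by (simp add: t_def power_mult_distrib power_mult[symmetric] mult.commute)
    also have "\<dots> = d * (det (mat n n (\<lambda>(i, j). p j i)))\<^sup>2"
      unfolding 2[symmetric] 1 d_def by (simp add: power_mult_distrib)
    finally have "t * (emb_det e n \<omega>')\<^sup>2 = d * (det (mat n n (\<lambda>(i, j). p j i)))\<^sup>2" .
    moreover have "(det (mat n n (\<lambda>(i, j). p j i)))\<^sup>2 \<in> integers_of k"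
      by (rule Ok(8), rule Ok(11)) (rule p(1))
    ultimately show ?thesis unfolding J_def using disc_in_integers[OF w'O] by blast
  qed
  have J: "ideal J (subring_of_CC (integers_of k))"
  proof -
    interpret R: cring "subring_of_CC (integers_of k)" by (rule integers_ring[OF k])
    have sub: "subgroup J (add_monoid (subring_of_CC (integers_of k)))"
    proof (rule R.add.subgroupI)
      show "J \<subseteq> carrier (subring_of_CC (integers_of k))" by (auto simp: J_def)
      have "0 \<in> J" unfolding J_def using Ok(1) by force
      then show "J \<noteq> {}" by auto
      fix a assume a: "a \<in> J"
      then obtain x where x: "a \<in> integers_of k" "t * a = d * x" "x \<in> integers_of k" by (auto simp: J_def)
      have "\<ominus>\<^bsub>subring_of_CC (integers_of k)\<^esub> a = - a"
        using R.minus_equality[of "-a" a] x(1) Ok(6)[OF x(1)] by simp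
      moreover have "t * (- a) = d * (- x)" using x(2) by simp
      then have "t * (- a) \<in> (*) d ` integers_of k" using Ok(6)[OF x(3)] by (metis imageI)
      ultimately show "\<ominus>\<^bsub>subring_of_CC (integers_of k)\<^esub> a \<in> J"
        unfolding J_def using Ok(6)[OF x(1)] by simp
      fix b assume b: "b \<in> J"
      then obtain y where y: "b \<in> integers_of k" "t * b = d * y" "y \<in> integers_of k" by (auto simp: J_def)
      have "t * (a + b) = d * (x + y)" using x(2) y(2) by (simp add: distrib_left)
      then show "a \<oplus>\<^bsub>subring_of_CC (integers_of k)\<^esub> b \<in> J"
        unfolding J_def using Ok(4)[OF x(1) y(1)] Ok(4)[OF x(3) y(3)] by auto
    qed
    show ?thesis
    proof (rule idealI[OF R.ring_axioms sub])
      fix a x assume a: "a \<in> J" and x: "x \<in> carrier (subring_of_CC (integers_of k))"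
      then obtain y where y: "a \<in> integers_of k" "t * a = d * y" "y \<in> integers_of k" "x \<in> integers_of k"
        by (auto simp: J_def)
      have "t * (x * a) = d * (x * y)" using y(2) by (metis mult.left_commute)
      then have "t * (x * a) \<in> (*) d ` integers_of k" using Ok(5)[OF y(4,3)] by (metis imageI)
      then have "x * a \<in> J" unfolding J_def using Ok(5)[OF y(4,1)] by simp
      then show "x \<otimes>\<^bsub>subring_of_CC (integers_of k)\<^esub> a \<in> J" "a \<otimes>\<^bsub>subring_of_CC (integers_of k)\<^esub> x \<in> J"
        by (simp_all add: mult.commute)
    qed
  qed
  have sub: "discriminant_ideal k K \<subseteq> J" by (rule discriminant_ideal_props(3)[OF J gen])
  have "covers (integers_of k) ((*) t ` discriminant_ideal k K) (A * Disc k K)"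
    by (rule covers_mult[OF Ok(4,5) t A[folded t_def] Disc_covers])
  then show ?thesis unfolding d_def[symmetric]
    by (rule covers_mono) (use sub in \<open>auto simp: J_def\<close>)
qed

end

section \<open>Nearly minimal integral bases\<close>

lemma det_replace_column:
  assumes "i0 < n"
  shows "det (mat n n (\<lambda>(l, j). if j = i0 then a l else if l = j then 1 else 0)) = (a i0 :: complex)"
proof -
  let ?R = "replace_col (1\<^sub>m n) (1\<^sub>m n *\<^sub>v vec n a) i0"
  have "mat n n (\<lambda>(l, j). if j = i0 then a l else if l = j then 1 else 0) = ?R"
    by (rule eq_matI) (auto simp: replace_col_def)
  moreover have "det ?R = vec n a $ i0 * det (1\<^sub>m n)"
    by (rule cramer_lemma_mat) (use assms in auto)
  ultimately show ?thesis using assms by simp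
qed

text \<open>
  Among the integral bases take one whose discriminant has minimal norm. If a coordinate of an
  integer, multiplied by a factor as in Hurwitz' lemma, were not integral, replacing one basis element
  would multiply the discriminant by the square of an element of norm less than one. All factors
  divide the factorial of their bound, which serves as \<open>T\<close> for all fields \<open>K\<close> simultaneously.
\<close>

lemma near_minimal_basis:
  assumes nf: "number_field k"
  obtains T :: nat where "T > 0"
    "\<And>n K e. extension_of_degree k n K \<Longrightarrow> emb_index k K {..<n} e \<Longrightarrow>
      \<exists>\<omega>. is_basis k K \<omega> \<and> set \<omega> \<subseteq> integers_of K \<and>
        (\<forall>x\<in>integers_of K. \<exists>c. (\<forall>i<n. c i \<in> integers_of k) \<and> of_nat T * x = (\<Sum>i<n. c i * \<omega> ! i))"
proof -
  obtain D where k: "subfield k CC" and D: "extension_of_degree \<rat> D k"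
    using number_fieldD[OF nf] by blast
  obtain N :: nat and e0 where e0: "emb_index \<rat> k {..<N} e0" using ex_emb_index_Rats[OF D] by (elim exE)
  obtain M :: nat where M: "M \<ge> 1"
    "\<And>c. c \<in> k \<Longrightarrow> \<exists>t q. 1 \<le> t \<and> t \<le> M \<and> q \<in> integers_of k \<and> norm (nrm e0 N (of_nat t * c - q)) < 1"
  proof (rule Hurwitz[OF D e0])
    fix M :: nat
    assume a: "1 \<le> M" and b: "\<And>c. c \<in> k \<Longrightarrow> \<exists>t q. 1 \<le> t \<and> t \<le> M \<and> q \<in> integers_of k \<and> norm (nrm e0 N (of_nat t * c - q)) < 1"
    show thesis by (rule that[OF a b])
  qed
  note Ok = integers_of_closed[OF k]
  show ?thesis
  proof (rule that[of "fact M"])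
    fix n K e assume K: "extension_of_degree k n K" and e: "emb_index k K {..<n} e"
    note KD = extensionD[OF k K]
    note OK = integers_of_closed[OF KD(1)]
    have KQ: "K \<subseteq> kbar \<rat>" using extensionD(3)[OF Rats_subfield extension_over_Rats[OF D K]] .
    define P where "P \<omega> \<longleftrightarrow> is_basis k K \<omega> \<and> set \<omega> \<subseteq> integers_of K" for \<omega>
    define \<mu> where "\<mu> \<omega> = nat \<lfloor>norm (nrm e0 N ((emb_det e n \<omega>)\<^sup>2))\<rfloor>" for \<omega>
    obtain \<omega>0 where "is_basis k K \<omega>0" "set \<omega>0 \<subseteq> integers_of K" "length \<omega>0 = n"
      by (rule integral_basis[OF k K KQ])
    then have "P \<omega>0" by (simp add: P_def)
    then have "\<exists>\<omega>. P \<omega> \<and> (\<forall>\<omega>'. P \<omega>' \<longrightarrow> \<mu> \<omega> \<le> \<mu> \<omega>')" by (rule ex_has_least_nat)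
    then obtain \<omega> where w: "P \<omega>" and min: "\<And>\<omega>'. P \<omega>' \<Longrightarrow> \<mu> \<omega> \<le> \<mu> \<omega>'" by auto
    have wb: "is_basis k K \<omega>" and wi: "set \<omega> \<subseteq> integers_of K" using w by (auto simp: P_def)
    have len: "length \<omega> = n" by (rule basis_length(1)[OF k K wb])
    have wO: "\<omega> ! i \<in> integers_of K" if "i < n" for i using subsetD[OF wi nth_mem] len that by simp
    have wK: "\<omega> ! i \<in> K" if "i < n" for i using wO[OF that] by (simp add: integers_of_def)
    note disc_int = disc_in_integers[OF k D K e]
    have coeff: "of_nat (fact M) * c i0 \<in> integers_of k"
      if x: "x \<in> integers_of K" "\<And>i. i < n \<Longrightarrow> c i \<in> k" "x = (\<Sum>i<n. c i * \<omega> ! i)" and i0: "i0 < n" for x c i0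
    proof -
      obtain t q where t: "1 \<le> t" "t \<le> M" "q \<in> integers_of k" "norm (nrm e0 N (of_nat t * c i0 - q)) < 1"
        using M(2)[OF x(2)[OF i0]] by blast
      define u where "u = of_nat t * c i0 - q"
      have qk: "q \<in> k" using t(3) by (simp add: integers_of_def)
      have uk: "u \<in> k" unfolding u_def
        using subfieldD(7)[OF k] subfieldD(4)[OF k subfield_of_nat[OF k] x(2)[OF i0]] qk by blast
      have qO: "q \<in> integers_of K" using t(3) KD(2) by (auto simp: integers_of_def)
      have "u = 0"
      proof (rule ccontr)
        assume u0: "u \<noteq> 0"
        \<comment> \<open>an integer of \<open>K\<close> whose coordinate at \<open>i0\<close> is \<open>u\<close>, of norm less than one\<close>
        define y where "y = of_nat t * x - q * \<omega> ! i0"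
        define a where "a l = (if l = i0 then u else of_nat t * c l)" for l
        have ak: "a l \<in> k" if "l < n" for l
          using uk subfieldD(4)[OF k subfield_of_nat[OF k] x(2)[OF that]] by (simp add: a_def)
        have y: "y = (\<Sum>l<n. a l * \<omega> ! l)"
        proof -
          have "y = (\<Sum>l<n. of_nat t * c l * \<omega> ! l) - q * \<omega> ! i0"
            unfolding y_def x(3) by (simp add: sum_distrib_left mult.assoc)
          also have "(\<Sum>l<n. of_nat t * c l * \<omega> ! l) = of_nat t * c i0 * \<omega> ! i0 + (\<Sum>l\<in>{..<n} - {i0}. of_nat t * c l * \<omega> ! l)"
            by (rule sum.remove) (use i0 in auto)
          also have "(\<Sum>l\<in>{..<n} - {i0}. of_nat t * c l * \<omega> ! l) = (\<Sum>l\<in>{..<n} - {i0}. a l * \<omega> ! l)"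
            by (rule sum.cong) (auto simp: a_def)
          also have "of_nat t * c i0 * \<omega> ! i0 + (\<Sum>l\<in>{..<n} - {i0}. a l * \<omega> ! l) - q * \<omega> ! i0
              = a i0 * \<omega> ! i0 + (\<Sum>l\<in>{..<n} - {i0}. a l * \<omega> ! l)"
            by (simp add: a_def u_def algebra_simps)
          also have "\<dots> = (\<Sum>l<n. a l * \<omega> ! l)" by (rule sum.remove[symmetric]) (use i0 in auto)
          finally show ?thesis .
        qed
        have yO: "y \<in> integers_of K" unfolding y_def
          by (intro OK(7) OK(5) OK(9) x(1) qO wO i0)
        define \<omega>' where "\<omega>' = list_update \<omega> i0 y"
        have len': "length \<omega>' = n" by (simp add: \<omega>'_def len)
        have w'O: "\<omega>' ! j \<in> integers_of K" if "j < n" for j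
          using yO wO that len by (cases "j = i0") (auto simp: \<omega>'_def)
        define p where "p l j = (if j = i0 then a l else if l = j then 1 else 0)" for l j
        have "emb_det e n \<omega>' = emb_det e n \<omega> * det (mat n n (\<lambda>(l, j). p l j))"
        proof (rule emb_det_change_basis[OF k KD(1-3) e])
          show "p l j \<in> k" if "l < n" for l j using ak[OF that] subfieldD(1,2)[OF k] by (simp add: p_def)
          show "\<omega>' ! j = (\<Sum>l<n. p l j * \<omega> ! l)" if j: "j < n" for j
          proof (cases "j = i0")
            case True
            then show ?thesis using y j len by (simp add: \<omega>'_def p_def)
          next
            case False
            have "(\<Sum>l<n. p l j * \<omega> ! l) = (\<Sum>l<n. if l = j then \<omega> ! l else 0)"
              by (rule sum.cong) (auto simp: p_def False)
            then show ?thesis using False j by (simp add: \<omega>'_def)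
          qed
        qed (rule wK)
        then have det': "emb_det e n \<omega>' = emb_det e n \<omega> * u"
          unfolding p_def det_replace_column[OF i0] by (simp add: a_def)
        have det0: "emb_det e n \<omega> \<noteq> 0" by (rule emb_det_basis_nonzero[OF k KD(1-3) e wb len])
        have w'int: "set \<omega>' \<subseteq> integers_of K" using w'O len' by (auto simp: in_set_conv_nth)
        then have w'K: "set \<omega>' \<subseteq> K" by (auto simp: integers_of_def)
        have "ring.independent CC k \<omega>'"
          by (rule emb_det_nonzero_independent[OF k KD(1-3) e w'K len']) (use det' det0 u0 in simp)
        then have "P \<omega>'" using basis_length(3)[OF k K _ w'K len'] w'int by (simp add: P_def)
        then have le: "\<mu> \<omega> \<le> \<mu> \<omega>'" by (rule min)
        have dk: "(emb_det e n \<omega>)\<^sup>2 \<in> k" using disc_int[OF wO] by (simp add: integers_of_def)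
        have u2: "u\<^sup>2 \<in> k" using subfieldD(4)[OF k uk uk] by (simp add: power2_eq_square)
        have "nrm e0 N ((emb_det e n \<omega>')\<^sup>2) = nrm e0 N ((emb_det e n \<omega>)\<^sup>2) * (nrm e0 N u)\<^sup>2"
          unfolding det' power_mult_distrib
          using nrm_mult[OF D e0 dk u2] nrm_mult[OF D e0 uk uk] by (simp add: power2_eq_square)
        then have nn: "norm (nrm e0 N ((emb_det e n \<omega>')\<^sup>2)) = norm (nrm e0 N ((emb_det e n \<omega>)\<^sup>2)) * (norm (nrm e0 N u))\<^sup>2"
          by (simp add: norm_mult norm_power)
        have pos: "0 < norm (nrm e0 N ((emb_det e n \<omega>)\<^sup>2))"
          using nrm_nonzero[OF D e0 dk] det0 by simp
        have "(norm (nrm e0 N u))\<^sup>2 < 1" using t(4) unfolding u_def[symmetric] by (simp add: abs_square_less_1)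
        then have less: "norm (nrm e0 N ((emb_det e n \<omega>')\<^sup>2)) < norm (nrm e0 N ((emb_det e n \<omega>)\<^sup>2))"
          unfolding nn using pos by simp
        obtain z z' where z: "nrm e0 N ((emb_det e n \<omega>)\<^sup>2) = of_int z" "nrm e0 N ((emb_det e n \<omega>')\<^sup>2) = of_int z'"
          using nrm_integer[OF D e0 disc_int[OF wO]] nrm_integer[OF D e0 disc_int[OF w'O]] by (metis Ints_cases)
        have "\<mu> \<omega> = nat \<bar>z\<bar>" "\<mu> \<omega>' = nat \<bar>z'\<bar>" unfolding \<mu>_def z by (simp_all flip: of_int_abs)
        moreover have "\<bar>z'\<bar> < \<bar>z\<bar>" using less unfolding z by (simp flip: of_int_abs)
        ultimately show False using le by linarith
      qed
      then have "of_nat t * c i0 \<in> integers_of k" using t(3) by (simp add: u_def)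
      moreover obtain m where m: "(fact M :: nat) = t * m" using dvd_fact[OF t(1,2)] by (auto simp: dvd_def)
      ultimately have "of_nat m * (of_nat t * c i0) \<in> integers_of k" using Ok(5,9) by blast
      moreover have "of_nat (fact M) * c i0 = of_nat m * (of_nat t * c i0)" unfolding m by simp
      ultimately show ?thesis by metis
    qed
    have "\<exists>c. (\<forall>i<n. c i \<in> integers_of k) \<and> of_nat (fact M) * x = (\<Sum>i<n. c i * \<omega> ! i)"
      if x: "x \<in> integers_of K" for x
    proof -
      have "x \<in> K" using x by (simp add: integers_of_def)
      then obtain c where c: "\<forall>i<n. c i \<in> k" "x = (\<Sum>i<n. c i * \<omega> ! i)"
        using is_basisD(2)[OF k wb] len by blast
      have "of_nat (fact M) * x = (\<Sum>i<n. (of_nat (fact M) * c i) * \<omega> ! i)"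
        unfolding c(2) by (simp add: sum_distrib_left mult.assoc)
      moreover have "of_nat (fact M) * c i \<in> integers_of k" if "i < n" for i
        by (rule coeff[OF x _ c(2) that]) (use c(1) in blast)
      ultimately show ?thesis by (intro exI[of _ "\<lambda>i. of_nat (fact M) * c i"]) blast
    qed
    then show "\<exists>\<omega>. is_basis k K \<omega> \<and> set \<omega> \<subseteq> integers_of K \<and>
        (\<forall>x\<in>integers_of K. \<exists>c. (\<forall>i<n. c i \<in> integers_of k) \<and> of_nat (fact M) * x = (\<Sum>i<n. c i * \<omega> ! i))"
      using wb wi by blast
  qed simp
qed

section \<open>Goursat's lemma\<close>

text \<open>
  With \<open>M\<close> and \<open>N\<close> the elements of \<open>G\<close> and \<open>H\<close> related to the identity, a subgroup of the product
  that surjects onto both factors is the graph of an isomorphism \<open>G/M \<cong> H/N\<close>. If these quotients must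
  be trivial, everything is related.
\<close>

lemma Goursat_no_common_quotient:
  fixes G :: "('a, 'c) monoid_scheme" and H :: "('b, 'd) monoid_scheme"
  assumes G: "group G" and H: "group H" and nq: "no_common_quotient G H"
    and R: "R \<subseteq> carrier G \<times> carrier H"
    and mult: "\<And>g h g' h'. (g, h) \<in> R \<Longrightarrow> (g', h') \<in> R \<Longrightarrow> (g \<otimes>\<^bsub>G\<^esub> g', h \<otimes>\<^bsub>H\<^esub> h') \<in> R"
    and inv: "\<And>g h. (g, h) \<in> R \<Longrightarrow> (inv\<^bsub>G\<^esub> g, inv\<^bsub>H\<^esub> h) \<in> R"
    and fst: "\<And>g. g \<in> carrier G \<Longrightarrow> \<exists>h. (g, h) \<in> R"
    and snd: "\<And>h. h \<in> carrier H \<Longrightarrow> \<exists>g. (g, h) \<in> R"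
  shows "R = carrier G \<times> carrier H"
proof -
  interpret G: group G by (rule G)
  interpret H: group H by (rule H)
  have RG: "g \<in> carrier G" "h \<in> carrier H" if "(g, h) \<in> R" for g h using that R by auto
  have one: "(\<one>\<^bsub>G\<^esub>, \<one>\<^bsub>H\<^esub>) \<in> R"
  proof -
    obtain h where h: "(\<one>\<^bsub>G\<^esub>, h) \<in> R" using fst[OF G.one_closed] by auto
    from mult[OF h inv[OF h]] show ?thesis using RG(2)[OF h] by simp
  qed
  define M where "M = {g. (g, \<one>\<^bsub>H\<^esub>) \<in> R}"
  define N where "N = {h. (\<one>\<^bsub>G\<^esub>, h) \<in> R}"
  have M: "M \<lhd> G"
  proof (rule G.normal_inv_iff[THEN iffD2], intro conjI ballI)
    show "subgroup M G"
    proof (rule G.subgroupI)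
      show "M \<subseteq> carrier G" using RG by (auto simp: M_def)
      show "M \<noteq> {}" using one by (auto simp: M_def)
      show "inv\<^bsub>G\<^esub> a \<in> M" if "a \<in> M" for a using inv[of a "\<one>\<^bsub>H\<^esub>"] that by (simp add: M_def)
      show "a \<otimes>\<^bsub>G\<^esub> b \<in> M" if "a \<in> M" "b \<in> M" for a b
        using mult[of a "\<one>\<^bsub>H\<^esub>" b "\<one>\<^bsub>H\<^esub>"] that by (simp add: M_def)
    qed
    fix x a assume x: "x \<in> carrier G" and a: "a \<in> M"
    obtain h where h: "(x, h) \<in> R" using fst[OF x] by auto
    have "(x \<otimes>\<^bsub>G\<^esub> a \<otimes>\<^bsub>G\<^esub> inv\<^bsub>G\<^esub> x, h \<otimes>\<^bsub>H\<^esub> \<one>\<^bsub>H\<^esub> \<otimes>\<^bsub>H\<^esub> inv\<^bsub>H\<^esub> h) \<in> R"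
      using mult[OF mult[OF h] inv[OF h]] a by (simp add: M_def)
    then show "x \<otimes>\<^bsub>G\<^esub> a \<otimes>\<^bsub>G\<^esub> inv\<^bsub>G\<^esub> x \<in> M" using RG(2)[OF h] by (simp add: M_def)
  qed
  have N: "N \<lhd> H"
  proof (rule H.normal_inv_iff[THEN iffD2], intro conjI ballI)
    show "subgroup N H"
    proof (rule H.subgroupI)
      show "N \<subseteq> carrier H" using RG by (auto simp: N_def)
      show "N \<noteq> {}" using one by (auto simp: N_def)
      show "inv\<^bsub>H\<^esub> a \<in> N" if "a \<in> N" for a using inv[of "\<one>\<^bsub>G\<^esub>" a] that by (simp add: N_def)
      show "a \<otimes>\<^bsub>H\<^esub> b \<in> N" if "a \<in> N" "b \<in> N" for a b
        using mult[of "\<one>\<^bsub>G\<^esub>" a "\<one>\<^bsub>G\<^esub>" b] that by (simp add: N_def)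
    qed
    fix x a assume x: "x \<in> carrier H" and a: "a \<in> N"
    obtain g where g: "(g, x) \<in> R" using snd[OF x] by auto
    have "(g \<otimes>\<^bsub>G\<^esub> \<one>\<^bsub>G\<^esub> \<otimes>\<^bsub>G\<^esub> inv\<^bsub>G\<^esub> g, x \<otimes>\<^bsub>H\<^esub> a \<otimes>\<^bsub>H\<^esub> inv\<^bsub>H\<^esub> x) \<in> R"
      using mult[OF mult[OF g] inv[OF g]] a by (simp add: N_def)
    then show "x \<otimes>\<^bsub>H\<^esub> a \<otimes>\<^bsub>H\<^esub> inv\<^bsub>H\<^esub> x \<in> N" using RG(1)[OF g] by (simp add: N_def)
  qed
  interpret N: normal N H by (rule N)
  interpret HN: group "H Mod N" by (rule N.factorgroup_is_group)
  \<comment> \<open>the homomorphism from \<open>G\<close> to \<open>H/N\<close> whose graph is induced by \<open>R\<close>\<close>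
  define \<phi> where "\<phi> g = N #>\<^bsub>H\<^esub> (SOME h. (g, h) \<in> R)" for g
  have \<phi>: "\<phi> g = N #>\<^bsub>H\<^esub> h" if gh: "(g, h) \<in> R" for g h
  proof -
    define h' where "h' = (SOME h. (g, h) \<in> R)"
    have h': "(g, h') \<in> R" unfolding h'_def using gh by (rule someI)
    have "(g \<otimes>\<^bsub>G\<^esub> inv\<^bsub>G\<^esub> g, h \<otimes>\<^bsub>H\<^esub> inv\<^bsub>H\<^esub> h') \<in> R" by (rule mult[OF gh inv[OF h']])
    then have n: "h \<otimes>\<^bsub>H\<^esub> inv\<^bsub>H\<^esub> h' \<in> N" using RG(1)[OF gh] by (simp add: N_def)
    have "h = (h \<otimes>\<^bsub>H\<^esub> inv\<^bsub>H\<^esub> h') \<otimes>\<^bsub>H\<^esub> h'" using RG(2)[OF gh] RG(2)[OF h'] by (simp add: H.m_assoc)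
    then have "h \<in> N #>\<^bsub>H\<^esub> h'" using n unfolding r_coset_def by blast
    then have "N #>\<^bsub>H\<^esub> h' = N #>\<^bsub>H\<^esub> h"
      by (rule H.repr_independence) (rule RG(2)[OF h'], rule N.subgroup_axioms)
    then show ?thesis by (simp add: \<phi>_def h'_def)
  qed
  have hom: "\<phi> \<in> Group.hom G (H Mod N)"
  proof (rule homI)
    fix g assume g: "g \<in> carrier G"
    obtain h where h: "(g, h) \<in> R" using fst[OF g] by auto
    show "\<phi> g \<in> carrier (H Mod N)" using \<phi>[OF h] RG(2)[OF h] by (auto simp: FactGroup_def RCOSETS_def)
    fix g' assume g': "g' \<in> carrier G"
    obtain h' where h': "(g', h') \<in> R" using fst[OF g'] by auto
    show "\<phi> (g \<otimes>\<^bsub>G\<^esub> g') = \<phi> g \<otimes>\<^bsub>H Mod N\<^esub> \<phi> g'"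
      unfolding \<phi>[OF mult[OF h h']] \<phi>[OF h] \<phi>[OF h']
      using N.rcos_sum[OF RG(2)[OF h] RG(2)[OF h']] by (simp add: FactGroup_def)
  qed
  interpret \<phi>: group_hom G "H Mod N" \<phi> by (unfold_locales) (rule hom)
  have surj: "\<phi> ` carrier G = carrier (H Mod N)"
  proof
    show "\<phi> ` carrier G \<subseteq> carrier (H Mod N)" by auto
    show "carrier (H Mod N) \<subseteq> \<phi> ` carrier G"
    proof
      fix c assume "c \<in> carrier (H Mod N)"
      then obtain h where h: "h \<in> carrier H" "c = N #>\<^bsub>H\<^esub> h" by (auto simp: FactGroup_def RCOSETS_def)
      then obtain g where g: "(g, h) \<in> R" using snd by blast
      then show "c \<in> \<phi> ` carrier G" using \<phi>[OF g] h(2) RG(1)[OF g] by (metis imageI)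
    qed
  qed
  have ker: "kernel G (H Mod N) \<phi> = M"
  proof (rule equalityI; rule subsetI)
    fix g assume "g \<in> kernel G (H Mod N) \<phi>"
    then have g: "g \<in> carrier G" "\<phi> g = N" by (auto simp: kernel_def FactGroup_def)
    obtain h where h: "(g, h) \<in> R" using fst[OF g(1)] by auto
    have "h \<in> N #>\<^bsub>H\<^esub> h" by (rule H.rcos_self[OF RG(2)[OF h] N.subgroup_axioms])
    then have "h \<in> N" using g(2) \<phi>[OF h] by simp
    then have "(\<one>\<^bsub>G\<^esub>, h) \<in> R" by (simp add: N_def)
    from mult[OF h inv[OF this]] show "g \<in> M" using RG[OF h] by (simp add: M_def)
  next
    fix g assume "g \<in> M"
    then have g: "(g, \<one>\<^bsub>H\<^esub>) \<in> R" by (simp add: M_def)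
    have "\<phi> g = N" unfolding \<phi>[OF g] by (rule H.coset_mult_one[OF N.subset])
    then show "g \<in> kernel G (H Mod N) \<phi>" using RG(1)[OF g] by (simp add: kernel_def FactGroup_def)
  qed
  have "G Mod M \<cong> H Mod N" using \<phi>.FactGroup_iso[OF surj] unfolding ker is_iso_def by blast
  then have "trivial_group (G Mod M)" using nq M N unfolding no_common_quotient_def by blast
  then have triv: "carrier (G Mod M) = {M}" by (simp add: trivial_group_def FactGroup_def)
  interpret M: normal M G by (rule M)
  have GM: "(g, \<one>\<^bsub>H\<^esub>) \<in> R" if g: "g \<in> carrier G" for g
  proof -
    have "M #>\<^bsub>G\<^esub> g \<in> carrier (G Mod M)" using g by (auto simp: FactGroup_def RCOSETS_def)
    then have "M #>\<^bsub>G\<^esub> g = M" using triv by simp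
    moreover have "g \<in> M #>\<^bsub>G\<^esub> g" by (rule G.rcos_self[OF g M.subgroup_axioms])
    ultimately show ?thesis by (simp add: M_def)
  qed
  have "(g, h) \<in> R" if gh: "g \<in> carrier G" "h \<in> carrier H" for g h
  proof -
    obtain g' where g': "(g', h) \<in> R" using snd[OF gh(2)] by auto
    have "g \<otimes>\<^bsub>G\<^esub> inv\<^bsub>G\<^esub> g' \<in> carrier G" using gh(1) RG(1)[OF g'] by simp
    from mult[OF GM[OF this] g'] show ?thesis
      using gh RG(1)[OF g'] by (simp add: G.m_assoc)
  qed
  then show ?thesis using R by auto
qed

section \<open>Permutation groups realised by Galois actions\<close>

definition perm_group_on :: "'i set \<Rightarrow> ('i \<Rightarrow> 'i) set \<Rightarrow> bool" where
  "perm_group_on \<Omega> G \<longleftrightarrow> group (perm_grp G) \<and> (\<forall>g\<in>G. (\<forall>i\<in>\<Omega>. g i \<in> \<Omega>) \<and> (\<forall>i. i \<notin> \<Omega> \<longrightarrow> g i = i))"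

lemma perm_group_onD:
  assumes "perm_group_on \<Omega> G"
  shows "group (perm_grp G)" "g \<in> G \<Longrightarrow> i \<in> \<Omega> \<Longrightarrow> g i \<in> \<Omega>" "g \<in> G \<Longrightarrow> i \<notin> \<Omega> \<Longrightarrow> g i = i"
    "g \<in> G \<Longrightarrow> h \<in> G \<Longrightarrow> g \<circ> h \<in> G" "id \<in> G"
    "g \<in> G \<Longrightarrow> \<exists>h\<in>G. g \<circ> h = id \<and> h \<circ> g = id"
proof -
  interpret group "perm_grp G" using assms by (simp add: perm_group_on_def)
  show "group (perm_grp G)" by (rule is_group)
  show "g \<in> G \<Longrightarrow> i \<in> \<Omega> \<Longrightarrow> g i \<in> \<Omega>" "g \<in> G \<Longrightarrow> i \<notin> \<Omega> \<Longrightarrow> g i = i"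
    using assms by (auto simp: perm_group_on_def)
  show "g \<in> G \<Longrightarrow> h \<in> G \<Longrightarrow> g \<circ> h \<in> G" using m_closed[of g h] by (simp add: perm_grp_def)
  show "id \<in> G" using one_closed by (simp add: perm_grp_def)
  show "g \<in> G \<Longrightarrow> \<exists>h\<in>G. g \<circ> h = id \<and> h \<circ> g = id"
    using inv_closed[of g] r_inv[of g] l_inv[of g] by (auto simp: perm_grp_def)
qed

lemma sym_subgroup_perm_group_on:
  assumes "subgroup G (sym_group n)"
  shows "perm_group_on {1..n} G"
proof -
  have "group (sym_group n)" by (rule sym_group_is_group)
  then have "group ((sym_group n)\<lparr>carrier := G\<rparr>)" by (rule subgroup.subgroup_is_group[OF assms])
  moreover have "(sym_group n)\<lparr>carrier := G\<rparr> = perm_grp G" by (simp add: sym_group_def perm_grp_def)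
  ultimately have "group (perm_grp G)" by simp
  moreover have "g permutes {1..n}" if "g \<in> G" for g
    using subgroup.subset[OF assms] that by (auto simp: sym_group_def)
  ultimately show ?thesis unfolding perm_group_on_def
    using permutes_in_image permutes_not_in by metis
qed

definition acts_as :: "complex set \<Rightarrow> 'i set \<Rightarrow> ('i \<Rightarrow> complex \<Rightarrow> complex) \<Rightarrow> (complex \<Rightarrow> complex) \<Rightarrow> ('i \<Rightarrow> 'i) \<Rightarrow> bool" where
  "acts_as K \<Omega> e \<gamma> g \<longleftrightarrow> (\<forall>i\<in>\<Omega>. \<forall>x\<in>K. \<gamma> (e i x) = e (g i) x)"

lemma gal_index_iff:
  "gal_index k K \<Omega> G e \<longleftrightarrow> emb_index k K \<Omega> e \<and> (\<forall>\<gamma>\<in>Gal k. \<exists>g\<in>G. acts_as K \<Omega> e \<gamma> g) \<and>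
     (\<forall>g\<in>G. \<exists>\<gamma>\<in>Gal k. acts_as K \<Omega> e \<gamma> g)"
  by (simp add: gal_index_def acts_as_def)

lemma acts_as_comp:
  "acts_as K \<Omega> e \<gamma> g \<Longrightarrow> acts_as K \<Omega> e \<delta> h \<Longrightarrow> perm_group_on \<Omega> G \<Longrightarrow> h \<in> G \<Longrightarrow> acts_as K \<Omega> e (\<gamma> \<circ> \<delta>) (g \<circ> h)"
  using perm_group_onD(2)[of \<Omega> G h] by (simp add: acts_as_def)

lemma acts_as_inv:
  assumes k: "subfield k CC" and g: "\<gamma> \<in> Gal k" and a: "acts_as K \<Omega> e \<gamma> g" and G: "perm_group_on \<Omega> G" "g \<in> G"
  shows "acts_as K \<Omega> e (inv' \<gamma>) (inv\<^bsub>perm_grp G\<^esub> g)"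
proof -
  interpret group "perm_grp G" by (rule perm_group_onD(1)[OF G(1)])
  let ?h = "inv\<^bsub>perm_grp G\<^esub> g"
  have h: "?h \<in> G" using inv_closed[of g] G(2) by (simp add: perm_grp_def)
  have gh: "g (?h i) = i" for i using r_inv[of g] G(2) by (simp add: perm_grp_def fun_eq_iff)
  show ?thesis unfolding acts_as_def
  proof (intro ballI)
    fix i x assume i: "i \<in> \<Omega>" "x \<in> K"
    have "\<gamma> (e (?h i) x) = e (g (?h i)) x"
      using a perm_group_onD(2)[OF G(1) h i(1)] i(2) by (simp add: acts_as_def)
    then have "\<gamma> (e (?h i) x) = e i x" unfolding gh .
    then show "inv' \<gamma> (e i x) = e (?h i) x"
      using Gal_bij[OF k g] by (metis bij_is_inj inv_f_f)
  qed
qed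

text \<open>
  The pairs of permutations induced by a common automorphism satisfy the hypotheses of Goursat's lemma.
\<close>

lemma Gal_realises_product:
  assumes k: "subfield k CC" and G1: "perm_group_on \<Omega>\<^sub>1 G\<^sub>1" and G2: "perm_group_on \<Omega>\<^sub>2 G\<^sub>2"
    and nq: "no_common_quotient (perm_grp G\<^sub>1) (perm_grp G\<^sub>2)"
    and e1: "gal_index k K\<^sub>1 \<Omega>\<^sub>1 G\<^sub>1 e\<^sub>1" and e2: "gal_index k K\<^sub>2 \<Omega>\<^sub>2 G\<^sub>2 e\<^sub>2"
    and g: "g\<^sub>1 \<in> G\<^sub>1" "g\<^sub>2 \<in> G\<^sub>2"
  shows "\<exists>\<gamma>\<in>Gal k. acts_as K\<^sub>1 \<Omega>\<^sub>1 e\<^sub>1 \<gamma> g\<^sub>1 \<and> acts_as K\<^sub>2 \<Omega>\<^sub>2 e\<^sub>2 \<gamma> g\<^sub>2"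
proof -
  define R where "R = {(g, h). g \<in> G\<^sub>1 \<and> h \<in> G\<^sub>2 \<and> (\<exists>\<gamma>\<in>Gal k. acts_as K\<^sub>1 \<Omega>\<^sub>1 e\<^sub>1 \<gamma> g \<and> acts_as K\<^sub>2 \<Omega>\<^sub>2 e\<^sub>2 \<gamma> h)}"
  have c: "carrier (perm_grp G\<^sub>1) = G\<^sub>1" "carrier (perm_grp G\<^sub>2) = G\<^sub>2" by (simp_all add: perm_grp_def)
  have e1': "\<exists>g\<in>G\<^sub>1. acts_as K\<^sub>1 \<Omega>\<^sub>1 e\<^sub>1 \<gamma> g" and e2': "\<exists>g\<in>G\<^sub>2. acts_as K\<^sub>2 \<Omega>\<^sub>2 e\<^sub>2 \<gamma> g" if "\<gamma> \<in> Gal k" for \<gamma>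
    using e1 e2 that unfolding gal_index_iff by blast+
  have e1'': "\<exists>\<gamma>\<in>Gal k. acts_as K\<^sub>1 \<Omega>\<^sub>1 e\<^sub>1 \<gamma> g" if "g \<in> G\<^sub>1" for g using e1 that unfolding gal_index_iff by blast
  have e2'': "\<exists>\<gamma>\<in>Gal k. acts_as K\<^sub>2 \<Omega>\<^sub>2 e\<^sub>2 \<gamma> g" if "g \<in> G\<^sub>2" for g using e2 that unfolding gal_index_iff by blast
  have "R = carrier (perm_grp G\<^sub>1) \<times> carrier (perm_grp G\<^sub>2)"
  proof (rule Goursat_no_common_quotient[OF perm_group_onD(1)[OF G1] perm_group_onD(1)[OF G2] nq])
    show "R \<subseteq> carrier (perm_grp G\<^sub>1) \<times> carrier (perm_grp G\<^sub>2)" unfolding c R_def by auto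
  next
    fix g h g' h' assume "(g, h) \<in> R" "(g', h') \<in> R"
    then obtain \<gamma> \<delta> where gd: "g \<in> G\<^sub>1" "h \<in> G\<^sub>2" "\<gamma> \<in> Gal k" "acts_as K\<^sub>1 \<Omega>\<^sub>1 e\<^sub>1 \<gamma> g" "acts_as K\<^sub>2 \<Omega>\<^sub>2 e\<^sub>2 \<gamma> h"
      "g' \<in> G\<^sub>1" "h' \<in> G\<^sub>2" "\<delta> \<in> Gal k" "acts_as K\<^sub>1 \<Omega>\<^sub>1 e\<^sub>1 \<delta> g'" "acts_as K\<^sub>2 \<Omega>\<^sub>2 e\<^sub>2 \<delta> h'"
      unfolding R_def by auto
    have "(g \<circ> g', h \<circ> h') \<in> R" unfolding R_def
      using perm_group_onD(4)[OF G1 gd(1,6)] perm_group_onD(4)[OF G2 gd(2,7)] Gal_comp[OF k gd(3,8)]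
        acts_as_comp[OF gd(4,9) G1 gd(6)] acts_as_comp[OF gd(5,10) G2 gd(7)] by blast
    then show "(g \<otimes>\<^bsub>perm_grp G\<^sub>1\<^esub> g', h \<otimes>\<^bsub>perm_grp G\<^sub>2\<^esub> h') \<in> R" by (simp add: perm_grp_def)
  next
    fix g h assume "(g, h) \<in> R"
    then obtain \<gamma> where gd: "g \<in> G\<^sub>1" "h \<in> G\<^sub>2" "\<gamma> \<in> Gal k" "acts_as K\<^sub>1 \<Omega>\<^sub>1 e\<^sub>1 \<gamma> g" "acts_as K\<^sub>2 \<Omega>\<^sub>2 e\<^sub>2 \<gamma> h"
      unfolding R_def by auto
    have "inv\<^bsub>perm_grp G\<^sub>1\<^esub> g \<in> G\<^sub>1" "inv\<^bsub>perm_grp G\<^sub>2\<^esub> h \<in> G\<^sub>2"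
      using group.inv_closed[OF perm_group_onD(1)[OF G1], of g] group.inv_closed[OF perm_group_onD(1)[OF G2], of h] gd(1,2)
      by (simp_all add: c)
    then show "(inv\<^bsub>perm_grp G\<^sub>1\<^esub> g, inv\<^bsub>perm_grp G\<^sub>2\<^esub> h) \<in> R" unfolding R_def
      using Gal_inv[OF k gd(3)] acts_as_inv[OF k gd(3,4) G1 gd(1)] acts_as_inv[OF k gd(3,5) G2 gd(2)] by blast
  next
    fix g assume "g \<in> carrier (perm_grp G\<^sub>1)"
    then have g: "g \<in> G\<^sub>1" by (simp add: c)
    then obtain \<gamma> where ga: "\<gamma> \<in> Gal k" "acts_as K\<^sub>1 \<Omega>\<^sub>1 e\<^sub>1 \<gamma> g" using e1'' by blast
    then obtain h where "h \<in> G\<^sub>2" "acts_as K\<^sub>2 \<Omega>\<^sub>2 e\<^sub>2 \<gamma> h" using e2' by blast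
    then show "\<exists>h. (g, h) \<in> R" unfolding R_def using g ga by blast
  next
    fix h assume "h \<in> carrier (perm_grp G\<^sub>2)"
    then have h: "h \<in> G\<^sub>2" by (simp add: c)
    then obtain \<gamma> where ga: "\<gamma> \<in> Gal k" "acts_as K\<^sub>2 \<Omega>\<^sub>2 e\<^sub>2 \<gamma> h" using e2'' by blast
    then obtain g where "g \<in> G\<^sub>1" "acts_as K\<^sub>1 \<Omega>\<^sub>1 e\<^sub>1 \<gamma> g" using e1' by blast
    then show "\<exists>g. (g, h) \<in> R" unfolding R_def using h ga by blast
  qed
  then have "(g\<^sub>1, g\<^sub>2) \<in> R" using g by (simp add: c)
  then show ?thesis unfolding R_def by blast
qed

section \<open>Determinants of Kronecker products\<close>

lemma bij_div_mod:
  assumes "(m::nat) > 0"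
  shows "bij_betw (\<lambda>l. (l div m, l mod m)) {..<n * m} ({..<n} \<times> {..<m})"
proof (rule bij_betwI[of _ _ _ "\<lambda>(i, j). i * m + j"])
  show "(\<lambda>l. (l div m, l mod m)) \<in> {..<n * m} \<rightarrow> {..<n} \<times> {..<m}"
    using assms by (auto simp: less_mult_imp_div_less)
  have "i * m + j < n * m" if "i < n" "j < m" for i j
  proof -
    have "i * m + j < Suc i * m" using that by simp
    also have "\<dots> \<le> n * m" using that by (intro mult_le_mono1) auto
    finally show ?thesis .
  qed
  then show "(\<lambda>(i, j). i * m + j) \<in> {..<n} \<times> {..<m} \<rightarrow> {..<n * m}" by auto
qed (use assms in auto)

lemma sum_div_mod:
  assumes "(m::nat) > 0"
  shows "(\<Sum>l<n * m. f (l div m) (l mod m)) = (\<Sum>i<n. \<Sum>j<m. f i j)"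
  using sum.reindex_bij_betw[OF bij_div_mod[OF assms], of "\<lambda>(i, j). f i j" n]
  by (simp add: sum.cartesian_product)

lemma det_block_diagonal:
  fixes b :: "nat \<Rightarrow> nat \<Rightarrow> complex"
  assumes m: "m > 0"
  shows "det (mat (n * m) (n * m) (\<lambda>(l, l'). if l div m = l' div m then b (l mod m) (l' mod m) else 0))
    = det (mat m m (\<lambda>(i, j). b i j)) ^ n"
proof (induction n)
  case (Suc n)
  let ?B = "mat m m (\<lambda>(i, j). b i j)"
  let ?D = "\<lambda>n. mat (n * m) (n * m) (\<lambda>(l, l'). if l div m = l' div m then b (l mod m) (l' mod m) else 0)"
  have "?D (Suc n) = four_block_mat ?B (0\<^sub>m m (n * m)) (0\<^sub>m (n * m) m) (?D n)"
  proof (rule eq_matI)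
    fix l l' assume "l < dim_row (four_block_mat ?B (0\<^sub>m m (n * m)) (0\<^sub>m (n * m) m) (?D n))"
      "l' < dim_col (four_block_mat ?B (0\<^sub>m m (n * m)) (0\<^sub>m (n * m) m) (?D n))"
    then have l: "l < m + n * m" "l' < m + n * m" by simp_all
    have d: "x div m = Suc ((x - m) div m)" "x mod m = (x - m) mod m" if "\<not> x < m" for x
      using that m by (simp_all add: le_div_geq le_mod_geq)
    have s: "x div m = 0" "x mod m = x" if "x < m" for x using that by simp_all
    show "?D (Suc n) $$ (l, l') = four_block_mat ?B (0\<^sub>m m (n * m)) (0\<^sub>m (n * m) m) (?D n) $$ (l, l')"
      using l by (cases "l < m"; cases "l' < m") (simp_all add: d s)
  qed simp_all
  then have "det (?D (Suc n)) = det ?B * det (?D n)"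
    using det_four_block_mat_upper_right_zero[of ?B m "0\<^sub>m m (n * m)" "n * m" "0\<^sub>m (n * m) m" "?D n"] by simp
  then show ?case using Suc by simp
qed simp

lemma det_permute_both:
  fixes a :: "nat \<Rightarrow> nat \<Rightarrow> complex"
  assumes p: "p permutes {0..<n}"
  shows "det (mat n n (\<lambda>(i, j). a (p i) (p j))) = det (mat n n (\<lambda>(i, j). a i j))"
proof -
  have pn: "p i < n" if "i < n" for i using permutes_in_image[OF p, of i] that by simp
  have "det (mat n n (\<lambda>(i, j). a (p i) (p j))) = det (mat n n (\<lambda>(i, j). mat n n (\<lambda>(i, j). a i (p j)) $$ (p i, j)))"
    by (rule arg_cong[where f = det], rule eq_matI) (auto simp: pn)
  also have "\<dots> = signof p * det (mat n n (\<lambda>(i, j). a i (p j)))" by (rule det_permute_rows[OF _ p]) simp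
  also have "det (mat n n (\<lambda>(i, j). a i (p j))) = det (mat n n (\<lambda>(i, j). a j (p i)))"
    by (rule det_transpose_fun[symmetric])
  also have "\<dots> = det (mat n n (\<lambda>(i, j). mat n n (\<lambda>(i, j). a j i) $$ (p i, j)))"
    by (rule arg_cong[where f = det], rule eq_matI) (auto simp: pn)
  also have "\<dots> = signof p * det (mat n n (\<lambda>(i, j). a j i))" by (rule det_permute_rows[OF _ p]) simp
  also have "det (mat n n (\<lambda>(i, j). a j i)) = det (mat n n (\<lambda>(i, j). a i j))" by (rule det_transpose_fun)
  finally show ?thesis by (auto simp: sign_def)
qed

text \<open>
  The Kronecker product factors as \<open>(a \<otimes> 1) (1 \<otimes> b)\<close>. The second factor is block diagonal, and the
  first becomes block diagonal when the two coordinates are interchanged.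
\<close>

lemma det_Kronecker:
  fixes a b :: "nat \<Rightarrow> nat \<Rightarrow> complex"
  assumes n: "n > 0" and m: "m > 0"
  shows "det (mat (n * m) (n * m) (\<lambda>(l, l'). a (l div m) (l' div m) * b (l mod m) (l' mod m)))
    = det (mat n n (\<lambda>(i, j). a i j)) ^ m * det (mat m m (\<lambda>(i, j). b i j)) ^ n"
proof -
  let ?N = "n * m"
  \<comment> \<open>the interchange of the two coordinates\<close>
  define p where "p l = (if l < ?N then (l mod n) * m + l div n else l)" for l
  have bnd: "(l mod n) * m + l div n < ?N" "l div n < m" if "l < ?N" for l
  proof -
    show "l div n < m" using that by (simp add: less_mult_imp_div_less mult.commute)
    then have "(l mod n) * m + l div n < Suc (l mod n) * m" by simp
    also have "\<dots> \<le> n * m" using n by (intro mult_le_mono1) (simp add: Suc_leI)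
    finally show "(l mod n) * m + l div n < ?N" .
  qed
  have pdm: "p l div m = l mod n" "p l mod m = l div n" if "l < ?N" for l
    using that bnd(2)[OF that] m by (simp_all add: p_def)
  have perm: "p permutes {0..<?N}"
  proof (rule bij_imp_permutes)
    have sub: "p ` {0..<?N} \<subseteq> {0..<?N}" using bnd(1) by (auto simp: p_def)
    have inj: "inj_on p {0..<?N}"
    proof (rule inj_onI)
      fix l l' assume l: "l \<in> {0..<?N}" "l' \<in> {0..<?N}" "p l = p l'"
      then have "l mod n = l' mod n" "l div n = l' div n" using pdm[of l] pdm[of l'] by auto
      then show "l = l'" by (metis div_mult_mod_eq)
    qed
    show "bij_betw p {0..<?N} {0..<?N}" unfolding bij_betw_def
      using endo_inj_surj[OF _ sub inj] inj by simp
  qed (simp add: p_def)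
  define A where "A l l' = (if l mod m = l' mod m then a (l div m) (l' div m) else 0)" for l l'
  define B where "B l l' = (if l div m = l' div m then b (l mod m) (l' mod m) else 0)" for l l'
  have prod: "(\<Sum>q<?N. A l q * B q l') = a (l div m) (l' div m) * b (l mod m) (l' mod m)"
    if l: "l < ?N" "l' < ?N" for l l'
  proof -
    have "(\<Sum>q<?N. A l q * B q l') = (\<Sum>i<n. \<Sum>j<m. (if l mod m = j then a (l div m) i else 0) * (if i = l' div m then b j (l' mod m) else 0))"
      unfolding A_def B_def
      by (rule sum_div_mod[OF m, of "\<lambda>i j. (if l mod m = j then a (l div m) i else 0) * (if i = l' div m then b j (l' mod m) else 0)"])
    also have "\<dots> = (\<Sum>i<n. if i = l' div m then a (l div m) i * b (l mod m) (l' mod m) else 0)"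
    proof (rule sum.cong[OF refl])
      fix i
      have "(\<Sum>j<m. (if l mod m = j then a (l div m) i else 0) * (if i = l' div m then b j (l' mod m) else 0))
         = (\<Sum>j<m. if j = l mod m then a (l div m) i * (if i = l' div m then b (l mod m) (l' mod m) else 0) else 0)"
        by (rule sum.cong) auto
      then show "(\<Sum>j<m. (if l mod m = j then a (l div m) i else 0) * (if i = l' div m then b j (l' mod m) else 0))
         = (if i = l' div m then a (l div m) i * b (l mod m) (l' mod m) else 0)"
        using m by simp
    qed
    also have "\<dots> = a (l div m) (l' div m) * b (l mod m) (l' mod m)"
      using less_mult_imp_div_less[OF l(2)] by simp
    finally show ?thesis .
  qed
  have "det (mat ?N ?N (\<lambda>(l, l'). a (l div m) (l' div m) * b (l mod m) (l' mod m)))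
      = det (mat ?N ?N (\<lambda>(l, l'). \<Sum>q<?N. A l q * B q l'))"
    by (rule arg_cong[where f = det], rule eq_matI) (auto simp: prod)
  also have "\<dots> = det (mat ?N ?N (\<lambda>(l, l'). A l l')) * det (mat ?N ?N (\<lambda>(l, l'). B l l'))"
    by (rule det_mult_fun)
  also have "det (mat ?N ?N (\<lambda>(l, l'). B l l')) = det (mat m m (\<lambda>(i, j). b i j)) ^ n"
    unfolding B_def by (rule det_block_diagonal[OF m])
  also have "det (mat ?N ?N (\<lambda>(l, l'). A l l')) = det (mat ?N ?N (\<lambda>(l, l'). A (p l) (p l')))"
    by (rule det_permute_both[OF perm, symmetric])
  also have "\<dots> = det (mat (m * n) (m * n) (\<lambda>(l, l'). if l div n = l' div n then a (l mod n) (l' mod n) else 0))"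
  proof -
    have "mat ?N ?N (\<lambda>(l, l'). A (p l) (p l')) = mat (m * n) (m * n) (\<lambda>(l, l'). if l div n = l' div n then a (l mod n) (l' mod n) else 0)"
      by (rule eq_matI) (auto simp: A_def pdm mult.commute)
    then show ?thesis by simp
  qed
  also have "\<dots> = det (mat n n (\<lambda>(i, j). a i j)) ^ m" by (rule det_block_diagonal[OF n])
  finally show ?thesis .
qed

section \<open>The compositum\<close>

text \<open>
  An inverse of an algebraic element is a polynomial in that element.
\<close>

lemma algebraic_subring_is_subfield:
  assumes k: "subfield k CC" and V: "k \<subseteq> V" "V \<subseteq> kbar k"
    and add: "\<And>x y. x \<in> V \<Longrightarrow> y \<in> V \<Longrightarrow> x + y \<in> V" and mult: "\<And>x y. x \<in> V \<Longrightarrow> y \<in> V \<Longrightarrow> x * y \<in> V"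
  shows "subfield V CC"
proof (rule subfieldI_CC)
  show one: "1 \<in> V" using subfieldD(2)[OF k] V(1) by auto
  show "x + y \<in> V" "x * y \<in> V" if "x \<in> V" "y \<in> V" for x y using that add mult by auto
  have m1: "- 1 \<in> V" using subfieldD(5)[OF k subfieldD(2)[OF k]] V(1) by auto
  show "- x \<in> V" if "x \<in> V" for x using mult[OF m1 that] by simp
  have z: "0 \<in> V" using subfieldD(1)[OF k] V(1) by auto
  fix x assume x: "x \<in> V" "x \<noteq> 0"
  obtain q where q: "poly_over k q" "inverse x = poly q x"
    using inverse_as_poly[OF k _ x(2)] x(1) V(2) by blast
  have "poly q x \<in> V" using q(1)
  proof (induction q)
    case (pCons c q)
    then have "c \<in> k" "poly_over k q" by (auto simp: poly_over_def coeff_pCons split: nat.splits)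
    then show ?case using pCons(2) V(1) add mult x(1) by auto
  qed (simp add: z)
  then show "inverse x \<in> V" using q(2) by simp
qed

definition compositum :: "complex set \<Rightarrow> complex set \<Rightarrow> complex set" where
  "compositum K L = generate_field CC (K \<union> L)"

lemma compositum_props:
  shows "subfield (compositum K L) CC" "K \<subseteq> compositum K L" "L \<subseteq> compositum K L"
    "subfield F CC \<Longrightarrow> K \<subseteq> F \<Longrightarrow> L \<subseteq> F \<Longrightarrow> compositum K L \<subseteq> F"
proof -
  interpret field CC by (rule CC_field)
  show "subfield (compositum K L) CC" unfolding compositum_def by (rule generate_field_is_subfield) simp
  show "K \<subseteq> compositum K L" "L \<subseteq> compositum K L" unfolding compositum_def by (auto intro: generate_field.incl)
  show "subfield F CC \<Longrightarrow> K \<subseteq> F \<Longrightarrow> L \<subseteq> F \<Longrightarrow> compositum K L \<subseteq> F"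
    unfolding compositum_def by (rule generate_field_min_subfield1) auto
qed

lemma Gal_eq_on_compositum:
  assumes k: "subfield k CC" and g: "\<gamma> \<in> Gal k" "\<delta> \<in> Gal k" and KL: "K \<subseteq> kbar k" "L \<subseteq> kbar k"
    and "\<And>x. x \<in> K \<Longrightarrow> \<gamma> x = \<delta> x" "\<And>x. x \<in> L \<Longrightarrow> \<gamma> x = \<delta> x" and x: "x \<in> compositum K L"
  shows "\<gamma> x = \<delta> x"
proof -
  have "compositum K L \<subseteq> {x \<in> kbar k. \<gamma> x = \<delta> x}"
    by (rule compositum_props(4)[OF Gal_eq_subfield[OF k g]]) (use assms in auto)
  then show ?thesis using x by auto
qed

text \<open>
  The products are listed lexicographically, so that division and remainder recover both indices;
  this is the indexing of the Kronecker product.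
\<close>

definition product_basis :: "complex list \<Rightarrow> complex list \<Rightarrow> complex list" where
  "product_basis \<omega> \<eta> = map (\<lambda>l. \<omega> ! (l div length \<eta>) * \<eta> ! (l mod length \<eta>)) [0..<length \<omega> * length \<eta>]"

text \<open>
  The span of the products is a ring that contains both fields; being algebraic over \<open>k\<close>, it is a
  field and hence contains the compositum.
\<close>

lemma compositum_span:
  assumes k: "subfield k CC" and K: "extension_of_degree k n K" and L: "extension_of_degree k m L"
    and w: "is_basis k K \<omega>" and h: "is_basis k L \<eta>"
  shows "x \<in> compositum K L \<longleftrightarrow> (\<exists>c. (\<forall>l<n * m. c l \<in> k) \<and> x = (\<Sum>l<n * m. c l * product_basis \<omega> \<eta> ! l))"
proof -
  note KD = extensionD[OF k K] and LD = extensionD[OF k L]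
  have lw: "length \<omega> = n" and lh: "length \<eta> = m" using basis_length(1)[OF k K w] basis_length(1)[OF k L h] .
  have m0: "m > 0" by (rule LD(5))
  have wK: "\<omega> ! i \<in> K" if "i < n" for i using is_basisD(1)[OF k w] lw that by simp
  have hL: "\<eta> ! j \<in> L" if "j < m" for j using is_basisD(1)[OF k h] lh that by simp
  have C: "subfield (compositum K L) CC" "K \<subseteq> compositum K L" "L \<subseteq> compositum K L"
    by (rule compositum_props)+
  note CF = subfieldD[OF C(1)]
  have pb: "product_basis \<omega> \<eta> ! l = \<omega> ! (l div m) * \<eta> ! (l mod m)" if "l < n * m" for l
    using that by (simp add: product_basis_def lw lh)
  define V where "V = {\<Sum>j<m. x j * \<eta> ! j | x. \<forall>j<m. x j \<in> K}"
  have VI: "(\<Sum>j<m. x j * \<eta> ! j) \<in> V" if "\<And>j. j < m \<Longrightarrow> x j \<in> K" for x unfolding V_def using that by blast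
  have V_iff: "x \<in> V \<longleftrightarrow> (\<exists>c. (\<forall>l<n * m. c l \<in> k) \<and> x = (\<Sum>l<n * m. c l * product_basis \<omega> \<eta> ! l))" for x
  proof
    assume "x \<in> V"
    then obtain y where y: "\<And>j. j < m \<Longrightarrow> y j \<in> K" "x = (\<Sum>j<m. y j * \<eta> ! j)" unfolding V_def by auto
    have "\<exists>c. j < m \<longrightarrow> (\<forall>i<n. c i \<in> k) \<and> y j = (\<Sum>i<n. c i * \<omega> ! i)" for j
      using is_basisD(2)[OF k w y(1)[of j]] lw by blast
    then obtain c where c: "\<And>j i. j < m \<Longrightarrow> i < n \<Longrightarrow> c j i \<in> k" "\<And>j. j < m \<Longrightarrow> y j = (\<Sum>i<n. c j i * \<omega> ! i)" by metis
    have "x = (\<Sum>j<m. \<Sum>i<n. c j i * (\<omega> ! i * \<eta> ! j))"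
      unfolding y(2) by (rule sum.cong[OF refl]) (simp add: c(2) sum_distrib_right mult.assoc)
    also have "\<dots> = (\<Sum>i<n. \<Sum>j<m. c j i * (\<omega> ! i * \<eta> ! j))" by (rule sum.swap)
    also have "\<dots> = (\<Sum>l<n * m. c (l mod m) (l div m) * (\<omega> ! (l div m) * \<eta> ! (l mod m)))"
      by (rule sum_div_mod[OF m0, symmetric])
    also have "\<dots> = (\<Sum>l<n * m. c (l mod m) (l div m) * product_basis \<omega> \<eta> ! l)"
      by (rule sum.cong[OF refl]) (simp add: pb)
    finally have "x = (\<Sum>l<n * m. c (l mod m) (l div m) * product_basis \<omega> \<eta> ! l)" .
    moreover have "c (l mod m) (l div m) \<in> k" if "l < n * m" for l
      by (rule c(1)) (use that m0 in \<open>simp_all add: less_mult_imp_div_less\<close>)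
    ultimately show "\<exists>c. (\<forall>l<n * m. c l \<in> k) \<and> x = (\<Sum>l<n * m. c l * product_basis \<omega> \<eta> ! l)"
      by (intro exI[of _ "\<lambda>l. c (l mod m) (l div m)"]) blast
  next
    assume "\<exists>c. (\<forall>l<n * m. c l \<in> k) \<and> x = (\<Sum>l<n * m. c l * product_basis \<omega> \<eta> ! l)"
    then obtain c where c: "\<And>l. l < n * m \<Longrightarrow> c l \<in> k" "x = (\<Sum>l<n * m. c l * product_basis \<omega> \<eta> ! l)" by auto
    have "x = (\<Sum>l<n * m. c ((l div m) * m + l mod m) * (\<omega> ! (l div m) * \<eta> ! (l mod m)))"
      unfolding c(2) by (rule sum.cong[OF refl]) (simp add: pb)
    also have "\<dots> = (\<Sum>i<n. \<Sum>j<m. c (i * m + j) * (\<omega> ! i * \<eta> ! j))" by (rule sum_div_mod[OF m0])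
    also have "\<dots> = (\<Sum>j<m. \<Sum>i<n. c (i * m + j) * (\<omega> ! i * \<eta> ! j))" by (rule sum.swap)
    also have "\<dots> = (\<Sum>j<m. (\<Sum>i<n. c (i * m + j) * \<omega> ! i) * \<eta> ! j)"
      by (simp add: sum_distrib_right mult.assoc)
    also have "\<dots> \<in> V"
    proof (rule VI, rule subfield_sum[OF KD(1)], rule subfieldD(4)[OF KD(1)])
      fix j i assume j: "j < m" and i: "i \<in> {..<n}"
      have "i * m + j < Suc i * m" using j by simp
      also have "\<dots> \<le> n * m" using i by (intro mult_le_mono1) auto
      finally show "c (i * m + j) \<in> K" using c(1) KD(2) by auto
      show "\<omega> ! i \<in> K" using wK i by simp
    qed
    finally show "x \<in> V" .
  qed
  have VC: "V \<subseteq> compositum K L"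
    unfolding V_def using C(2,3) hL by (auto intro!: subfield_sum[OF C(1)] CF(4))
  have LV: "L \<subseteq> V"
  proof
    fix y assume y: "y \<in> L"
    obtain c where c: "\<forall>j<m. c j \<in> k" "y = (\<Sum>j<m. c j * \<eta> ! j)" using is_basisD(2)[OF k h y] lh by blast
    show "y \<in> V" unfolding c(2) by (rule VI) (use c(1) KD(2) in auto)
  qed
  have KV: "K \<subseteq> V"
  proof
    fix y assume y: "y \<in> K"
    have "1 \<in> L" by (rule subfieldD(2)[OF LD(1)])
    then obtain c where c: "\<forall>j<m. c j \<in> k" "1 = (\<Sum>j<m. c j * \<eta> ! j)" using is_basisD(2)[OF k h] lh by blast
    have "y = y * (\<Sum>j<m. c j * \<eta> ! j)" using c(2) by simp
    then have "y = (\<Sum>j<m. (y * c j) * \<eta> ! j)" by (simp add: sum_distrib_left mult.assoc)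
    moreover have "(\<Sum>j<m. (y * c j) * \<eta> ! j) \<in> V"
      by (rule VI) (use y c(1) KD(2) subfieldD(4)[OF KD(1)] in auto)
    ultimately show "y \<in> V" by simp
  qed
  have Vadd: "x + y \<in> V" if xy: "x \<in> V" "y \<in> V" for x y
  proof -
    obtain a b where ab: "\<And>j. j < m \<Longrightarrow> a j \<in> K" "x = (\<Sum>j<m. a j * \<eta> ! j)" "\<And>j. j < m \<Longrightarrow> b j \<in> K" "y = (\<Sum>j<m. b j * \<eta> ! j)"
      using xy unfolding V_def by auto
    have "x + y = (\<Sum>j<m. (a j + b j) * \<eta> ! j)" unfolding ab(2,4) by (simp add: distrib_right sum.distrib)
    then show ?thesis using VI[of "\<lambda>j. a j + b j"] ab(1,3) subfieldD(3)[OF KD(1)] by simp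
  qed
  have Vsum: "sum f A \<in> V" if "\<And>i. i \<in> A \<Longrightarrow> f i \<in> V" for f and A :: "nat set"
    using that
  proof (induction A rule: infinite_finite_induct)
    case (insert a A)
    then show ?case using Vadd by simp
  qed (use KV subfieldD(1)[OF KD(1)] in auto)
  have Vscale: "a * x \<in> V" if xy: "a \<in> K" "x \<in> V" for a x
  proof -
    obtain b where ab: "\<And>j. j < m \<Longrightarrow> b j \<in> K" "x = (\<Sum>j<m. b j * \<eta> ! j)"
      using xy unfolding V_def by auto
    have "a * x = (\<Sum>j<m. (a * b j) * \<eta> ! j)" unfolding ab(2) by (simp add: sum_distrib_left mult.assoc)
    then show ?thesis using VI[of "\<lambda>j. a * b j"] ab(1) xy(1) subfieldD(4)[OF KD(1)] by simp
  qed
  have Vmult: "x * y \<in> V" if xy: "x \<in> V" "y \<in> V" for x y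
  proof -
    obtain a b where ab: "\<And>j. j < m \<Longrightarrow> a j \<in> K" "x = (\<Sum>j<m. a j * \<eta> ! j)" "\<And>j. j < m \<Longrightarrow> b j \<in> K" "y = (\<Sum>j<m. b j * \<eta> ! j)"
      using xy unfolding V_def by auto
    have "x * y = (\<Sum>i<m. \<Sum>j<m. (a i * b j) * (\<eta> ! i * \<eta> ! j))"
      unfolding ab(2,4) sum_product by (intro sum.cong refl) (simp add: mult_ac)
    also have "\<dots> \<in> V"
    proof (rule Vsum, rule Vsum, rule Vscale)
      fix i j assume ij: "i \<in> {..<m}" "j \<in> {..<m}"
      show "a i * b j \<in> K" using ab(1,3) ij subfieldD(4)[OF KD(1)] by auto
      have "\<eta> ! i * \<eta> ! j \<in> L" using hL ij subfieldD(4)[OF LD(1)] by auto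
      then show "\<eta> ! i * \<eta> ! j \<in> V" using LV by blast
    qed
    finally show ?thesis .
  qed
  have "compositum K L \<subseteq> V"
  proof (rule compositum_props(4)[OF _ KV LV], rule algebraic_subring_is_subfield[OF k _ _ Vadd Vmult])
    show "k \<subseteq> V" using KD(2) KV by blast
    have "compositum K L \<subseteq> kbar k" by (rule compositum_props(4)[OF kbar_subfield[OF k] KD(3) LD(3)])
    then show "V \<subseteq> kbar k" using VC by blast
  qed
  then have "compositum K L = V" using VC by blast
  then show ?thesis using V_iff by simp
qed

lemma covers_power:
  assumes add: "\<And>x y. x \<in> A \<Longrightarrow> y \<in> A \<Longrightarrow> x + y \<in> A" and mult: "\<And>x y. x \<in> A \<Longrightarrow> y \<in> A \<Longrightarrow> x * y \<in> A"
    and one: "0 \<in> A" and a: "a \<in> A" "covers A ((*) a ` A) p"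
  shows "covers A ((*) (a ^ r) ` A) (p ^ r)"
proof (induction r)
  case 0
  show ?case unfolding covers_def by (rule exI[of _ "{0}"]) (use one in auto)
next
  case (Suc r)
  have "covers A ((*) a ` ((*) (a ^ r) ` A)) (p * p ^ r)" by (rule covers_mult[OF add mult a Suc])
  then show ?case by (simp add: image_image mult.assoc)
qed

text \<open>
  Two extensions whose groups have no common nontrivial quotient, with labelled embeddings. The index
  sets carry different types, so that the product set labels the embeddings of the compositum.
\<close>

locale galois_pair =
  fixes k K\<^sub>1 K\<^sub>2 :: "complex set" and n m :: nat and \<Omega>\<^sub>1 :: "'i set" and \<Omega>\<^sub>2 :: "'j set"
    and G\<^sub>1 G\<^sub>2 and e\<^sub>1 e\<^sub>2
  assumes k: "subfield k CC"
    and K1: "extension_of_degree k n K\<^sub>1" and K2: "extension_of_degree k m K\<^sub>2"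
    and O1: "finite \<Omega>\<^sub>1" "card \<Omega>\<^sub>1 = n" and O2: "finite \<Omega>\<^sub>2" "card \<Omega>\<^sub>2 = m"
    and G1: "perm_group_on \<Omega>\<^sub>1 G\<^sub>1" "transitive_on \<Omega>\<^sub>1 G\<^sub>1"
    and G2: "perm_group_on \<Omega>\<^sub>2 G\<^sub>2" "transitive_on \<Omega>\<^sub>2 G\<^sub>2"
    and e1: "gal_index k K\<^sub>1 \<Omega>\<^sub>1 G\<^sub>1 e\<^sub>1" and e2: "gal_index k K\<^sub>2 \<Omega>\<^sub>2 G\<^sub>2 e\<^sub>2"
    and nq: "no_common_quotient (perm_grp G\<^sub>1) (perm_grp G\<^sub>2)"
begin

abbreviation "K \<equiv> compositum K\<^sub>1 K\<^sub>2"

lemmas K1D = extensionD[OF k K1] and K2D = extensionD[OF k K2]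

lemma ei: "emb_index k K\<^sub>1 \<Omega>\<^sub>1 e\<^sub>1" "emb_index k K\<^sub>2 \<Omega>\<^sub>2 e\<^sub>2"
  using e1 e2 by (simp_all add: gal_index_def)

lemma K_props: "subfield K CC" "k \<subseteq> K" "K \<subseteq> kbar k" "K\<^sub>1 \<subseteq> K" "K\<^sub>2 \<subseteq> K"
proof -
  show "subfield K CC" "K\<^sub>1 \<subseteq> K" "K\<^sub>2 \<subseteq> K" by (rule compositum_props)+
  then show "k \<subseteq> K" using K1D(2) by blast
  show "K \<subseteq> kbar k" by (rule compositum_props(4)[OF kbar_subfield[OF k] K1D(3) K2D(3)])
qed

lemma K_Gal_eq:
  "\<gamma> \<in> Gal k \<Longrightarrow> \<delta> \<in> Gal k \<Longrightarrow> (\<And>x. x \<in> K\<^sub>1 \<Longrightarrow> \<gamma> x = \<delta> x) \<Longrightarrow> (\<And>x. x \<in> K\<^sub>2 \<Longrightarrow> \<gamma> x = \<delta> x) \<Longrightarrow> x \<in> K \<Longrightarrow> \<gamma> x = \<delta> x"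
  by (rule Gal_eq_on_compositum[OF k _ _ K1D(3) K2D(3)])

text \<open>
  By transitivity the two identity embeddings can be moved to any prescribed pair of embeddings, and
  the two permutations needed are realised by a single automorphism.
\<close>

lemma joint_embedding:
  assumes i: "i \<in> \<Omega>\<^sub>1" and j: "j \<in> \<Omega>\<^sub>2"
  shows "\<exists>\<gamma>\<in>Gal k. (\<forall>x\<in>K\<^sub>1. \<gamma> x = e\<^sub>1 i x) \<and> (\<forall>x\<in>K\<^sub>2. \<gamma> x = e\<^sub>2 j x)"
proof -
  obtain i0 where i0: "i0 \<in> \<Omega>\<^sub>1" "\<And>x. x \<in> K\<^sub>1 \<Longrightarrow> e\<^sub>1 i0 x = x" using emb_index_id[OF ei(1) k] by blast
  obtain j0 where j0: "j0 \<in> \<Omega>\<^sub>2" "\<And>x. x \<in> K\<^sub>2 \<Longrightarrow> e\<^sub>2 j0 x = x" using emb_index_id[OF ei(2) k] by blast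
  obtain g1 where g1: "g1 \<in> G\<^sub>1" "g1 i0 = i" using G1(2) i0(1) i unfolding transitive_on_def by blast
  obtain g2 where g2: "g2 \<in> G\<^sub>2" "g2 j0 = j" using G2(2) j0(1) j unfolding transitive_on_def by blast
  obtain \<gamma> where g: "\<gamma> \<in> Gal k" "acts_as K\<^sub>1 \<Omega>\<^sub>1 e\<^sub>1 \<gamma> g1" "acts_as K\<^sub>2 \<Omega>\<^sub>2 e\<^sub>2 \<gamma> g2"
    using Gal_realises_product[OF k G1(1) G2(1) nq e1 e2 g1(1) g2(1)] by blast
  have "\<gamma> x = e\<^sub>1 i x" if "x \<in> K\<^sub>1" for x
    using g(2) i0 that g1(2) unfolding acts_as_def by metis
  moreover have "\<gamma> x = e\<^sub>2 j x" if "x \<in> K\<^sub>2" for x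
    using g(3) j0 that g2(2) unfolding acts_as_def by metis
  ultimately show ?thesis using g(1) by blast
qed

definition joint :: "'i \<times> 'j \<Rightarrow> complex \<Rightarrow> complex" where
  "joint p = (SOME \<gamma>. \<gamma> \<in> Gal k \<and> (\<forall>x\<in>K\<^sub>1. \<gamma> x = e\<^sub>1 (fst p) x) \<and> (\<forall>x\<in>K\<^sub>2. \<gamma> x = e\<^sub>2 (snd p) x))"

lemma joint:
  assumes "p \<in> \<Omega>\<^sub>1 \<times> \<Omega>\<^sub>2"
  shows "joint p \<in> Gal k" "x \<in> K\<^sub>1 \<Longrightarrow> joint p x = e\<^sub>1 (fst p) x" "x \<in> K\<^sub>2 \<Longrightarrow> joint p x = e\<^sub>2 (snd p) x"
proof -
  have "\<exists>\<gamma>. \<gamma> \<in> Gal k \<and> (\<forall>x\<in>K\<^sub>1. \<gamma> x = e\<^sub>1 (fst p) x) \<and> (\<forall>x\<in>K\<^sub>2. \<gamma> x = e\<^sub>2 (snd p) x)"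
    using joint_embedding[of "fst p" "snd p"] assms by (auto simp: mem_Times_iff)
  from someI_ex[OF this, folded joint_def]
  show "joint p \<in> Gal k" "x \<in> K\<^sub>1 \<Longrightarrow> joint p x = e\<^sub>1 (fst p) x" "x \<in> K\<^sub>2 \<Longrightarrow> joint p x = e\<^sub>2 (snd p) x" by blast+
qed

lemma joint_emb_index: "emb_index k K (\<Omega>\<^sub>1 \<times> \<Omega>\<^sub>2) joint"
  unfolding emb_index_def
proof (intro conjI ballI impI)
  show "\<exists>\<gamma>\<in>Gal k. \<forall>x\<in>K. joint p x = \<gamma> x" if "p \<in> \<Omega>\<^sub>1 \<times> \<Omega>\<^sub>2" for p using joint(1)[OF that] by blast
  show "\<exists>p\<in>\<Omega>\<^sub>1 \<times> \<Omega>\<^sub>2. \<forall>x\<in>K. joint p x = \<gamma> x" if g: "\<gamma> \<in> Gal k" for \<gamma>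
  proof -
    obtain i where i: "i \<in> \<Omega>\<^sub>1" "\<forall>x\<in>K\<^sub>1. e\<^sub>1 i x = \<gamma> x" using Gal_emb_index[OF ei(1) g] by blast
    obtain j where j: "j \<in> \<Omega>\<^sub>2" "\<forall>x\<in>K\<^sub>2. e\<^sub>2 j x = \<gamma> x" using Gal_emb_index[OF ei(2) g] by blast
    have p: "(i, j) \<in> \<Omega>\<^sub>1 \<times> \<Omega>\<^sub>2" using i(1) j(1) by simp
    have "joint (i, j) x = \<gamma> x" if "x \<in> K" for x
      by (rule K_Gal_eq[OF joint(1)[OF p] g _ _ that]) (use joint(2,3)[OF p] i(2) j(2) in auto)
    then show ?thesis using p by blast
  qed
  show "p = q" if pq: "p \<in> \<Omega>\<^sub>1 \<times> \<Omega>\<^sub>2" "q \<in> \<Omega>\<^sub>1 \<times> \<Omega>\<^sub>2" "\<forall>x\<in>K. joint p x = joint q x" for p q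
  proof (rule prod_eqI)
    have p: "fst p \<in> \<Omega>\<^sub>1" "snd p \<in> \<Omega>\<^sub>2" "fst q \<in> \<Omega>\<^sub>1" "snd q \<in> \<Omega>\<^sub>2" using pq(1,2) by auto
    show "fst p = fst q"
    proof (rule emb_index_distinct[OF ei(1) p(1,3)])
      fix x assume x: "x \<in> K\<^sub>1"
      then have "joint p x = joint q x" using pq(3) K_props(4) by blast
      then show "e\<^sub>1 (fst p) x = e\<^sub>1 (fst q) x" using joint(2)[OF pq(1) x] joint(2)[OF pq(2) x] by simp
    qed
    show "snd p = snd q"
    proof (rule emb_index_distinct[OF ei(2) p(2,4)])
      fix x assume x: "x \<in> K\<^sub>2"
      then have "joint p x = joint q x" using pq(3) K_props(5) by blast
      then show "e\<^sub>2 (snd p) x = e\<^sub>2 (snd q) x" using joint(3)[OF pq(1) x] joint(3)[OF pq(2) x] by simp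
    qed
  qed
qed

lemma joint_acts_as:
  assumes g: "\<gamma> \<in> Gal k" "acts_as K\<^sub>1 \<Omega>\<^sub>1 e\<^sub>1 \<gamma> g\<^sub>1" "acts_as K\<^sub>2 \<Omega>\<^sub>2 e\<^sub>2 \<gamma> g\<^sub>2" "g\<^sub>1 \<in> G\<^sub>1" "g\<^sub>2 \<in> G\<^sub>2"
  shows "acts_as K (\<Omega>\<^sub>1 \<times> \<Omega>\<^sub>2) joint \<gamma> (\<lambda>p. if p \<in> \<Omega>\<^sub>1 \<times> \<Omega>\<^sub>2 then map_prod g\<^sub>1 g\<^sub>2 p else p)"
  unfolding acts_as_def
proof (intro ballI)
  fix p x assume p: "p \<in> \<Omega>\<^sub>1 \<times> \<Omega>\<^sub>2" and x: "x \<in> K"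
  have pp: "fst p \<in> \<Omega>\<^sub>1" "snd p \<in> \<Omega>\<^sub>2" using p by auto
  let ?q = "map_prod g\<^sub>1 g\<^sub>2 p"
  have q: "?q \<in> \<Omega>\<^sub>1 \<times> \<Omega>\<^sub>2"
    using perm_group_onD(2)[OF G1(1) g(4) pp(1)] perm_group_onD(2)[OF G2(1) g(5) pp(2)] by (simp add: mem_Times_iff)
  have "(\<gamma> \<circ> joint p) x = joint ?q x"
  proof (rule K_Gal_eq[OF Gal_comp[OF k g(1) joint(1)[OF p]] joint(1)[OF q] _ _ x])
    show "(\<gamma> \<circ> joint p) x = joint ?q x" if "x \<in> K\<^sub>1" for x
      using joint(2)[OF p that] joint(2)[OF q that] g(2) pp(1) that by (simp add: acts_as_def)
    show "(\<gamma> \<circ> joint p) x = joint ?q x" if "x \<in> K\<^sub>2" for x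
      using joint(3)[OF p that] joint(3)[OF q that] g(3) pp(2) that by (simp add: acts_as_def)
  qed
  then show "\<gamma> (joint p x) = joint (if p \<in> \<Omega>\<^sub>1 \<times> \<Omega>\<^sub>2 then ?q else p) x" using p by simp
qed

lemma joint_gal_index: "gal_index k K (\<Omega>\<^sub>1 \<times> \<Omega>\<^sub>2) (perm_prod \<Omega>\<^sub>1 \<Omega>\<^sub>2 G\<^sub>1 G\<^sub>2) joint"
  unfolding gal_index_iff
proof (intro conjI joint_emb_index ballI)
  fix \<gamma> assume g: "\<gamma> \<in> Gal k"
  obtain g1 where g1: "g1 \<in> G\<^sub>1" "acts_as K\<^sub>1 \<Omega>\<^sub>1 e\<^sub>1 \<gamma> g1" using e1 g unfolding gal_index_iff by blast
  obtain g2 where g2: "g2 \<in> G\<^sub>2" "acts_as K\<^sub>2 \<Omega>\<^sub>2 e\<^sub>2 \<gamma> g2" using e2 g unfolding gal_index_iff by blast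
  show "\<exists>g\<in>perm_prod \<Omega>\<^sub>1 \<Omega>\<^sub>2 G\<^sub>1 G\<^sub>2. acts_as K (\<Omega>\<^sub>1 \<times> \<Omega>\<^sub>2) joint \<gamma> g"
    using joint_acts_as[OF g g1(2) g2(2) g1(1) g2(1)] g1(1) g2(1) unfolding perm_prod_def by blast
next
  fix g assume "g \<in> perm_prod \<Omega>\<^sub>1 \<Omega>\<^sub>2 G\<^sub>1 G\<^sub>2"
  then obtain g1 g2 where g: "g1 \<in> G\<^sub>1" "g2 \<in> G\<^sub>2" "g = (\<lambda>p. if p \<in> \<Omega>\<^sub>1 \<times> \<Omega>\<^sub>2 then map_prod g1 g2 p else p)"
    unfolding perm_prod_def by blast
  obtain \<gamma> where ga: "\<gamma> \<in> Gal k" "acts_as K\<^sub>1 \<Omega>\<^sub>1 e\<^sub>1 \<gamma> g1" "acts_as K\<^sub>2 \<Omega>\<^sub>2 e\<^sub>2 \<gamma> g2"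
    using Gal_realises_product[OF k G1(1) G2(1) nq e1 e2 g(1,2)] by blast
  show "\<exists>\<gamma>\<in>Gal k. acts_as K (\<Omega>\<^sub>1 \<times> \<Omega>\<^sub>2) joint \<gamma> g"
    using joint_acts_as[OF ga g(1,2)] ga(1) unfolding g(3) by blast
qed

lemma enumerations:
  obtains u\<^sub>1 u\<^sub>2 where "bij_betw u\<^sub>1 {..<n} \<Omega>\<^sub>1" "bij_betw u\<^sub>2 {..<m} \<Omega>\<^sub>2"
  using ex_bij_betw_nat_finite[OF O1(1)] ex_bij_betw_nat_finite[OF O2(1)] O1(2) O2(2)
  by (auto simp: atLeast0LessThan)

lemma joint_enum_emb_index:
  assumes u: "bij_betw u\<^sub>1 {..<n} \<Omega>\<^sub>1" "bij_betw u\<^sub>2 {..<m} \<Omega>\<^sub>2"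
  shows "emb_index k K {..<n * m} (\<lambda>l. joint (u\<^sub>1 (l div m), u\<^sub>2 (l mod m)))"
proof (rule emb_index_reindex[OF _ joint_emb_index])
  have "bij_betw (map_prod u\<^sub>1 u\<^sub>2) ({..<n} \<times> {..<m}) (\<Omega>\<^sub>1 \<times> \<Omega>\<^sub>2)"
    using u map_prod_inj_on[of u\<^sub>1 "{..<n}" u\<^sub>2 "{..<m}"] map_prod_surj_on[of u\<^sub>1 "{..<n}" \<Omega>\<^sub>1 u\<^sub>2 "{..<m}" \<Omega>\<^sub>2]
    by (simp add: bij_betw_def)
  from bij_betw_trans[OF bij_div_mod[OF K2D(5)] this]
  show "bij_betw (\<lambda>l. (u\<^sub>1 (l div m), u\<^sub>2 (l mod m))) {..<n * m} (\<Omega>\<^sub>1 \<times> \<Omega>\<^sub>2)"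
    by (simp add: comp_def)
qed

text \<open>
  An embedding of the compositum multiplies the values of the two factors, so the entries are those of
  a Kronecker product.
\<close>

lemma joint_emb_det:
  assumes u: "bij_betw u\<^sub>1 {..<n} \<Omega>\<^sub>1" "bij_betw u\<^sub>2 {..<m} \<Omega>\<^sub>2"
    and w: "is_basis k K\<^sub>1 \<omega>" and h: "is_basis k K\<^sub>2 \<eta>"
  shows "emb_det (\<lambda>l. joint (u\<^sub>1 (l div m), u\<^sub>2 (l mod m))) (n * m) (product_basis \<omega> \<eta>)
    = emb_det (\<lambda>i. e\<^sub>1 (u\<^sub>1 i)) n \<omega> ^ m * emb_det (\<lambda>j. e\<^sub>2 (u\<^sub>2 j)) m \<eta> ^ n"
proof -
  have lw: "length \<omega> = n" "length \<eta> = m" using basis_length(1)[OF k K1 w] basis_length(1)[OF k K2 h] .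
  have entry: "joint (u\<^sub>1 (l div m), u\<^sub>2 (l mod m)) (product_basis \<omega> \<eta> ! l')
      = e\<^sub>1 (u\<^sub>1 (l div m)) (\<omega> ! (l' div m)) * e\<^sub>2 (u\<^sub>2 (l mod m)) (\<eta> ! (l' mod m))"
    if l: "l < n * m" "l' < n * m" for l l'
  proof -
    have d: "x div m < n" "x mod m < m" if "x < n * m" for x
      using that K2D(5) by (simp_all add: less_mult_imp_div_less)
    have p: "(u\<^sub>1 (l div m), u\<^sub>2 (l mod m)) \<in> \<Omega>\<^sub>1 \<times> \<Omega>\<^sub>2" using bij_betwE[OF u(1)] bij_betwE[OF u(2)] d[OF l(1)] by simp
    have a: "\<omega> ! (l' div m) \<in> K\<^sub>1" "\<eta> ! (l' mod m) \<in> K\<^sub>2"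
      using is_basisD(1)[OF k w] is_basisD(1)[OF k h] lw d[OF l(2)] by auto
    have "product_basis \<omega> \<eta> ! l' = \<omega> ! (l' div m) * \<eta> ! (l' mod m)"
      using l(2) by (simp add: product_basis_def lw)
    moreover have "joint (u\<^sub>1 (l div m), u\<^sub>2 (l mod m)) (\<omega> ! (l' div m) * \<eta> ! (l' mod m))
        = joint (u\<^sub>1 (l div m), u\<^sub>2 (l mod m)) (\<omega> ! (l' div m)) * joint (u\<^sub>1 (l div m), u\<^sub>2 (l mod m)) (\<eta> ! (l' mod m))"
      by (rule GalD(2)[OF joint(1)[OF p]]) (use a K1D(3) K2D(3) in auto)
    ultimately show ?thesis using joint(2)[OF p a(1)] joint(3)[OF p a(2)] by simp
  qed
  have "mat (n * m) (n * m) (\<lambda>(l, l'). joint (u\<^sub>1 (l div m), u\<^sub>2 (l mod m)) (product_basis \<omega> \<eta> ! l'))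
     = mat (n * m) (n * m) (\<lambda>(l, l'). e\<^sub>1 (u\<^sub>1 (l div m)) (\<omega> ! (l' div m)) * e\<^sub>2 (u\<^sub>2 (l mod m)) (\<eta> ! (l' mod m)))"
    by (rule eq_matI) (simp_all add: entry)
  then show ?thesis unfolding emb_det_def
    using det_Kronecker[OF K1D(5) K2D(5), of "\<lambda>i j. e\<^sub>1 (u\<^sub>1 i) (\<omega> ! j)" "\<lambda>i j. e\<^sub>2 (u\<^sub>2 i) (\<eta> ! j)"] by simp
qed

lemma product_basis_in:
  assumes w: "is_basis k K\<^sub>1 \<omega>" and h: "is_basis k K\<^sub>2 \<eta>"
  shows "set (product_basis \<omega> \<eta>) \<subseteq> K" "length (product_basis \<omega> \<eta>) = n * m"
    "set \<omega> \<subseteq> integers_of K\<^sub>1 \<Longrightarrow> set \<eta> \<subseteq> integers_of K\<^sub>2 \<Longrightarrow> set (product_basis \<omega> \<eta>) \<subseteq> integers_of K"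
proof -
  have lw: "length \<omega> = n" "length \<eta> = m" using basis_length(1)[OF k K1 w] basis_length(1)[OF k K2 h] .
  have d: "x div m < n" "x mod m < m" if "x < n * m" for x
    using that K2D(5) by (simp_all add: less_mult_imp_div_less)
  have a: "\<omega> ! (l div m) \<in> K" "\<eta> ! (l mod m) \<in> K" if "l < n * m" for l
    using is_basisD(1)[OF k w] is_basisD(1)[OF k h] lw d[OF that] K_props(4,5) by auto
  show sub: "set (product_basis \<omega> \<eta>) \<subseteq> K"
    unfolding product_basis_def lw using a subfieldD(4)[OF K_props(1)] by auto
  show "length (product_basis \<omega> \<eta>) = n * m" by (simp add: product_basis_def lw)
  assume i: "set \<omega> \<subseteq> integers_of K\<^sub>1" "set \<eta> \<subseteq> integers_of K\<^sub>2"
  have b: "algebraic_int (\<omega> ! (l div m))" "algebraic_int (\<eta> ! (l mod m))" if "l < n * m" for l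
    using subsetD[OF i(1) nth_mem] subsetD[OF i(2) nth_mem] lw d[OF that] by (auto simp: integers_of_def)
  have "\<forall>x\<in>set (product_basis \<omega> \<eta>). algebraic_int x"
    unfolding product_basis_def lw using b algebraic_int_add_mult(2) by auto
  then show "set (product_basis \<omega> \<eta>) \<subseteq> integers_of K" using sub by (auto simp: integers_of_def)
qed

text \<open>
  The determinant of the conjugates of the products is nonzero by the Kronecker formula.
\<close>

lemma product_is_basis:
  assumes w: "is_basis k K\<^sub>1 \<omega>" and h: "is_basis k K\<^sub>2 \<eta>"
  shows "is_basis k K (product_basis \<omega> \<eta>)"
proof -
  have lw: "length \<omega> = n" "length \<eta> = m" using basis_length(1)[OF k K1 w] basis_length(1)[OF k K2 h] .
  obtain u1 u2 where u: "bij_betw u1 {..<n} \<Omega>\<^sub>1" "bij_betw u2 {..<m} \<Omega>\<^sub>2" by (rule enumerations)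
  have "emb_det (\<lambda>i. e\<^sub>1 (u1 i)) n \<omega> \<noteq> 0"
    by (rule emb_det_basis_nonzero[OF k K1D(1-3) emb_index_reindex[OF u(1) ei(1)] w lw(1)])
  moreover have "emb_det (\<lambda>j. e\<^sub>2 (u2 j)) m \<eta> \<noteq> 0"
    by (rule emb_det_basis_nonzero[OF k K2D(1-3) emb_index_reindex[OF u(2) ei(2)] h lw(2)])
  ultimately have "emb_det (\<lambda>l. joint (u1 (l div m), u2 (l mod m))) (n * m) (product_basis \<omega> \<eta>) \<noteq> 0"
    unfolding joint_emb_det[OF u w h] by simp
  then have ind: "ring.independent CC k (product_basis \<omega> \<eta>)"
    by (rule emb_det_nonzero_independent[OF k K_props(1-3) joint_enum_emb_index[OF u] product_basis_in(1,2)[OF w h]])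
  show ?thesis unfolding is_basis_def
  proof
    show "ring.Span CC k (product_basis \<omega> \<eta>) = K"
      unfolding set_eq_iff Span_iff[OF k] product_basis_in(2)[OF w h] compositum_span[OF k K1 K2 w h] by simp
  qed (rule ind)
qed

lemma compositum_degree: "extension_of_degree k (n * m) K"
proof -
  obtain \<omega> \<eta> where w: "is_basis k K\<^sub>1 \<omega>" and h: "is_basis k K\<^sub>2 \<eta>" using K1D(4) K2D(4) by blast
  show ?thesis unfolding extension_of_degree_iff[OF k]
    using K_props(1,2) product_is_basis[OF w h] product_basis_in(2)[OF w h] by blast
qed

lemma compositum_Disc_le:
  assumes D: "extension_of_degree \<rat> D k"
    and T1: "\<And>e. emb_index k K\<^sub>1 {..<n} e \<Longrightarrow> \<exists>\<omega>. is_basis k K\<^sub>1 \<omega> \<and> set \<omega> \<subseteq> integers_of K\<^sub>1 \<and>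
        covers (integers_of k) ((*) ((emb_det e n \<omega>)\<^sup>2) ` integers_of k) q\<^sub>1"
    and T2: "\<And>e. emb_index k K\<^sub>2 {..<m} e \<Longrightarrow> \<exists>\<omega>. is_basis k K\<^sub>2 \<omega> \<and> set \<omega> \<subseteq> integers_of K\<^sub>2 \<and>
        covers (integers_of k) ((*) ((emb_det e m \<omega>)\<^sup>2) ` integers_of k) q\<^sub>2"
  shows "Disc k K \<le> q\<^sub>1 ^ m * q\<^sub>2 ^ n"
proof -
  note Ok = integers_of_closed[OF k]
  obtain u1 u2 where u: "bij_betw u1 {..<n} \<Omega>\<^sub>1" "bij_betw u2 {..<m} \<Omega>\<^sub>2" by (rule enumerations)
  note i1 = emb_index_reindex[OF u(1) ei(1)] and i2 = emb_index_reindex[OF u(2) ei(2)]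
  obtain \<omega> where w: "is_basis k K\<^sub>1 \<omega>" "set \<omega> \<subseteq> integers_of K\<^sub>1"
    "covers (integers_of k) ((*) ((emb_det (\<lambda>i. e\<^sub>1 (u1 i)) n \<omega>)\<^sup>2) ` integers_of k) q\<^sub>1" using T1[OF i1] by blast
  obtain \<eta> where h: "is_basis k K\<^sub>2 \<eta>" "set \<eta> \<subseteq> integers_of K\<^sub>2"
    "covers (integers_of k) ((*) ((emb_det (\<lambda>i. e\<^sub>2 (u2 i)) m \<eta>)\<^sup>2) ` integers_of k) q\<^sub>2" using T2[OF i2] by blast
  define d1 d2 where "d1 = (emb_det (\<lambda>i. e\<^sub>1 (u1 i)) n \<omega>)\<^sup>2" and "d2 = (emb_det (\<lambda>i. e\<^sub>2 (u2 i)) m \<eta>)\<^sup>2"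
  have d1: "d1 \<in> integers_of k" unfolding d1_def
    by (rule disc_in_integers[OF k D K1 i1]) (rule nth_integral[OF k D K1 i1 w(1,2)])
  have d2: "d2 \<in> integers_of k" unfolding d2_def
    by (rule disc_in_integers[OF k D K2 i2]) (rule nth_integral[OF k D K2 i2 h(1,2)])
  have "covers (integers_of k) ((*) (d1 ^ m) ` ((*) (d2 ^ n) ` integers_of k)) (q\<^sub>1 ^ m * q\<^sub>2 ^ n)"
    by (rule covers_mult[OF Ok(4,5) Ok(8)[OF d1]])
      (use covers_power[OF Ok(4,5,1) d1 w(3)[folded d1_def]] covers_power[OF Ok(4,5,1) d2 h(3)[folded d2_def]] in simp_all)
  then have "covers (integers_of k) ((*) (d1 ^ m * d2 ^ n) ` integers_of k) (q\<^sub>1 ^ m * q\<^sub>2 ^ n)"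
    by (simp add: image_image mult.assoc)
  moreover have "(emb_det (\<lambda>l. joint (u1 (l div m), u2 (l mod m))) (n * m) (product_basis \<omega> \<eta>))\<^sup>2 = d1 ^ m * d2 ^ n"
    unfolding joint_emb_det[OF u w(1) h(1)] d1_def d2_def
    by (simp add: power_mult_distrib power_mult[symmetric] mult.commute)
  ultimately show ?thesis
    using Disc_le_covers[OF k D compositum_degree joint_enum_emb_index[OF u] product_is_basis[OF w(1) h(1)]
        product_basis_in(3)[OF w(1) h(1) w(2) h(2)]] by simp
qed

end

section \<open>Adjugate matrices\<close>

definition adj :: "nat \<Rightarrow> (nat \<Rightarrow> nat \<Rightarrow> complex) \<Rightarrow> nat \<Rightarrow> nat \<Rightarrow> complex" where
  "adj n a i j = adj_mat (mat n n (\<lambda>(i, j). a i j)) $$ (i, j)"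

lemma adj_mult:
  assumes "i < n" "j < n"
  shows "(\<Sum>l<n. adj n a i l * a l j) = (if i = j then det (mat n n (\<lambda>(i, j). a i j)) else 0)"
    "(\<Sum>l<n. a i l * adj n a l j) = (if i = j then det (mat n n (\<lambda>(i, j). a i j)) else 0)"
proof -
  let ?A = "mat n n (\<lambda>(i, j). a i j)"
  have A: "?A \<in> carrier_mat n n" by simp
  note ad = adj_mat[OF A]
  have "(adj_mat ?A * ?A) $$ (i, j) = (\<Sum>l<n. adj n a i l * a l j)"
    using assms ad(1) by (simp add: scalar_prod_def adj_def atLeast0LessThan)
  moreover have "(det ?A \<cdot>\<^sub>m 1\<^sub>m n) $$ (i, j) = (if i = j then det ?A else 0)" using assms by simp
  ultimately show "(\<Sum>l<n. adj n a i l * a l j) = (if i = j then det ?A else 0)"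
    unfolding ad(3) by metis
  have "(?A * adj_mat ?A) $$ (i, j) = (\<Sum>l<n. a i l * adj n a l j)"
    using assms ad(1) by (simp add: scalar_prod_def adj_def atLeast0LessThan)
  moreover have "(det ?A \<cdot>\<^sub>m 1\<^sub>m n) $$ (i, j) = (if i = j then det ?A else 0)" using assms by simp
  ultimately show "(\<Sum>l<n. a i l * adj n a l j) = (if i = j then det ?A else 0)"
    unfolding ad(2) by metis
qed

lemma adj_in_subring:
  assumes S: "\<And>x y. x \<in> S \<Longrightarrow> y \<in> S \<Longrightarrow> x + y \<in> S" "\<And>x y. x \<in> S \<Longrightarrow> y \<in> S \<Longrightarrow> x * y \<in> S" "1 \<in> S" "0 \<in> S"
    "\<And>x. x \<in> S \<Longrightarrow> - x \<in> S" and a: "\<And>i j. i < n \<Longrightarrow> j < n \<Longrightarrow> a i j \<in> S"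
    and ij: "i < n" "j < n"
  shows "adj n a i j \<in> S"
proof -
  let ?A = "mat n n (\<lambda>(i, j). a i j)"
  have "mat_delete ?A j i = mat (n - 1) (n - 1) (\<lambda>(i', j'). a (if i' < j then i' else Suc i') (if j' < i then j' else Suc j'))"
    unfolding mat_delete_def by (rule eq_matI) auto
  moreover have "det (mat (n - 1) (n - 1) (\<lambda>(i', j'). a (if i' < j then i' else Suc i') (if j' < i then j' else Suc j'))) \<in> S"
    by (rule det_in_subring[OF S]) (use a in auto)
  ultimately have d: "det (mat_delete ?A j i) \<in> S" by simp
  have "(-1) ^ m \<in> S" for m :: nat by (induction m) (use S in auto)
  then show ?thesis using ij S(2) d by (simp add: adj_def adj_mat_def cofactor_def)
qed

lemma sum_lessThan_add: "(\<Sum>l<s + r. f l) = (\<Sum>l<s. f l) + (\<Sum>l<r. f (s + l :: nat) :: complex)"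
  by (induction r) (simp_all add: add.assoc)

section \<open>The subfield belonging to a quotient action\<close>

text \<open>
  An equivariant surjection \<open>\<pi>\<close> from the labels of the embeddings of \<open>K\<close> onto a smaller set with a
  compatible group action; in the application a coordinate projection of a product. It corresponds to
  the subfield of \<open>K\<close> on which embeddings with equal image under \<open>\<pi>\<close> coincide.
\<close>

locale galois_quotient =
  fixes k K :: "complex set" and N n :: nat and \<Omega> :: "'i set" and G e and \<Omega>\<^sub>1 :: "'j set" and G\<^sub>1 and \<pi> :: "'i \<Rightarrow> 'j"
  assumes k: "subfield k CC" and K: "extension_of_degree k N K"
    and O: "finite \<Omega>" "card \<Omega> = N" and O1: "finite \<Omega>\<^sub>1" "card \<Omega>\<^sub>1 = n"
    and G: "perm_group_on \<Omega> G" and e: "gal_index k K \<Omega> G e"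
    and G1: "perm_group_on \<Omega>\<^sub>1 G\<^sub>1"
    and pi: "\<pi> ` \<Omega> = \<Omega>\<^sub>1"
    and equiv: "\<And>g. g \<in> G \<Longrightarrow> \<exists>g\<^sub>1\<in>G\<^sub>1. \<forall>p\<in>\<Omega>. \<pi> (g p) = g\<^sub>1 (\<pi> p)"
    and lift: "\<And>g\<^sub>1. g\<^sub>1 \<in> G\<^sub>1 \<Longrightarrow> \<exists>g\<in>G. \<forall>p\<in>\<Omega>. \<pi> (g p) = g\<^sub>1 (\<pi> p)"
begin

lemmas KD = extensionD[OF k K]

lemma ei: "emb_index k K \<Omega> e" using e by (simp add: gal_index_def)

lemmas eD = emb_indexD[OF k KD(1-3) ei]

definition sub :: "complex set" where
  "sub = {x \<in> K. \<forall>p\<in>\<Omega>. \<forall>q\<in>\<Omega>. \<pi> p = \<pi> q \<longrightarrow> e p x = e q x}"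

text \<open>
  The label of the inclusion of \<open>K\<close>.
\<close>

definition p\<^sub>0 where "p\<^sub>0 = (SOME p. p \<in> \<Omega> \<and> (\<forall>x\<in>K. e p x = x))"

lemma p0: "p\<^sub>0 \<in> \<Omega>" "x \<in> K \<Longrightarrow> e p\<^sub>0 x = x"
proof -
  have "\<exists>p. p \<in> \<Omega> \<and> (\<forall>x\<in>K. e p x = x)"
  proof (rule emb_index_id[OF ei k])
    fix i assume "i \<in> \<Omega>" "\<And>x. x \<in> K \<Longrightarrow> e i x = x"
    then show ?thesis by blast
  qed
  from someI_ex[OF this, folded p\<^sub>0_def] show "p\<^sub>0 \<in> \<Omega>" "x \<in> K \<Longrightarrow> e p\<^sub>0 x = x" by auto
qed

text \<open>
  The conjugates of the trace from \<open>K\<close> to the subfield: sums over the fibres of \<open>\<pi>\<close>. The trace itself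
  belongs to the fibre of the inclusion.
\<close>

definition tr :: "'j \<Rightarrow> complex \<Rightarrow> complex" where
  "tr i x = (\<Sum>p\<in>{p \<in> \<Omega>. \<pi> p = i}. e p x)"

lemma tr_kbar: "x \<in> K \<Longrightarrow> tr i x \<in> kbar k"
  unfolding tr_def by (rule subfield_sum[OF kbar_subfield[OF k]]) (use eD(4) in auto)

lemma Gal_tr:
  assumes g: "\<gamma> \<in> Gal k" "acts_as K \<Omega> e \<gamma> g" "g \<in> G" and g1: "g1 \<in> G\<^sub>1" "\<And>p. p \<in> \<Omega> \<Longrightarrow> \<pi> (g p) = g1 (\<pi> p)"
    and x: "x \<in> K" and i: "i \<in> \<Omega>\<^sub>1"
  shows "\<gamma> (tr i x) = tr (g1 i) x"
proof -
  obtain h where h: "h \<in> G" "g \<circ> h = id" "h \<circ> g = id" using perm_group_onD(6)[OF G g(3)] by blast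
  obtain h1 where h1: "h1 \<in> G\<^sub>1" "h1 \<circ> g1 = id" using perm_group_onD(6)[OF G1 g1(1)] by blast
  have gh: "g (h p) = p" "h (g p) = p" "h1 (g1 j) = j" for p j
    using h(2,3) h1(2) by (simp_all add: fun_eq_iff)
  have bij: "bij_betw g {p \<in> \<Omega>. \<pi> p = i} {p \<in> \<Omega>. \<pi> p = g1 i}"
  proof (rule bij_betwI[of _ _ _ h])
    show "g \<in> {p \<in> \<Omega>. \<pi> p = i} \<rightarrow> {p \<in> \<Omega>. \<pi> p = g1 i}"
      using g1(2) perm_group_onD(2)[OF G g(3)] by auto
    show "h \<in> {p \<in> \<Omega>. \<pi> p = g1 i} \<rightarrow> {p \<in> \<Omega>. \<pi> p = i}"
    proof
      fix p assume p: "p \<in> {p \<in> \<Omega>. \<pi> p = g1 i}"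
      have hp: "h p \<in> \<Omega>" using p perm_group_onD(2)[OF G h(1)] by auto
      have "g1 (\<pi> (h p)) = g1 i" using g1(2)[OF hp] p by (simp add: gh)
      then have "\<pi> (h p) = i" by (metis gh(3))
      then show "h p \<in> {p \<in> \<Omega>. \<pi> p = i}" using hp by simp
    qed
  qed (simp_all add: gh)
  have "\<gamma> (tr i x) = (\<Sum>p\<in>{p \<in> \<Omega>. \<pi> p = i}. \<gamma> (e p x))"
    unfolding tr_def by (rule Gal_sum[OF k g(1)]) (use eD(4) x in auto)
  also have "\<dots> = (\<Sum>p\<in>{p \<in> \<Omega>. \<pi> p = i}. e (g p) x)"
    by (rule sum.cong) (use g(2) x in \<open>auto simp: acts_as_def\<close>)
  also have "\<dots> = tr (g1 i) x" unfolding tr_def by (rule sum.reindex_bij_betw[OF bij])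
  finally show ?thesis .
qed

lemma Gal_acts: "\<gamma> \<in> Gal k \<Longrightarrow> \<exists>g\<in>G. acts_as K \<Omega> e \<gamma> g"
  and acts_Gal: "g \<in> G \<Longrightarrow> \<exists>\<gamma>\<in>Gal k. acts_as K \<Omega> e \<gamma> g"
  using e unfolding gal_index_iff by blast+

lemma acts_p0:
  assumes g: "\<gamma> \<in> Gal k" "acts_as K \<Omega> e \<gamma> g" "g \<in> G" and p: "p \<in> \<Omega>" "\<And>x. x \<in> K \<Longrightarrow> e p x = \<gamma> x"
  shows "g p\<^sub>0 = p"
proof (rule emb_index_distinct[OF ei perm_group_onD(2)[OF G g(3) p0(1)] p(1)])
  fix x assume "x \<in> K"
  then show "e (g p\<^sub>0) x = e p x" using g(2) p0 p(2) unfolding acts_as_def by metis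
qed

text \<open>
  An automorphism fixing \<open>K\<close> fixes the label of the inclusion and therefore permutes its fibre, so the
  trace lies in \<open>K\<close>; an automorphism inducing the embedding \<open>p\<close> carries that fibre to the fibre of \<open>p\<close>.
\<close>

lemma tr_in:
  assumes x: "x \<in> K"
  shows "tr (\<pi> p\<^sub>0) x \<in> K" "p \<in> \<Omega> \<Longrightarrow> e p (tr (\<pi> p\<^sub>0) x) = tr (\<pi> p) x" "tr (\<pi> p\<^sub>0) x \<in> sub"
proof -
  have i0: "\<pi> p\<^sub>0 \<in> \<Omega>\<^sub>1" using p0(1) pi by blast
  show K: "tr (\<pi> p\<^sub>0) x \<in> K"
  proof (rule ccontr)
    assume "tr (\<pi> p\<^sub>0) x \<notin> K"
    then obtain \<gamma> where g: "\<gamma> \<in> Gal k" "\<And>y. y \<in> K \<Longrightarrow> \<gamma> y = y" "\<gamma> (tr (\<pi> p\<^sub>0) x) \<noteq> tr (\<pi> p\<^sub>0) x"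
      using Gal_moves[OF k KD(1-3) tr_kbar[OF x]] by metis
    obtain g where gg: "g \<in> G" "acts_as K \<Omega> e \<gamma> g" using Gal_acts[OF g(1)] by blast
    obtain g1 where g1: "g1 \<in> G\<^sub>1" "\<forall>p\<in>\<Omega>. \<pi> (g p) = g1 (\<pi> p)" using equiv[OF gg(1)] by blast
    have "g p\<^sub>0 = p\<^sub>0" by (rule acts_p0[OF g(1) gg(2,1) p0(1)]) (use g(2) p0(2) in auto)
    then have "g1 (\<pi> p\<^sub>0) = \<pi> p\<^sub>0" using g1(2) p0(1) by metis
    then show False using Gal_tr[OF g(1) gg(2,1) g1(1) _ x i0] g1(2) g(3) by simp
  qed
  show ep: "e p (tr (\<pi> p\<^sub>0) x) = tr (\<pi> p) x" if p: "p \<in> \<Omega>" for p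
  proof -
    obtain \<gamma> where g: "\<gamma> \<in> Gal k" "\<forall>x\<in>K. e p x = \<gamma> x" using emb_index_Gal[OF ei p] by blast
    obtain g where gg: "g \<in> G" "acts_as K \<Omega> e \<gamma> g" using Gal_acts[OF g(1)] by blast
    obtain g1 where g1: "g1 \<in> G\<^sub>1" "\<forall>p\<in>\<Omega>. \<pi> (g p) = g1 (\<pi> p)" using equiv[OF gg(1)] by blast
    have "g p\<^sub>0 = p" by (rule acts_p0[OF g(1) gg(2,1) p]) (use g(2) in auto)
    then have "g1 (\<pi> p\<^sub>0) = \<pi> p" using g1(2) p0(1) by metis
    then show ?thesis using Gal_tr[OF g(1) gg(2,1) g1(1) _ x i0] g1(2) g(2) K by simp
  qed
  show "tr (\<pi> p\<^sub>0) x \<in> sub" unfolding sub_def using K ep by auto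
qed

lemma sub_props: "subfield sub CC" "k \<subseteq> sub" "sub \<subseteq> K" "sub \<subseteq> kbar k"
proof -
  show sK: "sub \<subseteq> K" by (auto simp: sub_def)
  then show kb: "sub \<subseteq> kbar k" using KD(3) by blast
  show ks: "k \<subseteq> sub" unfolding sub_def using KD(2) eD(3) by auto
  show "subfield sub CC"
  proof (rule algebraic_subring_is_subfield[OF k ks kb])
    fix x y assume xy: "x \<in> sub" "y \<in> sub"
    have K: "x \<in> K" "y \<in> K" using xy sK by auto
    have eq: "e p x = e q x" "e p y = e q y" if "p \<in> \<Omega>" "q \<in> \<Omega>" "\<pi> p = \<pi> q" for p q
      using xy that unfolding sub_def by blast+
    have "e p (x + y) = e q (x + y)" "e p (x * y) = e q (x * y)" if pq: "p \<in> \<Omega>" "q \<in> \<Omega>" "\<pi> p = \<pi> q" for p q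
      using eD(1,2)[OF pq(1) K] eD(1,2)[OF pq(2) K] eq[OF pq] by simp_all
    then show "x + y \<in> sub" "x * y \<in> sub"
      unfolding sub_def using subfieldD(3,4)[OF KD(1) K] by blast+
  qed
qed

text \<open>
  If two embeddings from different fibres agreed on the subfield, they would agree on all traces,
  which is a nontrivial linear relation between embeddings of \<open>K\<close>.
\<close>

lemma separates:
  assumes p: "p \<in> \<Omega>" "q \<in> \<Omega>" "\<pi> p \<noteq> \<pi> q"
  shows "\<exists>x\<in>sub. e p x \<noteq> e q x"
proof (rule ccontr)
  assume none: "\<not> ?thesis"
  \<comment> \<open>the coefficients of the difference of the traces over the two fibres\<close>
  define c :: "'i \<Rightarrow> complex" where "c r = (if \<pi> r = \<pi> p then 1 else 0) - (if \<pi> r = \<pi> q then 1 else 0)" for r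
  have "(\<Sum>r\<in>\<Omega>. c r * e r x) = 0" if x: "x \<in> K" for x
  proof -
    have s: "(\<Sum>r\<in>\<Omega>. (if \<pi> r = i then 1 else 0) * e r x) = tr i x" for i
    proof -
      have "(\<Sum>r\<in>\<Omega>. (if \<pi> r = i then 1 else 0) * e r x) = (\<Sum>r\<in>\<Omega>. if \<pi> r = i then e r x else 0)"
        by (intro sum.cong refl) simp
      also have "\<dots> = tr i x" unfolding tr_def by (rule sum.inter_filter[OF O(1), symmetric])
      finally show ?thesis .
    qed
    have "(\<Sum>r\<in>\<Omega>. c r * e r x) = tr (\<pi> p) x - tr (\<pi> q) x"
      unfolding c_def left_diff_distrib sum_subtractf s ..
    also have "\<dots> = e p (tr (\<pi> p\<^sub>0) x) - e q (tr (\<pi> p\<^sub>0) x)" using tr_in(2)[OF x] p by simp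
    also have "\<dots> = 0" using none tr_in(3)[OF x] by simp
    finally show ?thesis .
  qed
  from emb_index_Dedekind[OF k KD(1-3) ei O(1) this p(1)] have "c p = 0" .
  then show False using p(3) by (simp add: c_def)
qed

text \<open>
  The choice of a label in the fibre does not matter on the subfield.
\<close>

definition e\<^sub>1 :: "'j \<Rightarrow> complex \<Rightarrow> complex" where
  "e\<^sub>1 i = e (SOME p. p \<in> \<Omega> \<and> \<pi> p = i)"

lemma e1: assumes "p \<in> \<Omega>" "x \<in> sub" shows "e\<^sub>1 (\<pi> p) x = e p x"
proof -
  have "\<exists>q. q \<in> \<Omega> \<and> \<pi> q = \<pi> p" using assms(1) by blast
  from someI_ex[OF this] show ?thesis using assms unfolding e\<^sub>1_def sub_def by blast
qed

lemma e1_emb_index: "emb_index k sub \<Omega>\<^sub>1 e\<^sub>1"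
  unfolding emb_index_def
proof (intro conjI ballI impI)
  show "\<exists>\<gamma>\<in>Gal k. \<forall>x\<in>sub. e\<^sub>1 i x = \<gamma> x" if i: "i \<in> \<Omega>\<^sub>1" for i
  proof -
    obtain p where p: "p \<in> \<Omega>" "i = \<pi> p" using i pi by blast
    then show ?thesis using emb_index_Gal[OF ei p(1)] e1[OF p(1)] sub_props(3) by (metis subsetD)
  qed
  show "\<exists>i\<in>\<Omega>\<^sub>1. \<forall>x\<in>sub. e\<^sub>1 i x = \<gamma> x" if g: "\<gamma> \<in> Gal k" for \<gamma>
  proof -
    obtain p where p: "p \<in> \<Omega>" "\<forall>x\<in>K. e p x = \<gamma> x" using Gal_emb_index[OF ei g] by blast
    have "\<forall>x\<in>sub. e\<^sub>1 (\<pi> p) x = \<gamma> x" using e1[OF p(1)] p(2) sub_props(3) by auto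
    then show ?thesis using p(1) pi by blast
  qed
  show "i = j" if ij: "i \<in> \<Omega>\<^sub>1" "j \<in> \<Omega>\<^sub>1" "\<forall>x\<in>sub. e\<^sub>1 i x = e\<^sub>1 j x" for i j
  proof (rule ccontr)
    assume ne: "i \<noteq> j"
    obtain p q where p: "p \<in> \<Omega>" "i = \<pi> p" "q \<in> \<Omega>" "j = \<pi> q" using ij(1,2) pi by blast
    then obtain x where "x \<in> sub" "e p x \<noteq> e q x" using separates[OF p(1,3)] ne by blast
    then show False using ij(3) e1[OF p(1)] e1[OF p(3)] p(2,4) by metis
  qed
qed

lemma e1_acts:
  assumes g: "acts_as K \<Omega> e \<gamma> g" "g \<in> G" and g1: "\<And>p. p \<in> \<Omega> \<Longrightarrow> \<pi> (g p) = g1 (\<pi> p)"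
  shows "acts_as sub \<Omega>\<^sub>1 e\<^sub>1 \<gamma> g1"
  unfolding acts_as_def
proof (intro ballI)
  fix i x assume i: "i \<in> \<Omega>\<^sub>1" and x: "x \<in> sub"
  obtain p where p: "p \<in> \<Omega>" "i = \<pi> p" using i pi by blast
  have gp: "g p \<in> \<Omega>" by (rule perm_group_onD(2)[OF G g(2) p(1)])
  have "\<gamma> (e\<^sub>1 i x) = \<gamma> (e p x)" using e1[OF p(1) x] p(2) by simp
  also have "\<dots> = e (g p) x" using g(1) p(1) x sub_props(3) by (auto simp: acts_as_def)
  also have "\<dots> = e\<^sub>1 (\<pi> (g p)) x" using e1[OF gp x] by simp
  also have "\<dots> = e\<^sub>1 (g1 i) x" using g1[OF p(1)] p(2) by simp
  finally show "\<gamma> (e\<^sub>1 i x) = e\<^sub>1 (g1 i) x" .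
qed

lemma e1_gal_index: "gal_index k sub \<Omega>\<^sub>1 G\<^sub>1 e\<^sub>1"
  unfolding gal_index_iff
proof (intro conjI e1_emb_index ballI)
  fix \<gamma> assume g: "\<gamma> \<in> Gal k"
  obtain g where gg: "g \<in> G" "acts_as K \<Omega> e \<gamma> g" using Gal_acts[OF g] by blast
  obtain g1 where g1: "g1 \<in> G\<^sub>1" "\<forall>p\<in>\<Omega>. \<pi> (g p) = g1 (\<pi> p)" using equiv[OF gg(1)] by blast
  show "\<exists>g\<in>G\<^sub>1. acts_as sub \<Omega>\<^sub>1 e\<^sub>1 \<gamma> g" using e1_acts[OF gg(2,1)] g1 by blast
next
  fix g1 assume g1: "g1 \<in> G\<^sub>1"
  obtain g where gg: "g \<in> G" "\<forall>p\<in>\<Omega>. \<pi> (g p) = g1 (\<pi> p)" using lift[OF g1] by blast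
  obtain \<gamma> where g: "\<gamma> \<in> Gal k" "acts_as K \<Omega> e \<gamma> g" using acts_Gal[OF gg(1)] by blast
  show "\<exists>\<gamma>\<in>Gal k. acts_as sub \<Omega>\<^sub>1 e\<^sub>1 \<gamma> g1" using e1_acts[OF g(2) gg(1)] gg(2) g(1) by blast
qed

lemma enumerations:
  obtains u v where "bij_betw u {..<N} \<Omega>" "bij_betw v {..<n} \<Omega>\<^sub>1"
  using ex_bij_betw_nat_finite[OF O(1)] ex_bij_betw_nat_finite[OF O1(1)] O(2) O1(2)
  by (auto simp: atLeast0LessThan)

text \<open>
  Elements of the subfield have at most \<open>n\<close> different conjugates, so more than \<open>n\<close> of them have linearly
  dependent columns of conjugates. Completed to a basis of \<open>K\<close> they would contradict the nonvanishing
  of the discriminant.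
\<close>

lemma independent_in_sub:
  assumes xs: "ring.independent CC k xs" "set xs \<subseteq> sub"
  shows "length xs \<le> n"
proof (rule ccontr)
  interpret field CC by (rule CC_field)
  assume "\<not> length xs \<le> n"
  then have less: "n < length xs" by simp
  obtain u v where u: "bij_betw u {..<N} \<Omega>" and v: "bij_betw v {..<n} \<Omega>\<^sub>1" by (rule enumerations)
  have "dimension N k K" using K by (simp add: extension_of_degree_def)
  from complete_base[OF k this xs(1)] xs(2) sub_props(3)
  obtain Vs where Vs: "length (Vs @ xs) = N" "independent k (Vs @ xs)" "Span k (Vs @ xs) = K" by blast
  have nz: "emb_det (\<lambda>i. e (u i)) N (Vs @ xs) \<noteq> 0"
    by (rule emb_det_basis_nonzero[OF k KD(1-3) emb_index_reindex[OF u ei]])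
      (use Vs in \<open>simp_all add: is_basis_def\<close>)
  obtain c where c: "\<exists>l<length xs. c l \<noteq> 0" "\<And>j. j < n \<Longrightarrow> (\<Sum>l<length xs. c l * e\<^sub>1 (v j) (xs ! l)) = 0"
    using underdetermined_system[OF less, of "\<lambda>l j. e\<^sub>1 (v j) (xs ! l)"] by metis
  let ?s = "length Vs"
  have N: "N = ?s + length xs" using Vs(1) by simp
  have ker: "(\<Sum>l<N. e (u i) ((Vs @ xs) ! l) * (if l < ?s then 0 else c (l - ?s))) = 0" if i: "i < N" for i
  proof -
    have ui: "u i \<in> \<Omega>" using bij_betwE[OF u] i by auto
    then have "\<pi> (u i) \<in> \<Omega>\<^sub>1" using pi by blast
    then obtain j where j: "j < n" "\<pi> (u i) = v j" using v by (auto simp: bij_betw_def)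
    have "(\<Sum>l<N. e (u i) ((Vs @ xs) ! l) * (if l < ?s then 0 else c (l - ?s)))
       = (\<Sum>l<?s. e (u i) ((Vs @ xs) ! l) * 0) + (\<Sum>l<length xs. e (u i) ((Vs @ xs) ! (?s + l)) * c l)"
      unfolding N sum_lessThan_add by simp
    also have "\<dots> = (\<Sum>l<length xs. c l * e\<^sub>1 (v j) (xs ! l))"
    proof -
      have "e (u i) (xs ! l) = e\<^sub>1 (v j) (xs ! l)" if "l < length xs" for l
        using e1[OF ui, of "xs ! l"] xs(2) that j(2) nth_mem by fastforce
      then show ?thesis by (simp add: mult.commute nth_append)
    qed
    finally show ?thesis using c(2)[OF j(1)] by simp
  qed
  obtain l where l: "l < length xs" "c l \<noteq> 0" using c(1) by blast
  have "emb_det (\<lambda>i. e (u i)) N (Vs @ xs) = 0" unfolding emb_det_def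
    by (rule right_kernel_det_zero[where j = "?s + l" and c = "\<lambda>l. if l < ?s then 0 else c (l - ?s)"])
      (use ker l N in auto)
  then show False using nz by simp
qed

text \<open>
  The degree is at least the number \<open>n\<close> of embeddings and at most \<open>n\<close> by \<open>independent_in_sub\<close>.
\<close>

lemma sub_degree: "extension_of_degree k n sub"
proof -
  interpret field CC by (rule CC_field)
  define P where "P xs \<longleftrightarrow> independent k xs \<and> set xs \<subseteq> sub" for xs
  have "P []" by (simp add: P_def)
  moreover have "\<forall>xs. P xs \<longrightarrow> length xs < Suc n" using independent_in_sub by (auto simp: P_def less_Suc_eq_le)
  ultimately have "\<exists>xs. P xs \<and> (\<forall>ys. P ys \<longrightarrow> length ys \<le> length xs)" by (rule ex_has_greatest_nat)
  then obtain xs where xs: "P xs" and max: "\<And>ys. P ys \<Longrightarrow> length ys \<le> length xs" by auto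
  have "Span k xs = sub"
  proof
    show "Span k xs \<subseteq> sub"
    proof
      fix x assume "x \<in> Span k xs"
      then obtain c where c: "\<forall>i<length xs. c i \<in> k" "x = (\<Sum>i<length xs. c i * xs ! i)"
        using Span_iff[OF k] by blast
      show "x \<in> sub" unfolding c(2)
        by (rule subfield_sum[OF sub_props(1)], rule subfieldD(4)[OF sub_props(1)])
          (use c(1) sub_props(2) xs nth_mem in \<open>auto simp: P_def\<close>)
    qed
    show "sub \<subseteq> Span k xs"
    proof (rule ccontr)
      assume "\<not> sub \<subseteq> Span k xs"
      then obtain x where x: "x \<in> sub" "x \<notin> Span k xs" by blast
      then have "independent k (x # xs)" using xs by (intro li_Cons) (auto simp: P_def)
      then have "P (x # xs)" using xs x(1) by (simp add: P_def)
      then show False using max by fastforce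
    qed
  qed
  then have b: "is_basis k sub xs" using xs by (simp add: is_basis_def P_def)
  then have d: "extension_of_degree k (length xs) sub"
    unfolding extension_of_degree_iff[OF k] using sub_props(1,2) by blast
  have "n \<le> length xs" using emb_index_card(3)[OF k d e1_emb_index] O1(2) by simp
  moreover have "length xs \<le> n" using independent_in_sub xs by (simp add: P_def)
  ultimately show ?thesis using d by simp
qed

text \<open>
  Let \<open>\<eta>\<close> be a nearly minimal basis of the subfield. Traces to the subfield of integers of \<open>K\<close> are
  integers, so \<open>T\<close> times an element of the dual basis has integral trace products with a basis of \<open>K\<close>.
  By Cramer's rule the discriminant \<open>\<Delta>\<close> of that basis makes it integral. Hence \<open>T\<^sup>2 \<Delta>\<close> times the dual
  basis is expressed by \<open>\<eta>\<close> with coefficients in the integers of \<open>k\<close>, and taking determinants shows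
  that the discriminant of \<open>\<eta>\<close> divides the \<open>n\<close>-th power of \<open>T\<^sup>2 \<Delta>\<close>.
\<close>

lemma sub_Disc_le:
  assumes D: "extension_of_degree \<rat> D k"
    and \<omega>: "\<And>e. emb_index k K {..<N} e \<Longrightarrow> \<exists>\<omega>. is_basis k K \<omega> \<and> set \<omega> \<subseteq> integers_of K \<and>
        covers (integers_of k) ((*) ((emb_det e N \<omega>)\<^sup>2) ` integers_of k) q"
    and \<eta>: "is_basis k sub \<eta>" "set \<eta> \<subseteq> integers_of sub"
      "\<And>x. x \<in> integers_of sub \<Longrightarrow> \<exists>c. (\<forall>i<n. c i \<in> integers_of k) \<and> of_nat T * x = (\<Sum>i<n. c i * \<eta> ! i)"
    and T: "covers (integers_of k) ((*) (of_nat (T\<^sup>2)) ` integers_of k) A"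
  shows "Disc k sub \<le> (q * A) ^ n"
proof -
  note Ok = integers_of_closed[OF k] and Os = integers_of_closed[OF sub_props(1)]
  note sD = sub_props(1,2,4)
  obtain u v where u: "bij_betw u {..<N} \<Omega>" and v: "bij_betw v {..<n} \<Omega>\<^sub>1" by (rule enumerations)
  have uO: "u j \<in> \<Omega>" if "j < N" for j using bij_betwE[OF u] that by auto
  have vO: "v i \<in> \<Omega>\<^sub>1" if "i < n" for i using bij_betwE[OF v] that by auto
  define E where "E i = e\<^sub>1 (v i)" for i
  have Ei: "emb_index k sub {..<n} E" unfolding E_def by (rule emb_index_reindex[OF v e1_emb_index])
  have ui: "emb_index k K {..<N} (\<lambda>j. e (u j))" by (rule emb_index_reindex[OF u ei])
  obtain \<omega> where w: "is_basis k K \<omega>" "set \<omega> \<subseteq> integers_of K"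
    "covers (integers_of k) ((*) ((emb_det (\<lambda>j. e (u j)) N \<omega>)\<^sup>2) ` integers_of k) q" using \<omega>[OF ui] by blast
  define W where "W j l = e (u j) (\<omega> ! l)" for j l
  define \<Delta> where "\<Delta> = (emb_det (\<lambda>j. e (u j)) N \<omega>)\<^sup>2"
  have dW: "emb_det (\<lambda>j. e (u j)) N \<omega> = det (mat N N (\<lambda>(j, l). W j l))" by (simp add: emb_det_def W_def)
  have \<Delta>: "\<Delta> \<in> integers_of k" unfolding \<Delta>_def
    by (rule disc_in_integers[OF k D K ui]) (rule nth_integral[OF k D K ui w(1,2)])
  have wO: "\<omega> ! l \<in> integers_of K" if "l < N" for l by (rule nth_integral[OF k D K ui w(1,2) that])
  have wK: "\<omega> ! l \<in> K" if "l < N" for l using wO[OF that] by (simp add: integers_of_def)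
  have hO: "\<eta> ! i \<in> integers_of sub" if "i < n" for i
    by (rule nth_integral[OF k D sub_degree Ei \<eta>(1,2) that])
  have hs: "\<eta> ! i \<in> sub" if "i < n" for i using hO[OF that] by (simp add: integers_of_def)
  define a where "a i b = E i (\<eta> ! b)" for i b
  define \<delta> where "\<delta> = det (mat n n (\<lambda>(i, b). a i b))"
  have d\<eta>: "emb_det E n \<eta> = \<delta>" by (simp add: emb_det_def a_def \<delta>_def)
  have ln: "length \<eta> = n" by (rule basis_length(1)[OF k sub_degree \<eta>(1)])
  have \<delta>0: "\<delta> \<noteq> 0" unfolding d\<eta>[symmetric] by (rule emb_det_basis_nonzero[OF k sD Ei \<eta>(1) ln])
  have akb: "a i b \<in> kbar k" if "i < n" "b < n" for i b
    unfolding a_def using emb_indexD(4)[OF k sD Ei _ hs[OF that(2)], of i] that(1) by simp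
  \<comment> \<open>the inverse matrix: row \<open>c\<close> consists of the conjugates of an element of the dual basis\<close>
  define h where "h c i = adj n a c i / \<delta>" for c i
  have ha: "(\<Sum>i<n. h c i * a i b) = (if c = b then 1 else 0)" if "c < n" "b < n" for c b
    using adj_mult(1)[OF that, of a] \<delta>0 unfolding h_def \<delta>_def[symmetric]
    by (simp flip: sum_divide_distrib)
  have hkb: "h c i \<in> kbar k" if "c < n" "i < n" for c i
  proof -
    have "adj n a c i \<in> kbar k" by (rule adj_in_subring) (use kbar_closed[OF k] akb that in auto)
    moreover have "\<delta> \<in> kbar k" unfolding \<delta>_def by (rule det_in_subring) (use kbar_closed[OF k] akb in auto)
    ultimately show ?thesis unfolding h_def by (rule subfieldD(8)[OF kbar_subfield[OF k]])
  qed
  have Gal_h: "\<gamma> (h c i) = h c (\<sigma> i)"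
    if g: "\<gamma> \<in> Gal k" and s: "bij_betw \<sigma> {..<n} {..<n}" "\<And>i x. i \<in> {..<n} \<Longrightarrow> x \<in> sub \<Longrightarrow> \<gamma> (E i x) = E (\<sigma> i) x"
      and c: "c < n" and i: "i < n" for \<gamma> \<sigma> c i
  proof (rule ccontr)
    assume ne: "\<gamma> (h c i) \<noteq> h c (\<sigma> i)"
    have "(\<Sum>i<n. a (\<sigma> i) b * (\<gamma> (h c i) - h c (\<sigma> i))) = 0" if b: "b < n" for b
    proof -
      have "\<gamma> (\<Sum>i<n. h c i * a i b) = (\<Sum>i<n. \<gamma> (h c i * a i b))"
        by (rule Gal_sum[OF k g]) (use hkb akb c b kbar_closed(4)[OF k] in auto)
      also have "\<dots> = (\<Sum>i<n. \<gamma> (h c i) * a (\<sigma> i) b)"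
        by (rule sum.cong[OF refl]) (use GalD(2)[OF g hkb[OF c] akb[OF _ b]] s(2)[OF _ hs[OF b]] in \<open>simp add: a_def\<close>)
      finally have "\<gamma> (if c = b then 1 else 0) = (\<Sum>i<n. \<gamma> (h c i) * a (\<sigma> i) b)"
        unfolding ha[OF c b] .
      moreover have "\<gamma> (if c = b then 1 else 0) = (if c = b then 1 else 0)" using Gal_01[OF k g] by simp
      ultimately have 1: "(\<Sum>i<n. \<gamma> (h c i) * a (\<sigma> i) b) = (if c = b then 1 else 0)" by metis
      have 2: "(\<Sum>i<n. h c (\<sigma> i) * a (\<sigma> i) b) = (if c = b then 1 else 0)"
        using sum.reindex_bij_betw[OF s(1), of "\<lambda>i. h c i * a i b"] ha[OF c b] by simp
      have "(\<Sum>i<n. a (\<sigma> i) b * (\<gamma> (h c i) - h c (\<sigma> i)))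
          = (\<Sum>i<n. \<gamma> (h c i) * a (\<sigma> i) b) - (\<Sum>i<n. h c (\<sigma> i) * a (\<sigma> i) b)"
        by (simp add: algebra_simps sum_subtractf)
      then show ?thesis using 1 2 by simp
    qed
    then have "det (mat n n (\<lambda>(b, i). a (\<sigma> i) b)) = 0"
      by (rule right_kernel_det_zero[where j = i]) (use i ne in auto)
    then have z: "det (mat n n (\<lambda>(i, b). a (\<sigma> i) b)) = 0" by (subst det_transpose_fun[symmetric])
    have "\<delta> = 0"
    proof -
      obtain c where c: "\<exists>b<n. c b \<noteq> 0" "\<And>i. i < n \<Longrightarrow> (\<Sum>b<n. a (\<sigma> i) b * c b) = 0"
        using det_zero_right_kernel[OF z] by metis
      have "(\<Sum>b<n. a i b * c b) = 0" if "i < n" for i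
      proof -
        obtain j where "j < n" "i = \<sigma> j" using s(1) \<open>i < n\<close> by (auto simp: bij_betw_def)
        then show ?thesis using c(2) by simp
      qed
      then show ?thesis unfolding \<delta>_def using c(1) right_kernel_det_zero by blast
    qed
    then show False using \<delta>0 by simp
  qed
  obtain i0 where i0: "i0 < n" "v i0 = \<pi> p\<^sub>0"
  proof -
    have "\<pi> p\<^sub>0 \<in> \<Omega>\<^sub>1" using pi p0(1) by blast
    then have "\<exists>i<n. v i = \<pi> p\<^sub>0" using v by (auto simp: bij_betw_def)
    then show thesis using that by blast
  qed
  have E0: "E i0 x = x" if "x \<in> sub" for x
    unfolding E_def i0(2) using e1[OF p0(1) that] p0(2) that sub_props(3) by auto
  have y_sub: "h c i0 \<in> sub" and y_conj: "E i (h c i0) = h c i" if c: "c < n" and i: "i < n" for c i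
  proof -
    show sub: "h c i0 \<in> sub"
    proof (rule ccontr)
      assume "h c i0 \<notin> sub"
      then obtain \<gamma> where g: "\<gamma> \<in> Gal k" "\<And>y. y \<in> sub \<Longrightarrow> \<gamma> y = y" "\<gamma> (h c i0) \<noteq> h c i0"
        using Gal_moves[OF k sD hkb[OF c i0(1)]] by metis
      obtain \<sigma> where s: "bij_betw \<sigma> {..<n} {..<n}" "\<And>i x. i \<in> {..<n} \<Longrightarrow> x \<in> sub \<Longrightarrow> \<gamma> (E i x) = E (\<sigma> i) x"
        using emb_index_permute[OF k sD Ei _ g(1)] by blast
      have si: "\<sigma> i0 \<in> {..<n}" using bij_betwE[OF s(1)] i0(1) by auto
      have "\<sigma> i0 = i0"
      proof (rule emb_index_distinct[OF Ei si])
        show "i0 \<in> {..<n}" using i0(1) by simp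
        show "E (\<sigma> i0) x = E i0 x" if "x \<in> sub" for x
          using s(2)[OF _ that, of i0] i0(1) E0[OF that] g(2)[OF that] by simp
      qed
      then show False using Gal_h[OF g(1) s c i0(1)] g(3) by simp
    qed
    show "E i (h c i0) = h c i"
    proof -
      have "i \<in> {..<n}" using i by simp
      then obtain \<gamma> where g: "\<gamma> \<in> Gal k" "\<forall>x\<in>sub. E i x = \<gamma> x" using emb_index_Gal[OF Ei] by blast
      obtain \<sigma> where s: "bij_betw \<sigma> {..<n} {..<n}" "\<And>i x. i \<in> {..<n} \<Longrightarrow> x \<in> sub \<Longrightarrow> \<gamma> (E i x) = E (\<sigma> i) x"
        using emb_index_permute[OF k sD Ei _ g(1)] by blast
      have si: "\<sigma> i0 \<in> {..<n}" using bij_betwE[OF s(1)] i0(1) by auto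
      have "\<sigma> i0 = i"
      proof (rule emb_index_distinct[OF Ei si])
        show "i \<in> {..<n}" using i by simp
        show "E (\<sigma> i0) x = E i x" if "x \<in> sub" for x
          using s(2)[OF _ that, of i0] i0(1) E0[OF that] g(2) that by simp
      qed
      then show ?thesis using Gal_h[OF g(1) s c i0(1)] g(2) sub by simp
    qed
  qed
  \<comment> \<open>the traces to the subfield of the basis of \<open>K\<close>\<close>
  define z where "z l = tr (\<pi> p\<^sub>0) (\<omega> ! l)" for l
  have z: "z l \<in> integers_of sub" if "l < N" for l
  proof -
    have "algebraic_int (z l)" unfolding z_def tr_def
      by (rule algebraic_int_sum) (use emb_algebraic_int[OF k KD(3) ei] wO[OF that] in \<open>auto simp: integers_of_def\<close>)
    then show ?thesis using tr_in(3)[OF wK[OF that]] by (simp add: integers_of_def z_def)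
  qed
  have trace: "(\<Sum>j<N. W j l * e (u j) (of_nat T * h c i0)) \<in> integers_of k" if l: "l < N" and c: "c < n" for l c
  proof -
    obtain b where b: "\<And>i. i < n \<Longrightarrow> b i \<in> integers_of k" "of_nat T * z l = (\<Sum>i<n. b i * \<eta> ! i)"
      using \<eta>(3)[OF z[OF l]] by blast
    have Tk: "of_nat T \<in> k" by (rule subfield_of_nat[OF k])
    have ys: "h c i0 \<in> sub" by (rule y_sub[OF c i0(1)])
    have yK: "h c i0 \<in> K" using ys sub_props(3) by blast
    have eT: "e p (of_nat T * h c i0) = of_nat T * e p (h c i0)" if "p \<in> \<Omega>" for p
      using eD(2)[OF that _ yK, of "of_nat T"] eD(3)[OF that Tk] Tk KD(2) by auto
    have zs: "z l \<in> sub" using z[OF l] by (simp add: integers_of_def)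
    have "(\<Sum>j<N. W j l * e (u j) (of_nat T * h c i0)) = (\<Sum>p\<in>\<Omega>. e p (\<omega> ! l) * e p (of_nat T * h c i0))"
      unfolding W_def by (rule sum.reindex_bij_betw[OF u])
    also have "\<dots> = (\<Sum>p\<in>\<Omega>. of_nat T * (e p (\<omega> ! l) * e\<^sub>1 (\<pi> p) (h c i0)))"
      by (rule sum.cong[OF refl]) (simp add: eT e1[OF _ ys])
    also have "\<dots> = (\<Sum>i\<in>\<Omega>\<^sub>1. \<Sum>p\<in>{p \<in> \<Omega>. \<pi> p = i}. of_nat T * (e p (\<omega> ! l) * e\<^sub>1 (\<pi> p) (h c i0)))"
      by (rule sum.group[symmetric]) (use O(1) O1(1) pi in auto)
    also have "\<dots> = (\<Sum>i\<in>\<Omega>\<^sub>1. of_nat T * (e\<^sub>1 i (z l) * e\<^sub>1 i (h c i0)))"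
    proof (rule sum.cong[OF refl])
      fix i assume "i \<in> \<Omega>\<^sub>1"
      then obtain p where p: "p \<in> \<Omega>" "i = \<pi> p" using pi by blast
      have "e\<^sub>1 i (z l) = tr i (\<omega> ! l)"
        using e1[OF p(1) zs] tr_in(2)[OF wK[OF l] p(1)] p(2) by (simp add: z_def)
      moreover have "(\<Sum>p\<in>{p \<in> \<Omega>. \<pi> p = i}. of_nat T * (e p (\<omega> ! l) * e\<^sub>1 (\<pi> p) (h c i0)))
          = (\<Sum>p\<in>{p \<in> \<Omega>. \<pi> p = i}. e p (\<omega> ! l) * (of_nat T * e\<^sub>1 i (h c i0)))"
        by (rule sum.cong[OF refl]) (simp add: mult_ac)
      moreover have "\<dots> = tr i (\<omega> ! l) * (of_nat T * e\<^sub>1 i (h c i0))"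
        unfolding tr_def by (rule sum_distrib_right[symmetric])
      ultimately show "(\<Sum>p\<in>{p \<in> \<Omega>. \<pi> p = i}. of_nat T * (e p (\<omega> ! l) * e\<^sub>1 (\<pi> p) (h c i0)))
          = of_nat T * (e\<^sub>1 i (z l) * e\<^sub>1 i (h c i0))"
        by (simp add: mult_ac)
    qed
    also have "\<dots> = (\<Sum>i<n. of_nat T * (E i (z l) * E i (h c i0)))"
      unfolding E_def by (rule sum.reindex_bij_betw[OF v, symmetric])
    also have "\<dots> = (\<Sum>i<n. h c i * E i (of_nat T * z l))"
    proof (rule sum.cong[OF refl])
      fix i assume i: "i \<in> {..<n}"
      have "E i (of_nat T * z l) = of_nat T * E i (z l)"
        using emb_indexD(2)[OF k sD Ei i _ zs, of "of_nat T"] emb_indexD(3)[OF k sD Ei i Tk] Tk sub_props(2) by auto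
      then show "of_nat T * (E i (z l) * E i (h c i0)) = h c i * E i (of_nat T * z l)"
        using y_conj[OF c, of i] i by simp
    qed
    also have "\<dots> = (\<Sum>i<n. \<Sum>j<n. b j * (h c i * a i j))"
    proof (rule sum.cong[OF refl])
      fix i assume i: "i \<in> {..<n}"
      have "E i (\<Sum>j<n. b j * \<eta> ! j) = (\<Sum>j<n. b j * E i (\<eta> ! j))"
        by (rule emb_lincomb[OF k sD Ei]) (use i b(1) hs in \<open>auto simp: integers_of_def\<close>)
      then show "h c i * E i (of_nat T * z l) = (\<Sum>j<n. b j * (h c i * a i j))"
        unfolding b(2) by (simp add: sum_distrib_left a_def mult_ac)
    qed
    also have "\<dots> = (\<Sum>j<n. b j * (\<Sum>i<n. h c i * a i j))"
      by (subst sum.swap) (simp add: sum_distrib_left)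
    also have "\<dots> = (\<Sum>j<n. if j = c then b j else 0)"
      by (rule sum.cong[OF refl]) (use ha[OF c] in auto)
    also have "\<dots> = b c" using c by simp
    finally show ?thesis using b(1)[OF c] by simp
  qed
  \<comment> \<open>by Cramer's rule the discriminant of the big field clears the denominators of the dual basis\<close>
  have cleared: "\<Delta> * (of_nat T * h c i0) \<in> integers_of sub" if c: "c < n" for c
  proof -
    define t where "t l = (\<Sum>j<N. W j l * e (u j) (of_nat T * h c i0))" for l
    obtain j0 where j0: "j0 < N" "u j0 = p\<^sub>0" using u p0(1) by (auto simp: bij_betw_def)
    have Ws: "algebraic_int (W j l)" if "j < N" "l < N" for j l
      unfolding W_def using emb_algebraic_int[OF k KD(3) ei uO[OF that(1)]] wO[OF that(2)] by (simp add: integers_of_def)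
    have xs: "of_nat T * h c i0 \<in> sub"
      using subfieldD(4)[OF sub_props(1) subfield_of_nat[OF sub_props(1)] y_sub[OF c i0(1)]] .
    have "(\<Sum>l<N. t l * adj N W l j0) = (\<Sum>l<N. \<Sum>j<N. e (u j) (of_nat T * h c i0) * (W j l * adj N W l j0))"
      unfolding t_def sum_distrib_right by (intro sum.cong refl) (simp add: mult_ac)
    also have "\<dots> = (\<Sum>j<N. e (u j) (of_nat T * h c i0) * (\<Sum>l<N. W j l * adj N W l j0))"
      by (subst sum.swap) (simp add: sum_distrib_left)
    also have "\<dots> = (\<Sum>j<N. if j = j0 then e (u j) (of_nat T * h c i0) * det (mat N N (\<lambda>(j, l). W j l)) else 0)"
      by (rule sum.cong[OF refl]) (simp add: adj_mult(2)[OF _ j0(1)])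
    also have "\<dots> = (of_nat T * h c i0) * det (mat N N (\<lambda>(j, l). W j l))"
      using j0 p0(2)[of "of_nat T * h c i0"] xs sub_props(3) by auto
    finally have cr: "(\<Sum>l<N. t l * adj N W l j0) = (of_nat T * h c i0) * det (mat N N (\<lambda>(j, l). W j l))" .
    have "algebraic_int (\<Sum>l<N. t l * adj N W l j0)"
    proof (rule algebraic_int_sum, rule algebraic_int_add_mult(2))
      fix l assume l: "l \<in> {..<N}"
      show "algebraic_int (t l)" using trace[of l c] l c by (simp add: t_def integers_of_def)
      show "algebraic_int (adj N W l j0)"
        using adj_in_subring[of "{x. algebraic_int x}" N W l j0] Ws l j0(1)
        by (simp add: algebraic_int_add_mult algebraic_int_one)
    qed
    then have "algebraic_int ((of_nat T * h c i0) * det (mat N N (\<lambda>(j, l). W j l)) * det (mat N N (\<lambda>(j, l). W j l)))"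
      unfolding cr by (rule algebraic_int_add_mult(2)) (rule algebraic_int_det, rule Ws)
    moreover have "(of_nat T * h c i0) * det (mat N N (\<lambda>(j, l). W j l)) * det (mat N N (\<lambda>(j, l). W j l)) = \<Delta> * (of_nat T * h c i0)"
      unfolding \<Delta>_def dW by (simp add: power2_eq_square mult_ac)
    moreover have "\<Delta> * (of_nat T * h c i0) \<in> sub"
      using subfieldD(4)[OF sub_props(1) _ xs] \<Delta> sub_props(2) by (auto simp: integers_of_def)
    ultimately show ?thesis by (simp add: integers_of_def)
  qed
  have "\<exists>g. (\<forall>b<n. g b \<in> integers_of k) \<and> of_nat T * (\<Delta> * (of_nat T * h c i0)) = (\<Sum>b<n. g b * \<eta> ! b)" if "c < n" for c
    by (rule \<eta>(3)[OF cleared[OF that]])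
  then obtain g where g: "\<And>c b. c < n \<Longrightarrow> b < n \<Longrightarrow> g c b \<in> integers_of k"
    "\<And>c. c < n \<Longrightarrow> of_nat T * (\<Delta> * (of_nat T * h c i0)) = (\<Sum>b<n. g c b * \<eta> ! b)" by metis
  define s where "s = \<Delta> * of_nat (T\<^sup>2)"
  have sO: "s \<in> integers_of k" unfolding s_def by (rule Ok(5)[OF \<Delta> Ok(9)])
  have sk: "s \<in> k" using sO by (simp add: integers_of_def)
  have rel: "s * h c i = (\<Sum>b<n. g c b * a i b)" if c: "c < n" and i: "i < n" for c i
  proof -
    have "s * h c i0 = (\<Sum>b<n. g c b * \<eta> ! b)" using g(2)[OF c] by (simp add: s_def power2_eq_square mult_ac)
    then have "E i (s * h c i0) = (\<Sum>b<n. g c b * E i (\<eta> ! b))"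
      using emb_lincomb[OF k sD Ei i, of n "g c" "\<lambda>b. \<eta> ! b"] g(1)[OF c] hs by (simp add: integers_of_def)
    moreover have "E i (s * h c i0) = s * h c i"
      using emb_indexD(2)[OF k sD Ei _ _ y_sub[OF c i0(1)], of i s] emb_indexD(3)[OF k sD Ei _ sk, of i]
        y_conj[OF c i] i sk sub_props(2) by auto
    ultimately show ?thesis by (simp add: a_def)
  qed
  define \<theta> where "\<theta> = det (mat n n (\<lambda>(c, b). g c b))"
  have \<theta>: "\<theta> \<in> integers_of k" unfolding \<theta>_def by (rule Ok(11)) (rule g(1))
  have main: "s ^ n = \<theta> * \<delta>\<^sup>2"
  proof -
    have 1: "(\<Sum>i<n. (s * h c i) * a i b) = (if c = b then s else 0)" if "c < n" "b < n" for c b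
      using ha[OF that] by (simp add: mult.assoc flip: sum_distrib_left)
    have "s ^ n = det (mat n n (\<lambda>(c, b). if c = b then s else 0))"
    proof -
      have "mat n n (\<lambda>(c, b). if c = b then s else 0) = s \<cdot>\<^sub>m 1\<^sub>m n" by (rule eq_matI) auto
      then show ?thesis by simp
    qed
    also have "\<dots> = det (mat n n (\<lambda>(c, b). \<Sum>i<n. (s * h c i) * a i b))"
      by (rule arg_cong[where f = det], rule eq_matI) (simp_all add: 1)
    also have "\<dots> = det (mat n n (\<lambda>(c, i). s * h c i)) * \<delta>"
      unfolding \<delta>_def by (rule det_mult_fun)
    also have "mat n n (\<lambda>(c, i). s * h c i) = mat n n (\<lambda>(c, i). \<Sum>b<n. g c b * a i b)"
      by (rule eq_matI) (simp_all add: rel)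
    also have "det (mat n n (\<lambda>(c, i). \<Sum>b<n. g c b * a i b)) = \<theta> * det (mat n n (\<lambda>(b, i). a i b))"
      unfolding \<theta>_def by (rule det_mult_fun)
    also have "det (mat n n (\<lambda>(b, i). a i b)) = \<delta>" unfolding \<delta>_def by (rule det_transpose_fun)
    finally show ?thesis by (simp add: power2_eq_square)
  qed
  have "covers (integers_of k) ((*) \<Delta> ` ((*) (of_nat (T\<^sup>2)) ` integers_of k)) (q * A)"
    by (rule covers_mult[OF Ok(4,5) \<Delta> w(3)[folded \<Delta>_def] T])
  then have cs: "covers (integers_of k) ((*) s ` integers_of k) (q * A)"
    by (simp add: image_image s_def mult.assoc)
  have "covers (integers_of k) ((*) (s ^ n) ` integers_of k) ((q * A) ^ n)"
    by (rule covers_power[OF Ok(4,5,1) sO cs])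
  moreover have "(*) (s ^ n) ` integers_of k \<subseteq> (*) (\<delta>\<^sup>2) ` integers_of k"
  proof (rule image_subsetI)
    fix x assume "x \<in> integers_of k"
    then have "\<theta> * x \<in> integers_of k" using Ok(5)[OF \<theta>] by blast
    moreover have "s ^ n * x = \<delta>\<^sup>2 * (\<theta> * x)" unfolding main by simp
    ultimately show "s ^ n * x \<in> (*) (\<delta>\<^sup>2) ` integers_of k" by (metis imageI)
  qed
  ultimately have "covers (integers_of k) ((*) (\<delta>\<^sup>2) ` integers_of k) ((q * A) ^ n)"
    by (rule covers_mono) simp
  then show ?thesis using Disc_le_covers[OF k D sub_degree Ei \<eta>(1,2)] unfolding d\<eta> by simp
qed

end

section \<open>Counting pairs\<close>

text \<open>
  Taking the minimum covers exponents \<open>r\<close> of either sign at once.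
\<close>

lemma powr_comparable:
  fixes a b s t r :: real
  assumes "0 < a" "0 < s" "a * s \<le> t" "t \<le> b * s"
  shows "min (a powr r) (b powr r) * s powr r \<le> t powr r"
proof (cases "r \<ge> 0")
  case True
  have "min (a powr r) (b powr r) * s powr r \<le> a powr r * s powr r"
    by (intro mult_right_mono) auto
  also have "\<dots> = (a * s) powr r" using assms by (simp add: powr_mult)
  also have "\<dots> \<le> t powr r" using assms True by (intro powr_mono2) auto
  finally show ?thesis .
next
  case False
  have t: "0 < t" using assms by (smt (verit) mult_pos_pos)
  then have b: "0 < b" using assms by (smt (verit) mult_nonpos_nonneg)
  have "min (a powr r) (b powr r) * s powr r \<le> b powr r * s powr r"
    by (intro mult_right_mono) auto
  also have "\<dots> = (b * s) powr r" using assms b by (simp add: powr_mult)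
  also have "\<dots> \<le> t powr r" using assms False t by (intro powr_mono2') auto
  finally show ?thesis .
qed

definition count_le :: "'a set \<Rightarrow> ('a \<Rightarrow> real) \<Rightarrow> real \<Rightarrow> nat" where
  "count_le R d y = card {c \<in> R. d c \<le> y}"

text \<open>
  The base \<open>q\<close> is chosen so that the main term doubles, up to powers of the logarithm, from \<open>q\<^sup>j\<close> to
  \<open>q\<^sup>j\<^sup>+\<^sup>1\<close>; hence each shell contains a positive proportion of the elements up to its lower end.
\<close>

lemma shell_count:
  fixes d :: "'a \<Rightarrow> real"
  assumes fin: "\<And>y. finite {c \<in> R. d c \<le> y}" and al: "\<alpha> > 0" and A: "A > 0"
    and lim: "((\<lambda>y. real (count_le R d y) / (y powr \<alpha> * ln y powr r)) \<longlongrightarrow> A) at_top"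
  defines "q \<equiv> 2 powr (1 / \<alpha>)"
  shows "\<exists>a>0. \<forall>\<^sub>F j in sequentially. a * 2 ^ j * real j powr r \<le> real (count_le R d (q ^ j)) \<and>
      a * 2 ^ j * real j powr r \<le> real (card {c \<in> R. q ^ j < d c \<and> d c \<le> q ^ Suc j})"
proof -
  have q1: "q > 1" using al by (simp add: q_def)
  have lq: "ln q > 0" using q1 by simp
  have qp: "(q ^ j) powr \<alpha> = 2 ^ j" for j
    using q1 al by (simp add: q_def powr_realpow[symmetric] powr_powr)
  define f where "f j = real (count_le R d (q ^ j)) / (2 ^ j * real j powr r)" for j
  define B where "B = A * ln q powr r"
  have B: "B > 0" using A lq by (simp add: B_def)
  have "filterlim (\<lambda>j. q ^ j) at_top sequentially"
    by (rule filterlim_at_infinity_imp_filterlim_at_top[OF filterlim_realpow_sequentially_gt1]) (use q1 in auto)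
  from filterlim_compose[OF lim this]
  have "(\<lambda>j. real (count_le R d (q ^ j)) / ((q ^ j) powr \<alpha> * ln (q ^ j) powr r)) \<longlonglongrightarrow> A" .
  then have "(\<lambda>j. real (count_le R d (q ^ j)) / (2 ^ j * (real j * ln q) powr r) * ln q powr r) \<longlonglongrightarrow> A * ln q powr r"
    unfolding qp using q1 by (intro tendsto_mult tendsto_const) (simp add: ln_realpow)
  moreover have "\<forall>\<^sub>F j in sequentially. real (count_le R d (q ^ j)) / (2 ^ j * (real j * ln q) powr r) * ln q powr r = f j"
    using eventually_gt_at_top[of 0]
  proof eventually_elim
    case (elim j)
    then have "(real j * ln q) powr r = real j powr r * ln q powr r" using lq by (simp add: powr_mult)
    then show ?case unfolding f_def using lq by simp
  qed
  ultimately have f: "f \<longlonglongrightarrow> B" unfolding B_def by (rule Lim_transform_eventually)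
  have ratio: "(\<lambda>j. (real (Suc j) / real j) powr r) \<longlonglongrightarrow> 1 powr r"
    by (intro tendsto_powr LIMSEQ_Suc_n_over_n tendsto_const) simp
  have "(\<lambda>j. f (Suc j) * 2 * (real (Suc j) / real j) powr r - f j) \<longlonglongrightarrow> B * 2 * 1 powr r - B"
    by (intro tendsto_intros ratio f LIMSEQ_Suc[OF f])
  then have g: "(\<lambda>j. f (Suc j) * 2 * (real (Suc j) / real j) powr r - f j) \<longlonglongrightarrow> B" by simp
  have B2: "B / 2 < B" using B by simp
  have "\<forall>\<^sub>F j in sequentially. B / 2 * 2 ^ j * real j powr r \<le> real (count_le R d (q ^ j)) \<and>
      B / 2 * 2 ^ j * real j powr r \<le> real (card {c \<in> R. q ^ j < d c \<and> d c \<le> q ^ Suc j})"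
    using order_tendstoD(1)[OF f B2] order_tendstoD(1)[OF g B2] eventually_gt_at_top[of 0]
  proof eventually_elim
    case (elim j)
    have p: "0 < 2 ^ j * real j powr r" using elim(3) by simp
    have c1: "real (count_le R d (q ^ j)) = f j * (2 ^ j * real j powr r)" using elim(3) by (simp add: f_def)
    have "(real (Suc j) / real j) powr r = real (Suc j) powr r / real j powr r"
      using elim(3) by (simp add: powr_divide)
    then have c2: "real (count_le R d (q ^ Suc j)) = f (Suc j) * 2 * (real (Suc j) / real j) powr r * (2 ^ j * real j powr r)"
      using elim(3) by (simp add: f_def)
    have sub: "{c \<in> R. d c \<le> q ^ j} \<subseteq> {c \<in> R. d c \<le> q ^ Suc j}"
    proof safe
      fix c assume "d c \<le> q ^ j"
      also have "q ^ j \<le> q ^ Suc j" using q1 by (intro power_increasing) auto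
      finally show "d c \<le> q ^ Suc j" .
    qed
    have "{c \<in> R. q ^ j < d c \<and> d c \<le> q ^ Suc j} = {c \<in> R. d c \<le> q ^ Suc j} - {c \<in> R. d c \<le> q ^ j}"
      by auto
    then have "card {c \<in> R. q ^ j < d c \<and> d c \<le> q ^ Suc j} = count_le R d (q ^ Suc j) - count_le R d (q ^ j)"
      unfolding count_le_def using card_Diff_subset[OF fin sub] by simp
    moreover have "count_le R d (q ^ j) \<le> count_le R d (q ^ Suc j)"
      unfolding count_le_def by (rule card_mono[OF fin sub])
    ultimately have c3: "real (card {c \<in> R. q ^ j < d c \<and> d c \<le> q ^ Suc j})
        = (f (Suc j) * 2 * (real (Suc j) / real j) powr r - f j) * (2 ^ j * real j powr r)"
      unfolding left_diff_distrib c1[symmetric] c2[symmetric] by (simp add: of_nat_diff)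
    have "B / 2 * (2 ^ j * real j powr r) \<le> f j * (2 ^ j * real j powr r)"
      by (rule mult_right_mono) (use elim(1) p in auto)
    moreover have "B / 2 * (2 ^ j * real j powr r) \<le> (f (Suc j) * 2 * (real (Suc j) / real j) powr r - f j) * (2 ^ j * real j powr r)"
      by (rule mult_right_mono) (use elim(2) p in auto)
    ultimately show ?case unfolding c1 c3 by (simp add: mult.assoc)
  qed
  then show ?thesis using B by (intro exI[of _ "B / 2"]) auto
qed

definition pairs_le :: "'a set \<Rightarrow> ('a \<Rightarrow> real) \<Rightarrow> 'b set \<Rightarrow> ('b \<Rightarrow> real) \<Rightarrow> real \<Rightarrow> ('a \<times> 'b) set" where
  "pairs_le R\<^sub>1 d\<^sub>1 R\<^sub>2 d\<^sub>2 x = {(c\<^sub>1, c\<^sub>2). c\<^sub>1 \<in> R\<^sub>1 \<and> c\<^sub>2 \<in> R\<^sub>2 \<and> d\<^sub>1 c\<^sub>1 * d\<^sub>2 c\<^sub>2 \<le> x}"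

lemma finite_pairs_le:
  assumes "\<And>y. finite {c \<in> R\<^sub>1. d\<^sub>1 c \<le> y}" "\<And>y. finite {c \<in> R\<^sub>2. d\<^sub>2 c \<le> y}"
    "\<And>c. c \<in> R\<^sub>1 \<Longrightarrow> d\<^sub>1 c \<ge> 1" "\<And>c. c \<in> R\<^sub>2 \<Longrightarrow> d\<^sub>2 c \<ge> (1::real)"
  shows "finite (pairs_le R\<^sub>1 d\<^sub>1 R\<^sub>2 d\<^sub>2 x)"
proof (rule finite_subset)
  show "pairs_le R\<^sub>1 d\<^sub>1 R\<^sub>2 d\<^sub>2 x \<subseteq> {c \<in> R\<^sub>1. d\<^sub>1 c \<le> x} \<times> {c \<in> R\<^sub>2. d\<^sub>2 c \<le> x}"
  proof
    fix p assume "p \<in> pairs_le R\<^sub>1 d\<^sub>1 R\<^sub>2 d\<^sub>2 x"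
    then obtain c1 c2 where c: "p = (c1, c2)" "c1 \<in> R\<^sub>1" "c2 \<in> R\<^sub>2" "d\<^sub>1 c1 * d\<^sub>2 c2 \<le> x"
      unfolding pairs_le_def by auto
    have "d\<^sub>1 c1 * 1 \<le> d\<^sub>1 c1 * d\<^sub>2 c2" "1 * d\<^sub>2 c2 \<le> d\<^sub>1 c1 * d\<^sub>2 c2"
      using assms(3)[OF c(2)] assms(4)[OF c(3)] by (intro mult_left_mono mult_right_mono; simp)+
    then show "p \<in> {c \<in> R\<^sub>1. d\<^sub>1 c \<le> x} \<times> {c \<in> R\<^sub>2. d\<^sub>2 c \<le> x}" using c by simp
  qed
qed (use assms in simp)

text \<open>
  With \<open>x\<close> about \<open>q\<^sup>J\<close>, an element of the \<open>j\<close>-th shell can be combined with all elements below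
  \<open>q\<^sup>J\<^sup>-\<^sup>j\<^sup>-\<^sup>1\<close>. For \<open>j\<close> between \<open>J/4\<close> and \<open>J/2\<close> both indices are comparable to \<open>J\<close>, so each of these \<open>J/4\<close> values
  contributes a constant times \<open>2\<^sup>J\<close> and the powers \<open>r\<^sub>1\<close> and \<open>r\<^sub>2\<close> of \<open>J\<close>.
\<close>

lemma pairs_balanced:
  fixes d\<^sub>1 :: "'a \<Rightarrow> real" and d\<^sub>2 :: "'b \<Rightarrow> real"
  assumes fin1: "\<And>y. finite {c \<in> R\<^sub>1. d\<^sub>1 c \<le> y}" and fin2: "\<And>y. finite {c \<in> R\<^sub>2. d\<^sub>2 c \<le> y}"
    and ge1: "\<And>c. c \<in> R\<^sub>1 \<Longrightarrow> d\<^sub>1 c \<ge> 1" and ge2: "\<And>c. c \<in> R\<^sub>2 \<Longrightarrow> d\<^sub>2 c \<ge> 1"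
    and al: "\<alpha> > 0" and A: "A\<^sub>1 > 0" "A\<^sub>2 > 0"
    and lim1: "((\<lambda>y. real (count_le R\<^sub>1 d\<^sub>1 y) / (y powr \<alpha> * ln y powr r\<^sub>1)) \<longlongrightarrow> A\<^sub>1) at_top"
    and lim2: "((\<lambda>y. real (count_le R\<^sub>2 d\<^sub>2 y) / (y powr \<alpha> * ln y powr r\<^sub>2)) \<longlongrightarrow> A\<^sub>2) at_top"
  shows "\<exists>c>0. \<forall>\<^sub>F x in at_top. c * x powr \<alpha> * ln x powr (r\<^sub>1 + r\<^sub>2 + 1) \<le> real (card (pairs_le R\<^sub>1 d\<^sub>1 R\<^sub>2 d\<^sub>2 x))"
proof -
  define q where "q = (2::real) powr (1 / \<alpha>)"
  have q1: "q > 1" using al by (simp add: q_def)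
  have lq: "ln q > 0" using q1 by simp
  have qp: "(q ^ j) powr \<alpha> = 2 ^ j" for j
    using q1 al by (simp add: q_def powr_realpow[symmetric] powr_powr)
  obtain a1 where a1: "a1 > 0" "\<forall>\<^sub>F j in sequentially. a1 * 2 ^ j * real j powr r\<^sub>1 \<le> real (card {c \<in> R\<^sub>1. q ^ j < d\<^sub>1 c \<and> d\<^sub>1 c \<le> q ^ Suc j})"
    using shell_count[OF fin1 al A(1) lim1, folded q_def] unfolding eventually_conj_iff by blast
  obtain a2 where a2: "a2 > 0" "\<forall>\<^sub>F j in sequentially. a2 * 2 ^ j * real j powr r\<^sub>2 \<le> real (count_le R\<^sub>2 d\<^sub>2 (q ^ j))"
    using shell_count[OF fin2 al A(2) lim2, folded q_def] unfolding eventually_conj_iff by blast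
  obtain J1 where J1: "\<And>j. j \<ge> J1 \<Longrightarrow> a1 * 2 ^ j * real j powr r\<^sub>1 \<le> real (card {c \<in> R\<^sub>1. q ^ j < d\<^sub>1 c \<and> d\<^sub>1 c \<le> q ^ Suc j})"
    using a1(2) unfolding eventually_sequentially by blast
  obtain J2 where J2: "\<And>j. j \<ge> J2 \<Longrightarrow> a2 * 2 ^ j * real j powr r\<^sub>2 \<le> real (count_le R\<^sub>2 d\<^sub>2 (q ^ j))"
    using a2(2) unfolding eventually_sequentially by blast
  define w1 w2 where "w1 = min ((1/8) powr r\<^sub>1) (1 powr r\<^sub>1)" and "w2 = min ((1/8) powr r\<^sub>2) (1 powr r\<^sub>2)"
  have w: "w1 > 0" "w2 > 0" by (simp_all add: w1_def w2_def)
  have lower: "a1 * a2 / 2 * w1 * w2 / 8 * 2 ^ J * real J powr (r\<^sub>1 + r\<^sub>2 + 1) \<le> real (card (pairs_le R\<^sub>1 d\<^sub>1 R\<^sub>2 d\<^sub>2 x))"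
    if J: "J \<ge> 8 * (J1 + J2 + 2)" and x: "q ^ J \<le> x" for J x
  proof -
    \<comment> \<open>only shells whose index \<open>j\<close> and whose complement \<open>J - j - 1\<close> are both comparable to \<open>J\<close>\<close>
    let ?S = "{J div 4..J div 2}"
    define T where "T j = {c \<in> R\<^sub>1. q ^ j < d\<^sub>1 c \<and> d\<^sub>1 c \<le> q ^ Suc j} \<times> {c \<in> R\<^sub>2. d\<^sub>2 c \<le> q ^ (J - j - 1)}" for j
    have finT: "finite (T j)" for j
      unfolding T_def by (intro finite_cartesian_product fin2 finite_subset[OF _ fin1[of "q ^ Suc j"]]) auto
    have sub: "(\<Union>j\<in>?S. T j) \<subseteq> pairs_le R\<^sub>1 d\<^sub>1 R\<^sub>2 d\<^sub>2 x"
    proof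
      fix p assume "p \<in> (\<Union>j\<in>?S. T j)"
      then obtain j c1 c2 where j: "j \<le> J div 2" "p = (c1, c2)" "c1 \<in> R\<^sub>1" "c2 \<in> R\<^sub>2" "d\<^sub>1 c1 \<le> q ^ Suc j" "d\<^sub>2 c2 \<le> q ^ (J - j - 1)"
        unfolding T_def by auto
      have "d\<^sub>1 c1 * d\<^sub>2 c2 \<le> q ^ Suc j * q ^ (J - j - 1)"
        by (rule mult_mono[OF j(5,6)]) (use q1 ge2[OF j(4)] in auto)
      also have "\<dots> = q ^ J" using j(1) J by (simp flip: power_add power_Suc)
      finally show "p \<in> pairs_le R\<^sub>1 d\<^sub>1 R\<^sub>2 d\<^sub>2 x" unfolding pairs_le_def using j x by auto
    qed
    have disj: "T i \<inter> T j = {}" if "i \<noteq> j" for i j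
    proof (rule ccontr)
      assume "T i \<inter> T j \<noteq> {}"
      then obtain c where c: "q ^ i < d\<^sub>1 c" "d\<^sub>1 c \<le> q ^ Suc i" "q ^ j < d\<^sub>1 c" "d\<^sub>1 c \<le> q ^ Suc j"
        unfolding T_def by blast
      have "q ^ i < q ^ Suc j" "q ^ j < q ^ Suc i" using c by linarith+
      then have "i < Suc j" "j < Suc i" using power_less_imp_less_exp[OF q1] by blast+
      then show False using that by simp
    qed
    have block: "a1 * a2 / 2 * w1 * w2 * 2 ^ J * real J powr (r\<^sub>1 + r\<^sub>2) \<le> real (card (T j))" if j: "j \<in> ?S" for j
    proof -
      define i where "i = J - j - 1"
      have jJ: "j + i + 1 = J" using j J unfolding i_def by auto
      have jr: "1/8 * real J \<le> real j" "real j \<le> 1 * real J" "1/8 * real J \<le> real i" "real i \<le> 1 * real J"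
        using j J jJ by auto
      have J0: "0 < real J" using J by simp
      have p1: "w1 * real J powr r\<^sub>1 \<le> real j powr r\<^sub>1"
        unfolding w1_def by (rule powr_comparable) (use jr J0 in auto)
      have p2: "w2 * real J powr r\<^sub>2 \<le> real i powr r\<^sub>2"
        unfolding w2_def by (rule powr_comparable) (use jr J0 in auto)
      have "j \<ge> J1" "i \<ge> J2" using j J jJ by auto
      note b = J1[OF this(1)] J2[OF this(2)]
      have "a1 * 2 ^ j * (w1 * real J powr r\<^sub>1) \<le> a1 * 2 ^ j * real j powr r\<^sub>1"
        using p1 a1(1) by (intro mult_left_mono) auto
      also note b(1)
      finally have c1: "a1 * 2 ^ j * (w1 * real J powr r\<^sub>1) \<le> real (card {c \<in> R\<^sub>1. q ^ j < d\<^sub>1 c \<and> d\<^sub>1 c \<le> q ^ Suc j})" .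
      have "a2 * 2 ^ i * (w2 * real J powr r\<^sub>2) \<le> a2 * 2 ^ i * real i powr r\<^sub>2"
        using p2 a2(1) by (intro mult_left_mono) auto
      also note b(2)
      finally have c2: "a2 * 2 ^ i * (w2 * real J powr r\<^sub>2) \<le> real (count_le R\<^sub>2 d\<^sub>2 (q ^ i))" .
      have "(2::real) ^ J = 2 * (2 ^ j * 2 ^ i)" unfolding jJ[symmetric] by (simp add: power_add)
      then have "a1 * a2 / 2 * w1 * w2 * 2 ^ J * real J powr (r\<^sub>1 + r\<^sub>2)
          = (a1 * 2 ^ j * (w1 * real J powr r\<^sub>1)) * (a2 * 2 ^ i * (w2 * real J powr r\<^sub>2))"
        by (simp add: powr_add mult_ac)
      also have "\<dots> \<le> real (card {c \<in> R\<^sub>1. q ^ j < d\<^sub>1 c \<and> d\<^sub>1 c \<le> q ^ Suc j}) * real (count_le R\<^sub>2 d\<^sub>2 (q ^ i))"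
        by (rule mult_mono[OF c1 c2]) (use a2(1) w(2) in auto)
      also have "\<dots> = real (card (T j))" unfolding T_def count_le_def i_def by (simp add: card_cartesian_product)
      finally show ?thesis .
    qed
    have card_S: "real J / 8 \<le> real (card ?S)" using J by auto
    have "a1 * a2 / 2 * w1 * w2 / 8 * 2 ^ J * real J powr (r\<^sub>1 + r\<^sub>2 + 1)
        = real J / 8 * (a1 * a2 / 2 * w1 * w2 * 2 ^ J * real J powr (r\<^sub>1 + r\<^sub>2))"
      using J by (simp add: powr_add)
    also have "\<dots> \<le> real (card ?S) * (a1 * a2 / 2 * w1 * w2 * 2 ^ J * real J powr (r\<^sub>1 + r\<^sub>2))"
      by (rule mult_right_mono[OF card_S]) (use a1(1) a2(1) w in auto)
    also have "\<dots> \<le> (\<Sum>j\<in>?S. real (card (T j)))"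
      by (rule sum_bounded_below) (rule block)
    also have "\<dots> = real (card (\<Union>j\<in>?S. T j))"
      by (subst card_UN_disjoint) (use finT disj in auto)
    also have "\<dots> \<le> real (card (pairs_le R\<^sub>1 d\<^sub>1 R\<^sub>2 d\<^sub>2 x))"
      using card_mono[OF finite_pairs_le[OF fin1 fin2 ge1 ge2] sub] by simp
    finally show ?thesis .
  qed
  define r where "r = r\<^sub>1 + r\<^sub>2 + 1"
  define w3 where "w3 = min ((1 / (2 * ln q)) powr r) ((1 / ln q) powr r)"
  define c0 where "c0 = a1 * a2 / 2 * w1 * w2 / 8"
  have w3: "w3 > 0" using lq by (simp add: w3_def)
  have c0: "c0 > 0" using a1(1) a2(1) w by (simp add: c0_def)
  define Z where "Z = real (8 * (J1 + J2 + 2))"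
  have Z0: "Z \<ge> 0" unfolding Z_def by (rule of_nat_0_le_iff)
  have "\<forall>\<^sub>F x in at_top. ln x \<ge> 2 * ln q * (Z + 1)"
    by (rule eventually_compose_filterlim[OF eventually_ge_at_top ln_at_top])
  then have "\<forall>\<^sub>F x in at_top. c0 / 2 * w3 * x powr \<alpha> * ln x powr r \<le> real (card (pairs_le R\<^sub>1 d\<^sub>1 R\<^sub>2 d\<^sub>2 x))"
    using eventually_gt_at_top[of 1]
  proof eventually_elim
    case (elim x)
    have lx: "ln x > 0" using elim(2) by simp
    define y where "y = ln x / ln q"
    have y: "y \<ge> 2 * (Z + 1)" unfolding y_def using elim(1) lq by (simp add: field_simps)
    \<comment> \<open>the largest exponent with \<open>q ^ J \<le> x\<close>\<close>
    define J where "J = nat \<lfloor>y\<rfloor>"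
    have y': "Z + Z + 1 + 1 \<le> y" using y by (simp add: algebra_simps)
    have "0 \<le> y" using y' Z0 by simp
    then have Jy: "real J \<le> y" "y < real J + 1" unfolding J_def by linarith+
    have "Z \<le> real J" using Jy y' Z0 by simp
    then have J8: "J \<ge> 8 * (J1 + J2 + 2)" unfolding Z_def by (simp only: of_nat_le_iff)
    have xq: "x = q powr y" using elim(2) q1 lq by (simp add: y_def powr_def)
    have "q ^ J = q powr real J" using q1 by (simp add: powr_realpow)
    also have "\<dots> \<le> x" unfolding xq using Jy(1) q1 by (intro powr_mono) auto
    finally have qx: "q ^ J \<le> x" .
    have "x \<le> q powr (real J + 1)" unfolding xq using Jy(2) q1 by (intro powr_mono) auto
    also have "\<dots> = q ^ Suc J" using q1 by (simp add: powr_realpow[symmetric] powr_add)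
    finally have "x powr \<alpha> \<le> (q ^ Suc J) powr \<alpha>" using elim(2) al by (intro powr_mono2) auto
    then have xa: "x powr \<alpha> \<le> 2 * 2 ^ J" unfolding qp by simp
    have lr: "w3 * ln x powr r \<le> real J powr r" unfolding w3_def
    proof (rule powr_comparable)
      have "y / 2 \<le> real J" using Jy y' Z0 by simp
      then show "1 / (2 * ln q) * ln x \<le> real J" by (simp add: y_def)
      show "real J \<le> 1 / ln q * ln x" using Jy(1) by (simp add: y_def)
    qed (use lq lx in auto)
    have "c0 / 2 * w3 * x powr \<alpha> * ln x powr r = c0 / 2 * (x powr \<alpha> * (w3 * ln x powr r))" by simp
    also have "\<dots> \<le> c0 / 2 * ((2 * 2 ^ J) * real J powr r)"
      by (intro mult_left_mono mult_mono xa lr) (use c0 w3 in auto)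
    also have "\<dots> = c0 * 2 ^ J * real J powr r" by simp
    also have "\<dots> \<le> real (card (pairs_le R\<^sub>1 d\<^sub>1 R\<^sub>2 d\<^sub>2 x))"
      using lower[OF J8 qx] by (simp add: c0_def r_def)
    finally show ?case .
  qed
  then show ?thesis using c0 w3 unfolding r_def by (intro exI[of _ "c0 / 2 * w3"]) auto
qed

text \<open>
  Pairs with one fixed second entry suffice.
\<close>

lemma pairs_unbalanced:
  fixes d\<^sub>1 :: "'a \<Rightarrow> real" and d\<^sub>2 :: "'b \<Rightarrow> real"
  assumes fin1: "\<And>y. finite {c \<in> R\<^sub>1. d\<^sub>1 c \<le> y}" and fin2: "\<And>y. finite {c \<in> R\<^sub>2. d\<^sub>2 c \<le> y}"
    and ge1: "\<And>c. c \<in> R\<^sub>1 \<Longrightarrow> d\<^sub>1 c \<ge> 1" and ge2: "\<And>c. c \<in> R\<^sub>2 \<Longrightarrow> d\<^sub>2 c \<ge> 1"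
    and al: "\<alpha> > 0" and A: "A > 0" and c2: "c\<^sub>2 \<in> R\<^sub>2"
    and lim: "((\<lambda>y. real (count_le R\<^sub>1 d\<^sub>1 y) / (y powr \<alpha> * ln y powr r)) \<longlongrightarrow> A) at_top"
  shows "\<exists>c>0. \<forall>\<^sub>F x in at_top. c * x powr \<alpha> * ln x powr r \<le> real (card (pairs_le R\<^sub>1 d\<^sub>1 R\<^sub>2 d\<^sub>2 x))"
proof -
  \<comment> \<open>the second factor has the constant size \<open>L\<close>, so the first may be as large as \<open>x / L\<close>\<close>
  define L where "L = d\<^sub>2 c\<^sub>2"
  have L: "L \<ge> 1" using ge2[OF c2] by (simp add: L_def)
  define w where "w = min ((1/2) powr r) (1 powr r)"
  have w: "w > 0" by (simp add: w_def)
  have fl: "filterlim (\<lambda>x. x / L) at_top at_top"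
    using filterlim_tendsto_pos_mult_at_top[OF tendsto_const, of "1 / L" "\<lambda>x. x" at_top] L
    by (simp add: filterlim_ident)
  have A2: "A / 2 < A" using A by simp
  have "\<forall>\<^sub>F y in at_top. A / 2 < real (count_le R\<^sub>1 d\<^sub>1 y) / (y powr \<alpha> * ln y powr r)"
    by (rule order_tendstoD(1)[OF lim A2])
  then have ev: "\<forall>\<^sub>F x in at_top. A / 2 < real (count_le R\<^sub>1 d\<^sub>1 (x / L)) / ((x / L) powr \<alpha> * ln (x / L) powr r)"
    by (rule eventually_compose_filterlim[OF _ fl])
  have "\<forall>\<^sub>F x in at_top. ln x \<ge> 2 * ln L" by (rule eventually_compose_filterlim[OF eventually_ge_at_top ln_at_top])
  then have "\<forall>\<^sub>F x in at_top. A / 2 * w * L powr (-\<alpha>) * x powr \<alpha> * ln x powr r \<le> real (card (pairs_le R\<^sub>1 d\<^sub>1 R\<^sub>2 d\<^sub>2 x))"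
    using ev eventually_gt_at_top[of L]
  proof eventually_elim
    case (elim x)
    have x: "x > 1" "x / L > 1" using elim(3) L by auto
    have lnx: "ln (x / L) = ln x - ln L" using x L by (simp add: ln_div)
    have lr: "w * ln x powr r \<le> ln (x / L) powr r" unfolding w_def
      by (rule powr_comparable) (use elim(1) lnx x L in auto)
    have pos: "0 < (x / L) powr \<alpha> * ln (x / L) powr r"
    proof (rule mult_pos_pos)
      have "ln (x / L) > 0" using x(2) by (rule ln_gt_zero)
      then show "0 < ln (x / L) powr r" by simp
      have "x / L \<noteq> 0" using x(2) by linarith
      then show "0 < (x / L) powr \<alpha>" by (subst powr_gt_zero)
    qed
    have "A / 2 * w * L powr (-\<alpha>) * x powr \<alpha> * ln x powr r = A / 2 * ((x / L) powr \<alpha> * (w * ln x powr r))"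
      using x L by (simp add: powr_divide powr_minus field_simps)
    also have "\<dots> \<le> A / 2 * ((x / L) powr \<alpha> * ln (x / L) powr r)"
      using lr A by (intro mult_left_mono) auto
    also have "\<dots> \<le> real (count_le R\<^sub>1 d\<^sub>1 (x / L))" using elim(2) pos by (simp add: field_simps)
    also have "\<dots> \<le> real (card (pairs_le R\<^sub>1 d\<^sub>1 R\<^sub>2 d\<^sub>2 x))"
    proof -
      have "(\<lambda>c. (c, c\<^sub>2)) ` {c \<in> R\<^sub>1. d\<^sub>1 c \<le> x / L} \<subseteq> pairs_le R\<^sub>1 d\<^sub>1 R\<^sub>2 d\<^sub>2 x"
        unfolding pairs_le_def using c2 L by (auto simp: L_def[symmetric] field_simps)
      then have "card ((\<lambda>c. (c, c\<^sub>2)) ` {c \<in> R\<^sub>1. d\<^sub>1 c \<le> x / L}) \<le> card (pairs_le R\<^sub>1 d\<^sub>1 R\<^sub>2 d\<^sub>2 x)"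
        by (intro card_mono finite_pairs_le fin1 fin2 ge1 ge2)
      moreover have "card ((\<lambda>c. (c, c\<^sub>2)) ` {c \<in> R\<^sub>1. d\<^sub>1 c \<le> x / L}) = count_le R\<^sub>1 d\<^sub>1 (x / L)"
        unfolding count_le_def by (rule card_image) (simp add: inj_on_def)
      ultimately show ?thesis by simp
    qed
    finally show ?case .
  qed
  moreover have "A / 2 * w * L powr (-\<alpha>) > 0" using A w L by simp
  ultimately show ?thesis by (intro exI[of _ "A / 2 * w * L powr (-\<alpha>)"]) auto
qed

lemma powr_filterlim_at_top:
  fixes p :: real
  assumes "p > 0"
  shows "filterlim (\<lambda>y::real. y powr p) at_top at_top"
proof -
  have "filterlim (\<lambda>y::real. exp (p * ln y)) at_top at_top"
    by (rule filterlim_compose[OF exp_at_top filterlim_tendsto_pos_mult_at_top[OF tendsto_const assms ln_at_top]])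
  moreover have "\<forall>\<^sub>F y::real in at_top. exp (p * ln y) = y powr p"
    using eventually_gt_at_top[of 0] by eventually_elim (simp add: powr_def)
  ultimately show ?thesis by (simp add: filterlim_cong)
qed

text \<open>
  Passing from discriminants to their \<open>m\<close>-th powers divides the exponent by \<open>m\<close> and multiplies the
  constant by a power of \<open>1 / m\<close> that comes from the logarithm.
\<close>

lemma count_power_asymptotics:
  fixes D :: "'a \<Rightarrow> nat" and a m :: nat
  assumes m: "m > 0" and C: "C > 0"
    and asy: "(\<lambda>x. real (card {c \<in> R. real (D c) \<le> x})) \<sim>[at_top] (\<lambda>x. C * x powr (1 / real a) * ln x powr r)"
  shows "((\<lambda>y. real (count_le R (\<lambda>c. real (D c) ^ m) y) / (y powr (1 / (real m * real a)) * ln y powr r))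
    \<longlongrightarrow> C * (1 / real m) powr r) at_top"
proof -
  have "((\<lambda>x. real (card {c \<in> R. real (D c) \<le> x}) / (C * x powr (1 / real a) * ln x powr r)) \<longlongrightarrow> 1) at_top"
  proof (rule asymp_equivD_strong[OF asy])
    show "\<forall>\<^sub>F x in at_top. real (card {c \<in> R. real (D c) \<le> x}) \<noteq> 0 \<or> C * x powr (1 / real a) * ln x powr r \<noteq> 0"
      using eventually_gt_at_top[of 1] by eventually_elim (use C in auto)
  qed
  moreover have fl: "filterlim (\<lambda>y::real. y powr (1 / real m)) at_top at_top"
    by (rule powr_filterlim_at_top) (use m in simp)
  ultimately have "((\<lambda>y. real (card {c \<in> R. real (D c) \<le> y powr (1 / real m)}) /
      (C * (y powr (1 / real m)) powr (1 / real a) * ln (y powr (1 / real m)) powr r)) \<longlongrightarrow> 1) at_top"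
    by (rule filterlim_compose)
  then have "((\<lambda>y. real (card {c \<in> R. real (D c) \<le> y powr (1 / real m)}) /
      (C * (y powr (1 / real m)) powr (1 / real a) * ln (y powr (1 / real m)) powr r) * (C * (1 / real m) powr r)) \<longlongrightarrow> 1 * (C * (1 / real m) powr r)) at_top"
    by (intro tendsto_mult tendsto_const)
  moreover have "\<forall>\<^sub>F y in at_top. real (card {c \<in> R. real (D c) \<le> y powr (1 / real m)}) /
      (C * (y powr (1 / real m)) powr (1 / real a) * ln (y powr (1 / real m)) powr r) * (C * (1 / real m) powr r)
      = real (count_le R (\<lambda>c. real (D c) ^ m) y) / (y powr (1 / (real m * real a)) * ln y powr r)"
    using eventually_gt_at_top[of 1]
  proof eventually_elim
    case (elim y)
    have "real (D c) \<le> y powr (1 / real m) \<longleftrightarrow> real (D c) ^ m \<le> y" for c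
    proof -
      have "y powr (1 / real m) \<ge> 0" by simp
      then have "real (D c) \<le> y powr (1 / real m) \<longleftrightarrow> real (D c) ^ m \<le> (y powr (1 / real m)) ^ m"
        using m by (simp add: power_mono_iff)
      also have "(y powr (1 / real m)) ^ m = y" using m elim by (simp add: powr_realpow[symmetric] powr_powr)
      finally show ?thesis .
    qed
    then have 1: "card {c \<in> R. real (D c) \<le> y powr (1 / real m)} = count_le R (\<lambda>c. real (D c) ^ m) y"
      by (simp add: count_le_def)
    have 2: "(y powr (1 / real m)) powr (1 / real a) = y powr (1 / (real m * real a))"
      by (simp add: powr_powr)
    have 3: "ln (y powr (1 / real m)) powr r = (1 / real m) powr r * ln y powr r"
      using elim m powr_mult[of "1 / real m" "ln y" r] by (simp add: ln_powr)
    have "(1 / real m) powr r \<noteq> 0" using m by simp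
    then show ?case unfolding 1 2 3 using C by simp
  qed
  ultimately show ?thesis by (simp add: Lim_transform_eventually)
qed

section \<open>Isomorphism classes\<close>

lemma Gal_image_inv: "\<gamma> \<in> Gal k \<Longrightarrow> subfield k CC \<Longrightarrow> inv' \<gamma> ` (\<gamma> ` K) = K"
  using Gal_bij[of k \<gamma>] by (simp add: bij_def image_image)

lemma Gal_image_basis:
  assumes k: "subfield k CC" and K: "K \<subseteq> kbar k" and g: "\<gamma> \<in> Gal k" and w: "is_basis k K \<omega>"
  shows "is_basis k (\<gamma> ` K) (map \<gamma> \<omega>)"
proof -
  have wK: "\<omega> ! i \<in> kbar k" if "i < length \<omega>" for i using is_basisD(1)[OF k w that] K by blast
  have lin: "(\<Sum>i<length \<omega>. c i * map \<gamma> \<omega> ! i) = \<gamma> (\<Sum>i<length \<omega>. c i * \<omega> ! i)"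
    "(\<Sum>i<length \<omega>. c i * \<omega> ! i) \<in> kbar k"
    if c: "\<And>i. i < length \<omega> \<Longrightarrow> c i \<in> k" for c
  proof -
    have t: "c i * \<omega> ! i \<in> kbar k" if "i < length \<omega>" for i
      by (rule kbar_closed(4)[OF k]) (use wK that c subset_kbar[OF k] in auto)
    then show "(\<Sum>i<length \<omega>. c i * \<omega> ! i) \<in> kbar k"
      by (intro subfield_sum[OF kbar_subfield[OF k]]) auto
    have "\<gamma> (\<Sum>i<length \<omega>. c i * \<omega> ! i) = (\<Sum>i<length \<omega>. \<gamma> (c i * \<omega> ! i))"
      by (rule Gal_sum[OF k g]) (use t in auto)
    also have "\<dots> = (\<Sum>i<length \<omega>. c i * map \<gamma> \<omega> ! i)"
    proof (rule sum.cong[OF refl])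
      fix i assume "i \<in> {..<length \<omega>}"
      then have i: "i < length \<omega>" by simp
      have "c i \<in> kbar k" using c[OF i] subset_kbar[OF k] by blast
      then show "\<gamma> (c i * \<omega> ! i) = c i * map \<gamma> \<omega> ! i"
        using GalD(2)[OF g, of "c i" "\<omega> ! i"] wK[OF i] GalD(3)[OF g c[OF i]] i by simp
    qed
    finally show "(\<Sum>i<length \<omega>. c i * map \<gamma> \<omega> ! i) = \<gamma> (\<Sum>i<length \<omega>. c i * \<omega> ! i)" by simp
  qed
  show ?thesis
  proof (rule is_basisI[OF k])
    fix c assume c: "\<And>i. i < length (map \<gamma> \<omega>) \<Longrightarrow> c i \<in> k" "(\<Sum>i<length (map \<gamma> \<omega>). c i * map \<gamma> \<omega> ! i) = 0"
    have c1: "\<And>i. i < length \<omega> \<Longrightarrow> c i \<in> k" using c(1) by simp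
    have "\<gamma> (\<Sum>i<length \<omega>. c i * \<omega> ! i) = 0" using c(2) lin(1)[OF c1] by simp
    moreover have "(\<Sum>i<length \<omega>. c i * \<omega> ! i) \<in> kbar k" by (rule lin(2)) (rule c1)
    ultimately have "(\<Sum>i<length \<omega>. c i * \<omega> ! i) = 0" using Gal_nonzero[OF k g] by blast
    then have "c i = 0" if "i < length \<omega>" for i using is_basisD(4)[OF k w, of c i] c1 \<open>(\<Sum>i<length \<omega>. c i * \<omega> ! i) = 0\<close> that by simp
    then show "\<forall>i<length (map \<gamma> \<omega>). c i = 0" by simp
  next
    fix x
    show "x \<in> \<gamma> ` K \<longleftrightarrow> (\<exists>c. (\<forall>i<length (map \<gamma> \<omega>). c i \<in> k) \<and> x = (\<Sum>i<length (map \<gamma> \<omega>). c i * map \<gamma> \<omega> ! i))"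
    proof
      assume "x \<in> \<gamma> ` K"
      then obtain y where y: "y \<in> K" "x = \<gamma> y" by blast
      obtain c where c: "\<forall>i<length \<omega>. c i \<in> k" "y = (\<Sum>i<length \<omega>. c i * \<omega> ! i)"
        using is_basisD(2)[OF k w y(1)] by blast
      then show "\<exists>c. (\<forall>i<length (map \<gamma> \<omega>). c i \<in> k) \<and> x = (\<Sum>i<length (map \<gamma> \<omega>). c i * map \<gamma> \<omega> ! i)"
        using lin(1)[of c] y(2) by (intro exI[of _ c]) simp
    next
      assume "\<exists>c. (\<forall>i<length (map \<gamma> \<omega>). c i \<in> k) \<and> x = (\<Sum>i<length (map \<gamma> \<omega>). c i * map \<gamma> \<omega> ! i)"
      then obtain c where c: "\<And>i. i < length \<omega> \<Longrightarrow> c i \<in> k" "x = (\<Sum>i<length \<omega>. c i * map \<gamma> \<omega> ! i)" by auto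
      then show "x \<in> \<gamma> ` K" using lin(1)[of c] is_basisD(3)[OF k w, of c] by auto
    qed
  qed
qed

lemma Gal_image_degree:
  assumes k: "subfield k CC" and K: "extension_of_degree k n K" and g: "\<gamma> \<in> Gal k"
  shows "extension_of_degree k n (\<gamma> ` K)"
proof -
  note KD = extensionD[OF k K]
  obtain \<omega> where w: "is_basis k K \<omega>" "length \<omega> = n" using KD(4) by blast
  have "c \<in> \<gamma> ` K" if "c \<in> k" for c using GalD(3)[OF g that] KD(2) that by (metis imageI subsetD)
  then show ?thesis unfolding extension_of_degree_iff[OF k]
    using Gal_image_subfield[OF k g KD(1,3)] Gal_image_basis[OF k KD(3) g w(1)] w(2) by (intro conjI exI[of _ "map \<gamma> \<omega>"]) auto
qed

lemma Gal_image_gal_index: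
  assumes k: "subfield k CC" and g: "\<gamma> \<in> Gal k" and e: "gal_index k K \<Omega> G e"
  shows "gal_index k (\<gamma> ` K) \<Omega> G (\<lambda>i x. e i (inv' \<gamma> x))"
proof -
  have iv: "inv' \<gamma> (\<gamma> x) = x" for x using Gal_bij[OF k g] by (simp add: bij_is_inj)
  have vi: "\<gamma> (inv' \<gamma> x) = x" for x using Gal_bij[OF k g] by (simp add: bij_is_surj surj_f_inv_f)
  have ei: "emb_index k K \<Omega> e" using e by (simp add: gal_index_def)
  have "emb_index k (\<gamma> ` K) \<Omega> (\<lambda>i x. e i (inv' \<gamma> x))" unfolding emb_index_def
  proof (intro conjI ballI impI)
    fix i assume i: "i \<in> \<Omega>"
    obtain \<delta> where d: "\<delta> \<in> Gal k" "\<forall>x\<in>K. e i x = \<delta> x" using emb_index_Gal[OF ei i] by blast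
    show "\<exists>\<delta>\<in>Gal k. \<forall>x\<in>\<gamma> ` K. e i (inv' \<gamma> x) = \<delta> x"
      by (rule bexI[OF _ Gal_comp[OF k d(1) Gal_inv[OF k g]]]) (use d(2) iv in auto)
  next
    fix \<delta> assume d: "\<delta> \<in> Gal k"
    obtain i where i: "i \<in> \<Omega>" "\<forall>x\<in>K. e i x = (\<delta> \<circ> \<gamma>) x" using Gal_emb_index[OF ei Gal_comp[OF k d g]] by blast
    then show "\<exists>i\<in>\<Omega>. \<forall>x\<in>\<gamma> ` K. e i (inv' \<gamma> x) = \<delta> x" using iv by auto
  next
    fix i j assume ij: "i \<in> \<Omega>" "j \<in> \<Omega>" and eq: "\<forall>x\<in>\<gamma> ` K. e i (inv' \<gamma> x) = e j (inv' \<gamma> x)"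
    show "i = j" by (rule emb_index_distinct[OF ei ij]) (use eq iv in auto)
  qed
  then show ?thesis using e iv unfolding gal_index_def by simp
qed

text \<open>
  An automorphism carries integral bases to integral bases with the same discriminants. Applying this
  to the inverse automorphism as well gives equality.
\<close>

lemma Gal_image_Disc:
  assumes k: "subfield k CC" and K: "extension_of_degree k n K" and g: "\<gamma> \<in> Gal k" and e: "gal_index k K \<Omega> G e"
    and O: "finite \<Omega>" "card \<Omega> = n"
  shows "Disc k (\<gamma> ` K) = Disc k K"
proof -
  have sub: "basis_discriminants k K \<subseteq> basis_discriminants k (\<gamma> ` K)"
    if K: "extension_of_degree k n K" and g: "\<gamma> \<in> Gal k" and e: "gal_index k K \<Omega> G e" for K \<gamma> e
  proof
    note KD = extensionD[OF k K]
    note K' = Gal_image_degree[OF k K g] note KD' = extensionD[OF k K']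
    obtain u where u: "bij_betw u {..<n} \<Omega>" using ex_bij_betw_nat_finite[OF O(1)] O(2) by (auto simp: atLeast0LessThan)
    have e1: "emb_index k K {..<n} (\<lambda>i. e (u i))"
      by (rule emb_index_reindex[OF u]) (use e in \<open>simp add: gal_index_def\<close>)
    have e2: "emb_index k (\<gamma> ` K) {..<n} (\<lambda>i. (\<lambda>i x. e i (inv' \<gamma> x)) (u i))"
      by (rule emb_index_reindex[OF u]) (use Gal_image_gal_index[OF k g e] in \<open>simp add: gal_index_def\<close>)
    have iv: "inv' \<gamma> (\<gamma> x) = x" for x using Gal_bij[OF k g] by (simp add: bij_is_inj)
    fix d assume "d \<in> basis_discriminants k K"
    then obtain \<omega> where w: "d = (emb_det (\<lambda>i. e (u i)) n \<omega>)\<^sup>2" "set \<omega> \<subseteq> integers_of K" "is_basis k K \<omega>"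
      unfolding basis_discriminants_eq[OF k KD(1-3) e1 K] by blast
    have l: "length \<omega> = n" by (rule basis_length(1)[OF k K w(3)])
    have "mat n n (\<lambda>(i, j). e (u i) (inv' \<gamma> (map \<gamma> \<omega> ! j))) = mat n n (\<lambda>(i, j). e (u i) (\<omega> ! j))"
      by (rule eq_matI) (auto simp: l iv)
    then have "d = (emb_det (\<lambda>i x. e (u i) (inv' \<gamma> x)) n (map \<gamma> \<omega>))\<^sup>2" unfolding w(1) emb_det_def by simp
    moreover have "set (map \<gamma> \<omega>) \<subseteq> integers_of (\<gamma> ` K)"
    proof -
      have "x \<in> K" "algebraic_int x" if "x \<in> set \<omega>" for x using w(2) that by (auto simp: integers_of_def)
      then show ?thesis using Gal_algebraic_int[OF k g] KD(3) by (auto simp: integers_of_def)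
    qed
    ultimately show "d \<in> basis_discriminants k (\<gamma> ` K)"
      unfolding basis_discriminants_eq[OF k KD'(1-3) e2 K'] using Gal_image_basis[OF k KD(3) g w(3)] by blast
  qed
  have "basis_discriminants k (\<gamma> ` K) \<subseteq> basis_discriminants k (inv' \<gamma> ` (\<gamma> ` K))"
    by (rule sub[OF Gal_image_degree[OF k K g] Gal_inv[OF k g] Gal_image_gal_index[OF k g e]])
  then have "basis_discriminants k (\<gamma> ` K) = basis_discriminants k K"
    using sub[OF K g e] unfolding Gal_image_inv[OF g k] by blast
  then show ?thesis by (simp add: Disc_def discriminant_ideal_def)
qed

text \<open>
  Isomorphism over \<open>k\<close> is conjugacy, because an isomorphism extends to the algebraic closure.
\<close>

lemma field_iso_over_iff:
  assumes k: "subfield k CC" and K: "subfield K CC" "k \<subseteq> K" "K \<subseteq> kbar k"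
    and K': "subfield K' CC" "k \<subseteq> K'" "K' \<subseteq> kbar k"
  shows "(K, K') \<in> field_iso_over k \<longleftrightarrow> (\<exists>\<gamma>\<in>Gal k. K' = \<gamma> ` K)"
proof
  assume "(K, K') \<in> field_iso_over k"
  then obtain h where h: "h \<in> ring_iso (subring_of_CC K) (subring_of_CC K')" "\<forall>x\<in>k. h x = x"
    unfolding field_iso_over_def by blast
  have bij: "bij_betw h K K'" using h(1) by (simp add: ring_iso_def)
  obtain \<gamma> where g: "\<gamma> \<in> Gal k" "\<And>x. x \<in> K \<Longrightarrow> \<gamma> x = h x"
  proof (rule hom_extends[OF k K, of h])
    show "h (x + y) = h x + h y" "h (x * y) = h x * h y" if "x \<in> K" "y \<in> K" for x y
      using h(1) that by (simp_all add: ring_iso_def Ring.ring_hom_def)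
    show "h c = c" if "c \<in> k" for c using h(2) that by blast
    fix \<gamma> assume "\<gamma> \<in> Gal k" "\<And>x. x \<in> K \<Longrightarrow> \<gamma> x = h x"
    then show thesis by (rule that)
  qed
  have "\<gamma> ` K = h ` K" by (rule image_cong[OF refl]) (rule g(2))
  then show "\<exists>\<gamma>\<in>Gal k. K' = \<gamma> ` K" using g(1) bij by (auto simp: bij_betw_def)
next
  assume "\<exists>\<gamma>\<in>Gal k. K' = \<gamma> ` K"
  then obtain \<gamma> where g: "\<gamma> \<in> Gal k" "K' = \<gamma> ` K" by blast
  have "inj \<gamma>" using Gal_bij[OF k g(1)] by (simp add: bij_is_inj)
  then have "bij_betw \<gamma> K K'" unfolding g(2) by (simp add: bij_betw_def inj_on_def)
  moreover have "\<gamma> (x + y) = \<gamma> x + \<gamma> y" "\<gamma> (x * y) = \<gamma> x * \<gamma> y" if "x \<in> K" "y \<in> K" for x y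
    using GalD(1,2)[OF g(1)] that K(3) by blast+
  ultimately have "\<gamma> \<in> ring_iso (subring_of_CC K) (subring_of_CC K')"
    using g(2) Gal_01(2)[OF k g(1)] by (auto simp: ring_iso_def Ring.ring_hom_def)
  then show "(K, K') \<in> field_iso_over k"
    unfolding field_iso_over_def using GalD(3)[OF g(1)] by blast
qed

text \<open>
  The conjugates of \<open>K\<close>, i.e. its isomorphism class over \<open>k\<close>.
\<close>

definition orb :: "complex set \<Rightarrow> complex set \<Rightarrow> complex set set" where
  "orb k K = (\<lambda>\<gamma>. \<gamma> ` K) ` Gal k"

definition exts :: "complex set \<Rightarrow> 'i set \<Rightarrow> ('i \<Rightarrow> 'i) set \<Rightarrow> complex set set" where
  "exts k \<Omega> G = {K. extension_of_degree k (card \<Omega>) K \<and> (\<exists>e. gal_index k K \<Omega> G e)}"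

definition ext_classes :: "complex set \<Rightarrow> 'i set \<Rightarrow> ('i \<Rightarrow> 'i) set \<Rightarrow> complex set set set" where
  "ext_classes k \<Omega> G = orb k ` exts k \<Omega> G"

text \<open>
  An arbitrary field from an isomorphism class; all class functions are evaluated at it.
\<close>

definition rep :: "complex set set \<Rightarrow> complex set" where
  "rep c = (SOME K. K \<in> c)"

lemma orb_self: "subfield k CC \<Longrightarrow> K \<in> orb k K"
  unfolding orb_def using Gal_id[of k] by (metis image_eqI image_id id_apply)

lemma orb_eq:
  assumes k: "subfield k CC" and L: "L \<in> orb k K"
  shows "orb k L = orb k K" "K \<in> orb k L"
proof -
  obtain \<gamma> where g: "\<gamma> \<in> Gal k" "L = \<gamma> ` K" using L unfolding orb_def by blast
  have sub: "orb k (\<gamma> ` K) \<subseteq> orb k K" if "\<gamma> \<in> Gal k" for \<gamma> K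
  proof
    fix M assume "M \<in> orb k (\<gamma> ` K)"
    then obtain \<delta> where d: "\<delta> \<in> Gal k" "M = \<delta> ` (\<gamma> ` K)" unfolding orb_def by blast
    have "M = (\<delta> \<circ> \<gamma>) ` K" using d(2) by (simp add: image_comp)
    then show "M \<in> orb k K" unfolding orb_def using Gal_comp[OF k d(1) that] by blast
  qed
  have "orb k (inv' \<gamma> ` (\<gamma> ` K)) \<subseteq> orb k (\<gamma> ` K)" by (rule sub[OF Gal_inv[OF k g(1)]])
  then show eq: "orb k L = orb k K" using sub[OF g(1), of K] unfolding Gal_image_inv[OF g(1) k] g(2) by blast
  show "K \<in> orb k L" unfolding eq by (rule orb_self[OF k])
qed

lemma exts_closed:
  assumes k: "subfield k CC" and K: "K \<in> exts k \<Omega> G" and L: "L \<in> orb k K"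
  shows "L \<in> exts k \<Omega> G"
proof -
  obtain \<gamma> where g: "\<gamma> \<in> Gal k" "L = \<gamma> ` K" using L unfolding orb_def by blast
  then show ?thesis using K Gal_image_degree[OF k _ g(1)] Gal_image_gal_index[OF k g(1)] unfolding exts_def by blast
qed

lemma Disc_orb:
  assumes k: "subfield k CC" and K: "K \<in> exts k \<Omega> G" and O: "finite \<Omega>" and L: "L \<in> orb k K"
  shows "Disc k L = Disc k K"
proof -
  obtain \<gamma> where g: "\<gamma> \<in> Gal k" "L = \<gamma> ` K" using L unfolding orb_def by blast
  obtain e where e: "gal_index k K \<Omega> G e" using K unfolding exts_def by blast
  show ?thesis unfolding g(2) by (rule Gal_image_Disc[OF k _ g(1) e O refl]) (use K in \<open>simp add: exts_def\<close>)
qed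

lemma rep_in: "subfield k CC \<Longrightarrow> rep (orb k K) \<in> orb k K"
  unfolding rep_def by (rule someI[of _ K]) (rule orb_self)

lemma ext_classesD:
  assumes k: "subfield k CC" and c: "c \<in> ext_classes k \<Omega> G"
  shows "rep c \<in> exts k \<Omega> G" "orb k (rep c) = c"
proof -
  obtain K where K: "K \<in> exts k \<Omega> G" "c = orb k K" using c unfolding ext_classes_def by blast
  show "rep c \<in> exts k \<Omega> G" unfolding K(2) by (rule exts_closed[OF k K(1) rep_in[OF k]])
  show "orb k (rep c) = c" unfolding K(2) by (rule orb_eq(1)[OF k rep_in[OF k]])
qed

lemma Disc_rep:
  assumes k: "subfield k CC" and K: "K \<in> exts k \<Omega> G" and O: "finite \<Omega>"
  shows "Disc k (rep (orb k K)) = Disc k K"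
  by (rule Disc_orb[OF k K O rep_in[OF k]])

text \<open>
  The classes of the truncated set are full conjugacy orbits, since degree, group and discriminant are
  invariant. So the classes for varying bounds are subsets of one set, independent of the bound.
\<close>

lemma N_ext_eq_card_classes:
  assumes k: "subfield k CC" and O: "finite \<Omega>" and G: "perm_group_on \<Omega> G"
  shows "N_ext k \<Omega> G x = card {c \<in> ext_classes k \<Omega> G. real (Disc k (rep c)) \<le> x}"
proof -
  define S where "S = {K. extension_of_degree k (card \<Omega>) K \<and> has_galois_perm_group k K \<Omega> G \<and> real (Disc k K) \<le> x}"
  have gal: "has_galois_perm_group k K \<Omega> G \<longleftrightarrow> (\<exists>e. gal_index k K \<Omega> G e)" if "extension_of_degree k (card \<Omega>) K" for K
    by (rule has_galois_perm_group_iff[OF k extensionD(1-3)[OF k that]]) (simp_all add: perm_group_onD(2-4)[OF G])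
  have S: "S = {K \<in> exts k \<Omega> G. real (Disc k K) \<le> x}" unfolding S_def exts_def using gal by blast
  have deg: "extension_of_degree k (card \<Omega>) K" if "K \<in> S" for K using that by (simp add: S_def)
  have cls: "(field_iso_over k \<inter> S \<times> S) `` {K} = orb k K" if K: "K \<in> S" for K
  proof -
    have "L \<in> S" if L: "L \<in> orb k K" for L
      using K exts_closed[OF k _ L] Disc_orb[OF k _ O L] unfolding S by auto
    moreover have "(K, L) \<in> field_iso_over k \<longleftrightarrow> L \<in> orb k K" if "L \<in> S" for L
      unfolding field_iso_over_iff[OF k extensionD(1-3)[OF k deg[OF K]] extensionD(1-3)[OF k deg[OF that]]] orb_def
      by blast
    ultimately show ?thesis using K by blast
  qed
  have "S // (field_iso_over k \<inter> S \<times> S) = orb k ` S"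
    unfolding quotient_def using cls by auto
  also have "\<dots> = {c \<in> ext_classes k \<Omega> G. real (Disc k (rep c)) \<le> x}"
    unfolding S ext_classes_def using Disc_rep[OF k _ O] by auto
  finally show ?thesis unfolding N_ext_def S_def[symmetric] Let_def by simp
qed

lemma finite_orb:
  assumes e: "emb_index k K \<Omega> e" and O: "finite \<Omega>"
  shows "finite (orb k K)"
proof (rule finite_subset)
  show "orb k K \<subseteq> (\<lambda>i. e i ` K) ` \<Omega>"
  proof
    fix L assume "L \<in> orb k K"
    then obtain \<gamma> where g: "\<gamma> \<in> Gal k" "L = \<gamma> ` K" unfolding orb_def by blast
    obtain i where i: "i \<in> \<Omega>" "\<forall>x\<in>K. e i x = \<gamma> x" using Gal_emb_index[OF e g(1)] by blast
    have "e i ` K = \<gamma> ` K" by (rule image_cong) (use i(2) in auto)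
    then show "L \<in> (\<lambda>i. e i ` K) ` \<Omega>" using i(1) g(2) by blast
  qed
qed (use O in simp)

section \<open>Products of permutation groups and the index\<close>

lemma perm_prodE:
  assumes "g \<in> perm_prod \<Omega>\<^sub>1 \<Omega>\<^sub>2 G\<^sub>1 G\<^sub>2"
  obtains g\<^sub>1 g\<^sub>2 where "g\<^sub>1 \<in> G\<^sub>1" "g\<^sub>2 \<in> G\<^sub>2" "g = (\<lambda>p. if p \<in> \<Omega>\<^sub>1 \<times> \<Omega>\<^sub>2 then map_prod g\<^sub>1 g\<^sub>2 p else p)"
  using assms unfolding perm_prod_def by blast

lemma perm_prodI:
  "g\<^sub>1 \<in> G\<^sub>1 \<Longrightarrow> g\<^sub>2 \<in> G\<^sub>2 \<Longrightarrow> (\<lambda>p. if p \<in> \<Omega>\<^sub>1 \<times> \<Omega>\<^sub>2 then map_prod g\<^sub>1 g\<^sub>2 p else p) \<in> perm_prod \<Omega>\<^sub>1 \<Omega>\<^sub>2 G\<^sub>1 G\<^sub>2"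
  unfolding perm_prod_def by blast

lemma perm_prod_perm_group_on:
  assumes G1: "perm_group_on \<Omega>\<^sub>1 G\<^sub>1" and G2: "perm_group_on \<Omega>\<^sub>2 G\<^sub>2"
  shows "perm_group_on (\<Omega>\<^sub>1 \<times> \<Omega>\<^sub>2) (perm_prod \<Omega>\<^sub>1 \<Omega>\<^sub>2 G\<^sub>1 G\<^sub>2)"
proof -
  note D1 = perm_group_onD[OF G1] and D2 = perm_group_onD[OF G2]
  let ?P = "perm_prod \<Omega>\<^sub>1 \<Omega>\<^sub>2 G\<^sub>1 G\<^sub>2"
  let ?p = "\<lambda>g\<^sub>1 g\<^sub>2 p. if p \<in> \<Omega>\<^sub>1 \<times> \<Omega>\<^sub>2 then map_prod g\<^sub>1 g\<^sub>2 p else p"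
  have comp: "?p g1 g2 \<circ> ?p h1 h2 = ?p (g1 \<circ> h1) (g2 \<circ> h2)" if "h1 \<in> G\<^sub>1" "h2 \<in> G\<^sub>2" for g1 g2 h1 h2
    using D1(2)[OF that(1)] D2(2)[OF that(2)] by (auto simp: fun_eq_iff)
  have one: "?p id id = id" by (auto simp: fun_eq_iff)
  have "group (perm_grp ?P)"
  proof (rule groupI)
    fix x y assume "x \<in> carrier (perm_grp ?P)" "y \<in> carrier (perm_grp ?P)"
    then have xy: "x \<in> ?P" "y \<in> ?P" by (simp_all add: perm_grp_def)
    obtain g1 g2 where g: "g1 \<in> G\<^sub>1" "g2 \<in> G\<^sub>2" "x = ?p g1 g2" by (rule perm_prodE[OF xy(1)])
    obtain h1 h2 where h: "h1 \<in> G\<^sub>1" "h2 \<in> G\<^sub>2" "y = ?p h1 h2" by (rule perm_prodE[OF xy(2)])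
    have "x \<circ> y \<in> ?P" unfolding g(3) h(3) comp[OF h(1,2)]
      by (rule perm_prodI[OF D1(4)[OF g(1) h(1)] D2(4)[OF g(2) h(2)]])
    then show "x \<otimes>\<^bsub>perm_grp ?P\<^esub> y \<in> carrier (perm_grp ?P)" by (simp add: perm_grp_def)
  next
    show "\<one>\<^bsub>perm_grp ?P\<^esub> \<in> carrier (perm_grp ?P)"
      using perm_prodI[OF D1(5) D2(5), of \<Omega>\<^sub>1 \<Omega>\<^sub>2] unfolding one by (simp add: perm_grp_def)
  next
    fix x assume "x \<in> carrier (perm_grp ?P)"
    then have x: "x \<in> ?P" by (simp add: perm_grp_def)
    obtain g1 g2 where g: "g1 \<in> G\<^sub>1" "g2 \<in> G\<^sub>2" "x = ?p g1 g2" by (rule perm_prodE[OF x])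
    obtain h1 where h1: "h1 \<in> G\<^sub>1" "h1 \<circ> g1 = id" using D1(6)[OF g(1)] by blast
    obtain h2 where h2: "h2 \<in> G\<^sub>2" "h2 \<circ> g2 = id" using D2(6)[OF g(2)] by blast
    have "?p h1 h2 \<circ> x = id" unfolding g(3) comp[OF g(1,2)] h1(2) h2(2) one ..
    then show "\<exists>y\<in>carrier (perm_grp ?P). y \<otimes>\<^bsub>perm_grp ?P\<^esub> x = \<one>\<^bsub>perm_grp ?P\<^esub>"
      using perm_prodI[OF h1(1) h2(1), of \<Omega>\<^sub>1 \<Omega>\<^sub>2] by (auto simp: perm_grp_def)
  qed (auto simp: perm_grp_def comp_assoc)
  moreover have "(\<forall>i\<in>\<Omega>\<^sub>1 \<times> \<Omega>\<^sub>2. g i \<in> \<Omega>\<^sub>1 \<times> \<Omega>\<^sub>2) \<and> (\<forall>i. i \<notin> \<Omega>\<^sub>1 \<times> \<Omega>\<^sub>2 \<longrightarrow> g i = i)" if gP: "g \<in> ?P" for g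
  proof -
    obtain g1 g2 where g: "g1 \<in> G\<^sub>1" "g2 \<in> G\<^sub>2" "g = ?p g1 g2" by (rule perm_prodE[OF gP])
    show ?thesis unfolding g(3) using D1(2)[OF g(1)] D2(2)[OF g(2)] by auto
  qed
  ultimately show ?thesis unfolding perm_group_on_def by blast
qed

text \<open>
  A nontrivial permutation moves some point, which then shares its orbit with another point.
\<close>

lemma malle_a_pos:
  assumes G: "subgroup G (sym_group n)" and tr: "transitive_on {1..n} G" and n: "n \<ge> 2"
  shows "malle_a {1..n} G > 0"
proof -
  have perm: "g permutes {1..n}" if "g \<in> G" for g
    using subgroup.subset[OF G] that by (auto simp: sym_group_def)
  have "G \<subseteq> {g. g permutes {1..n}}" using perm by blast
  then have fin: "finite (G - {id})" using finite_permutations[of "{1..n}"] finite_subset by blast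
  obtain g where g: "g \<in> G" "g 1 = 2" using tr n unfolding transitive_on_def by force
  then have ne: "G - {id} \<noteq> {}" by auto
  have "ind {1..n} g > 0" if g: "g \<in> G - {id}" for g
  proof -
    have p: "g permutes {1..n}" and "g \<noteq> id" using g perm by auto
    then obtain i where i: "g i \<noteq> i" by (auto simp: fun_eq_iff)
    have iO: "i \<in> {1..n}" using permutes_not_in[OF p] i by blast
    have giO: "g i \<in> {1..n}" using permutes_in_image[OF p] iO by blast
    have "permutation g" using p permutation_permutes by blast
    then have o: "Orbits.orbit g (g i) = Orbits.orbit g i" by (rule permutation_orbit_step)
    have "card (Orbits.orbit g ` {1..n}) \<noteq> card {1..n}"
    proof
      assume "card (Orbits.orbit g ` {1..n}) = card {1..n}"
      then have "inj_on (Orbits.orbit g) {1..n}" by (intro eq_card_imp_inj_on) auto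
      then show False using inj_onD[of "Orbits.orbit g" "{1..n}" "g i" i] o giO iO i by blast
    qed
    moreover have "card (Orbits.orbit g ` {1..n}) \<le> card {1..n}" by (rule card_image_le) simp
    ultimately show ?thesis unfolding ind_def by linarith
  qed
  then show ?thesis unfolding malle_a_def using fin ne by (subst Min_gr_iff) auto
qed

section \<open>Discriminant bounds uniform in the extension\<close>

text \<open>
  The constants \<open>T\<close> and \<open>A n\<close> depend on the base field and the degree only; this is the uniformity in \<open>K\<close>
  that the discriminant bounds need.
\<close>

definition near_minimal_bases :: "complex set \<Rightarrow> nat \<Rightarrow> (nat \<Rightarrow> nat) \<Rightarrow> bool" where
  "near_minimal_bases k T A \<longleftrightarrow> (\<forall>n K e. extension_of_degree k n K \<longrightarrow> emb_index k K {..<n} e \<longrightarrow>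
      (\<exists>\<omega>. is_basis k K \<omega> \<and> set \<omega> \<subseteq> integers_of K \<and>
        (\<forall>x\<in>integers_of K. \<exists>c. (\<forall>i<n. c i \<in> integers_of k) \<and> of_nat T * x = (\<Sum>i<n. c i * \<omega> ! i)) \<and>
        covers (integers_of k) ((*) ((emb_det e n \<omega>)\<^sup>2) ` integers_of k) (A n * Disc k K)))"

lemma near_minimal_basesD:
  assumes "near_minimal_bases k T A" "extension_of_degree k n K" "emb_index k K {..<n} e"
  shows "\<exists>\<omega>. is_basis k K \<omega> \<and> set \<omega> \<subseteq> integers_of K \<and>
        (\<forall>x\<in>integers_of K. \<exists>c. (\<forall>i<n. c i \<in> integers_of k) \<and> of_nat T * x = (\<Sum>i<n. c i * \<omega> ! i)) \<and>
        covers (integers_of k) ((*) ((emb_det e n \<omega>)\<^sup>2) ` integers_of k) (A n * Disc k K)"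
  using assms unfolding near_minimal_bases_def by blast

lemma near_minimal_bases_exist:
  assumes nf: "number_field k"
  shows "\<exists>T B A. covers (integers_of k) ((*) (of_nat (T\<^sup>2)) ` integers_of k) B \<and> near_minimal_bases k T A"
proof (rule near_minimal_basis[OF nf])
  obtain D where D: "subfield k CC" "extension_of_degree \<rat> D k" by (rule number_fieldD[OF nf])
  fix T :: nat
  assume T: "T > 0" "\<And>n K e. extension_of_degree k n K \<Longrightarrow> emb_index k K {..<n} e \<Longrightarrow>
      \<exists>\<omega>. is_basis k K \<omega> \<and> set \<omega> \<subseteq> integers_of K \<and>
        (\<forall>x\<in>integers_of K. \<exists>c. (\<forall>i<n. c i \<in> integers_of k) \<and> of_nat T * x = (\<Sum>i<n. c i * \<omega> ! i))"
  have "\<exists>a. covers (integers_of k) ((*) (of_nat (T ^ (2 * n))) ` integers_of k) a" for n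
    by (rule covers_nat[OF D(2)]) (use T(1) in simp)
  then obtain A where A: "\<And>n. covers (integers_of k) ((*) (of_nat (T ^ (2 * n))) ` integers_of k) (A n)"
    by metis
  have "near_minimal_bases k T A" unfolding near_minimal_bases_def
  proof (intro allI impI)
    fix n K e assume K: "extension_of_degree k n K" and e: "emb_index k K {..<n} e"
    obtain \<omega> where w: "is_basis k K \<omega>" "set \<omega> \<subseteq> integers_of K"
      "\<forall>x\<in>integers_of K. \<exists>c. (\<forall>i<n. c i \<in> integers_of k) \<and> of_nat T * x = (\<Sum>i<n. c i * \<omega> ! i)"
      using T(2)[OF K e] by blast
    show "\<exists>\<omega>. is_basis k K \<omega> \<and> set \<omega> \<subseteq> integers_of K \<and>
        (\<forall>x\<in>integers_of K. \<exists>c. (\<forall>i<n. c i \<in> integers_of k) \<and> of_nat T * x = (\<Sum>i<n. c i * \<omega> ! i)) \<and>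
        covers (integers_of k) ((*) ((emb_det e n \<omega>)\<^sup>2) ` integers_of k) (A n * Disc k K)"
      using w covers_near_minimal[OF D(1,2) K e w(1,2) w(3)[rule_format] A] by blast
  qed
  moreover have "covers (integers_of k) ((*) (of_nat (T\<^sup>2)) ` integers_of k) (A 1)" using A[of 1] by simp
  ultimately show ?thesis by blast
qed

text \<open>
  Nearly minimal bases of the two fields enter through their product basis, with constants that depend
  only on the two degrees.
\<close>

lemma compositum_Disc_bound:
  assumes nf: "number_field k"
  shows "\<exists>C>0. \<forall>K\<^sub>1 K\<^sub>2 (\<Omega>\<^sub>1 :: 'i set) (\<Omega>\<^sub>2 :: 'j set) G\<^sub>1 G\<^sub>2 e\<^sub>1 e\<^sub>2. galois_pair k K\<^sub>1 K\<^sub>2 n m \<Omega>\<^sub>1 \<Omega>\<^sub>2 G\<^sub>1 G\<^sub>2 e\<^sub>1 e\<^sub>2 \<longrightarrow>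
    Disc k (compositum K\<^sub>1 K\<^sub>2) \<le> C * (Disc k K\<^sub>1 ^ m * Disc k K\<^sub>2 ^ n)"
proof -
  obtain D where D: "subfield k CC" "extension_of_degree \<rat> D k" by (rule number_fieldD[OF nf])
  obtain T B A where B: "covers (integers_of k) ((*) (of_nat (T\<^sup>2)) ` integers_of k) B"
    and nm: "near_minimal_bases k T A" using near_minimal_bases_exist[OF nf] by blast
  note A = near_minimal_basesD[OF nm]
  \<comment> \<open>the successor makes the constant positive\<close>
  have "Disc k (compositum K\<^sub>1 K\<^sub>2) \<le> Suc (A n ^ m * A m ^ n) * (Disc k K\<^sub>1 ^ m * Disc k K\<^sub>2 ^ n)"
    if gp: "galois_pair k K\<^sub>1 K\<^sub>2 n m \<Omega>\<^sub>1 \<Omega>\<^sub>2 G\<^sub>1 G\<^sub>2 e\<^sub>1 e\<^sub>2"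
    for K\<^sub>1 K\<^sub>2 and \<Omega>\<^sub>1 :: "'i set" and \<Omega>\<^sub>2 :: "'j set" and G\<^sub>1 G\<^sub>2 e\<^sub>1 e\<^sub>2
  proof -
    interpret galois_pair k K\<^sub>1 K\<^sub>2 n m \<Omega>\<^sub>1 \<Omega>\<^sub>2 G\<^sub>1 G\<^sub>2 e\<^sub>1 e\<^sub>2 by (rule gp)
    have "Disc k (compositum K\<^sub>1 K\<^sub>2) \<le> (A n * Disc k K\<^sub>1) ^ m * (A m * Disc k K\<^sub>2) ^ n"
    proof (rule compositum_Disc_le[OF D(2)])
      fix e assume "emb_index k K\<^sub>1 {..<n} e"
      from A[OF K1 this] show "\<exists>\<omega>. is_basis k K\<^sub>1 \<omega> \<and> set \<omega> \<subseteq> integers_of K\<^sub>1 \<and>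
        covers (integers_of k) ((*) ((emb_det e n \<omega>)\<^sup>2) ` integers_of k) (A n * Disc k K\<^sub>1)" by blast
    next
      fix e assume "emb_index k K\<^sub>2 {..<m} e"
      from A[OF K2 this] show "\<exists>\<omega>. is_basis k K\<^sub>2 \<omega> \<and> set \<omega> \<subseteq> integers_of K\<^sub>2 \<and>
        covers (integers_of k) ((*) ((emb_det e m \<omega>)\<^sup>2) ` integers_of k) (A m * Disc k K\<^sub>2)" by blast
    qed
    also have "\<dots> = (A n ^ m * A m ^ n) * (Disc k K\<^sub>1 ^ m * Disc k K\<^sub>2 ^ n)"
      by (simp add: power_mult_distrib mult_ac)
    also have "\<dots> \<le> Suc (A n ^ m * A m ^ n) * (Disc k K\<^sub>1 ^ m * Disc k K\<^sub>2 ^ n)"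
      by (intro mult_right_mono) auto
    finally show ?thesis .
  qed
  then show ?thesis by (intro exI[of _ "Suc (A n ^ m * A m ^ n)"]) blast
qed

lemma subfield_Disc_bound:
  assumes nf: "number_field k"
  shows "\<exists>C. \<forall>K (\<Omega> :: 'i set) G e (\<Omega>\<^sub>1 :: 'j set) G\<^sub>1 \<pi>. galois_quotient k K N n \<Omega> G e \<Omega>\<^sub>1 G\<^sub>1 \<pi> \<longrightarrow>
    Disc k (galois_quotient.sub K \<Omega> e \<pi>) \<le> C * Disc k K ^ n"
proof -
  obtain D where D: "subfield k CC" "extension_of_degree \<rat> D k" by (rule number_fieldD[OF nf])
  obtain T B A where B: "covers (integers_of k) ((*) (of_nat (T\<^sup>2)) ` integers_of k) B"
    and nm: "near_minimal_bases k T A" using near_minimal_bases_exist[OF nf] by blast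
  note A = near_minimal_basesD[OF nm]
  have "Disc k (galois_quotient.sub K \<Omega> e \<pi>) \<le> (A N * B) ^ n * Disc k K ^ n"
    if gq: "galois_quotient k K N n \<Omega> G e \<Omega>\<^sub>1 G\<^sub>1 \<pi>"
    for K and \<Omega> :: "'i set" and G e and \<Omega>\<^sub>1 :: "'j set" and G\<^sub>1 \<pi>
  proof -
    interpret galois_quotient k K N n \<Omega> G e \<Omega>\<^sub>1 G\<^sub>1 \<pi> by (rule gq)
    obtain u v where u: "bij_betw u {..<N} \<Omega>" and v: "bij_betw v {..<n} \<Omega>\<^sub>1" by (rule enumerations)
    obtain \<eta> where h: "is_basis k sub \<eta>" "set \<eta> \<subseteq> integers_of sub"
      "\<And>x. x \<in> integers_of sub \<Longrightarrow> \<exists>c. (\<forall>i<n. c i \<in> integers_of k) \<and> of_nat T * x = (\<Sum>i<n. c i * \<eta> ! i)"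
      using A[OF sub_degree emb_index_reindex[OF v e1_emb_index]] by blast
    have "Disc k sub \<le> (A N * Disc k K * B) ^ n"
    proof (rule sub_Disc_le[OF D(2) _ h B])
      fix e assume "emb_index k K {..<N} e"
      from A[OF K this] show "\<exists>\<omega>. is_basis k K \<omega> \<and> set \<omega> \<subseteq> integers_of K \<and>
        covers (integers_of k) ((*) ((emb_det e N \<omega>)\<^sup>2) ` integers_of k) (A N * Disc k K)" by blast
    qed
    then show ?thesis by (simp add: power_mult_distrib mult_ac)
  qed
  then show ?thesis by blast
qed

lemma exts_Disc_pos:
  assumes nf: "number_field k" and O: "finite \<Omega>" and K: "K \<in> exts k \<Omega> G"
  shows "Disc k K > 0"
proof -
  obtain D where D: "subfield k CC" "extension_of_degree \<rat> D k" by (rule number_fieldD[OF nf])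
  obtain e where e: "gal_index k K \<Omega> G e" and K: "extension_of_degree k (card \<Omega>) K" using K by (auto simp: exts_def)
  obtain u where u: "bij_betw u {..<card \<Omega>} \<Omega>" using ex_bij_betw_nat_finite[OF O] by (auto simp: atLeast0LessThan)
  have ei: "emb_index k K \<Omega> e" using e by (simp add: gal_index_def)
  show ?thesis by (rule Disc_pos[OF D K emb_index_reindex[OF u ei]])
qed

section \<open>Composita with product Galois group\<close>

text \<open>
  The hypotheses on the two groups, without chosen fields.
\<close>

locale product_setup =
  fixes k :: "complex set" and \<Omega>\<^sub>1 :: "'i set" and \<Omega>\<^sub>2 :: "'j set" and G\<^sub>1 G\<^sub>2
  assumes nf: "number_field k"
    and O1: "finite \<Omega>\<^sub>1" "\<Omega>\<^sub>1 \<noteq> {}" and O2: "finite \<Omega>\<^sub>2" "\<Omega>\<^sub>2 \<noteq> {}"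
    and G1: "perm_group_on \<Omega>\<^sub>1 G\<^sub>1" "transitive_on \<Omega>\<^sub>1 G\<^sub>1"
    and G2: "perm_group_on \<Omega>\<^sub>2 G\<^sub>2" "transitive_on \<Omega>\<^sub>2 G\<^sub>2"
    and nq: "no_common_quotient (perm_grp G\<^sub>1) (perm_grp G\<^sub>2)"
begin

abbreviation "P \<equiv> perm_prod \<Omega>\<^sub>1 \<Omega>\<^sub>2 G\<^sub>1 G\<^sub>2"

lemma k: "subfield k CC" by (rule number_fieldD[OF nf])

lemma compositum_in_exts:
  assumes K1: "K\<^sub>1 \<in> exts k \<Omega>\<^sub>1 G\<^sub>1" and K2: "K\<^sub>2 \<in> exts k \<Omega>\<^sub>2 G\<^sub>2"
  shows "compositum K\<^sub>1 K\<^sub>2 \<in> exts k (\<Omega>\<^sub>1 \<times> \<Omega>\<^sub>2) P"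
    "\<exists>e\<^sub>1 e\<^sub>2. galois_pair k K\<^sub>1 K\<^sub>2 (card \<Omega>\<^sub>1) (card \<Omega>\<^sub>2) \<Omega>\<^sub>1 \<Omega>\<^sub>2 G\<^sub>1 G\<^sub>2 e\<^sub>1 e\<^sub>2"
proof -
  obtain e1 where e1: "gal_index k K\<^sub>1 \<Omega>\<^sub>1 G\<^sub>1 e1" using K1 by (auto simp: exts_def)
  obtain e2 where e2: "gal_index k K\<^sub>2 \<Omega>\<^sub>2 G\<^sub>2 e2" using K2 by (auto simp: exts_def)
  have gp: "galois_pair k K\<^sub>1 K\<^sub>2 (card \<Omega>\<^sub>1) (card \<Omega>\<^sub>2) \<Omega>\<^sub>1 \<Omega>\<^sub>2 G\<^sub>1 G\<^sub>2 e1 e2"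
    by (rule galois_pair.intro) (use K1 K2 k O1 O2 G1 G2 nq e1 e2 in \<open>simp_all add: exts_def\<close>)
  then show "\<exists>e\<^sub>1 e\<^sub>2. galois_pair k K\<^sub>1 K\<^sub>2 (card \<Omega>\<^sub>1) (card \<Omega>\<^sub>2) \<Omega>\<^sub>1 \<Omega>\<^sub>2 G\<^sub>1 G\<^sub>2 e\<^sub>1 e\<^sub>2" by blast
  show "compositum K\<^sub>1 K\<^sub>2 \<in> exts k (\<Omega>\<^sub>1 \<times> \<Omega>\<^sub>2) P"
    using galois_pair.joint_gal_index[OF gp] galois_pair.compositum_degree[OF gp]
    unfolding exts_def by (auto simp: card_cartesian_product)
qed

lemma quotients:
  assumes K: "extension_of_degree k (card (\<Omega>\<^sub>1 \<times> \<Omega>\<^sub>2)) K" and e: "gal_index k K (\<Omega>\<^sub>1 \<times> \<Omega>\<^sub>2) P e"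
  shows "galois_quotient k K (card (\<Omega>\<^sub>1 \<times> \<Omega>\<^sub>2)) (card \<Omega>\<^sub>1) (\<Omega>\<^sub>1 \<times> \<Omega>\<^sub>2) P e \<Omega>\<^sub>1 G\<^sub>1 fst"
    "galois_quotient k K (card (\<Omega>\<^sub>1 \<times> \<Omega>\<^sub>2)) (card \<Omega>\<^sub>2) (\<Omega>\<^sub>1 \<times> \<Omega>\<^sub>2) P e \<Omega>\<^sub>2 G\<^sub>2 snd"
proof -
  have P: "perm_group_on (\<Omega>\<^sub>1 \<times> \<Omega>\<^sub>2) P" by (rule perm_prod_perm_group_on[OF G1(1) G2(1)])
  have fin: "finite (\<Omega>\<^sub>1 \<times> \<Omega>\<^sub>2)" using O1 O2 by simp
  show "galois_quotient k K (card (\<Omega>\<^sub>1 \<times> \<Omega>\<^sub>2)) (card \<Omega>\<^sub>1) (\<Omega>\<^sub>1 \<times> \<Omega>\<^sub>2) P e \<Omega>\<^sub>1 G\<^sub>1 fst"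
  proof (rule galois_quotient.intro)
    show "fst ` (\<Omega>\<^sub>1 \<times> \<Omega>\<^sub>2) = \<Omega>\<^sub>1" using O2 by auto
    show "\<exists>g1\<in>G\<^sub>1. \<forall>p\<in>\<Omega>\<^sub>1 \<times> \<Omega>\<^sub>2. fst (g p) = g1 (fst p)" if gP: "g \<in> P" for g
    proof -
      obtain g1 g2 where "g1 \<in> G\<^sub>1" "g = (\<lambda>p. if p \<in> \<Omega>\<^sub>1 \<times> \<Omega>\<^sub>2 then map_prod g1 g2 p else p)"
        using gP by (elim perm_prodE)
      then show ?thesis by (intro bexI[of _ g1]) auto
    qed
    show "\<exists>g\<in>P. \<forall>p\<in>\<Omega>\<^sub>1 \<times> \<Omega>\<^sub>2. fst (g p) = g1 (fst p)" if g1: "g1 \<in> G\<^sub>1" for g1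
      by (rule bexI[OF _ perm_prodI[OF g1 perm_group_onD(5)[OF G2(1)]]]) auto
  qed (use k K fin O1(1) P e G1(1) in simp_all)
  show "galois_quotient k K (card (\<Omega>\<^sub>1 \<times> \<Omega>\<^sub>2)) (card \<Omega>\<^sub>2) (\<Omega>\<^sub>1 \<times> \<Omega>\<^sub>2) P e \<Omega>\<^sub>2 G\<^sub>2 snd"
  proof (rule galois_quotient.intro)
    show "snd ` (\<Omega>\<^sub>1 \<times> \<Omega>\<^sub>2) = \<Omega>\<^sub>2" using O1 by auto
    show "\<exists>g2\<in>G\<^sub>2. \<forall>p\<in>\<Omega>\<^sub>1 \<times> \<Omega>\<^sub>2. snd (g p) = g2 (snd p)" if gP: "g \<in> P" for g
    proof -
      obtain g1 g2 where "g2 \<in> G\<^sub>2" "g = (\<lambda>p. if p \<in> \<Omega>\<^sub>1 \<times> \<Omega>\<^sub>2 then map_prod g1 g2 p else p)"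
        using gP by (elim perm_prodE)
      then show ?thesis by (intro bexI[of _ g2]) auto
    qed
    show "\<exists>g\<in>P. \<forall>p\<in>\<Omega>\<^sub>1 \<times> \<Omega>\<^sub>2. snd (g p) = g2 (snd p)" if g2: "g2 \<in> G\<^sub>2" for g2
      by (rule bexI[OF _ perm_prodI[OF perm_group_onD(5)[OF G1(1)] g2]]) auto
  qed (use k K fin O2(1) P e G2(1) in simp_all)
qed

text \<open>
  An automorphism that is trivial on both subfields preserves both coordinates of every label, hence
  it is trivial on \<open>K\<close>.
\<close>

lemma eq_compositum_of_subs:
  assumes K: "extension_of_degree k (card (\<Omega>\<^sub>1 \<times> \<Omega>\<^sub>2)) K" and e: "gal_index k K (\<Omega>\<^sub>1 \<times> \<Omega>\<^sub>2) P e"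
  shows "compositum (galois_quotient.sub K (\<Omega>\<^sub>1 \<times> \<Omega>\<^sub>2) e fst) (galois_quotient.sub K (\<Omega>\<^sub>1 \<times> \<Omega>\<^sub>2) e snd) = K"
proof -
  interpret Q1: galois_quotient k K "card (\<Omega>\<^sub>1 \<times> \<Omega>\<^sub>2)" "card \<Omega>\<^sub>1" "\<Omega>\<^sub>1 \<times> \<Omega>\<^sub>2" P e \<Omega>\<^sub>1 G\<^sub>1 fst by (rule quotients(1)[OF K e])
  interpret Q2: galois_quotient k K "card (\<Omega>\<^sub>1 \<times> \<Omega>\<^sub>2)" "card \<Omega>\<^sub>2" "\<Omega>\<^sub>1 \<times> \<Omega>\<^sub>2" P e \<Omega>\<^sub>2 G\<^sub>2 snd by (rule quotients(2)[OF K e])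
  note KD = extensionD[OF k K]
  let ?F = "compositum Q1.sub Q2.sub"
  have F: "?F \<subseteq> K" by (rule compositum_props(4)[OF KD(1) Q1.sub_props(3) Q2.sub_props(3)])
  have kF: "k \<subseteq> ?F" using Q1.sub_props(2) compositum_props(2) by blast
  have "x \<in> ?F" if x: "x \<in> K" for x
  proof (rule ccontr)
    assume "x \<notin> ?F"
    moreover have "x \<in> kbar k" using x KD(3) by blast
    ultimately obtain \<gamma> where g: "\<gamma> \<in> Gal k" "\<And>y. y \<in> ?F \<Longrightarrow> \<gamma> y = y" "\<gamma> x \<noteq> x"
      using Gal_moves[OF k compositum_props(1) kF order_trans[OF F KD(3)]] by metis
    have ei: "emb_index k K (\<Omega>\<^sub>1 \<times> \<Omega>\<^sub>2) e" using e by (simp add: gal_index_def)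
    obtain p where p: "p \<in> \<Omega>\<^sub>1 \<times> \<Omega>\<^sub>2" "\<And>x. x \<in> K \<Longrightarrow> e p x = \<gamma> x" using Gal_emb_index[OF ei g(1)] by blast
    obtain q where q: "q \<in> \<Omega>\<^sub>1 \<times> \<Omega>\<^sub>2" "\<And>x. x \<in> K \<Longrightarrow> e q x = x" using emb_index_id[OF ei k] by blast
    have "e p y = e q y" if y: "y \<in> Q1.sub \<or> y \<in> Q2.sub" for y
    proof -
      have yF: "y \<in> ?F" using y compositum_props(2,3) by blast
      then have "y \<in> K" using F by blast
      then show ?thesis using p(2) q(2) g(2)[OF yF] by simp
    qed
    then have "fst p = fst q" "snd p = snd q"
      using Q1.separates[OF p(1) q(1)] Q2.separates[OF p(1) q(1)] by blast+
    then have "p = q" by (rule prod_eqI)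
    then show False using p(2)[OF x] q(2)[OF x] g(3) by simp
  qed
  then show ?thesis using F by blast
qed

text \<open>
  \<open>K\<close> is the compositum of its two subfields, each of which lies in one of finitely many classes, and
  every class is finite as a set of subfields of the complex numbers.
\<close>

lemma finite_product_classes:
  assumes fin1: "\<And>y. finite {c \<in> ext_classes k \<Omega>\<^sub>1 G\<^sub>1. real (Disc k (rep c)) \<le> y}"
    and fin2: "\<And>y. finite {c \<in> ext_classes k \<Omega>\<^sub>2 G\<^sub>2. real (Disc k (rep c)) \<le> y}"
  shows "finite {c \<in> ext_classes k (\<Omega>\<^sub>1 \<times> \<Omega>\<^sub>2) P. real (Disc k (rep c)) \<le> x}"
proof -
  let ?N = "card (\<Omega>\<^sub>1 \<times> \<Omega>\<^sub>2)"
  have Ofin: "finite (\<Omega>\<^sub>1 \<times> \<Omega>\<^sub>2)" using O1 O2 by simp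
  obtain C1 where C1: "\<And>K \<Omega> G e \<Omega>\<^sub>1 G\<^sub>1 \<pi>. galois_quotient k K ?N (card \<Omega>\<^sub>1) (\<Omega> :: ('i \<times> 'j) set) G e (\<Omega>\<^sub>1 :: 'i set) G\<^sub>1 \<pi> \<Longrightarrow>
      Disc k (galois_quotient.sub K \<Omega> e \<pi>) \<le> C1 (card \<Omega>\<^sub>1) * Disc k K ^ card \<Omega>\<^sub>1"
    using subfield_Disc_bound[OF nf] by metis
  obtain C2 where C2: "\<And>K \<Omega> G e \<Omega>\<^sub>1 G\<^sub>1 \<pi>. galois_quotient k K ?N (card \<Omega>\<^sub>1) (\<Omega> :: ('i \<times> 'j) set) G e (\<Omega>\<^sub>1 :: 'j set) G\<^sub>1 \<pi> \<Longrightarrow>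
      Disc k (galois_quotient.sub K \<Omega> e \<pi>) \<le> C2 (card \<Omega>\<^sub>1) * Disc k K ^ card \<Omega>\<^sub>1"
    using subfield_Disc_bound[OF nf] by metis
  define y1 y2 where "y1 = real (C1 (card \<Omega>\<^sub>1)) * \<bar>x\<bar> ^ card \<Omega>\<^sub>1" and "y2 = real (C2 (card \<Omega>\<^sub>2)) * \<bar>x\<bar> ^ card \<Omega>\<^sub>2"
  define F1 where "F1 = \<Union>{c \<in> ext_classes k \<Omega>\<^sub>1 G\<^sub>1. real (Disc k (rep c)) \<le> y1}"
  define F2 where "F2 = \<Union>{c \<in> ext_classes k \<Omega>\<^sub>2 G\<^sub>2. real (Disc k (rep c)) \<le> y2}"
  have "finite c" if c: "c \<in> ext_classes k \<Omega>\<^sub>1 G\<^sub>1" for c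
    using c finite_orb[OF _ O1(1)] unfolding ext_classes_def exts_def gal_index_def by blast
  then have F1: "finite F1" unfolding F1_def by (intro finite_Union fin1) auto
  have "finite c" if c: "c \<in> ext_classes k \<Omega>\<^sub>2 G\<^sub>2" for c
    using c finite_orb[OF _ O2(1)] unfolding ext_classes_def exts_def gal_index_def by blast
  then have F2: "finite F2" unfolding F2_def by (intro finite_Union fin2) auto
  have "{c \<in> ext_classes k (\<Omega>\<^sub>1 \<times> \<Omega>\<^sub>2) P. real (Disc k (rep c)) \<le> x}
      \<subseteq> (\<lambda>(K\<^sub>1, K\<^sub>2). orb k (compositum K\<^sub>1 K\<^sub>2)) ` (F1 \<times> F2)"
  proof
    fix c assume c: "c \<in> {c \<in> ext_classes k (\<Omega>\<^sub>1 \<times> \<Omega>\<^sub>2) P. real (Disc k (rep c)) \<le> x}"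
    define K where "K = rep c"
    have Kx: "real (Disc k K) \<le> x" using c by (simp add: K_def)
    have cK: "orb k K = c" "K \<in> exts k (\<Omega>\<^sub>1 \<times> \<Omega>\<^sub>2) P" unfolding K_def using ext_classesD[OF k] c by blast+
    obtain e where e: "gal_index k K (\<Omega>\<^sub>1 \<times> \<Omega>\<^sub>2) P e" and K: "extension_of_degree k ?N K"
      using cK(2) by (auto simp: exts_def)
    interpret Q1: galois_quotient k K ?N "card \<Omega>\<^sub>1" "\<Omega>\<^sub>1 \<times> \<Omega>\<^sub>2" P e \<Omega>\<^sub>1 G\<^sub>1 fst by (rule quotients(1)[OF K e])
    interpret Q2: galois_quotient k K ?N "card \<Omega>\<^sub>2" "\<Omega>\<^sub>1 \<times> \<Omega>\<^sub>2" P e \<Omega>\<^sub>2 G\<^sub>2 snd by (rule quotients(2)[OF K e])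
    have E1: "Q1.sub \<in> exts k \<Omega>\<^sub>1 G\<^sub>1" using Q1.sub_degree Q1.e1_gal_index by (auto simp: exts_def)
    have E2: "Q2.sub \<in> exts k \<Omega>\<^sub>2 G\<^sub>2" using Q2.sub_degree Q2.e1_gal_index by (auto simp: exts_def)
    have "real (Disc k Q1.sub) \<le> real (C1 (card \<Omega>\<^sub>1) * Disc k K ^ card \<Omega>\<^sub>1)"
      using C1[OF quotients(1)[OF K e]] by (simp only: of_nat_le_iff)
    also have "\<dots> \<le> y1" unfolding y1_def of_nat_mult of_nat_power
      by (intro mult_left_mono power_mono) (use Kx in auto)
    finally have D1: "real (Disc k Q1.sub) \<le> y1" .
    have "real (Disc k Q2.sub) \<le> real (C2 (card \<Omega>\<^sub>2) * Disc k K ^ card \<Omega>\<^sub>2)"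
      using C2[OF quotients(2)[OF K e]] by (simp only: of_nat_le_iff)
    also have "\<dots> \<le> y2" unfolding y2_def of_nat_mult of_nat_power
      by (intro mult_left_mono power_mono) (use Kx in auto)
    finally have D2: "real (Disc k Q2.sub) \<le> y2" .
    have 1: "Q1.sub \<in> F1" unfolding F1_def
    proof (rule UnionI)
      show "orb k Q1.sub \<in> {c \<in> ext_classes k \<Omega>\<^sub>1 G\<^sub>1. real (Disc k (rep c)) \<le> y1}"
        using E1 D1 Disc_rep[OF k E1 O1(1)] by (simp add: ext_classes_def)
    qed (rule orb_self[OF k])
    have 2: "Q2.sub \<in> F2" unfolding F2_def
    proof (rule UnionI)
      show "orb k Q2.sub \<in> {c \<in> ext_classes k \<Omega>\<^sub>2 G\<^sub>2. real (Disc k (rep c)) \<le> y2}"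
        using E2 D2 Disc_rep[OF k E2 O2(1)] by (simp add: ext_classes_def)
    qed (rule orb_self[OF k])
    have "c = orb k (compositum Q1.sub Q2.sub)" unfolding eq_compositum_of_subs[OF K e] cK(1) ..
    then show "c \<in> (\<lambda>(K\<^sub>1, K\<^sub>2). orb k (compositum K\<^sub>1 K\<^sub>2)) ` (F1 \<times> F2)" using 1 2 by auto
  qed
  then show ?thesis by (rule finite_subset) (use F1 F2 in simp)
qed

end

definition intermediate :: "complex set \<Rightarrow> complex set \<Rightarrow> complex set set" where
  "intermediate k K = {F. subfield F CC \<and> k \<subseteq> F \<and> F \<subseteq> K}"

text \<open>
  An intermediate field is determined by the relation that two embeddings of \<open>K\<close> coincide on it.
\<close>

lemma intermediate_fields_bound:
  assumes k: "subfield k CC" and K: "K \<subseteq> kbar k" and e: "emb_index k K \<Omega> e" and O: "finite \<Omega>"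
  shows "finite (intermediate k K)" "card (intermediate k K) \<le> 2 ^ (card \<Omega> * card \<Omega>)"
proof -
  define R where "R F = {(p, q) \<in> \<Omega> \<times> \<Omega>. \<forall>x\<in>F. e p x = e q x}" for F
  have sub: "F' \<subseteq> F" if F: "F \<in> intermediate k K" and F': "F' \<in> intermediate k K" and eq: "R F = R F'" for F F'
  proof (rule ccontr)
    assume "\<not> F' \<subseteq> F"
    then obtain x where x: "x \<in> F'" "x \<notin> F" by blast
    have xK: "x \<in> K" using x(1) F' by (auto simp: intermediate_def)
    obtain \<gamma> where g: "\<gamma> \<in> Gal k" "\<And>y. y \<in> F \<Longrightarrow> \<gamma> y = y" "\<gamma> x \<noteq> x"
    proof (rule Gal_moves[OF k, of F x])
      show "subfield F CC" "k \<subseteq> F" "F \<subseteq> kbar k" "x \<in> kbar k" "x \<notin> F"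
        using F K xK x(2) by (auto simp: intermediate_def)
      fix \<gamma> assume "\<gamma> \<in> Gal k" "\<And>y. y \<in> F \<Longrightarrow> \<gamma> y = y" "\<gamma> x \<noteq> x"
      then show thesis by (rule that)
    qed
    obtain p where p: "p \<in> \<Omega>" "\<And>x. x \<in> K \<Longrightarrow> e p x = \<gamma> x" using Gal_emb_index[OF e g(1)] by blast
    obtain q where q: "q \<in> \<Omega>" "\<And>x. x \<in> K \<Longrightarrow> e q x = x" using emb_index_id[OF e k] by blast
    have "(p, q) \<in> R F" using p q g(2) F unfolding R_def intermediate_def by auto
    then have "e p x = e q x" unfolding eq using x(1) by (auto simp: R_def)
    then show False using p(2)[OF xK] q(2)[OF xK] g(3) by simp
  qed
  have inj: "inj_on R (intermediate k K)" by (rule inj_onI) (use sub in blast)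
  have R: "R ` intermediate k K \<subseteq> Pow (\<Omega> \<times> \<Omega>)" by (auto simp: R_def)
  have fin: "finite (Pow (\<Omega> \<times> \<Omega>))" using O by simp
  show "finite (intermediate k K)" by (rule inj_on_finite[OF inj R fin])
  show "card (intermediate k K) \<le> 2 ^ (card \<Omega> * card \<Omega>)"
    using card_inj_on_le[OF inj R fin] O by (simp add: card_Pow card_cartesian_product)
qed

lemma card_le_fibres:
  assumes B: "finite B" and f: "\<And>a. a \<in> A \<Longrightarrow> f a \<in> B"
    and fib: "\<And>b. b \<in> B \<Longrightarrow> card {a \<in> A. f a = b} \<le> M"
  shows "card A \<le> M * card B"
proof -
  have "A = (\<Union>b\<in>B. {a \<in> A. f a = b})" using f by blast
  then have "card A \<le> (\<Sum>b\<in>B. card {a \<in> A. f a = b})" using card_UN_le[OF B, of "\<lambda>b. {a \<in> A. f a = b}"] by simp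
  also have "\<dots> \<le> card B * M" using sum_bounded_above[of B "\<lambda>b. card {a \<in> A. f a = b}" M] fib by simp
  finally show ?thesis by (simp add: mult.commute)
qed

context product_setup
begin

text \<open>
  If the compositum of two fields is conjugate to \<open>K\<close>, then conjugates of both fields are intermediate
  fields of \<open>K\<close>. So the fibre of \<open>K\<close> has at most as many elements as there are pairs of such fields.
\<close>

lemma product_count:
  assumes fin1: "\<And>y. finite {c \<in> ext_classes k \<Omega>\<^sub>1 G\<^sub>1. real (Disc k (rep c)) \<le> y}"
    and fin2: "\<And>y. finite {c \<in> ext_classes k \<Omega>\<^sub>2 G\<^sub>2. real (Disc k (rep c)) \<le> y}"
  shows "\<exists>C>0. \<exists>M>0. \<forall>y. real (card (pairs_le (ext_classes k \<Omega>\<^sub>1 G\<^sub>1) (\<lambda>c. real (Disc k (rep c)) ^ card \<Omega>\<^sub>2)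
      (ext_classes k \<Omega>\<^sub>2 G\<^sub>2) (\<lambda>c. real (Disc k (rep c)) ^ card \<Omega>\<^sub>1) y))
    \<le> real M * real (N_ext k (\<Omega>\<^sub>1 \<times> \<Omega>\<^sub>2) P (real C * y))"
proof -
  have Ofin: "finite (\<Omega>\<^sub>1 \<times> \<Omega>\<^sub>2)" using O1 O2 by simp
  have P: "perm_group_on (\<Omega>\<^sub>1 \<times> \<Omega>\<^sub>2) P" by (rule perm_prod_perm_group_on[OF G1(1) G2(1)])
  obtain C :: nat where C: "C > 0" "\<And>K\<^sub>1 K\<^sub>2 (\<Omega>\<^sub>1' :: 'i set) (\<Omega>\<^sub>2' :: 'j set) G\<^sub>1 G\<^sub>2 e\<^sub>1 e\<^sub>2.
      galois_pair k K\<^sub>1 K\<^sub>2 (card \<Omega>\<^sub>1) (card \<Omega>\<^sub>2) \<Omega>\<^sub>1' \<Omega>\<^sub>2' G\<^sub>1 G\<^sub>2 e\<^sub>1 e\<^sub>2 \<Longrightarrow>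
      Disc k (compositum K\<^sub>1 K\<^sub>2) \<le> C * (Disc k K\<^sub>1 ^ card \<Omega>\<^sub>2 * Disc k K\<^sub>2 ^ card \<Omega>\<^sub>1)"
    using compositum_Disc_bound[OF nf, of "card \<Omega>\<^sub>1" "card \<Omega>\<^sub>2"] by blast
  define b where "b = (2::nat) ^ (card (\<Omega>\<^sub>1 \<times> \<Omega>\<^sub>2) * card (\<Omega>\<^sub>1 \<times> \<Omega>\<^sub>2))"
  define f where "f = (\<lambda>(c\<^sub>1, c\<^sub>2). orb k (compositum (rep c\<^sub>1) (rep c\<^sub>2)))"
  have "card (pairs_le (ext_classes k \<Omega>\<^sub>1 G\<^sub>1) (\<lambda>c. real (Disc k (rep c)) ^ card \<Omega>\<^sub>2)
      (ext_classes k \<Omega>\<^sub>2 G\<^sub>2) (\<lambda>c. real (Disc k (rep c)) ^ card \<Omega>\<^sub>1) y) \<le> (b * b) * N_ext k (\<Omega>\<^sub>1 \<times> \<Omega>\<^sub>2) P (real C * y)" for y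
    unfolding N_ext_eq_card_classes[OF k Ofin P]
  proof (rule card_le_fibres[where f = f])
    let ?S = "pairs_le (ext_classes k \<Omega>\<^sub>1 G\<^sub>1) (\<lambda>c. real (Disc k (rep c)) ^ card \<Omega>\<^sub>2)
      (ext_classes k \<Omega>\<^sub>2 G\<^sub>2) (\<lambda>c. real (Disc k (rep c)) ^ card \<Omega>\<^sub>1) y"
    show "finite {c \<in> ext_classes k (\<Omega>\<^sub>1 \<times> \<Omega>\<^sub>2) P. real (Disc k (rep c)) \<le> real C * y}"
      by (rule finite_product_classes[OF fin1 fin2])
    have mem: "\<exists>c\<^sub>1 c\<^sub>2. a = (c\<^sub>1, c\<^sub>2) \<and> orb k (rep c\<^sub>1) = c\<^sub>1 \<and> orb k (rep c\<^sub>2) = c\<^sub>2 \<and> rep c\<^sub>1 \<in> exts k \<Omega>\<^sub>1 G\<^sub>1 \<and> rep c\<^sub>2 \<in> exts k \<Omega>\<^sub>2 G\<^sub>2 \<and>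
        real (Disc k (rep c\<^sub>1)) ^ card \<Omega>\<^sub>2 * real (Disc k (rep c\<^sub>2)) ^ card \<Omega>\<^sub>1 \<le> y" if aS: "a \<in> ?S" for a
    proof -
      obtain c1 c2 where c: "a = (c1, c2)" "c1 \<in> ext_classes k \<Omega>\<^sub>1 G\<^sub>1" "c2 \<in> ext_classes k \<Omega>\<^sub>2 G\<^sub>2"
        "real (Disc k (rep c1)) ^ card \<Omega>\<^sub>2 * real (Disc k (rep c2)) ^ card \<Omega>\<^sub>1 \<le> y"
        using aS unfolding pairs_le_def by auto
      show ?thesis
        by (intro exI[of _ c1] exI[of _ c2] conjI c(1,4) ext_classesD[OF k c(2)] ext_classesD[OF k c(3)])
    qed
    show "f a \<in> {c \<in> ext_classes k (\<Omega>\<^sub>1 \<times> \<Omega>\<^sub>2) P. real (Disc k (rep c)) \<le> real C * y}" if a: "a \<in> ?S" for a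
    proof -
      obtain c1 c2 where c: "a = (c1, c2)" "rep c1 \<in> exts k \<Omega>\<^sub>1 G\<^sub>1" "rep c2 \<in> exts k \<Omega>\<^sub>2 G\<^sub>2"
        "real (Disc k (rep c1)) ^ card \<Omega>\<^sub>2 * real (Disc k (rep c2)) ^ card \<Omega>\<^sub>1 \<le> y" using mem[OF a] by blast
      note L = compositum_in_exts[OF c(2,3)]
      have "real (Disc k (compositum (rep c1) (rep c2))) \<le> real (C * (Disc k (rep c1) ^ card \<Omega>\<^sub>2 * Disc k (rep c2) ^ card \<Omega>\<^sub>1))"
        using L(2) C(2) of_nat_le_iff by blast
      also have "\<dots> \<le> real C * y" using c(4) C(1) by simp
      finally show ?thesis unfolding f_def c(1) using L(1) Disc_rep[OF k L(1) Ofin] by (simp add: ext_classes_def)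
    qed
    fix c assume "c \<in> {c \<in> ext_classes k (\<Omega>\<^sub>1 \<times> \<Omega>\<^sub>2) P. real (Disc k (rep c)) \<le> real C * y}"
    then have c: "rep c \<in> exts k (\<Omega>\<^sub>1 \<times> \<Omega>\<^sub>2) P" "orb k (rep c) = c" using ext_classesD[OF k] by blast+
    let ?K = "rep c"
    obtain e where e: "emb_index k ?K (\<Omega>\<^sub>1 \<times> \<Omega>\<^sub>2) e" and K: "extension_of_degree k (card (\<Omega>\<^sub>1 \<times> \<Omega>\<^sub>2)) ?K"
      using c(1) unfolding exts_def gal_index_def by blast
    let ?I = "intermediate k ?K"
    have I: "finite ?I" "card ?I \<le> b"
      unfolding b_def by (rule intermediate_fields_bound[OF k extensionD(3)[OF k K] e Ofin])+
    have "{a \<in> ?S. f a = c} \<subseteq> (\<lambda>(F\<^sub>1, F\<^sub>2). (orb k F\<^sub>1, orb k F\<^sub>2)) ` (?I \<times> ?I)"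
    proof
      fix a assume "a \<in> {a \<in> ?S. f a = c}"
      then have a: "a \<in> ?S" "f a = c" by blast+
      obtain c1 c2 where c12: "a = (c1, c2)" "orb k (rep c1) = c1" "orb k (rep c2) = c2"
        "rep c1 \<in> exts k \<Omega>\<^sub>1 G\<^sub>1" "rep c2 \<in> exts k \<Omega>\<^sub>2 G\<^sub>2" using mem[OF a(1)] by blast
      let ?L = "compositum (rep c1) (rep c2)"
      have "?K \<in> orb k ?L" using a(2) rep_in[OF k, of ?L] by (simp add: f_def c12(1))
      then obtain \<gamma> where g: "\<gamma> \<in> Gal k" "?K = \<gamma> ` ?L" unfolding orb_def by blast
      have I1: "\<gamma> ` F \<in> ?I \<and> orb k (\<gamma> ` F) = orb k F" if F: "F \<subseteq> ?L" and d: "extension_of_degree k d F" for F d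
      proof -
        have "\<gamma> ` F \<in> ?I" unfolding intermediate_def g(2)
          using extensionD(1,2)[OF k Gal_image_degree[OF k d g(1)]] F by blast
        moreover have "\<gamma> ` F \<in> orb k F" unfolding orb_def using g(1) by blast
        ultimately show ?thesis using orb_eq(1)[OF k] by blast
      qed
      have "\<gamma> ` rep c1 \<in> ?I \<and> orb k (\<gamma> ` rep c1) = c1"
        using I1[OF compositum_props(2)] c12(2,4) unfolding exts_def by auto
      moreover have "\<gamma> ` rep c2 \<in> ?I \<and> orb k (\<gamma> ` rep c2) = c2"
        using I1[OF compositum_props(3)] c12(3,5) unfolding exts_def by auto
      ultimately show "a \<in> (\<lambda>(F\<^sub>1, F\<^sub>2). (orb k F\<^sub>1, orb k F\<^sub>2)) ` (?I \<times> ?I)"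
        unfolding c12(1) by (intro image_eqI[of _ _ "(\<gamma> ` rep c1, \<gamma> ` rep c2)"]) auto
    qed
    then have "card {a \<in> ?S. f a = c} \<le> card (?I \<times> ?I)"
      using I(1) by (meson card_image_le card_mono finite_SigmaI finite_imageI order_trans)
    also have "\<dots> \<le> b * b" unfolding card_cartesian_product using I(2) by (intro mult_mono) auto
    finally show "card {a \<in> ?S. f a = c} \<le> b * b" .
  qed
  then have "real (card (pairs_le (ext_classes k \<Omega>\<^sub>1 G\<^sub>1) (\<lambda>c. real (Disc k (rep c)) ^ card \<Omega>\<^sub>2)
      (ext_classes k \<Omega>\<^sub>2 G\<^sub>2) (\<lambda>c. real (Disc k (rep c)) ^ card \<Omega>\<^sub>1) y))
    \<le> real (b * b) * real (N_ext k (\<Omega>\<^sub>1 \<times> \<Omega>\<^sub>2) P (real C * y))" for y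
    unfolding of_nat_mult[symmetric] of_nat_le_iff .
  moreover have "b * b > 0" by (simp add: b_def)
  ultimately show ?thesis using C(1) by blast
qed

end

section \<open>The lower bound\<close>

text \<open>
  Replacing \<open>x\<close> by \<open>x / C\<close> changes neither the power of \<open>x\<close> nor that of \<open>ln x\<close> by more than a constant
  factor.
\<close>

lemma count_lower_bound_rescale:
  fixes f g :: "real \<Rightarrow> real"
  assumes c: "c > 0" and C: "C \<ge> 1" and M: "M > 0"
    and f: "\<forall>\<^sub>F x in at_top. c * x powr \<alpha> * ln x powr r \<le> f x" and fg: "\<And>y. f y \<le> M * g (C * y)"
  shows "\<exists>c'>0. \<forall>\<^sub>F x in at_top. c' * x powr \<alpha> * ln x powr r \<le> g x"
proof -
  define w where "w = min ((1/2) powr r) (1 powr r)"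
  have w: "w > 0" by (simp add: w_def)
  have fl: "filterlim (\<lambda>x. x / C) at_top at_top"
    using filterlim_tendsto_pos_mult_at_top[OF tendsto_const, of "1 / C" "\<lambda>x. x" at_top] C
    by (simp add: filterlim_ident)
  have ev: "\<forall>\<^sub>F x in at_top. c * (x / C) powr \<alpha> * ln (x / C) powr r \<le> f (x / C)"
    by (rule eventually_compose_filterlim[OF f fl])
  have "\<forall>\<^sub>F x in at_top. ln x \<ge> 2 * ln C" by (rule eventually_compose_filterlim[OF eventually_ge_at_top ln_at_top])
  then have "\<forall>\<^sub>F x in at_top. c * w * C powr (-\<alpha>) / M * x powr \<alpha> * ln x powr r \<le> g x"
    using ev eventually_gt_at_top[of C]
  proof eventually_elim
    case (elim x)
    have x: "x > 1" "x / C > 1" using elim(3) C by auto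
    have lnx: "ln (x / C) = ln x - ln C" using x C by (simp add: ln_div)
    have lr: "w * ln x powr r \<le> ln (x / C) powr r" unfolding w_def
      by (rule powr_comparable) (use elim(1) lnx x C in auto)
    have "c * w * C powr (-\<alpha>) * x powr \<alpha> * ln x powr r = c * (x / C) powr \<alpha> * (w * ln x powr r)"
      using x C by (simp add: powr_divide powr_minus field_simps)
    also have "\<dots> \<le> c * (x / C) powr \<alpha> * ln (x / C) powr r"
      using lr c by (intro mult_left_mono) auto
    also have "\<dots> \<le> M * g x" using elim(2) fg[of "x / C"] C by simp
    finally show ?case using M by (simp add: field_simps)
  qed
  moreover have "c * w * C powr (-\<alpha>) / M > 0" using c w C M by simp
  ultimately show ?thesis by blast
qed

text \<open>
  The asymptotic count is eventually positive. A set of positive cardinality is finite, so all sets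
  with a smaller bound are finite too.
\<close>

lemma malle_conjecture_classes:
  assumes k: "subfield k CC" and O: "finite \<Omega>" and G: "perm_group_on \<Omega> G" and mc: "malle_conjecture k \<Omega> G"
  shows "finite {c \<in> ext_classes k \<Omega> G. real (Disc k (rep c)) \<le> y}" "ext_classes k \<Omega> G \<noteq> {}"
    "m > 0 \<Longrightarrow> \<exists>A>0. ((\<lambda>y. real (count_le (ext_classes k \<Omega> G) (\<lambda>c. real (Disc k (rep c)) ^ m) y) /
      (y powr (1 / (real m * real (malle_a \<Omega> G))) * ln y powr (real (malle_b k \<Omega> G) - 1))) \<longlongrightarrow> A) at_top"
proof -
  let ?R = "ext_classes k \<Omega> G" and ?D = "\<lambda>c. Disc k (rep c)"
  obtain C where C: "C > 0" and asy: "(\<lambda>x. real (card {c \<in> ?R. real (?D c) \<le> x})) \<sim>[at_top]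
      (\<lambda>x. C * x powr (1 / real (malle_a \<Omega> G)) * ln x powr (real (malle_b k \<Omega> G) - 1))"
    using mc unfolding malle_conjecture_def N_ext_eq_card_classes[OF k O G] by blast
  have nz: "\<forall>\<^sub>F x in at_top. card {c \<in> ?R. real (?D c) \<le> x} \<noteq> 0"
    using asymp_equiv_eventually_zeros[OF asy] eventually_gt_at_top[of 1]
    by eventually_elim (use C in auto)
  obtain x where x: "x \<ge> y" "card {c \<in> ?R. real (?D c) \<le> x} \<noteq> 0"
    using eventually_happens'[OF _ eventually_conj[OF eventually_ge_at_top[of y] nz]] by auto
  have fx: "finite {c \<in> ?R. real (?D c) \<le> x}" by (rule card_ge_0_finite) (use x(2) in simp)
  show "finite {c \<in> ?R. real (?D c) \<le> y}" by (rule finite_subset[OF _ fx]) (use x(1) in auto)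
  show "?R \<noteq> {}" using x(2) by auto
  assume m: "m > 0"
  have "C * (1 / real m) powr (real (malle_b k \<Omega> G) - 1) > 0" using C m by simp
  then show "\<exists>A>0. ((\<lambda>y. real (count_le ?R (\<lambda>c. real (?D c) ^ m) y) /
      (y powr (1 / (real m * real (malle_a \<Omega> G))) * ln y powr (real (malle_b k \<Omega> G) - 1))) \<longlongrightarrow> A) at_top"
    using count_power_asymptotics[OF m C asy] by blast
qed

theorem corollary3p3:
  fixes k :: "complex set" and n m :: nat
    and G\<^sub>1 G\<^sub>2 :: "(nat \<Rightarrow> nat) set" and \<alpha> r :: real
  assumes "number_field k"
    and "n \<ge> 2" and "m \<ge> 2"
    and "subgroup G\<^sub>1 (sym_group n)" and "transitive_on {1..n} G\<^sub>1"
    and "subgroup G\<^sub>2 (sym_group m)" and "transitive_on {1..m} G\<^sub>2"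
    and "no_common_quotient (perm_grp G\<^sub>1) (perm_grp G\<^sub>2)"
    and "malle_conjecture k {1..n} G\<^sub>1" and "malle_conjecture k {1..m} G\<^sub>2"
    and "\<alpha> = max (1 / (real m * real (malle_a {1..n} G\<^sub>1))) (1 / (real n * real (malle_a {1..m} G\<^sub>2)))"
    and "(1 / (real m * real (malle_a {1..n} G\<^sub>1)) = 1 / (real n * real (malle_a {1..m} G\<^sub>2))
            \<and> r = real (malle_b k {1..n} G\<^sub>1) + real (malle_b k {1..m} G\<^sub>2) - 1)
       \<or> (1 / (real m * real (malle_a {1..n} G\<^sub>1)) > 1 / (real n * real (malle_a {1..m} G\<^sub>2))
            \<and> r = real (malle_b k {1..n} G\<^sub>1) - 1)"
  shows "\<exists>C>0. \<exists>e \<in> o[at_top](\<lambda>x. x powr \<alpha> * ln x powr r). \<forall>\<^sub>F x in at_top.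
           real (N_ext k ({1..n} \<times> {1..m}) (perm_prod {1..n} {1..m} G\<^sub>1 G\<^sub>2) x)
             \<ge> C * x powr \<alpha> * ln x powr r + e x"
proof -
  have k: "subfield k CC" by (rule number_fieldD[OF assms(1)])
  note P1 = sym_subgroup_perm_group_on[OF assms(4)] and P2 = sym_subgroup_perm_group_on[OF assms(6)]
  interpret product_setup k "{1..n}" "{1..m}" G\<^sub>1 G\<^sub>2
    by (rule product_setup.intro) (use assms P1 P2 in auto)
  let ?R1 = "ext_classes k {1..n} G\<^sub>1" and ?R2 = "ext_classes k {1..m} G\<^sub>2"
  let ?d1 = "\<lambda>c. real (Disc k (rep c)) ^ m" and ?d2 = "\<lambda>c. real (Disc k (rep c)) ^ n"
  have O: "finite {1..n}" "finite {1..m}" by auto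
  note M1 = malle_conjecture_classes[OF k O(1) P1 assms(9)] and M2 = malle_conjecture_classes[OF k O(2) P2 assms(10)]
  have nm: "n > 0" "m > 0" using assms(2,3) by auto
  have D1: "real (Disc k (rep c)) \<ge> 1" if "c \<in> ?R1" for c
    using exts_Disc_pos[OF assms(1) O(1) ext_classesD(1)[OF k that]] by simp
  have D2: "real (Disc k (rep c)) \<ge> 1" if "c \<in> ?R2" for c
    using exts_Disc_pos[OF assms(1) O(2) ext_classesD(1)[OF k that]] by simp
  have ge1: "?d1 c \<ge> 1" if "c \<in> ?R1" for c by (rule one_le_power[OF D1[OF that]])
  have ge2: "?d2 c \<ge> 1" if "c \<in> ?R2" for c by (rule one_le_power[OF D2[OF that]])
  have fin1: "finite {c \<in> ?R1. ?d1 c \<le> y}" for y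
  proof (rule finite_subset[OF _ M1(1)[of y]])
    have "real (Disc k (rep c)) \<le> ?d1 c" if "c \<in> ?R1" for c by (rule self_le_power[OF D1[OF that] nm(2)])
    then show "{c \<in> ?R1. ?d1 c \<le> y} \<subseteq> {c \<in> ?R1. real (Disc k (rep c)) \<le> y}" using order_trans by blast
  qed
  have fin2: "finite {c \<in> ?R2. ?d2 c \<le> y}" for y
  proof (rule finite_subset[OF _ M2(1)[of y]])
    have "real (Disc k (rep c)) \<le> ?d2 c" if "c \<in> ?R2" for c by (rule self_le_power[OF D2[OF that] nm(1)])
    then show "{c \<in> ?R2. ?d2 c \<le> y} \<subseteq> {c \<in> ?R2. real (Disc k (rep c)) \<le> y}" using order_trans by blast
  qed
  obtain A1 where A1: "A1 > 0" "((\<lambda>y. real (count_le ?R1 ?d1 y) /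
      (y powr (1 / (real m * real (malle_a {1..n} G\<^sub>1))) * ln y powr (real (malle_b k {1..n} G\<^sub>1) - 1))) \<longlongrightarrow> A1) at_top"
    using M1(3)[OF nm(2)] by blast
  obtain A2 where A2: "A2 > 0" "((\<lambda>y. real (count_le ?R2 ?d2 y) /
      (y powr (1 / (real n * real (malle_a {1..m} G\<^sub>2))) * ln y powr (real (malle_b k {1..m} G\<^sub>2) - 1))) \<longlongrightarrow> A2) at_top"
    using M2(3)[OF nm(1)] by blast
  have a1: "malle_a {1..n} G\<^sub>1 > 0" by (rule malle_a_pos[OF assms(4,5,2)])
  have al2: "\<alpha> = 1 / (real m * real (malle_a {1..n} G\<^sub>1))" using assms(11,12) by linarith
  have "\<alpha> > 0" unfolding al2 using nm(2) a1 by (intro divide_pos_pos mult_pos_pos) auto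
  note al = this al2
  have "\<exists>c>0. \<forall>\<^sub>F x in at_top. c * x powr \<alpha> * ln x powr r \<le> real (card (pairs_le ?R1 ?d1 ?R2 ?d2 x))"
    using assms(12)
  proof (elim disjE conjE)
    assume eq: "1 / (real m * real (malle_a {1..n} G\<^sub>1)) = 1 / (real n * real (malle_a {1..m} G\<^sub>2))"
      and r: "r = real (malle_b k {1..n} G\<^sub>1) + real (malle_b k {1..m} G\<^sub>2) - 1"
    have r': "r = (real (malle_b k {1..n} G\<^sub>1) - 1) + (real (malle_b k {1..m} G\<^sub>2) - 1) + 1" using r by simp
    show ?thesis unfolding r'
      by (rule pairs_balanced[OF fin1 fin2 ge1 ge2 al(1) A1(1) A2(1)])
        (use A1(2) A2(2) in \<open>simp_all only: al(2) eq\<close>)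
  next
    assume r: "r = real (malle_b k {1..n} G\<^sub>1) - 1"
    obtain c2 where c2: "c2 \<in> ?R2" using M2(2) by blast
    show ?thesis unfolding r
      by (rule pairs_unbalanced[OF fin1 fin2 ge1 ge2 al(1) A1(1) c2]) (use A1(2) in \<open>simp_all only: al(2)\<close>)
  qed
  then obtain c where c: "c > 0" "\<forall>\<^sub>F x in at_top. c * x powr \<alpha> * ln x powr r \<le> real (card (pairs_le ?R1 ?d1 ?R2 ?d2 x))"
    by blast
  obtain C M :: nat where CM: "C > 0" "M > 0" "\<And>y. real (card (pairs_le ?R1 ?d1 ?R2 ?d2 y))
      \<le> real M * real (N_ext k ({1..n} \<times> {1..m}) P (real C * y))"
    using product_count[OF M1(1) M2(1)] by auto
  have "\<exists>c'>0. \<forall>\<^sub>F x in at_top. c' * x powr \<alpha> * ln x powr r \<le> real (N_ext k ({1..n} \<times> {1..m}) P x)"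
    by (rule count_lower_bound_rescale[OF c(1) _ _ c(2), of "real C" "real M"]) (use CM in auto)
  then obtain c' where c': "c' > 0" "\<forall>\<^sub>F x in at_top. c' * x powr \<alpha> * ln x powr r \<le> real (N_ext k ({1..n} \<times> {1..m}) P x)"
    by blast
  show ?thesis
  proof (intro exI[of _ c'] conjI bexI[of _ "\<lambda>_. 0"])
    show "\<forall>\<^sub>F x in at_top. c' * x powr \<alpha> * ln x powr r + 0 \<le> real (N_ext k ({1..n} \<times> {1..m}) P x)"
      using c'(2) by simp
  qed (use c'(1) in simp_all)
qed

end
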